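(* Let $D\subset\mathbb{R}^N$, $N\in\{1,2,3\}$, be a bounded domain with Lipschitz boundary $\partial D$ and outward normal $n$, and let $T>0$. Let $\Gamma_{\mathrm{in}},\Gamma_{\mathrm{out}}\subset\partial D$ be open and disjoint with $\Gamma_{\mathrm{out}}$ nonempty. Let $f\in W^{1,\infty}(\mathbb{R})$ have Lipschitz constant $L_f$, with $f(0)=f(1)=0$ and $f(s)\ge0$ for every $0<s<1$. Let $g\in W^{1,\infty}(\mathbb{R})$ have Lipschitz constant $L_g$ and be monotonically decreasing with $g(0)=1$, $g(1)=0$. For $i=1,2$ let $\underline u_i^0\in L^2(D)$ with $0\le\underline u_i^0\le1$; let $a_i\in L^\infty((0,T)\times\Gamma_{\mathrm{in}})$ and $b_i\in L^\infty((0,T)\times\Gamma_{\mathrm{out}})$ be such that, for some $a_0,b_0>0$, $a_0\le a_i\le1$ a.e. in $(0,T)\times\Gamma_{\mathrm{in}}$ and $b_0\le b_i\le1$ a.e. in $(0,T)\times\Gamma_{\mathrm{out}}$; and let $V_i\in L^2((0,T);W^{1,\infty}(D))$ with $\Delta V_i=0$. Let $u_i$, $i=1,2$, be weak solutions, with initial conditions $\underline u_i^0$, of $$\begin{aligned}\partial_t u_i+\nabla\cdot J_i&=0&&\text{in }(0,T)\times D,\\ -J_i\cdot n&=a_i\,g(u_i)&&\text{on }(0,T)\times\Gamma_{\mathrm{in}},\\ J_i\cdot n&=b_i\,u_i&&\text{on }(0,T)\times\Gamma_{\mathrm{out}},\\ J_i\cdot n&=0&&\text{on }(0,T)\times\partial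 D\setminus(\Gamma_{\mathrm{in}}\cup\Gamma_{\mathrm{out}}),\end{aligned}\qquad J_i=-\nabla u_i+f(u_i)\nabla V_i.$$ Then there exist constants $C,\tilde C>0$, independent of the difference $u_1-u_2$, such that $$\|u_1-u_2\|_{L^2((0,T);H^1(D))}^2\le Ce^{\tilde CT}\Big(\|a_1-a_2\|_{L^\infty((0,T)\times\Gamma_{\mathrm{in}})}^2+\|b_1-b_2\|_{L^\infty((0,T)\times\Gamma_{\mathrm{out}})}^2+\|V_1-V_2\|_{L^2((0,T);W^{1,\infty}(D))}^2+\|\underline u_1^0-\underline u_2^0\|_{L^2(D)}^2\Big).$$
   Context: A function $u\in L^2((0,T);H^1(D))$ with $\partial_t u\in L^2((0,T);H^1(D)^* )$ is a weak solution for data $(a,b,V)$ if $$\int_D\partial_t u\,\varphi\,dx-\int_D(-\nabla u+f(u)\nabla V)\cdot\nabla\varphi\,dx+\int_{\Gamma_{\mathrm{out}}}b(t,x)\,u\,\varphi\,d\sigma=\int_{\Gamma_{\mathrm{in}}}a(t,x)\,g(u)\,\varphi\,d\sigma$$ for all $\varphi\in H^1(D)$ and a.e. $t\in[0,T]$. Here $\int_D\partial_t u\,\varphi\,dx$ is understood as the duality pairing between $H^1(D)^*$ and $H^1(D)$, $\sigma$ is the $(N-1)$-dimensional Hausdorff measure on $\partial D$, and boundary values are in the sense of traces. Under the stated hypotheses on the data it is known that the weak solution with prescribed initial condition exists, is unique, and satisfies $0\le u\le1$. *)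

theory Defs
  imports "HOL-Analysis.Analysis" "HOL-Probability.Essential_Supremum"
begin

text \<open>Elements of function spaces are represented by functions; equality in the spaces is
  equality almost everywhere, i.e. norm distance zero.\<close>

section \<open>Lipschitz domains\<close>

text \<open>\<^term>\<open>x - (x \<bullet> e) *\<^sub>R e\<close> is the orthogonal projection of \<^term>\<open>x\<close> to the hyperplane
  orthogonal to the unit vector \<^term>\<open>e\<close>, so locally the domain is the set of points below the
  graph of a Lipschitz function over that hyperplane.\<close>

definition lipschitz_boundary :: "'a::euclidean_space set \<Rightarrow> bool" where
  "lipschitz_boundary D \<longleftrightarrow>
     (\<forall>p\<in>frontier D. \<exists>e r \<gamma> L. norm e = 1 \<and> r > 0 \<and> L-lipschitz_on UNIV \<gamma> \<and>
        D \<inter> ball p r = {x \<in> ball p r. x \<bullet> e < (\<gamma> (x - (x \<bullet> e) *\<^sub>R e) :: real)})"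

definition bounded_lipschitz_domain :: "'a::euclidean_space set \<Rightarrow> bool" where
  "bounded_lipschitz_domain D \<longleftrightarrow>
     open D \<and> connected D \<and> D \<noteq> {} \<and> bounded D \<and> lipschitz_boundary D"

section \<open>Hausdorff measure\<close>

text \<open>The empty set has to be treated separately because \<open>0 ^ 0 = 1\<close>; for \<open>s = 0\<close> the result is
  counting measure.\<close>

definition hausdorff_gauge :: "nat \<Rightarrow> 'a::metric_space set \<Rightarrow> ennreal" where
  "hausdorff_gauge s E =
     (if E = {} then 0 else ennreal (unit_ball_vol (real s) * (diameter E / 2) ^ s))"

definition hausdorff_outer :: "nat \<Rightarrow> 'a::metric_space set \<Rightarrow> ennreal" where
  "hausdorff_outer s A =
     (SUP \<delta>\<in>{0::real<..}.
        INF U\<in>{U::nat \<Rightarrow> 'a set. A \<subseteq> (\<Union>i. U i) \<and> (\<forall>i. bounded (U i) \<and> diameter (U i) \<le> \<delta>)}.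
          \<Sum>i. hausdorff_gauge s (U i))"

text \<open>Since \<^const>\<open>hausdorff_outer\<close> is a metric outer measure, it is countably additive on the
  Borel sets.\<close>

definition hausdorff_measure :: "nat \<Rightarrow> 'a::metric_space measure" where
  "hausdorff_measure s = measure_of UNIV (sets borel) (hausdorff_outer s)"

definition surface :: "'a::euclidean_space set \<Rightarrow> 'a measure" where
  "surface \<Gamma> = restrict_space (hausdorff_measure (DIM('a) - 1)) \<Gamma>"

section \<open>Lebesgue spaces\<close>

definition L2 :: "'b measure \<Rightarrow> ('b \<Rightarrow> 'c::euclidean_space) set" where
  "L2 M = {u \<in> borel_measurable M. integrable M (\<lambda>x. (norm (u x))\<^sup>2)}"

definition L2_norm :: "'b measure \<Rightarrow> ('b \<Rightarrow> 'c::euclidean_space) \<Rightarrow> real" where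
  "L2_norm M u = sqrt (LINT x|M. (norm (u x))\<^sup>2)"

definition Linf :: "'b measure \<Rightarrow> ('b \<Rightarrow> 'c::euclidean_space) set" where
  "Linf M = {u \<in> borel_measurable M. esssup M (\<lambda>x. ereal (norm (u x))) < \<infinity>}"

text \<open>If \<^term>\<open>M\<close> is the null measure, the essential supremum is \<open>-\<infinity>\<close> and the norm is 0.\<close>

definition Linf_norm :: "'b measure \<Rightarrow> ('b \<Rightarrow> 'c::euclidean_space) \<Rightarrow> real" where
  "Linf_norm M u = real_of_ereal (esssup M (\<lambda>x. ereal (norm (u x))))"

section \<open>Test functions, weak gradients and Sobolev spaces\<close>

primrec Ck :: "nat \<Rightarrow> ('a::real_normed_vector \<Rightarrow> real) \<Rightarrow> bool" where
  "Ck 0 \<phi> \<longleftrightarrow> continuous_on UNIV \<phi>"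
| "Ck (Suc k) \<phi> \<longleftrightarrow>
     (\<exists>\<phi>'. (\<forall>x. (\<phi> has_derivative \<phi>' x) (at x)) \<and> (\<forall>h. Ck k (\<lambda>x. \<phi>' x h)))"

definition smooth :: "('a::real_normed_vector \<Rightarrow> real) \<Rightarrow> bool" where
  "smooth \<phi> \<longleftrightarrow> (\<forall>k. Ck k \<phi>)"

definition test_functions :: "'a::real_normed_vector set \<Rightarrow> ('a \<Rightarrow> real) set" where
  "test_functions D = {\<phi>. smooth \<phi> \<and> (\<exists>K. compact K \<and> K \<subseteq> D \<and> (\<forall>x. x \<notin> K \<longrightarrow> \<phi> x = 0))}"

definition has_weak_gradient ::
  "'a::euclidean_space set \<Rightarrow> ('a \<Rightarrow> real) \<Rightarrow> ('a \<Rightarrow> 'a) \<Rightarrow> bool" where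
  "has_weak_gradient D u G \<longleftrightarrow>
     (\<forall>K. compact K \<and> K \<subseteq> D \<longrightarrow> u absolutely_integrable_on K \<and> G absolutely_integrable_on K) \<and>
     (\<forall>\<phi>\<in>test_functions D. \<forall>h.
        (LINT x|lebesgue_on D. u x * frechet_derivative \<phi> (at x) h) =
        - (LINT x|lebesgue_on D. (G x \<bullet> h) * \<phi> x))"

definition weak_gradient :: "'a::euclidean_space set \<Rightarrow> ('a \<Rightarrow> real) \<Rightarrow> 'a \<Rightarrow> 'a" where
  "weak_gradient D u = (SOME G. has_weak_gradient D u G)"

definition H1 :: "'a::euclidean_space set \<Rightarrow> ('a \<Rightarrow> real) set" where
  "H1 D = {u \<in> L2 (lebesgue_on D). \<exists>G\<in>L2 (lebesgue_on D). has_weak_gradient D u G}"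

definition H1_norm :: "'a::euclidean_space set \<Rightarrow> ('a \<Rightarrow> real) \<Rightarrow> real" where
  "H1_norm D u =
     sqrt ((L2_norm (lebesgue_on D) u)\<^sup>2 + (L2_norm (lebesgue_on D) (weak_gradient D u))\<^sup>2)"

definition W1inf :: "'a::euclidean_space set \<Rightarrow> ('a \<Rightarrow> real) set" where
  "W1inf D = {u \<in> Linf (lebesgue_on D). \<exists>G\<in>Linf (lebesgue_on D). has_weak_gradient D u G}"

definition W1inf_norm :: "'a::euclidean_space set \<Rightarrow> ('a \<Rightarrow> real) \<Rightarrow> real" where
  "W1inf_norm D u =
     Linf_norm (lebesgue_on D) u + Linf_norm (lebesgue_on D) (weak_gradient D u)"

definition weakly_harmonic :: "'a::euclidean_space set \<Rightarrow> ('a \<Rightarrow> real) \<Rightarrow> bool" where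
  "weakly_harmonic D v \<longleftrightarrow>
     (\<forall>\<phi>\<in>test_functions D.
        (LINT x|lebesgue_on D. frechet_derivative \<phi> (at x) (weak_gradient D v x)) = 0)"

definition H1_dual :: "'a::euclidean_space set \<Rightarrow> (('a \<Rightarrow> real) \<Rightarrow> real) set" where
  "H1_dual D = {F.
     (\<forall>u\<in>H1 D. \<forall>v\<in>H1 D. F (\<lambda>x. u x + v x) = F u + F v) \<and>
     (\<forall>u\<in>H1 D. \<forall>c. F (\<lambda>x. c * u x) = c * F u) \<and>
     (\<exists>K. \<forall>u\<in>H1 D. \<bar>F u\<bar> \<le> K * H1_norm D u)}"

definition H1_dual_norm :: "'a::euclidean_space set \<Rightarrow> (('a \<Rightarrow> real) \<Rightarrow> real) \<Rightarrow> real" where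
  "H1_dual_norm D F = (SUP u\<in>{u \<in> H1 D. H1_norm D u \<le> 1}. \<bar>F u\<bar>)"

text \<open>Boundary traces: the trace operator is the continuous extension to \<open>H\<^sup>1(D)\<close> of the restriction
  \<open>w \<mapsto> w|\<partial>D\<close> of functions smooth up to the boundary, as an operator into \<open>L\<^sup>2(\<partial>D)\<close>.
  It is given here by its graph.\<close>

definition has_trace :: "'a::euclidean_space set \<Rightarrow> ('a \<Rightarrow> real) \<Rightarrow> ('a \<Rightarrow> real) \<Rightarrow> bool" where
  "has_trace D u v \<longleftrightarrow> u \<in> H1 D \<and> v \<in> L2 (surface (frontier D)) \<and>
     (\<exists>w::nat \<Rightarrow> 'a \<Rightarrow> real. (\<forall>k. smooth (w k)) \<and>
        (\<lambda>k. H1_norm D (\<lambda>x. w k x - u x)) \<longlonglongrightarrow> 0 \<and>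
        (\<lambda>k. L2_norm (surface (frontier D)) (\<lambda>x. w k x - v x)) \<longlonglongrightarrow> 0)"

section \<open>Bochner spaces on the interval (0,T)\<close>

text \<open>\<^term>\<open>bochner_L2 T X N\<close> is \<open>L\<^sup>2((0,T);X)\<close> for a function space \<^term>\<open>X\<close> with norm \<^term>\<open>N\<close>:
  strongly measurable functions (limits almost everywhere of simple functions) with
  square-integrable norm. The functionals in \<^const>\<open>H1_dual\<close> are real functions as well, so the
  definition also covers \<open>X = H\<^sup>1(D)\<^sup>*\<close>.\<close>

definition bochner_L2 ::
  "real \<Rightarrow> ('c \<Rightarrow> real) set \<Rightarrow> (('c \<Rightarrow> real) \<Rightarrow> real) \<Rightarrow> (real \<Rightarrow> 'c \<Rightarrow> real) set" where
  "bochner_L2 T X N = {u.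
     (AE t in lebesgue_on {0<..<T}. u t \<in> X) \<and>
     (\<exists>s::nat \<Rightarrow> real \<Rightarrow> 'c \<Rightarrow> real.
        (\<forall>k. simple_function (lebesgue_on {0<..<T}) (s k) \<and> s k ` {0<..<T} \<subseteq> X) \<and>
        (AE t in lebesgue_on {0<..<T}. (\<lambda>k. N (\<lambda>x. s k t x - u t x)) \<longlonglongrightarrow> 0)) \<and>
     integrable (lebesgue_on {0<..<T}) (\<lambda>t. (N (u t))\<^sup>2)}"

definition bochner_norm ::
  "real \<Rightarrow> (('c \<Rightarrow> real) \<Rightarrow> real) \<Rightarrow> (real \<Rightarrow> 'c \<Rightarrow> real) \<Rightarrow> real" where
  "bochner_norm T N u = sqrt (LINT t|lebesgue_on {0<..<T}. (N (u t))\<^sup>2)"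

text \<open>Distributional time derivative with values in \<open>H\<^sup>1(D)\<^sup>*\<close>, with \<open>H\<^sup>1(D)\<close> embedded into its dual
  through the inner product of \<open>L\<^sup>2(D)\<close>; the defining identity between elements of \<open>H\<^sup>1(D)\<^sup>*\<close> is
  evaluated at each \<open>\<phi> \<in> H\<^sup>1(D)\<close>.\<close>

definition has_weak_time_derivative ::
  "'a::euclidean_space set \<Rightarrow> real \<Rightarrow> (real \<Rightarrow> 'a \<Rightarrow> real) \<Rightarrow> (real \<Rightarrow> ('a \<Rightarrow> real) \<Rightarrow> real) \<Rightarrow> bool"
where
  "has_weak_time_derivative D T u u' \<longleftrightarrow>
     u' \<in> bochner_L2 T (H1_dual D) (H1_dual_norm D) \<and>
     (\<forall>\<psi>\<in>test_functions {0<..<T}. \<forall>\<phi>\<in>H1 D.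
        (LINT t|lebesgue_on {0<..<T}. deriv \<psi> t * (LINT x|lebesgue_on D. u t x * \<phi> x)) =
        - (LINT t|lebesgue_on {0<..<T}. \<psi> t * u' t \<phi>))"

text \<open>The initial value is the value at time 0 of the representative in \<open>C([0,T];L\<^sup>2(D))\<close>.\<close>

definition has_initial_value ::
  "'a::euclidean_space set \<Rightarrow> real \<Rightarrow> (real \<Rightarrow> 'a \<Rightarrow> real) \<Rightarrow> ('a \<Rightarrow> real) \<Rightarrow> bool" where
  "has_initial_value D T u u0 \<longleftrightarrow>
     (\<exists>v::real \<Rightarrow> 'a \<Rightarrow> real.
        (\<forall>t\<in>{0..T}. v t \<in> L2 (lebesgue_on D)) \<and>
        (\<forall>t\<in>{0..T}.
           ((\<lambda>s. L2_norm (lebesgue_on D) (\<lambda>x. v s x - v t x)) \<longlongrightarrow> 0) (at t within {0..T})) \<and>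
        (AE t in lebesgue_on {0<..<T}. AE x in lebesgue_on D. u t x = v t x) \<and>
        (AE x in lebesgue_on D. v 0 x = u0 x))"

section \<open>The boundary value problem\<close>

text \<open>The witness \<^term>\<open>u'\<close> is the time derivative of \<^term>\<open>u\<close> and \<^term>\<open>\<gamma> t\<close> is the trace of
  \<^term>\<open>u t\<close>.\<close>

definition weak_solution ::
  "'a::euclidean_space set \<Rightarrow> real \<Rightarrow> 'a set \<Rightarrow> 'a set \<Rightarrow> (real \<Rightarrow> real) \<Rightarrow> (real \<Rightarrow> real) \<Rightarrow>
   (real \<times> 'a \<Rightarrow> real) \<Rightarrow> (real \<times> 'a \<Rightarrow> real) \<Rightarrow> (real \<Rightarrow> 'a \<Rightarrow> real) \<Rightarrow>
   (real \<Rightarrow> 'a \<Rightarrow> real) \<Rightarrow> bool" where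
  "weak_solution D T \<Gamma>in \<Gamma>out f g a b V u \<longleftrightarrow>
     u \<in> bochner_L2 T (H1 D) (H1_norm D) \<and>
     (\<exists>u' \<gamma>. has_weak_time_derivative D T u u' \<and>
        (AE t in lebesgue_on {0<..<T}. has_trace D (u t) (\<gamma> t)) \<and>
        (\<forall>\<phi>\<in>H1 D. \<forall>\<gamma>\<phi>. has_trace D \<phi> \<gamma>\<phi> \<longrightarrow>
          (AE t in lebesgue_on {0<..<T}.
             u' t \<phi>
             - (LINT x|lebesgue_on D.
                  (- weak_gradient D (u t) x + f (u t x) *\<^sub>R weak_gradient D (V t) x)
                    \<bullet> weak_gradient D \<phi> x)
             + (LINT x|surface \<Gamma>out. b (t, x) * \<gamma> t x * \<gamma>\<phi> x)
             = (LINT x|surface \<Gamma>in. a (t, x) * g (\<gamma> t x) * \<gamma>\<phi> x))))"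

abbreviation lateral :: "real \<Rightarrow> 'a::euclidean_space set \<Rightarrow> (real \<times> 'a) measure" where
  "lateral T \<Gamma> \<equiv> lebesgue_on {0<..<T} \<Otimes>\<^sub>M surface \<Gamma>"

definition admissible_data ::
  "'a::euclidean_space set \<Rightarrow> real \<Rightarrow> 'a set \<Rightarrow> 'a set \<Rightarrow> real \<Rightarrow> real \<Rightarrow>
   (real \<times> 'a \<Rightarrow> real) \<Rightarrow> (real \<times> 'a \<Rightarrow> real) \<Rightarrow> (real \<Rightarrow> 'a \<Rightarrow> real) \<Rightarrow> ('a \<Rightarrow> real) \<Rightarrow> bool" where
  "admissible_data D T \<Gamma>in \<Gamma>out a0 b0 a b V u0 \<longleftrightarrow>
     a \<in> Linf (lateral T \<Gamma>in) \<and> (AE p in lateral T \<Gamma>in. a0 \<le> a p \<and> a p \<le> 1) \<and>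
     b \<in> Linf (lateral T \<Gamma>out) \<and> (AE p in lateral T \<Gamma>out. b0 \<le> b p \<and> b p \<le> 1) \<and>
     V \<in> bochner_L2 T (W1inf D) (W1inf_norm D) \<and>
     (AE t in lebesgue_on {0<..<T}. weakly_harmonic D (V t)) \<and>
     u0 \<in> L2 (lebesgue_on D) \<and> (AE x in lebesgue_on D. 0 \<le> u0 x \<and> u0 x \<le> 1)"

end

theory Submission
  imports Defs
begin

text \<open>With \<open>w = u\<^sub>1 - u\<^sub>2\<close> as test function, the difference of the two equations bounds the derivative of
  \<open>\<parallel>w\<parallel>\<^sup>2 / 2\<close> in \<open>L\<^sup>2(D)\<close> by \<open>-\<parallel>\<nabla>w\<parallel>\<^sup>2\<close> plus terms that Young's inequality absorbs: the inflow and outflow terms that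
  are quadratic in \<open>w\<close> have the good sign because \<open>g\<close> decreases and \<open>b \<ge> 0\<close>, and the drift contributes
  \<open>\<parallel>\<nabla>V\<^sub>1\<parallel>\<^sup>2 \<parallel>w\<parallel>\<^sup>2\<close>, whose coefficient is integrable in time, so Gronwall's inequality applies. The
  maximum principle \<open>0 \<le> u \<le> 1\<close> is not used: the same estimate for \<open>u\<^sub>2\<close> alone, together with the trace
  inequality, controls the boundary term \<open>(b\<^sub>1 - b\<^sub>2) u\<^sub>2 w\<close>.

  The trace inequality for smooth functions compares the Hausdorff measure of a piece of the boundary with
  the volume of a thin strip inside the domain and integrates along the transversal direction. The energy
  inequality comes from \<open>\<parallel>v(t)\<parallel>\<^sup>2 - \<parallel>v(t - h)\<parallel>\<^sup>2 \<le> 2 (v(t) - v(t - h), v(t))\<close>, averaged over \<open>t\<close> as \<open>h \<rightarrow> 0\<close>,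
  by continuity of translations in \<open>L\<^sup>2((0,T);H\<^sup>1(D))\<close>. All steps use scalar functions of time only, since
  the representatives \<open>u t x\<close> need not be jointly measurable.\<close>

section \<open>Square-integrable and essentially bounded functions\<close>

text \<open>Two obstacles shape the argument. A weak solution satisfies its equation for each fixed
  test function outside a null set of times that depends on that function, while the estimate needs
  the test function \<open>u1 t - u2 t\<close>, which changes with t. Strong measurability makes
  almost all values of a Bochner function limits of countably many of its own values; their
  exceptional sets can be united, and continuity of the equation in the test function does the rest.
  Boundary integrals enter this continuity, hence the trace inequality. Second, the constants are
  fixed before T and the data. Gronwall's inequality brings a factor exp(8 Lf^2 M^2), so C depends
  on the bound M for the potentials; factors T + 1 are absorbed into exp T, which gives the rate 5:
  three from the bound on u2, two from the estimate of the difference. The Hausdorff measure is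
  bounded without parametrising the boundary: if n balls of radius h with h-separated centres cover
  a piece of it, then n h^N is at most a multiple of the volume of the strip of height h, which is
  O(h), so n h^(N-1) stays bounded.\<close>

lemma L2_D: "u \<in> L2 M \<Longrightarrow> u \<in> borel_measurable M" "u \<in> L2 M \<Longrightarrow> integrable M (\<lambda>x. (norm (u x))\<^sup>2)"
  by (auto simp: L2_def)

lemma L2_norm_nonneg [simp]: "0 \<le> L2_norm M u"
  by (simp add: L2_norm_def)

lemma L2_norm_sq: "(L2_norm M u)\<^sup>2 = (LINT x|M. (norm (u x))\<^sup>2)"
  by (simp add: L2_norm_def)

lemma L2_mult_integrable:
  assumes "u \<in> L2 M" "v \<in> L2 M"
  shows "integrable M (\<lambda>x. norm (u x) * norm (v x))"
proof (rule Bochner_Integration.integrable_bound)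
  show "integrable M (\<lambda>x. (norm (u x))\<^sup>2 + (norm (v x))\<^sup>2)"
    using assms by (intro Bochner_Integration.integrable_add L2_D)
  show "(\<lambda>x. norm (u x) * norm (v x)) \<in> borel_measurable M"
    using L2_D(1)[OF assms(1)] L2_D(1)[OF assms(2)] by measurable
  have "norm a * norm b \<le> (norm a)\<^sup>2 + (norm b)\<^sup>2" for a :: 'b and b :: 'c
  proof -
    have "2 * norm a * norm b \<le> (norm a)\<^sup>2 + (norm b)\<^sup>2" by (rule sum_squares_bound)
    moreover have "0 \<le> norm a * norm b" by simp
    ultimately show ?thesis by linarith
  qed
  then show "AE x in M. norm (norm (u x) * norm (v x)) \<le> norm ((norm (u x))\<^sup>2 + (norm (v x))\<^sup>2)"
    by simp
qed

text \<open>Discriminant argument behind the Cauchy-Schwarz inequality. The case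
  \<open>B = 0\<close> is separate because the quadratic degenerates to an affine function, which is
  nonnegative everywhere only if its slope vanishes.\<close>

lemma quadratic_nonneg_imp_le_sqrt:
  fixes A B P :: real
  assumes "\<And>t. 0 \<le> A - 2 * t * P + t\<^sup>2 * B" "0 \<le> A" "0 \<le> B"
  shows "P \<le> sqrt A * sqrt B"
proof (cases "B = 0")
  case True
  have "P \<le> 0"
  proof (rule ccontr)
    assume "\<not> P \<le> 0"
    \<comment> \<open>At this t the affine function takes the value -1.\<close>
    then have "0 \<le> A - 2 * ((A + 1) / (2 * P)) * P" using assms(1)[of "(A + 1) / (2 * P)"] True by simp
    then show False using \<open>\<not> P \<le> 0\<close> by (simp add: field_simps)
  qed
  then show ?thesis using True by simp
next
  case False
  \<comment> \<open>\<open>P / B\<close> is the minimiser of the quadratic.\<close>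
  then have "0 \<le> A - P\<^sup>2 / B"
    using assms(1)[of "P / B"] by (simp add: power2_eq_square field_simps)
  then have "P\<^sup>2 \<le> A * B" using False assms(3) by (simp add: field_simps)
  then have "P \<le> sqrt (A * B)" by (rule real_le_rsqrt)
  then show ?thesis by (simp add: real_sqrt_mult)
qed

text \<open>The quadratic of the previous lemma is the integral of
  \<open>(norm (u x) - t * norm (v x))\<^sup>2\<close>. Working with norms lets u and v take values
  in different Euclidean spaces.\<close>

lemma L2_Cauchy_Schwarz:
  assumes "u \<in> L2 M" "v \<in> L2 M"
  shows "(LINT x|M. norm (u x) * norm (v x)) \<le> L2_norm M u * L2_norm M v"
  unfolding L2_norm_def
proof (rule quadratic_nonneg_imp_le_sqrt)
  fix t :: real
  note i = L2_mult_integrable[OF assms] L2_D(2)[OF assms(1)] L2_D(2)[OF assms(2)]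
  have "0 \<le> (LINT x|M. (norm (u x) - t * norm (v x))\<^sup>2)" by simp
  also have "\<dots> = (LINT x|M. (norm (u x))\<^sup>2 - (2 * t) * (norm (u x) * norm (v x)) + t\<^sup>2 * (norm (v x))\<^sup>2)"
    by (intro Bochner_Integration.integral_cong) (auto simp: power2_diff power_mult_distrib)
  also have "\<dots> = (LINT x|M. (norm (u x))\<^sup>2) - 2 * t * (LINT x|M. norm (u x) * norm (v x)) + t\<^sup>2 * (LINT x|M. (norm (v x))\<^sup>2)"
    using i by simp
  finally show "0 \<le> \<dots>" .
qed auto

lemma L2_inner_integrable:
  assumes "u \<in> L2 M" "v \<in> L2 M"
  shows "integrable M (\<lambda>x. u x \<bullet> v x)"
  by (rule Bochner_Integration.integrable_bound[OF L2_mult_integrable[OF assms]])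
    (use L2_D(1)[OF assms(1)] L2_D(1)[OF assms(2)] in \<open>auto intro!: AE_I2 simp: Cauchy_Schwarz_ineq2 borel_measurable_inner\<close>)

lemma L2_inner_bound:
  assumes "u \<in> L2 M" "v \<in> L2 M"
  shows "\<bar>LINT x|M. u x \<bullet> v x\<bar> \<le> L2_norm M u * L2_norm M v"
proof -
  have "\<bar>LINT x|M. u x \<bullet> v x\<bar> \<le> (LINT x|M. \<bar>u x \<bullet> v x\<bar>)" by (rule integral_abs_bound)
  also have "\<dots> \<le> (LINT x|M. norm (u x) * norm (v x))"
    using L2_inner_integrable[OF assms] L2_mult_integrable[OF assms]
    by (intro integral_mono) (auto simp: Cauchy_Schwarz_ineq2)
  also have "\<dots> \<le> L2_norm M u * L2_norm M v" by (rule L2_Cauchy_Schwarz[OF assms])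
  finally show ?thesis .
qed

lemma L2_scaleR: "u \<in> L2 M \<Longrightarrow> (\<lambda>x. c *\<^sub>R u x) \<in> L2 M"
  by (auto simp: L2_def power_mult_distrib)

lemma L2_add:
  assumes "u \<in> L2 M" "v \<in> L2 M"
  shows "(\<lambda>x. u x + v x) \<in> L2 M"
proof -
  have "integrable M (\<lambda>x. (norm (u x))\<^sup>2 + 2 * (u x \<bullet> v x) + (norm (v x))\<^sup>2)"
    using L2_inner_integrable[OF assms] L2_D(2)[OF assms(1)] L2_D(2)[OF assms(2)]
    by auto
  then have "integrable M (\<lambda>x. (norm (u x + v x))\<^sup>2)"
    by (simp add: power2_norm_eq_inner inner_simps inner_commute algebra_simps)
  then show ?thesis using L2_D(1)[OF assms(1)] L2_D(1)[OF assms(2)] by (simp add: L2_def)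
qed

lemma L2_diff:
  assumes "u \<in> L2 M" "v \<in> L2 M"
  shows "(\<lambda>x. u x - v x) \<in> L2 M"
  using L2_add[OF assms(1) L2_scaleR[OF assms(2), of "-1"]] by simp

lemma L2_norm_scaleR: "L2_norm M (\<lambda>x. c *\<^sub>R u x) = \<bar>c\<bar> * L2_norm M u"
  by (simp add: L2_norm_def power_mult_distrib real_sqrt_mult)

lemma L2_norm_triangle:
  assumes "u \<in> L2 M" "v \<in> L2 M"
  shows "L2_norm M (\<lambda>x. u x + v x) \<le> L2_norm M u + L2_norm M v"
proof (rule power2_le_imp_le)
  have "(L2_norm M (\<lambda>x. u x + v x))\<^sup>2 = (LINT x|M. (norm (u x))\<^sup>2 + 2 * (u x \<bullet> v x) + (norm (v x))\<^sup>2)"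
    by (simp add: L2_norm_sq power2_norm_eq_inner inner_simps inner_commute algebra_simps)
  also have "\<dots> = (L2_norm M u)\<^sup>2 + 2 * (LINT x|M. u x \<bullet> v x) + (L2_norm M v)\<^sup>2"
    using L2_inner_integrable[OF assms] L2_D(2)[OF assms(1)] L2_D(2)[OF assms(2)]
    by (simp add: L2_norm_sq)
  also have "\<dots> \<le> (L2_norm M u + L2_norm M v)\<^sup>2"
    using L2_inner_bound[OF assms] by (simp add: power2_sum)
  finally show "(L2_norm M (\<lambda>x. u x + v x))\<^sup>2 \<le> (L2_norm M u + L2_norm M v)\<^sup>2" .
qed simp

lemma L2_AE_eq:
  assumes "u \<in> L2 M" "v \<in> borel_measurable M" "AE x in M. u x = v x"
  shows "v \<in> L2 M"
proof -
  have "integrable M (\<lambda>x. (norm (v x))\<^sup>2)"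
    using assms L2_D[OF assms(1)] by (subst integrable_cong_AE[where g="\<lambda>x. (norm (u x))\<^sup>2"]) auto
  then show ?thesis using assms by (simp add: L2_def)
qed

lemma L2_norm_AE_eq:
  assumes "u \<in> borel_measurable M" "v \<in> borel_measurable M" "AE x in M. u x = v x"
  shows "L2_norm M u = L2_norm M v"
  unfolding L2_norm_def using assms by (subst integral_cong_AE[where g="\<lambda>x. (norm (v x))\<^sup>2"]) auto

lemma L2_bounded:
  fixes u :: "'b \<Rightarrow> 'c::euclidean_space"
  assumes "finite_measure M" "u \<in> borel_measurable M" "AE x in M. norm (u x) \<le> c"
  shows "u \<in> L2 M" "(L2_norm M u)\<^sup>2 \<le> c\<^sup>2 * measure M (space M)"
proof -
  interpret finite_measure M by fact
  have *: "AE x in M. (norm (u x))\<^sup>2 \<le> c\<^sup>2" using assms(3) by eventually_elim (simp add: power_mono)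
  have i: "integrable M (\<lambda>x. (norm (u x))\<^sup>2)"
    using * assms(2) by (intro integrable_const_bound[where B="c\<^sup>2"]) auto
  then show "u \<in> L2 M" using assms(2) by (simp add: L2_def)
  have "(LINT x|M. (norm (u x))\<^sup>2) \<le> (LINT x|M. c\<^sup>2)"
    using i * by (intro integral_mono_AE) auto
  then show "(L2_norm M u)\<^sup>2 \<le> c\<^sup>2 * measure M (space M)" by (simp add: L2_norm_sq mult.commute)
qed

lemma L2_dominated:
  fixes u :: "'b \<Rightarrow> 'c::euclidean_space" and v :: "'b \<Rightarrow> 'd::euclidean_space"
  assumes "u \<in> L2 M" "v \<in> borel_measurable M" "AE x in M. norm (v x) \<le> c * norm (u x)" "0 \<le> c"
  shows "v \<in> L2 M" "L2_norm M v \<le> c * L2_norm M u"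
proof -
  have *: "AE x in M. (norm (v x))\<^sup>2 \<le> c\<^sup>2 * (norm (u x))\<^sup>2"
    using assms(3) by eventually_elim (metis norm_ge_zero power_mono power_mult_distrib)
  have i: "integrable M (\<lambda>x. c\<^sup>2 * (norm (u x))\<^sup>2)" using L2_D(2)[OF assms(1)] by simp
  have i2: "integrable M (\<lambda>x. (norm (v x))\<^sup>2)"
  proof (rule Bochner_Integration.integrable_bound[OF i])
    show "(\<lambda>x. (norm (v x))\<^sup>2) \<in> borel_measurable M" using assms(2) by measurable
  qed (use * in auto)
  show "v \<in> L2 M" using assms(2) i2 by (simp add: L2_def)
  have "(LINT x|M. (norm (v x))\<^sup>2) \<le> (LINT x|M. c\<^sup>2 * (norm (u x))\<^sup>2)"
    by (rule integral_mono_AE[OF i2 i *])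
  then have "(L2_norm M v)\<^sup>2 \<le> (c * L2_norm M u)\<^sup>2"
    by (simp add: L2_norm_sq power_mult_distrib)
  then show "L2_norm M v \<le> c * L2_norm M u" by (rule power2_le_imp_le) (simp add: assms(4))
qed

lemma L2_norm_le_bounded:
  fixes u :: "'b \<Rightarrow> 'c::euclidean_space"
  assumes "finite_measure M" "u \<in> borel_measurable M" "AE x in M. norm (u x) \<le> c" "0 \<le> c"
  shows "L2_norm M u \<le> c * sqrt (measure M (space M))"
proof (rule power2_le_imp_le)
  show "(L2_norm M u)\<^sup>2 \<le> (c * sqrt (measure M (space M)))\<^sup>2"
    using L2_bounded(2)[OF assms(1-3)] by (simp add: power_mult_distrib)
qed (use assms in simp)

lemma L2_inner_le_norms:
  assumes "u \<in> L2 M" "v \<in> L2 M"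
  shows "(LINT x|M. u x \<bullet> v x) \<le> L2_norm M u * L2_norm M v"
  using L2_inner_bound[OF assms] by linarith

section \<open>Essentially bounded functions\<close>

lemma Linf_I:
  fixes u :: "'b \<Rightarrow> 'c::euclidean_space"
  assumes "u \<in> borel_measurable M" "AE x in M. norm (u x) \<le> c"
  shows "u \<in> Linf M"
proof -
  have "esssup M (\<lambda>x. ereal (norm (u x))) \<le> ereal c" using assms by (intro esssup_I) auto
  then show ?thesis using assms(1) by (auto simp: Linf_def)
qed

lemma Linf_norm_AE:
  fixes u :: "'b \<Rightarrow> 'c::euclidean_space"
  assumes "u \<in> Linf M"
  shows "AE x in M. norm (u x) \<le> Linf_norm M u"
proof -
  let ?e = "esssup M (\<lambda>x. ereal (norm (u x)))"
  have "AE x in M. ereal (norm (u x)) \<le> ?e" by (rule esssup_AE)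
  moreover have "?e < \<infinity>" using assms by (simp add: Linf_def)
  ultimately have "AE x in M. ereal (norm (u x)) \<le> ?e \<and> ?e < \<infinity>" by simp
  then show ?thesis
  proof eventually_elim
    case (elim x)
    then obtain r where "?e = ereal r" by (cases ?e) auto
    then show ?case using elim by (simp add: Linf_norm_def)
  qed
qed

lemma Linf_norm_null:
  assumes "emeasure M (space M) = 0" "u \<in> borel_measurable M"
  shows "Linf_norm M u = 0"
proof -
  have "esssup M (\<lambda>x. ereal (norm (u x))) = -\<infinity>"
    using esssup_zero_space[OF assms(1), of "\<lambda>x. ereal (norm (u x))"] assms(2) by (simp add: bot_ereal_def)
  then show ?thesis by (simp add: Linf_norm_def)
qed

text \<open>On a null measure the essential supremum is -\<infinity> and becomes 0 by the conversion
  to a real. Otherwise the almost-everywhere filter is proper, so an inequality that does not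
  mention the point and holds almost everywhere holds outright.\<close>

lemma Linf_norm_nonneg: "0 \<le> Linf_norm M u" if "u \<in> Linf M"
proof (cases "emeasure M (space M) = 0")
  case True
  then show ?thesis using that by (simp add: Linf_norm_null Linf_def)
next
  case False
  then have nb: "ae_filter M \<noteq> bot" by (simp add: ae_filter_eq_bot_iff)
  have "AE x in M. 0 \<le> Linf_norm M u"
    using Linf_norm_AE[OF that] by eventually_elim (metis norm_ge_zero order_trans)
  then show ?thesis using nb by (simp add: trivial_limit_def eventually_const)
qed

lemma Linf_norm_le:
  fixes u :: "'b \<Rightarrow> 'c::euclidean_space"
  assumes "u \<in> borel_measurable M" "AE x in M. norm (u x) \<le> c" "0 \<le> c"
  shows "Linf_norm M u \<le> c"
proof -
  have "esssup M (\<lambda>x. ereal (norm (u x))) \<le> ereal c" using assms by (intro esssup_I) auto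
  then show ?thesis using assms(3)
    by (cases "esssup M (\<lambda>x. ereal (norm (u x)))") (auto simp: Linf_norm_def)
qed

lemma Linf_measurable: "u \<in> Linf M \<Longrightarrow> u \<in> borel_measurable M"
  by (simp add: Linf_def)

lemma Linf_add:
  assumes "u \<in> Linf M" "v \<in> Linf M"
  shows "(\<lambda>x. u x + v x) \<in> Linf M" "Linf_norm M (\<lambda>x. u x + v x) \<le> Linf_norm M u + Linf_norm M v"
proof -
  have m: "(\<lambda>x. u x + v x) \<in> borel_measurable M"
    using Linf_measurable[OF assms(1)] Linf_measurable[OF assms(2)] by measurable
  have *: "AE x in M. norm (u x + v x) \<le> Linf_norm M u + Linf_norm M v"
    using Linf_norm_AE[OF assms(1)] Linf_norm_AE[OF assms(2)]
    by eventually_elim (rule norm_triangle_le, simp)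
  show "(\<lambda>x. u x + v x) \<in> Linf M" by (rule Linf_I[OF m *])
  show "Linf_norm M (\<lambda>x. u x + v x) \<le> Linf_norm M u + Linf_norm M v"
    using m * Linf_norm_nonneg[OF assms(1)] Linf_norm_nonneg[OF assms(2)] by (intro Linf_norm_le) auto
qed

text \<open>Scaling by c gives one inequality, scaling the result back by \<open>1 / c\<close> the
  other; for \<open>c = 0\<close> nonnegativity of the norm closes the gap.\<close>

lemma Linf_scaleR:
  assumes "u \<in> Linf M"
  shows "(\<lambda>x. c *\<^sub>R u x) \<in> Linf M" "Linf_norm M (\<lambda>x. c *\<^sub>R u x) = \<bar>c\<bar> * Linf_norm M u"
proof -
  have 1: "(\<lambda>x. c *\<^sub>R u x) \<in> Linf M \<and> Linf_norm M (\<lambda>x. c *\<^sub>R u x) \<le> \<bar>c\<bar> * Linf_norm M u"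
    if "u \<in> Linf M" for c u
  proof -
    have m: "(\<lambda>x. c *\<^sub>R u x) \<in> borel_measurable M" using Linf_measurable[OF that] by measurable
    have *: "AE x in M. norm (c *\<^sub>R u x) \<le> \<bar>c\<bar> * Linf_norm M u"
      using Linf_norm_AE[OF that] by eventually_elim (simp add: mult_left_mono)
    show ?thesis using Linf_I[OF m *] m * Linf_norm_nonneg[OF that] by (auto intro!: Linf_norm_le)
  qed
  show "(\<lambda>x. c *\<^sub>R u x) \<in> Linf M" using 1[OF assms] by blast
  show "Linf_norm M (\<lambda>x. c *\<^sub>R u x) = \<bar>c\<bar> * Linf_norm M u"
  proof (cases "c = 0")
    case True
    then show ?thesis using 1[OF assms, of 0] Linf_norm_nonneg[of "\<lambda>x. c *\<^sub>R u x"] by fastforce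
  next
    case False
    have "Linf_norm M (\<lambda>x. (1/c) *\<^sub>R (c *\<^sub>R u x)) \<le> \<bar>1/c\<bar> * Linf_norm M (\<lambda>x. c *\<^sub>R u x)"
      using 1[of "\<lambda>x. c *\<^sub>R u x" "1/c"] 1[OF assms, of c] by blast
    then have "\<bar>c\<bar> * Linf_norm M u \<le> Linf_norm M (\<lambda>x. c *\<^sub>R u x)"
      using False by (simp add: field_simps)
    then show ?thesis using 1[OF assms, of c] by linarith
  qed
qed

lemma Linf_diff:
  assumes "u \<in> Linf M" "v \<in> Linf M"
  shows "(\<lambda>x. u x - v x) \<in> Linf M"
  using Linf_add(1)[OF assms(1) Linf_scaleR(1)[OF assms(2), of "-1"]] by simp

lemma Linf_norm_AE_eq:
  assumes "u \<in> Linf M" "v \<in> borel_measurable M" "AE x in M. u x = v x"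
  shows "v \<in> Linf M" "Linf_norm M v = Linf_norm M u"
proof -
  have "esssup M (\<lambda>x. ereal (norm (v x))) = esssup M (\<lambda>x. ereal (norm (u x)))"
    using assms Linf_measurable[OF assms(1)] by (intro esssup_AE_cong) auto
  then show "v \<in> Linf M" "Linf_norm M v = Linf_norm M u"
    using assms by (auto simp: Linf_def Linf_norm_def)
qed

text \<open>Elements are representatives, so N is a seminorm: functions that agree almost everywhere
  have distance 0 without being equal. L2, H1, W1inf and the dual of H1, whose elements are real
  functions of functions, are all instances, and the theory of Bochner spaces is developed once for
  all of them.\<close>

locale seminormed_functions =
  fixes X :: "('c \<Rightarrow> real) set" and N :: "('c \<Rightarrow> real) \<Rightarrow> real"
  assumes add_closed: "u \<in> X \<Longrightarrow> v \<in> X \<Longrightarrow> (\<lambda>x. u x + v x) \<in> X"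
    and scale_closed: "u \<in> X \<Longrightarrow> (\<lambda>x. c * u x) \<in> X"
    and triangle: "u \<in> X \<Longrightarrow> v \<in> X \<Longrightarrow> N (\<lambda>x. u x + v x) \<le> N u + N v"
    and homogeneous: "u \<in> X \<Longrightarrow> N (\<lambda>x. c * u x) = \<bar>c\<bar> * N u"
begin

lemma diff_closed: "u \<in> X \<Longrightarrow> v \<in> X \<Longrightarrow> (\<lambda>x. u x - v x) \<in> X"
  using add_closed[of u "\<lambda>x. -1 * v x"] scale_closed[of v "-1"] by simp

lemma minus_commute: "u \<in> X \<Longrightarrow> v \<in> X \<Longrightarrow> N (\<lambda>x. u x - v x) = N (\<lambda>x. v x - u x)"
  using homogeneous[of "\<lambda>x. u x - v x" "-1"] diff_closed by simp

lemma triangle_diff: "u \<in> X \<Longrightarrow> v \<in> X \<Longrightarrow> N (\<lambda>x. u x - v x) \<le> N u + N v"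
  using triangle[of u "\<lambda>x. -1 * v x"] scale_closed[of v "-1"] homogeneous[of v "-1"] by simp

lemma triangle_via:
  assumes "u \<in> X" "v \<in> X" "z \<in> X"
  shows "N (\<lambda>x. u x - v x) \<le> N (\<lambda>x. u x - z x) + N (\<lambda>x. z x - v x)"
  using triangle[of "\<lambda>x. u x - z x" "\<lambda>x. z x - v x"] assms diff_closed by simp

lemma nonneg: assumes "u \<in> X" shows "0 \<le> N u"
proof -
  have "N (\<lambda>x. 0 * u x) = 0" using homogeneous[OF assms, of 0] by simp
  then show ?thesis using triangle_diff[OF assms assms] by simp
qed

lemma le_add_diff: assumes "u \<in> X" "v \<in> X" shows "N u \<le> N v + N (\<lambda>x. u x - v x)"
  using triangle[of v "\<lambda>x. u x - v x"] assms diff_closed by simp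

lemma abs_diff_le: assumes "u \<in> X" "v \<in> X" shows "\<bar>N u - N v\<bar> \<le> N (\<lambda>x. u x - v x)"
  using le_add_diff[OF assms] le_add_diff[OF assms(2,1)] minus_commute[OF assms] by linarith

end

lemma seminormed_functions_L2: "seminormed_functions (L2 M) (L2_norm M)"
proof
  fix u v :: "'a \<Rightarrow> real" and c :: real
  show "u \<in> L2 M \<Longrightarrow> v \<in> L2 M \<Longrightarrow> (\<lambda>x. u x + v x) \<in> L2 M" by (rule L2_add)
  show "u \<in> L2 M \<Longrightarrow> (\<lambda>x. c * u x) \<in> L2 M" using L2_scaleR[of u M c] by simp
  show "u \<in> L2 M \<Longrightarrow> v \<in> L2 M \<Longrightarrow> L2_norm M (\<lambda>x. u x + v x) \<le> L2_norm M u + L2_norm M v"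
    by (rule L2_norm_triangle)
  show "L2_norm M (\<lambda>x. c * u x) = \<bar>c\<bar> * L2_norm M u" using L2_norm_scaleR[of M c u] by simp
qed

section \<open>Smooth cut-off functions\<close>

lemma Ck_SucI:
  assumes "\<And>x. (\<phi> has_derivative \<phi>' x) (at x)" "\<And>h. Ck k (\<lambda>x. \<phi>' x h)"
  shows "Ck (Suc k) \<phi>"
  unfolding Ck.simps(2) by (rule exI[where x=\<phi>']) (intro conjI allI assms)

lemma Ck_SucE:
  assumes "Ck (Suc k) \<phi>"
  obtains \<phi>' where "\<And>x. (\<phi> has_derivative \<phi>' x) (at x)" "\<And>h. Ck k (\<lambda>x. \<phi>' x h)"
proof -
  from assms[unfolded Ck.simps(2)] show ?thesis
    by (elim exE conjE) (rule that, (erule spec)+)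
qed

lemma Ck_const: "Ck k (\<lambda>x. c)"
proof (induction k arbitrary: c)
  case 0
  show ?case by simp
next
  case (Suc k)
  show ?case by (rule Ck_SucI[where \<phi>'="\<lambda>x h. 0"]) (auto intro: Suc)
qed

lemma Ck_Suc_imp_continuous:
  assumes "Ck (Suc k) \<phi>"
  shows "continuous_on UNIV \<phi>"
proof -
  obtain \<phi>' where "\<And>x. (\<phi> has_derivative \<phi>' x) (at x)" using Ck_SucE[OF assms] by metis
  then show ?thesis by (intro continuous_at_imp_continuous_on ballI has_derivative_continuous)
qed

lemma Ck_lower: "Ck (Suc k) \<phi> \<Longrightarrow> Ck k \<phi>"
proof (induction k arbitrary: \<phi>)
  case 0
  then show ?case using Ck_Suc_imp_continuous[of 0] by (simp only: Ck.simps(1))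
next
  case (Suc k)
  obtain \<phi>' where \<phi>: "\<And>x. (\<phi> has_derivative \<phi>' x) (at x)" "\<And>h. Ck (Suc k) (\<lambda>x. \<phi>' x h)"
    using Ck_SucE[OF Suc.prems] by metis
  show ?case by (rule Ck_SucI[OF \<phi>(1) Suc.IH[OF \<phi>(2)]])
qed

lemma Ck_continuous: "Ck k \<phi> \<Longrightarrow> continuous_on UNIV \<phi>"
  by (cases k) (simp, rule Ck_Suc_imp_continuous, simp only:)

lemma Ck_add: "Ck k f \<Longrightarrow> Ck k g \<Longrightarrow> Ck k (\<lambda>x. f x + g x)"
proof (induction k arbitrary: f g)
  case 0
  then show ?case by (auto intro: continuous_on_add)
next
  case (Suc k)
  obtain f' where f: "\<And>x. (f has_derivative f' x) (at x)" "\<And>h. Ck k (\<lambda>x. f' x h)" using Ck_SucE[OF Suc.prems(1)] by metis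
  obtain g' where g: "\<And>x. (g has_derivative g' x) (at x)" "\<And>h. Ck k (\<lambda>x. g' x h)" using Ck_SucE[OF Suc.prems(2)] by metis
  show ?case by (rule Ck_SucI[where \<phi>'="\<lambda>x h. f' x h + g' x h"]) (rule has_derivative_add f g Suc.IH)+
qed

lemma Ck_mult: "Ck k f \<Longrightarrow> Ck k g \<Longrightarrow> Ck k (\<lambda>x. f x * g x)"
proof (induction k arbitrary: f g)
  case 0
  then show ?case by (auto intro: continuous_on_mult)
next
  case (Suc k)
  obtain f' where f: "\<And>x. (f has_derivative f' x) (at x)" "\<And>h. Ck k (\<lambda>x. f' x h)" using Ck_SucE[OF Suc.prems(1)] by metis
  obtain g' where g: "\<And>x. (g has_derivative g' x) (at x)" "\<And>h. Ck k (\<lambda>x. g' x h)" using Ck_SucE[OF Suc.prems(2)] by metis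
  have "Ck k (\<lambda>x. f x * g' x h + f' x h * g x)" for h
    by (rule Ck_add[OF Suc.IH[OF Ck_lower[OF Suc.prems(1)] g(2)] Suc.IH[OF f(2) Ck_lower[OF Suc.prems(2)]]])
  then show ?case by (rule Ck_SucI[OF has_derivative_mult[OF f(1) g(1)]])
qed

lemma Ck_bounded_linear: assumes "bounded_linear \<phi>" shows "Ck k \<phi>"
proof (cases k)
  case 0
  then show ?thesis using assms by (simp add: linear_continuous_on)
next
  case (Suc m)
  show ?thesis unfolding Suc
    by (rule Ck_SucI[where \<phi>'="\<lambda>x. \<phi>"]) (rule bounded_linear_imp_has_derivative assms Ck_const)+
qed

text \<open>Induction on k through the chain rule. The derivative of f at \<open>g x\<close> is
  linear on the reals, hence multiplication by \<open>f' (g x) 1\<close>; this turns the derivative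
  of the composite into a product, to which \<open>Ck_mult\<close> and the induction hypothesis
  apply.\<close>

lemma Ck_compose_real:
  fixes f :: "real \<Rightarrow> real"
  shows "Ck k f \<Longrightarrow> Ck k g \<Longrightarrow> Ck k (\<lambda>x. f (g x))"
proof (induction k arbitrary: f g)
  case 0
  then show ?case by (auto intro: continuous_on_compose2)
next
  case (Suc k)
  obtain f' where f: "\<And>x. (f has_derivative f' x) (at x)" "\<And>h. Ck k (\<lambda>x. f' x h)" using Ck_SucE[OF Suc.prems(1)] by metis
  obtain g' where g: "\<And>x. (g has_derivative g' x) (at x)" "\<And>h. Ck k (\<lambda>x. g' x h)" using Ck_SucE[OF Suc.prems(2)] by metis
  have d: "((\<lambda>x. f (g x)) has_derivative (\<lambda>h. f' (g x) (g' x h))) (at x)" for x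
    using has_derivative_compose[of g "g' x" x UNIV f "f' (g x)"] f g by auto
  have eq: "f' (g x) (g' x h) = f' (g x) 1 * g' x h" for x h
  proof -
    have "linear (f' (g x))" using f(1) has_derivative_linear by blast
    then show ?thesis using linear_scale[of "f' (g x)" "g' x h" 1] by (simp add: mult.commute)
  qed
  have "Ck k (\<lambda>x. f' (g x) 1)"
    using f(2) Ck_lower[OF Suc.prems(2)] Suc.IH[of "\<lambda>x. f' x 1" g] by blast
  then have "Ck k (\<lambda>x. f' (g x) (g' x h))" for h
    unfolding eq by (rule Ck_mult[OF _ g(2)])
  then show ?case by (rule Ck_SucI[OF d])
qed

lemma smooth_const: "smooth (\<lambda>x. c)" by (simp add: smooth_def Ck_const)
lemma smooth_add: "smooth f \<Longrightarrow> smooth g \<Longrightarrow> smooth (\<lambda>x. f x + g x)" by (simp add: smooth_def Ck_add)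
lemma smooth_mult: "smooth f \<Longrightarrow> smooth g \<Longrightarrow> smooth (\<lambda>x. f x * g x)" by (simp add: smooth_def Ck_mult)
lemma smooth_bounded_linear: "bounded_linear f \<Longrightarrow> smooth f" by (simp add: smooth_def Ck_bounded_linear)
lemma smooth_compose_real: "smooth f \<Longrightarrow> smooth g \<Longrightarrow> smooth (\<lambda>x. f (g x :: real))"
  by (simp add: smooth_def Ck_compose_real)
lemma smooth_diff: "smooth f \<Longrightarrow> smooth g \<Longrightarrow> smooth (\<lambda>x. f x - g x)"
  using smooth_add[OF _ smooth_mult[OF smooth_const[of "-1"]]] by fastforce

lemma smooth_prod: "finite I \<Longrightarrow> (\<And>i. i \<in> I \<Longrightarrow> smooth (\<lambda>x. f i x)) \<Longrightarrow> smooth (\<lambda>x. \<Prod>i\<in>I. f i x :: real)"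
  by (induction I rule: finite_induct) (auto intro: smooth_const smooth_mult)

lemma smooth_continuous: "smooth f \<Longrightarrow> continuous_on UNIV f"
  using Ck_continuous smooth_def by blast

lemma smooth_has_derivative: "smooth f \<Longrightarrow> (f has_derivative frechet_derivative f (at x)) (at x)"
proof -
  assume "smooth f"
  then have "Ck (Suc 0) f" by (simp only: smooth_def)
  then obtain f' where "(f has_derivative f' x) (at x)" using Ck_SucE by metis
  then have "f differentiable at x" by (rule differentiableI)
  then show ?thesis by (simp add: frechet_derivative_works)
qed

lemma smooth_frechet_derivative: assumes "smooth f" shows "smooth (\<lambda>x. frechet_derivative f (at x) h)"
  unfolding smooth_def
proof
  fix k
  have "Ck (Suc k) f" using assms by (simp only: smooth_def)
  then obtain f' where f: "\<And>x. (f has_derivative f' x) (at x)" "\<And>h. Ck k (\<lambda>x. f' x h)"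
    using Ck_SucE by metis
  have "frechet_derivative f (at x) = f' x" for x using f(1) frechet_derivative_at by metis
  then show "Ck k (\<lambda>x. frechet_derivative f (at x) h)" using f(2) by simp
qed

lemma smoothI_real_derivative:
  assumes "\<And>x. (F has_real_derivative r x) (at x)" "smooth r"
  shows "smooth F"
  unfolding smooth_def
proof
  fix k
  have "Ck (Suc k) F"
  proof (rule Ck_SucI)
    fix x h show "(F has_derivative (\<lambda>h. h * r x)) (at x)"
      using assms(1) by (simp add: has_field_derivative_def mult_commute_abs)
    show "Ck k (\<lambda>x. h * r x)" using assms(2) by (intro Ck_mult Ck_const) (simp add: smooth_def)
  qed
  then show "Ck k F" by (rule Ck_lower)
qed

section \<open>Flat functions at the origin and a smooth step\<close>

definition flat :: "nat \<Rightarrow> real \<Rightarrow> real" where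
  "flat n x = (if 0 < x then inverse x ^ n * exp (- inverse x) else 0)"

text \<open>Substituting \<open>inverse x\<close> turns the limit from the right into the decay of a
  power divided by the exponential at infinity.\<close>

lemma tendsto_flat_0: "(flat n \<longlongrightarrow> 0) (at 0)"
proof -
  have "((\<lambda>x::real. inverse x ^ n / exp (inverse x)) \<longlongrightarrow> 0) (at_right 0)"
    using tendsto_power_div_exp_0[of n] filterlim_inverse_at_top_right by (rule filterlim_compose)
  then have r: "(flat n \<longlongrightarrow> 0) (at_right 0)"
    by (rule Lim_transform_eventually)
      (auto simp: eventually_at_right_less flat_def exp_minus field_simps intro!: eventually_mono[OF eventually_at_right_less])
  have l: "(flat n \<longlongrightarrow> 0) (at_left 0)"
    by (rule Lim_transform_eventually[OF tendsto_const])
      (auto simp: flat_def eventually_at_filter)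
  show ?thesis using r l by (simp add: filterlim_split_at)
qed

text \<open>The family is closed under differentiation up to linear combinations, which is why the
  exponent n is carried along: smoothness of all members then follows by one induction. At 0 the
  difference quotient of \<open>flat n\<close> is \<open>flat (n+1)\<close>, which tends to
  0.\<close>

lemma flat_derivative: "(flat n has_real_derivative flat (n+2) x - of_nat n * flat (n+1) x) (at x)"
proof (cases x "0::real" rule: linorder_cases)
  case less
  have "((\<lambda>x. 0) has_real_derivative 0) (at x)" by simp
  then have "(flat n has_real_derivative 0) (at x)"
    by (rule has_field_derivative_transform_within_open[where S="{..<0}"]) (use less in \<open>auto simp: flat_def\<close>)
  then show ?thesis using less by (simp add: flat_def)
next
  case greater
  have "((\<lambda>x. inverse x ^ n * exp (- inverse x)) has_real_derivative
     flat (n+2) x - of_nat n * flat (n+1) x) (at x)"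
  proof -
    have i: "(inverse has_real_derivative - (inverse x * inverse x)) (at x)"
      using DERIV_inverse[of x] greater by (simp add: power2_eq_square)
    have p: "((\<lambda>x. inverse x ^ n) has_real_derivative of_nat n * (inverse x ^ (n - Suc 0) * - (inverse x * inverse x))) (at x)"
      using DERIV_power[OF i, of n] by (simp add: mult_ac)
    have e: "((\<lambda>x. exp (- inverse x)) has_real_derivative exp (- inverse x) * (inverse x * inverse x)) (at x)"
      using DERIV_fun_exp[OF DERIV_minus[OF i]] by simp
    have "flat (n+2) x - of_nat n * flat (n+1) x =
      (of_nat n * (inverse x ^ (n - Suc 0) * - (inverse x * inverse x))) * exp (- inverse x)
      + (exp (- inverse x) * (inverse x * inverse x)) * inverse x ^ n"
    proof -
      have "y ^ (n+2) * E - of_nat n * (y ^ (n+1) * E) = (of_nat n * (y ^ (n - Suc 0) * - (y * y))) * E + (E * (y * y)) * y ^ n"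
        for y E :: real by (cases n) (simp_all add: algebra_simps)
      moreover have "flat m x = inverse x ^ m * exp (- inverse x)" for m
        using greater by (simp add: flat_def)
      ultimately show ?thesis by (simp only:)
    qed
    then show ?thesis using DERIV_mult[OF p e] by simp
  qed
  then show ?thesis
    by (rule has_field_derivative_transform_within_open[where S="{0<..}"]) (use greater in \<open>auto simp: flat_def\<close>)
next
  case equal
  have "((\<lambda>y. (flat n y - flat n 0) / (y - 0)) \<longlongrightarrow> 0) (at 0)"
    using tendsto_flat_0[of "n+1"]
    by (rule Lim_transform_eventually) (auto simp: flat_def eventually_at_filter divide_inverse)
  then show ?thesis using equal by (simp add: has_field_derivative_iff flat_def)
qed

lemma smooth_flat: "smooth (flat n)"
  unfolding smooth_def
proof
  fix k show "Ck k (flat n)"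
  proof (induction k arbitrary: n)
    case 0
    show ?case using flat_derivative
      by (auto intro!: continuous_at_imp_continuous_on DERIV_isCont)
  next
    case (Suc k)
    have "Ck k (\<lambda>x. h * (flat (n+2) x + - of_nat n * flat (n+1) x))" for h
      by (intro Ck_mult Ck_add Ck_const Suc)
    moreover have "\<And>x. (flat n has_derivative (\<lambda>h. h * (flat (n+2) x + - of_nat n * flat (n+1) x))) (at x)"
      using flat_derivative[of n] by (simp add: has_field_derivative_def mult_commute_abs)
    ultimately show ?case
      by (rule Ck_SucI[rotated])
  qed
qed

lemma continuous_antiderivative_real:
  fixes r :: "real \<Rightarrow> real"
  assumes "continuous_on UNIV r"
  obtains F where "\<And>x. (F has_real_derivative r x) (at x)"
proof -
  have "\<exists>F. \<forall>x::real. -\<infinity> < ereal x \<longrightarrow> ereal x < \<infinity> \<longrightarrow> (F has_vector_derivative r x) (at x)"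
    by (rule einterval_antiderivative) (use assms in \<open>auto simp: continuous_on_eq_continuous_at\<close>)
  then show ?thesis using that by (auto simp: has_real_derivative_iff_has_vector_derivative)
qed

text \<open>R is the normalised primitive of a bump that vanishes outside the open unit interval.
  Both are exported: R builds cut-off functions, and its derivative r, rescaled, is the mollifier in
  \<open>approximate_identity\<close>.\<close>

lemma smooth_step_exists:
  obtains R :: "real \<Rightarrow> real" and r where "smooth R" "\<And>x. (R has_real_derivative r x) (at x)"
    "\<And>x. r x \<ge> 0" "\<And>x. x \<le> 0 \<Longrightarrow> R x = 0" "\<And>x. 1 \<le> x \<Longrightarrow> R x = 1"
    "\<And>x. 0 \<le> R x" "\<And>x. R x \<le> 1" "continuous_on UNIV r" "\<And>x. x \<notin> {0<..<1} \<Longrightarrow> r x = 0"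
proof -
  define \<rho> where "\<rho> x = flat 0 x * flat 0 (1 - x)" for x
  have s: "smooth \<rho>" unfolding \<rho>_def
    by (intro smooth_mult smooth_flat smooth_compose_real[of "flat 0"] smooth_diff smooth_const smooth_bounded_linear bounded_linear_ident)
  obtain F where F: "\<And>x. (F has_real_derivative \<rho> x) (at x)"
    using continuous_antiderivative_real[OF smooth_continuous[OF s]] by blast
  have nn: "0 \<le> \<rho> x" for x by (simp add: \<rho>_def flat_def)
  have z: "\<rho> x = 0" if "x \<notin> {0<..<1}" for x using that by (auto simp: \<rho>_def flat_def)
  have mono: "F x \<le> F y" if "x \<le> y" for x y using that DERIV_nonneg_imp_nondecreasing[of x y F] F nn by blast
  have pos: "F 0 < F 1"
  proof (rule DERIV_pos_imp_increasing_open[of 0 1 F])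
    show "\<exists>y. DERIV F x :> y \<and> y > 0" if "0 < x" "x < 1" for x using that F[of x] by (auto simp: \<rho>_def flat_def)
    show "continuous_on {0..1} F" using F DERIV_isCont continuous_at_imp_continuous_on by blast
  qed simp
  have cF: "continuous_on S F" for S
    using F DERIV_isCont continuous_at_imp_continuous_on by blast
  have c0: "F x = F 0" if "x \<le> 0" for x
  proof (cases "x = 0")
    case False
    then have "x < 0" using that by simp
    moreover have "DERIV F y :> 0" if "x < y" "y < 0" for y using that F[of y] z[of y] by simp
    ultimately show ?thesis using DERIV_isconst2[of x 0 F 0] cF by simp
  qed simp
  have c1: "F x = F 1" if "1 \<le> x" for x
  proof (cases "x = 1")
    case False
    then have "1 < x" using that by simp
    moreover have "DERIV F y :> 0" if "1 < y" "y < x" for y using that F[of y] z[of y] by simp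
    ultimately show ?thesis using DERIV_isconst2[of 1 x F x] cF by simp
  qed simp
  define c where "c = inverse (F 1 - F 0)"
  define R where "R x = c * (F x - F 0)" for x
  have cpos: "0 < c" using pos by (simp add: c_def)
  have dR: "(R has_real_derivative c * \<rho> x) (at x)" for x
    unfolding R_def using F by (auto intro!: derivative_eq_intros)
  show ?thesis
  proof (rule that[of R "\<lambda>x. c * \<rho> x"])
    show "smooth R" by (rule smoothI_real_derivative[OF dR]) (intro smooth_mult smooth_const s)
    show "(R has_real_derivative c * \<rho> x) (at x)" for x by (rule dR)
    show "0 \<le> c * \<rho> x" for x using nn cpos by simp
    show "R x = 0" if "x \<le> 0" for x using c0[OF that] by (simp add: R_def)
    show r1: "R x = 1" if "1 \<le> x" for x using c1[OF that] pos by (simp add: R_def c_def)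
    show "0 \<le> R x" for x using c0[of x] mono[of 0 x] cpos by (cases "x \<le> 0") (auto simp: R_def)
    show "R x \<le> 1" for x
      using mono[of x 1] r1[of x] cpos pos by (cases "1 \<le> x") (auto simp: R_def c_def field_simps)
    show "continuous_on UNIV (\<lambda>x. c * \<rho> x)" by (intro continuous_intros smooth_continuous s)
    show "c * \<rho> x = 0" if "x \<notin> {0<..<1}" for x using z[OF that] by simp
  qed
qed

section \<open>Weak gradients and Sobolev norms\<close>

lemma AE_eq_sym: "AE x in M. f x = g x \<Longrightarrow> AE x in M. g x = f x"
  by (rule eventually_mono) auto

lemma prod_eq_0_outside:
  fixes x :: "'a::euclidean_space"
  assumes "x \<notin> box a b" "\<And>s. s \<le> 0 \<Longrightarrow> R s = (0::real)" "0 \<le> c"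
  shows "(\<Prod>i\<in>Basis. R (c * (x \<bullet> i - a \<bullet> i)) * R (c * (b \<bullet> i - x \<bullet> i))) = 0"
proof -
  obtain i where i: "i \<in> Basis" "x \<bullet> i \<le> a \<bullet> i \<or> b \<bullet> i \<le> x \<bullet> i"
    using assms(1) by (auto simp: mem_box not_less)
  then have "R (c * (x \<bullet> i - a \<bullet> i)) * R (c * (b \<bullet> i - x \<bullet> i)) = 0"
    using assms(2)[of "c * (x \<bullet> i - a \<bullet> i)"] assms(2)[of "c * (b \<bullet> i - x \<bullet> i)"]
      mult_nonneg_nonpos[OF assms(3)] by auto
  then show ?thesis using i(1) by (intro prod_zero) auto
qed

text \<open>Each face contributes a step that rises from 0 to 1 within distance 1/n inside the box.
  So the approximants vanish outside the open box and are eventually 1 at each of its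
  points.\<close>

lemma smooth_box_approximation:
  fixes a b :: "'a::euclidean_space"
  obtains \<phi> :: "nat \<Rightarrow> 'a \<Rightarrow> real"
  where "\<And>n. smooth (\<phi> n)" "\<And>n x. x \<notin> box a b \<Longrightarrow> \<phi> n x = 0"
    "\<And>n x. 0 \<le> \<phi> n x" "\<And>n x. \<phi> n x \<le> 1" "\<And>x. (\<lambda>n. \<phi> n x) \<longlonglongrightarrow> indicator (box a b) x"
proof -
  obtain R r :: "real \<Rightarrow> real" where R: "smooth R" "\<And>x. x \<le> 0 \<Longrightarrow> R x = 0" "\<And>x. 1 \<le> x \<Longrightarrow> R x = 1"
    "\<And>x. 0 \<le> R x" "\<And>x. R x \<le> 1" by (rule smooth_step_exists) blast
  define \<phi> where "\<phi> n x = (\<Prod>i\<in>Basis. R (real n * (x \<bullet> i - a \<bullet> i)) * R (real n * (b \<bullet> i - x \<bullet> i)))" for n :: nat and x :: 'a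
  have z: "\<phi> n x = 0" if "x \<notin> box a b" for n x
    unfolding \<phi>_def by (rule prod_eq_0_outside[OF that]) (auto simp: R)
  show ?thesis
  proof (rule that[of \<phi>])
    show "smooth (\<phi> n)" for n
      unfolding \<phi>_def
      by (intro smooth_prod smooth_mult smooth_compose_real[OF R(1)] smooth_diff smooth_const
          smooth_bounded_linear bounded_linear_inner_left finite_Basis)
    show "\<phi> n x = 0" if "x \<notin> box a b" for n x using z[OF that] .
    show "0 \<le> \<phi> n x" for n x unfolding \<phi>_def by (intro prod_nonneg mult_nonneg_nonneg R)
    show "\<phi> n x \<le> 1" for n x unfolding \<phi>_def by (intro prod_le_1 conjI mult_nonneg_nonneg mult_le_one R)
    show "(\<lambda>n. \<phi> n x) \<longlonglongrightarrow> indicator (box a b) x" for x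
    proof (cases "x \<in> box a b")
      case False
      then show ?thesis using z by simp
    next
      case True
      have 1: "\<forall>\<^sub>F n in sequentially. R (real n * d) = 1" if "0 < d" for d
      proof -
        obtain m :: nat where "1 / d < m" using reals_Archimedean2 by blast
        then have "1 \<le> real n * d" if "n \<ge> m" for n
        proof -
          have "1 < m * d" using \<open>1 / d < m\<close> \<open>0 < d\<close> by (simp add: field_simps)
          also have "\<dots> \<le> n * d" using that \<open>0 < d\<close> by simp
          finally show ?thesis by simp
        qed
        then show ?thesis using R(3) eventually_sequentially by blast
      qed
      have "\<forall>\<^sub>F n in sequentially. \<forall>i\<in>Basis. R (real n * (x \<bullet> i - a \<bullet> i)) = 1 \<and> R (real n * (b \<bullet> i - x \<bullet> i)) = 1"
        using True by (intro eventually_ball_finite ballI eventually_conj 1) (auto simp: mem_box)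
      then have "\<forall>\<^sub>F n in sequentially. 1 = \<phi> n x"
        by eventually_elim (simp add: \<phi>_def)
      then show ?thesis using True by (auto intro: Lim_transform_eventually[OF tendsto_const])
    qed
  qed
qed

section \<open>Lebesgue measure on an open set and the fundamental lemma of the calculus of
  variations\<close>

lemma integrable_lebesgue_on_iff:
  fixes f :: "'a::euclidean_space \<Rightarrow> 'b::euclidean_space"
  assumes "D \<in> sets lebesgue"
  shows "integrable (lebesgue_on D) f \<longleftrightarrow> integrable lebesgue (\<lambda>x. indicator D x *\<^sub>R f x)"
  by (subst integrable_restrict_space) (use assms in auto)

lemma integral_lebesgue_on_eq:
  fixes f :: "'a::euclidean_space \<Rightarrow> 'b::euclidean_space"
  assumes "D \<in> sets lebesgue"
  shows "(LINT x|lebesgue_on D. f x) = (LINT x|lebesgue. indicator D x *\<^sub>R f x)"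
  by (subst integral_restrict_space) (use assms in auto)

lemma AE_lebesgue_on_iff:
  assumes "D \<in> sets lebesgue"
  shows "(AE x in lebesgue_on D. P x) \<longleftrightarrow> (AE x in lebesgue. x \<in> D \<longrightarrow> P x)"
  by (subst AE_restrict_space_iff) (use assms in auto)

lemma open_sets_lebesgue [simp]: "open D \<Longrightarrow> D \<in> sets lebesgue"
  by (simp add: borel_open)

text \<open>Lebesgue measure is complete, so changing a measurable function on a null set keeps it
  measurable. This is used whenever a chosen or limiting function is known only almost
  everywhere.\<close>

lemma measurable_lebesgue_on_AE_eq:
  fixes f :: "'a::euclidean_space \<Rightarrow> 'b::euclidean_space"
  assumes "D \<in> sets lebesgue" "f \<in> borel_measurable (lebesgue_on D)" "AE x in lebesgue_on D. f x = g x"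
  shows "g \<in> borel_measurable (lebesgue_on D)"
proof -
  have "(\<lambda>x. if x \<in> D then f x else 0) \<in> borel_measurable lebesgue"
    using assms borel_measurable_if by blast
  moreover have "AE x in lebesgue. (if x \<in> D then f x else 0) = (if x \<in> D then g x else 0)"
    using assms(3) by (auto simp: AE_lebesgue_on_iff[OF assms(1)])
  ultimately have "(\<lambda>x. if x \<in> D then g x else 0) \<in> borel_measurable lebesgue"
    by (rule borel_measurable_AE)
  then show ?thesis by (rule borel_measurable_if_D)
qed

text \<open>\<open>has_weak_gradient\<close> provides integrability on compact subsets of D.
  Products with test functions are therefore rewritten as integrals over the whole space with the
  indicator of K, where the continuous factor is bounded.\<close>

lemma compactly_supported_product:
  fixes f :: "'a::euclidean_space \<Rightarrow> 'b::euclidean_space"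
  assumes "compact K" "K \<subseteq> D" "f absolutely_integrable_on K"
    and "continuous_on UNIV \<psi>" "\<And>x. x \<notin> K \<Longrightarrow> \<psi> x = (0::real)" "D \<in> sets lebesgue"
  shows "integrable (lebesgue_on D) (\<lambda>x. \<psi> x *\<^sub>R f x)"
    and "integrable lebesgue (\<lambda>x. \<psi> x *\<^sub>R (indicator K x *\<^sub>R f x))"
    and "(LINT x|lebesgue_on D. \<psi> x *\<^sub>R f x) = (LINT x|lebesgue. \<psi> x *\<^sub>R (indicator K x *\<^sub>R f x))"
proof -
  have eq: "indicator D x *\<^sub>R (\<psi> x *\<^sub>R f x) = \<psi> x *\<^sub>R (indicator K x *\<^sub>R f x)" for x
    using assms(2,5) by (cases "x \<in> K") (auto simp: indicator_def)
  have "compact (\<psi> ` K)" using assms by (intro compact_continuous_image) (auto intro: continuous_on_subset)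
  then obtain B where B: "\<And>x. x \<in> K \<Longrightarrow> \<bar>\<psi> x\<bar> \<le> B"
    using compact_imp_bounded[of "\<psi> ` K"] by (auto simp: bounded_iff)
  have i: "integrable lebesgue (\<lambda>x. indicator K x *\<^sub>R f x)" using assms(3) by (simp add: set_integrable_def)
  show 2: "integrable lebesgue (\<lambda>x. \<psi> x *\<^sub>R (indicator K x *\<^sub>R f x))"
  proof (rule Bochner_Integration.integrable_bound)
    show "integrable lebesgue (\<lambda>x. B *\<^sub>R norm (indicator K x *\<^sub>R f x))"
      using integrable_norm[OF i] by simp
    have "\<psi> \<in> borel_measurable lebesgue"
      using assms(4) by (simp add: borel_measurable_continuous_onI measurable_completion)
    then show "(\<lambda>x. \<psi> x *\<^sub>R (indicator K x *\<^sub>R f x)) \<in> borel_measurable lebesgue"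
      using i by measurable
    show "AE x in lebesgue. norm (\<psi> x *\<^sub>R (indicator K x *\<^sub>R f x)) \<le> norm (B *\<^sub>R norm (indicator K x *\<^sub>R f x))"
    proof (intro AE_I2)
      fix x show "norm (\<psi> x *\<^sub>R (indicator K x *\<^sub>R f x)) \<le> norm (B *\<^sub>R norm (indicator K x *\<^sub>R f x))"
        using B[of x] by (cases "x \<in> K") (auto intro!: mult_right_mono)
    qed
  qed
  show "integrable (lebesgue_on D) (\<lambda>x. \<psi> x *\<^sub>R f x)"
    using 2 by (simp only: integrable_lebesgue_on_iff[OF assms(6)] eq)
  show "(LINT x|lebesgue_on D. \<psi> x *\<^sub>R f x) = (LINT x|lebesgue. \<psi> x *\<^sub>R (indicator K x *\<^sub>R f x))"
    by (simp only: integral_lebesgue_on_eq[OF assms(6)] eq)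
qed

text \<open>Smooth approximations of boxes, taken as test functions, show that g has integral 0 over
  every closed box inside D. Differentiation of integrals over shrinking cubes then gives g = 0
  almost everywhere.\<close>

lemma fundamental_lemma_calculus_of_variations:
  fixes g :: "'a::euclidean_space \<Rightarrow> real"
  assumes "open D" and ai: "\<And>K. compact K \<Longrightarrow> K \<subseteq> D \<Longrightarrow> g absolutely_integrable_on K"
    and zero: "\<And>\<phi>. \<phi> \<in> test_functions D \<Longrightarrow> (LINT x|lebesgue_on D. \<phi> x * g x) = 0"
  shows "AE x in lebesgue_on D. g x = 0"
proof -
  have box0: "integral (cbox a b) g = 0" if "cbox a b \<subseteq> D" for a b
  proof -
    obtain \<phi> :: "nat \<Rightarrow> 'a \<Rightarrow> real" where
      \<phi>: "\<And>n. smooth (\<phi> n)" "\<And>n x. x \<notin> box a b \<Longrightarrow> \<phi> n x = 0"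
        "\<And>n x. 0 \<le> \<phi> n x" "\<And>n x. \<phi> n x \<le> 1" "\<And>x. (\<lambda>n. \<phi> n x) \<longlonglongrightarrow> indicator (box a b) x"
      by (rule smooth_box_approximation) blast
    have i: "integrable lebesgue (\<lambda>x. indicator (cbox a b) x *\<^sub>R g x)"
      using ai[OF compact_cbox that] by (simp add: set_integrable_def)
    have zc: "\<phi> n x = 0" if "x \<notin> cbox a b" for n x using \<phi>(2)[of x] that box_subset_cbox by blast
    have t: "\<phi> n \<in> test_functions D" for n
      using \<phi>(1) zc that compact_cbox[of a b] by (auto simp: test_functions_def intro!: exI[where x="cbox a b"])
    have "(LINT x|lebesgue. \<phi> n x *\<^sub>R (indicator (cbox a b) x *\<^sub>R g x)) = 0" for n
      using compactly_supported_product(3)[OF compact_cbox that ai[OF compact_cbox that] smooth_continuous[OF \<phi>(1)] zc, of n]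
        zero[OF t[of n]] assms(1) by simp
    moreover have "(\<lambda>n. LINT x|lebesgue. \<phi> n x *\<^sub>R (indicator (cbox a b) x *\<^sub>R g x))
        \<longlonglongrightarrow> (LINT x|lebesgue. indicator (box a b) x *\<^sub>R (indicator (cbox a b) x *\<^sub>R g x))"
    proof (rule integral_dominated_convergence)
      show "integrable lebesgue (\<lambda>x. norm (indicator (cbox a b) x *\<^sub>R g x))" using i by (rule integrable_norm)
      show "(\<lambda>x. indicator (box a b) x *\<^sub>R (indicator (cbox a b) x *\<^sub>R g x)) \<in> borel_measurable lebesgue"
        by (intro borel_measurable_scaleR borel_measurable_indicator borel_measurable_integrable[OF i]) simp
      show "(\<lambda>x. \<phi> n x *\<^sub>R (indicator (cbox a b) x *\<^sub>R g x)) \<in> borel_measurable lebesgue" for n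
      proof -
        have "\<phi> n \<in> borel_measurable lebesgue"
          using smooth_continuous[OF \<phi>(1)] by (simp add: borel_measurable_continuous_onI measurable_completion)
        then show ?thesis using i by measurable
      qed
      show "AE x in lebesgue. (\<lambda>n. \<phi> n x *\<^sub>R indicator (cbox a b) x *\<^sub>R g x)
         \<longlonglongrightarrow> indicator (box a b) x *\<^sub>R indicator (cbox a b) x *\<^sub>R g x"
        by (intro AE_I2 tendsto_scaleR \<phi> tendsto_const)
      show "AE x in lebesgue. norm (\<phi> n x *\<^sub>R indicator (cbox a b) x *\<^sub>R g x) \<le> norm (indicator (cbox a b) x *\<^sub>R g x)" for n
        using \<phi>(3,4) by (intro AE_I2) (simp add: abs_mult mult_left_le_one_le)
    qed
    ultimately have "(LINT x|lebesgue. indicator (box a b) x *\<^sub>R (indicator (cbox a b) x *\<^sub>R g x)) = 0"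
      by (simp only: LIMSEQ_const_iff)
    moreover have "indicator (box a b) x *\<^sub>R (indicator (cbox a b) x *\<^sub>R g x) = indicator (box a b) x *\<^sub>R g x" for x
      using box_subset_cbox[of a b] by (auto simp: indicator_def)
    ultimately have "(LINT x:box a b|lebesgue. g x) = 0" by (simp only: set_lebesgue_integral_def)
    moreover have "set_integrable lebesgue (box a b) g"
      using ai[OF compact_cbox that] by (rule set_integrable_subset) (auto intro: box_subset_cbox[THEN subsetD])
    ultimately have "integral (box a b) g = 0" using set_lebesgue_integral_eq_integral(2) by metis
    then show ?thesis using integral_open_interval[of a b g] by simp
  qed
  have cube: "AE x in lebesgue. x \<in> cbox c d \<longrightarrow> g x = 0" if "cbox c d \<subseteq> D" for c d
  proof -
    \<comment> \<open>The differentiation theorem asks for a function integrable on every box, so g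
      is cut off outside \<open>cbox c d\<close>.\<close>
    let ?f = "\<lambda>x. if x \<in> cbox c d then g x else 0"
    have i: "g absolutely_integrable_on cbox c d" using ai[OF compact_cbox that] .
    have "?f absolutely_integrable_on UNIV" using i by (simp add: absolutely_integrable_restrict_UNIV)
    then have "?f integrable_on UNIV" by (rule set_lebesgue_integral_eq_integral)
    then have "?f integrable_on cbox a b" for a b by (rule integrable_on_subcbox) simp
    then obtain N where N: "negligible N" "\<And>x e. \<lbrakk>x \<notin> N; 0 < e\<rbrakk> \<Longrightarrow>
               \<exists>d>0. \<forall>h. 0 < h \<and> h < d \<longrightarrow> norm (integral (cbox x (x + h *\<^sub>R One)) ?f /\<^sub>R h ^ DIM('a) - ?f x) < e"
      using integrable_ccontinuous_explicit[of ?f] by blast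
    have *: "g x = 0" if x: "x \<in> box c d" "x \<notin> N" for x
    proof (rule ccontr)
      assume "g x \<noteq> 0"
      then obtain \<delta> where \<delta>: "\<delta> > 0" "\<And>h. 0 < h \<Longrightarrow> h < \<delta> \<Longrightarrow> norm (integral (cbox x (x + h *\<^sub>R One)) ?f /\<^sub>R h ^ DIM('a) - ?f x) < \<bar>g x\<bar>"
        using N(2)[OF x(2), of "\<bar>g x\<bar>"] by auto
      \<comment> \<open>The cubes have x as their lower corner, so only the distance to the upper
        faces of the box restricts their side length.\<close>
      define m where "m = Min ((\<lambda>i. d \<bullet> i - x \<bullet> i) ` Basis)"
      have m: "m > 0" "\<And>i. i \<in> Basis \<Longrightarrow> m \<le> d \<bullet> i - x \<bullet> i"
        using x(1) by (auto simp: m_def mem_box)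
      define h where "h = min \<delta> m / 2"
      have h: "0 < h" "h < \<delta>" "h \<le> m" using \<delta> m by (auto simp: h_def)
      have sub: "cbox x (x + h *\<^sub>R One) \<subseteq> cbox c d"
        using x(1) m(2) h by (fastforce simp: mem_box subset_box inner_simps)
      have "integral (cbox x (x + h *\<^sub>R One)) ?f = integral (cbox x (x + h *\<^sub>R One)) g"
        using sub by (intro Henstock_Kurzweil_Integration.integral_cong) auto
      also have "\<dots> = 0" using box0 sub \<open>cbox c d \<subseteq> D\<close> by blast
      finally show False using \<delta>(2)[OF h(1,2)] x(1) box_subset_cbox[of c d] by (auto split: if_splits)
    qed
    have "AE x in lebesgue. x \<notin> N" using N(1)
      unfolding negligible_iff_null_sets by (rule AE_not_in)
    moreover have "AE x in lebesgue. x \<notin> cbox c d - box c d"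
      using negligible_frontier_interval unfolding negligible_iff_null_sets by (rule AE_not_in)
    ultimately show ?thesis by eventually_elim (use * in blast)
  qed
  obtain \<D> where \<D>: "countable \<D>" "\<D> \<subseteq> Pow D" "\<And>X. X \<in> \<D> \<Longrightarrow> \<exists>a b. X = cbox a b" "\<Union>\<D> = D"
    using open_countable_Union_open_cbox[OF assms(1)] by metis
  have "AE x in lebesgue. x \<in> X \<longrightarrow> g x = 0" if "X \<in> \<D>" for X
    using \<D>(2,3) that cube by (metis PowD subsetD)
  then have "AE x in lebesgue. \<forall>X\<in>\<D>. x \<in> X \<longrightarrow> g x = 0"
    using \<D>(1) by (subst AE_ball_countable) auto
  then have "AE x in lebesgue. x \<in> D \<longrightarrow> g x = 0"
    by (rule eventually_mono) (use \<D>(4) in blast)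
  then show ?thesis using assms(1) by (simp add: AE_lebesgue_on_iff)
qed


section \<open>Uniqueness and linearity of weak gradients; the spaces H1 and W1inf\<close>

lemma test_functions_derivative_vanishes:
  assumes "compact K" "\<And>x. x \<notin> K \<Longrightarrow> \<phi> x = 0" "x \<notin> (K :: 'a::euclidean_space set)"
  shows "frechet_derivative \<phi> (at x) h = (0::real)"
proof -
  have "((\<lambda>x. 0) has_derivative (\<lambda>h. 0)) (at x)" by simp
  then have "(\<phi> has_derivative (\<lambda>h. 0)) (at x)"
    by (rule has_derivative_transform_within_open[where s="- K"])
      (use assms compact_imp_closed in auto)
  then show ?thesis using frechet_derivative_at by metis
qed

lemma weak_gradient_integrable:
  assumes "open D" "has_weak_gradient D u G" "\<phi> \<in> test_functions D"
  shows "integrable (lebesgue_on D) (\<lambda>x. u x * frechet_derivative \<phi> (at x) h)"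
    and "integrable (lebesgue_on D) (\<lambda>x. (G x \<bullet> h) * \<phi> x)"
proof -
  obtain K where K: "compact K" "K \<subseteq> D" "\<And>x. x \<notin> K \<Longrightarrow> \<phi> x = 0" and s: "smooth \<phi>"
    using assms(3) by (auto simp: test_functions_def)
  have ai: "u absolutely_integrable_on K" "G absolutely_integrable_on K"
    using assms(2) K by (auto simp: has_weak_gradient_def)
  have D: "D \<in> sets lebesgue" using assms(1) by simp
  show "integrable (lebesgue_on D) (\<lambda>x. u x * frechet_derivative \<phi> (at x) h)"
    using compactly_supported_product(1)[OF K(1,2) ai(1) smooth_continuous[OF smooth_frechet_derivative[OF s]]
        test_functions_derivative_vanishes[OF K(1,3)] D]
    by (simp add: mult.commute)
  have "integrable (lebesgue_on D) (\<lambda>x. \<phi> x *\<^sub>R G x)"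
    using compactly_supported_product(1)[OF K(1,2) ai(2) smooth_continuous[OF s] K(3) D] by simp
  then have "integrable (lebesgue_on D) (\<lambda>x. (\<phi> x *\<^sub>R G x) \<bullet> h)"
    by (rule integrable_bounded_linear[OF bounded_linear_inner_left])
  then show "integrable (lebesgue_on D) (\<lambda>x. (G x \<bullet> h) * \<phi> x)" by (simp add: mult.commute)
qed

lemma has_weak_gradientD:
  assumes "has_weak_gradient D u G" "\<phi> \<in> test_functions D"
  shows "(LINT x|lebesgue_on D. u x * frechet_derivative \<phi> (at x) h) = - (LINT x|lebesgue_on D. (G x \<bullet> h) * \<phi> x)"
  using assms by (auto simp: has_weak_gradient_def)

text \<open>\<open>weak_gradient\<close> is a choice, so it is known only up to null sets, and every
  algebraic rule for it goes through this lemma. The fundamental lemma is for real functions and is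
  applied to one direction h at a time.\<close>

lemma has_weak_gradient_unique:
  assumes "open D" "has_weak_gradient D u G" "has_weak_gradient D v H"
    and eq: "AE x in lebesgue_on D. u x = v x"
  shows "AE x in lebesgue_on D. G x = H x"
proof -
  have "AE x in lebesgue_on D. (G x - H x) \<bullet> h = 0" for h
  proof (rule fundamental_lemma_calculus_of_variations[OF assms(1)])
    fix K assume "compact K" "K \<subseteq> D"
    then have "G absolutely_integrable_on K" "H absolutely_integrable_on K"
      using assms(2,3) by (auto simp: has_weak_gradient_def)
    then have "(\<lambda>x. G x - H x) absolutely_integrable_on K" by (rule set_integral_diff)
    then show "(\<lambda>x. (G x - H x) \<bullet> h) absolutely_integrable_on K"
      by (rule absolutely_integrable_linear[where h="\<lambda>x. x \<bullet> h", unfolded o_def]) (rule bounded_linear_inner_left)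
  next
    fix \<phi> assume \<phi>: "\<phi> \<in> test_functions D"
    have "(LINT x|lebesgue_on D. u x * frechet_derivative \<phi> (at x) h) = (LINT x|lebesgue_on D. v x * frechet_derivative \<phi> (at x) h)"
      using weak_gradient_integrable(1)[OF assms(1,2) \<phi>, of h] weak_gradient_integrable(1)[OF assms(1,3) \<phi>, of h] eq
      by (intro integral_cong_AE) auto
    then have "(LINT x|lebesgue_on D. (G x \<bullet> h) * \<phi> x) = (LINT x|lebesgue_on D. (H x \<bullet> h) * \<phi> x)"
      using has_weak_gradientD[OF assms(2) \<phi>] has_weak_gradientD[OF assms(3) \<phi>] by simp
    then have "(LINT x|lebesgue_on D. (G x \<bullet> h) * \<phi> x - (H x \<bullet> h) * \<phi> x) = 0"
      using weak_gradient_integrable(2)[OF assms(1,2) \<phi>] weak_gradient_integrable(2)[OF assms(1,3) \<phi>] by simp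
    then show "(LINT x|lebesgue_on D. \<phi> x * ((G x - H x) \<bullet> h)) = 0"
      by (simp add: inner_diff_left algebra_simps)
  qed
  then have "AE x in lebesgue_on D. \<forall>h\<in>Basis. (G x - H x) \<bullet> h = 0"
    by (subst AE_ball_countable) (auto simp: countable_finite)
  then show ?thesis by (rule eventually_mono) (simp add: euclidean_all_zero_iff)
qed

lemma has_weak_gradient_weak_gradient: "has_weak_gradient D u G \<Longrightarrow> has_weak_gradient D u (weak_gradient D u)"
  unfolding weak_gradient_def by (rule someI[of "has_weak_gradient D u"])

lemma weak_gradient_AE_eq:
  assumes "open D" "has_weak_gradient D u G"
  shows "AE x in lebesgue_on D. weak_gradient D u x = G x"
  using has_weak_gradient_unique[OF assms(1) has_weak_gradient_weak_gradient[OF assms(2)] assms(2)] by simp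

lemma has_weak_gradient_add:
  assumes "open D" "has_weak_gradient D u G" "has_weak_gradient D v H"
  shows "has_weak_gradient D (\<lambda>x. u x + v x) (\<lambda>x. G x + H x)"
  unfolding has_weak_gradient_def
proof (intro conjI allI impI ballI)
  fix K assume K: "compact K \<and> K \<subseteq> D"
  then show "(\<lambda>x. u x + v x) absolutely_integrable_on K" "(\<lambda>x. G x + H x) absolutely_integrable_on K"
    using assms(2,3) by (auto simp: has_weak_gradient_def intro!: set_integral_add)
next
  fix \<phi> h assume \<phi>: "\<phi> \<in> test_functions D"
  note i = weak_gradient_integrable[OF assms(1,2) \<phi>, of h] weak_gradient_integrable[OF assms(1,3) \<phi>, of h]
  show "(LINT x|lebesgue_on D. (u x + v x) * frechet_derivative \<phi> (at x) h) = - (LINT x|lebesgue_on D. ((G x + H x) \<bullet> h) * \<phi> x)"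
    using i has_weak_gradientD[OF assms(2) \<phi>, of h] has_weak_gradientD[OF assms(3) \<phi>, of h]
    by (simp add: distrib_right inner_add_left)
qed

lemma has_weak_gradient_scale:
  assumes "open D" "has_weak_gradient D u G"
  shows "has_weak_gradient D (\<lambda>x. c * u x) (\<lambda>x. c *\<^sub>R G x)"
  unfolding has_weak_gradient_def
proof (intro conjI allI impI ballI)
  fix K assume K: "compact K \<and> K \<subseteq> D"
  then show "(\<lambda>x. c * u x) absolutely_integrable_on K" "(\<lambda>x. c *\<^sub>R G x) absolutely_integrable_on K"
    using assms(2) absolutely_integrable_scaleR_left[of K u c] absolutely_integrable_scaleR_left[of K G c]
    by (auto simp: has_weak_gradient_def)
next
  fix \<phi> h assume \<phi>: "\<phi> \<in> test_functions D"
  show "(LINT x|lebesgue_on D. (c * u x) * frechet_derivative \<phi> (at x) h) = - (LINT x|lebesgue_on D. ((c *\<^sub>R G x) \<bullet> h) * \<phi> x)"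
    using has_weak_gradientD[OF assms(2) \<phi>, of h] by (simp add: mult.assoc)
qed

lemma weak_gradient_add:
  assumes "open D" "has_weak_gradient D u G" "has_weak_gradient D v H"
  shows "AE x in lebesgue_on D. weak_gradient D (\<lambda>x. u x + v x) x = weak_gradient D u x + weak_gradient D v x"
  by (rule weak_gradient_AE_eq[OF assms(1) has_weak_gradient_add[OF assms(1)]])
    (use assms has_weak_gradient_weak_gradient in blast)+

lemma weak_gradient_scale:
  assumes "open D" "has_weak_gradient D u G"
  shows "AE x in lebesgue_on D. weak_gradient D (\<lambda>x. c * u x) x = c *\<^sub>R weak_gradient D u x"
  by (rule weak_gradient_AE_eq[OF assms(1) has_weak_gradient_scale[OF assms(1)]])
    (use assms has_weak_gradient_weak_gradient in blast)+

lemma weak_gradient_diff: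
  assumes "open D" "has_weak_gradient D u G" "has_weak_gradient D v H"
  shows "AE x in lebesgue_on D. weak_gradient D (\<lambda>x. u x - v x) x = weak_gradient D u x - weak_gradient D v x"
  using weak_gradient_AE_eq[OF assms(1) has_weak_gradient_add[OF assms(1) has_weak_gradient_weak_gradient[OF assms(2)]
      has_weak_gradient_scale[OF assms(1) has_weak_gradient_weak_gradient[OF assms(3)], of "-1"]]]
  by simp

text \<open>The chosen weak gradient agrees almost everywhere with a square-integrable one; its
  measurability then comes from completeness of Lebesgue measure.\<close>

lemma H1_D:
  assumes "open D" "u \<in> H1 D"
  shows "u \<in> L2 (lebesgue_on D)" "has_weak_gradient D u (weak_gradient D u)"
    "weak_gradient D u \<in> L2 (lebesgue_on D)"
proof -
  obtain G where G: "G \<in> L2 (lebesgue_on D)" "has_weak_gradient D u G" and u: "u \<in> L2 (lebesgue_on D)"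
    using assms(2) by (auto simp: H1_def)
  have "AE x in lebesgue_on D. G x = weak_gradient D u x"
    using weak_gradient_AE_eq[OF assms(1) G(2)] by (rule AE_eq_sym)
  moreover from this have "weak_gradient D u \<in> borel_measurable (lebesgue_on D)"
    by (rule measurable_lebesgue_on_AE_eq[OF open_sets_lebesgue[OF assms(1)] L2_D(1)[OF G(1)]])
  ultimately show "weak_gradient D u \<in> L2 (lebesgue_on D)" by (intro L2_AE_eq[OF G(1)])
  show "u \<in> L2 (lebesgue_on D)" "has_weak_gradient D u (weak_gradient D u)"
    using u has_weak_gradient_weak_gradient[OF G(2)] by auto
qed

lemma W1inf_D:
  assumes "open D" "u \<in> W1inf D"
  shows "u \<in> Linf (lebesgue_on D)" "has_weak_gradient D u (weak_gradient D u)"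
    "weak_gradient D u \<in> Linf (lebesgue_on D)"
proof -
  obtain G where G: "G \<in> Linf (lebesgue_on D)" "has_weak_gradient D u G" and u: "u \<in> Linf (lebesgue_on D)"
    using assms(2) by (auto simp: W1inf_def)
  have "AE x in lebesgue_on D. G x = weak_gradient D u x"
    using weak_gradient_AE_eq[OF assms(1) G(2)] by (rule AE_eq_sym)
  moreover from this have "weak_gradient D u \<in> borel_measurable (lebesgue_on D)"
    by (rule measurable_lebesgue_on_AE_eq[OF open_sets_lebesgue[OF assms(1)] Linf_measurable[OF G(1)]])
  ultimately show "weak_gradient D u \<in> Linf (lebesgue_on D)" by (intro Linf_norm_AE_eq(1)[OF G(1)])
  show "u \<in> Linf (lebesgue_on D)" "has_weak_gradient D u (weak_gradient D u)"
    using u has_weak_gradient_weak_gradient[OF G(2)] by auto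
qed

lemma H1_norm_sq: "(H1_norm D u)\<^sup>2 = (L2_norm (lebesgue_on D) u)\<^sup>2 + (L2_norm (lebesgue_on D) (weak_gradient D u))\<^sup>2"
  by (simp add: H1_norm_def)

lemma H1_norm_nonneg [simp]: "0 \<le> H1_norm D u"
  by (simp add: H1_norm_def)

lemma L2_norm_le_H1_norm: "L2_norm (lebesgue_on D) u \<le> H1_norm D u"
  "L2_norm (lebesgue_on D) (weak_gradient D u) \<le> H1_norm D u"
  by (simp_all add: H1_norm_def real_le_rsqrt)

text \<open>The two components of the norm are treated as a vector in the plane, whose Euclidean
  norm supplies the triangle inequality. The weak gradient of a sum or a multiple is the expected
  one only almost everywhere, a difference that the L2 norm does not see.\<close>

lemma seminormed_functions_H1:
  assumes "open D"
  shows "seminormed_functions (H1 D) (H1_norm D)"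
proof
  let ?M = "lebesgue_on D"
  fix u v :: "'a \<Rightarrow> real" and c :: real
  assume u: "u \<in> H1 D"
  note U = H1_D[OF assms u]
  have s: "L2_norm ?M (weak_gradient D (\<lambda>x. c * u x)) = \<bar>c\<bar> * L2_norm ?M (weak_gradient D u)"
    "(\<lambda>x. c * u x) \<in> H1 D"
  proof -
    show h: "(\<lambda>x. c * u x) \<in> H1 D"
      using L2_scaleR[OF U(1), of c] L2_scaleR[OF U(3), of c] has_weak_gradient_scale[OF assms U(2), of c]
      by (auto simp: H1_def)
    have "L2_norm ?M (weak_gradient D (\<lambda>x. c * u x)) = L2_norm ?M (\<lambda>x. c *\<^sub>R weak_gradient D u x)"
      by (rule L2_norm_AE_eq[OF L2_D(1)[OF H1_D(3)[OF assms h]] L2_D(1)[OF L2_scaleR[OF U(3)]] weak_gradient_scale[OF assms U(2)]])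
    then show "L2_norm ?M (weak_gradient D (\<lambda>x. c * u x)) = \<bar>c\<bar> * L2_norm ?M (weak_gradient D u)"
      by (simp add: L2_norm_scaleR)
  qed
  show "(\<lambda>x. c * u x) \<in> H1 D" by (rule s(2))
  show "H1_norm D (\<lambda>x. c * u x) = \<bar>c\<bar> * H1_norm D u"
    using L2_norm_scaleR[of ?M c u]
    by (simp add: H1_norm_def s power_mult_distrib distrib_left[symmetric] real_sqrt_mult)
  assume v: "v \<in> H1 D"
  note V = H1_D[OF assms v]
  show h: "(\<lambda>x. u x + v x) \<in> H1 D"
    using L2_add[OF U(1) V(1)] L2_add[OF U(3) V(3)] has_weak_gradient_add[OF assms U(2) V(2)]
    by (auto simp: H1_def)
  have "L2_norm ?M (weak_gradient D (\<lambda>x. u x + v x)) = L2_norm ?M (\<lambda>x. weak_gradient D u x + weak_gradient D v x)"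
    by (rule L2_norm_AE_eq[OF L2_D(1)[OF H1_D(3)[OF assms h]] L2_D(1)[OF L2_add[OF U(3) V(3)]] weak_gradient_add[OF assms U(2) V(2)]])
  then have "H1_norm D (\<lambda>x. u x + v x) \<le> sqrt ((L2_norm ?M u + L2_norm ?M v)\<^sup>2 +
      (L2_norm ?M (weak_gradient D u) + L2_norm ?M (weak_gradient D v))\<^sup>2)"
    unfolding H1_norm_def using L2_norm_triangle[OF U(1) V(1)] L2_norm_triangle[OF U(3) V(3)]
    by (intro real_sqrt_le_mono add_mono power_mono) auto
  also have "\<dots> \<le> H1_norm D u + H1_norm D v"
    unfolding H1_norm_def by (rule real_sqrt_sum_squares_triangle_ineq)
  finally show "H1_norm D (\<lambda>x. u x + v x) \<le> H1_norm D u + H1_norm D v" .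
qed

lemma seminormed_functions_W1inf:
  assumes "open D"
  shows "seminormed_functions (W1inf D) (W1inf_norm D)"
proof
  let ?M = "lebesgue_on D"
  fix u v :: "'a \<Rightarrow> real" and c :: real
  assume u: "u \<in> W1inf D"
  note U = W1inf_D[OF assms u]
  show h: "(\<lambda>x. c * u x) \<in> W1inf D"
    using Linf_scaleR(1)[OF U(1), of c] Linf_scaleR(1)[OF U(3), of c] has_weak_gradient_scale[OF assms U(2), of c]
    by (auto simp: W1inf_def)
  have "Linf_norm ?M (weak_gradient D (\<lambda>x. c * u x)) = Linf_norm ?M (\<lambda>x. c *\<^sub>R weak_gradient D u x)"
    by (rule Linf_norm_AE_eq(2)[OF Linf_scaleR(1)[OF U(3)] Linf_measurable[OF W1inf_D(3)[OF assms h]]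
          AE_eq_sym[OF weak_gradient_scale[OF assms U(2)]]])
  then show "W1inf_norm D (\<lambda>x. c * u x) = \<bar>c\<bar> * W1inf_norm D u"
    using Linf_scaleR(2)[OF U(1), of c] Linf_scaleR(2)[OF U(3), of c]
    by (simp add: W1inf_norm_def distrib_left)
  assume v: "v \<in> W1inf D"
  note V = W1inf_D[OF assms v]
  show h: "(\<lambda>x. u x + v x) \<in> W1inf D"
    using Linf_add(1)[OF U(1) V(1)] Linf_add(1)[OF U(3) V(3)] has_weak_gradient_add[OF assms U(2) V(2)]
    by (auto simp: W1inf_def)
  have "Linf_norm ?M (weak_gradient D (\<lambda>x. u x + v x)) = Linf_norm ?M (\<lambda>x. weak_gradient D u x + weak_gradient D v x)"
    by (rule Linf_norm_AE_eq(2)[OF Linf_add(1)[OF U(3) V(3)] Linf_measurable[OF W1inf_D(3)[OF assms h]]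
          AE_eq_sym[OF weak_gradient_add[OF assms U(2) V(2)]]])
  then show "W1inf_norm D (\<lambda>x. u x + v x) \<le> W1inf_norm D u + W1inf_norm D v"
    using Linf_add(2)[OF U(1) V(1)] Linf_add(2)[OF U(3) V(3)]
    by (simp add: W1inf_norm_def)
qed

lemma weak_gradient_W1inf_bound:
  assumes "open D" "V \<in> W1inf D"
  shows "AE x in lebesgue_on D. norm (weak_gradient D V x) \<le> W1inf_norm D V"
  using Linf_norm_AE[OF W1inf_D(3)[OF assms]]
proof eventually_elim
  case (elim x)
  then show ?case using Linf_norm_nonneg[OF W1inf_D(1)[OF assms]] by (simp add: W1inf_norm_def)
qed

section \<open>The dual space of H1\<close>

lemma H1_dualI:
  assumes "\<And>u v. u \<in> H1 D \<Longrightarrow> v \<in> H1 D \<Longrightarrow> F (\<lambda>x. u x + v x) = F u + F v"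
    "\<And>u c. u \<in> H1 D \<Longrightarrow> F (\<lambda>x. c * u x) = c * F u"
    "\<forall>u\<in>H1 D. \<bar>F u\<bar> \<le> K * H1_norm D u"
  shows "F \<in> H1_dual D"
  unfolding H1_dual_def using assms by blast

lemma H1_dual_D:
  assumes "F \<in> H1_dual D"
  shows "\<And>u v. u \<in> H1 D \<Longrightarrow> v \<in> H1 D \<Longrightarrow> F (\<lambda>x. u x + v x) = F u + F v"
    "\<And>u c. u \<in> H1 D \<Longrightarrow> F (\<lambda>x. c * u x) = c * F u"
    "\<exists>K\<ge>0. \<forall>u\<in>H1 D. \<bar>F u\<bar> \<le> K * H1_norm D u"
proof -
  obtain K where K: "\<forall>u\<in>H1 D. \<bar>F u\<bar> \<le> K * H1_norm D u" using assms by (auto simp: H1_dual_def)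
  have "\<bar>F u\<bar> \<le> max K 0 * H1_norm D u" if "u \<in> H1 D" for u
    using K that by (meson H1_norm_nonneg max.cobounded1 mult_right_mono order_trans)
  then show "\<exists>K\<ge>0. \<forall>u\<in>H1 D. \<bar>F u\<bar> \<le> K * H1_norm D u" by (intro exI[where x="max K 0"]) auto
qed (use assms in \<open>auto simp: H1_dual_def\<close>)

lemma zero_in_H1: "(\<lambda>x. 0) \<in> H1 D" "H1_norm D (\<lambda>x. 0) = 0" if "open D"
proof -
  have "has_weak_gradient D (\<lambda>x. 0) (\<lambda>x. 0)" by (auto simp: has_weak_gradient_def)
  then show h: "(\<lambda>x. 0) \<in> H1 D" by (auto simp: H1_def L2_def intro!: exI[where x="\<lambda>x. 0"])
  interpret seminormed_functions "H1 D" "H1_norm D" by (rule seminormed_functions_H1[OF that])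
  show "H1_norm D (\<lambda>x. 0) = 0" using homogeneous[OF h, of 0] by simp
qed

text \<open>\<open>H1_dual_norm\<close> is a supremum of reals, so its rules need the values on the
  unit ball to be bounded above. Elements of seminorm 0 cannot be normalised; for them the bound in
  \<open>H1_dual\<close> already gives \<open>F u = 0\<close>.\<close>

lemma H1_dual_norm_bounds:
  assumes "open D" "F \<in> H1_dual D"
  shows "\<And>u. u \<in> H1 D \<Longrightarrow> \<bar>F u\<bar> \<le> H1_dual_norm D F * H1_norm D u"
    and "\<And>K. K \<ge> 0 \<Longrightarrow> (\<And>u. u \<in> H1 D \<Longrightarrow> \<bar>F u\<bar> \<le> K * H1_norm D u) \<Longrightarrow> H1_dual_norm D F \<le> K"
proof -
  interpret seminormed_functions "H1 D" "H1_norm D" by (rule seminormed_functions_H1[OF assms(1)])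
  let ?B = "{u \<in> H1 D. H1_norm D u \<le> 1}"
  obtain K where K: "K \<ge> 0" "\<And>u. u \<in> H1 D \<Longrightarrow> \<bar>F u\<bar> \<le> K * H1_norm D u" using H1_dual_D(3)[OF assms(2)] by blast
  have le: "\<bar>F u\<bar> \<le> L" if "u \<in> ?B" "L \<ge> 0" "\<And>u. u \<in> H1 D \<Longrightarrow> \<bar>F u\<bar> \<le> L * H1_norm D u" for u L
    using that(3)[of u] that(1,2) mult_left_le[of "H1_norm D u" L] by auto
  have bdd: "bdd_above ((\<lambda>u. \<bar>F u\<bar>) ` ?B)"
    using le[OF _ K] by (intro bdd_aboveI2[where M=K]) auto
  show "\<bar>F u\<bar> \<le> H1_dual_norm D F * H1_norm D u" if u: "u \<in> H1 D" for u
  proof (cases "H1_norm D u = 0")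
    case True
    then show ?thesis using K(2)[OF u] by simp
  next
    case False
    define n where "n = H1_norm D u"
    have n: "n > 0" using False H1_norm_nonneg[of D u] by (simp add: n_def less_le)
    have "(\<lambda>x. inverse n * u x) \<in> ?B"
      using scale_closed[OF u] homogeneous[OF u, of "inverse n"] n by (simp add: n_def)
    then have "\<bar>F (\<lambda>x. inverse n * u x)\<bar> \<le> H1_dual_norm D F"
      unfolding H1_dual_norm_def by (rule cSUP_upper[OF _ bdd])
    then have "inverse n * \<bar>F u\<bar> \<le> H1_dual_norm D F"
      using H1_dual_D(2)[OF assms(2) u, of "inverse n"] n by (simp add: abs_mult)
    then show ?thesis using n by (simp add: n_def[symmetric] field_simps)
  qed
  show "H1_dual_norm D F \<le> L" if "L \<ge> 0" "\<And>u. u \<in> H1 D \<Longrightarrow> \<bar>F u\<bar> \<le> L * H1_norm D u" for L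
    unfolding H1_dual_norm_def using le[OF _ that] zero_in_H1[OF assms(1)]
    by (intro cSUP_least) (auto intro!: exI[where x="\<lambda>x. 0"])
qed

lemma H1_dual_norm_nonneg:
  assumes "open D" "F \<in> H1_dual D"
  shows "0 \<le> H1_dual_norm D F"
proof -
  let ?B = "{u \<in> H1 D. H1_norm D u \<le> 1}"
  obtain K where K: "K \<ge> 0" "\<And>u. u \<in> H1 D \<Longrightarrow> \<bar>F u\<bar> \<le> K * H1_norm D u" using H1_dual_D(3)[OF assms(2)] by blast
  have "bdd_above ((\<lambda>u. \<bar>F u\<bar>) ` ?B)"
  proof (rule bdd_aboveI2)
    fix u assume "u \<in> ?B"
    then show "\<bar>F u\<bar> \<le> K" using K(2)[of u] mult_left_le[of "H1_norm D u" K] K(1) by auto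
  qed
  then have "\<bar>F (\<lambda>x. 0)\<bar> \<le> H1_dual_norm D F"
    unfolding H1_dual_norm_def using zero_in_H1[OF assms(1)] by (intro cSUP_upper) auto
  then show ?thesis by linarith
qed

text \<open>The norm rules come from the dual norm being the smallest nonnegative constant that
  bounds the functional; equality in the homogeneity is obtained by scaling back with
  \<open>inverse c\<close>.\<close>

lemma seminormed_functions_H1_dual:
  assumes "open D"
  shows "seminormed_functions (H1_dual D) (H1_dual_norm D)"
proof
  interpret h: seminormed_functions "H1 D" "H1_norm D" by (rule seminormed_functions_H1[OF assms])
  fix F G :: "('a \<Rightarrow> real) \<Rightarrow> real" and c :: real
  assume F: "F \<in> H1_dual D"
  note Fb = H1_dual_norm_bounds(1)[OF assms F] and nF = H1_dual_norm_nonneg[OF assms F]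
  have cF: "(\<lambda>u. c * F u) \<in> H1_dual D" for c
  proof -
    have "\<forall>u\<in>H1 D. \<bar>c * F u\<bar> \<le> (\<bar>c\<bar> * H1_dual_norm D F) * H1_norm D u"
      using Fb by (simp add: abs_mult mult.assoc mult_left_mono)
    then show ?thesis using H1_dual_D(1,2)[OF F] by (intro H1_dualI[where K="\<bar>c\<bar> * H1_dual_norm D F"]) (auto simp: algebra_simps)
  qed
  then show "(\<lambda>u. c * F u) \<in> H1_dual D" .
  have le: "H1_dual_norm D (\<lambda>u. c * F u) \<le> \<bar>c\<bar> * H1_dual_norm D F" if "F \<in> H1_dual D" "(\<lambda>u. c * F u) \<in> H1_dual D" for c F
  proof (rule H1_dual_norm_bounds(2)[OF assms that(2)])
    show "0 \<le> \<bar>c\<bar> * H1_dual_norm D F" using H1_dual_norm_nonneg[OF assms that(1)] by simp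
    show "\<bar>c * F u\<bar> \<le> \<bar>c\<bar> * H1_dual_norm D F * H1_norm D u" if "u \<in> H1 D" for u
      using H1_dual_norm_bounds(1)[OF assms \<open>F \<in> H1_dual D\<close> that] by (simp add: abs_mult mult.assoc mult_left_mono)
  qed
  show "H1_dual_norm D (\<lambda>u. c * F u) = \<bar>c\<bar> * H1_dual_norm D F"
  proof (cases "c = 0")
    case True
    then show ?thesis using le[OF F cF, of 0] H1_dual_norm_nonneg[OF assms cF, of 0] by simp
  next
    case False
    have "H1_dual_norm D (\<lambda>u. inverse c * (c * F u)) \<le> \<bar>inverse c\<bar> * H1_dual_norm D (\<lambda>u. c * F u)"
      by (rule le[OF cF]) (use cF[of 1] False in \<open>simp add: mult.assoc[symmetric]\<close>)
    then have "\<bar>c\<bar> * H1_dual_norm D F \<le> H1_dual_norm D (\<lambda>u. c * F u)"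
      using False by (simp add: mult.assoc[symmetric] field_simps)
    then show ?thesis using le[OF F cF, of c] by linarith
  qed
  assume G: "G \<in> H1_dual D"
  note Gb = H1_dual_norm_bounds(1)[OF assms G] and nG = H1_dual_norm_nonneg[OF assms G]
  have b: "\<bar>F u + G u\<bar> \<le> (H1_dual_norm D F + H1_dual_norm D G) * H1_norm D u" if "u \<in> H1 D" for u
    using Fb[OF that] Gb[OF that] by (simp add: distrib_right)
  show FG: "(\<lambda>u. F u + G u) \<in> H1_dual D"
    using H1_dual_D(1,2)[OF F] H1_dual_D(1,2)[OF G] b
    by (intro H1_dualI[where K="H1_dual_norm D F + H1_dual_norm D G"]) (auto simp: algebra_simps)
  show "H1_dual_norm D (\<lambda>u. F u + G u) \<le> H1_dual_norm D F + H1_dual_norm D G"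
    using H1_dual_norm_bounds(2)[OF assms FG, of "H1_dual_norm D F + H1_dual_norm D G"] b nF nG by simp
qed

lemma H1_dual_diff:
  assumes "open D" "F \<in> H1_dual D" "u \<in> H1 D" "v \<in> H1 D"
  shows "F (\<lambda>x. u x - v x) = F u - F v"
proof -
  interpret seminormed_functions "H1 D" "H1_norm D" by (rule seminormed_functions_H1[OF assms(1)])
  show ?thesis
    using H1_dual_D(1)[OF assms(2,3) scale_closed[OF assms(4), of "-1"]] H1_dual_D(2)[OF assms(2,4), of "-1"] by simp
qed

section \<open>Smooth functions as elements of H1\<close>

definition gradient :: "('a::euclidean_space \<Rightarrow> real) \<Rightarrow> 'a \<Rightarrow> 'a" where
  "gradient w x = (\<Sum>i\<in>Basis. frechet_derivative w (at x) i *\<^sub>R i)"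

lemma gradient_inner:
  assumes "smooth w"
  shows "gradient w x \<bullet> h = frechet_derivative w (at x) h"
proof -
  have lin: "linear (frechet_derivative w (at x))"
    using smooth_has_derivative[OF assms] has_derivative_linear by blast
  have "frechet_derivative w (at x) h = frechet_derivative w (at x) (\<Sum>i\<in>Basis. (h \<bullet> i) *\<^sub>R i)"
    by (simp add: euclidean_representation)
  also have "\<dots> = (\<Sum>i\<in>Basis. (h \<bullet> i) * frechet_derivative w (at x) i)"
    using lin by (simp add: linear_sum linear_scale)
  finally have "frechet_derivative w (at x) h = (\<Sum>i\<in>Basis. frechet_derivative w (at x) i * (i \<bullet> h))"
    by (simp add: mult.commute inner_commute)
  then show ?thesis by (simp add: gradient_def inner_sum_left)
qed

lemma gradient_continuous: "smooth w \<Longrightarrow> continuous_on UNIV (gradient w)"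
  unfolding gradient_def by (intro continuous_on_sum continuous_on_scaleR smooth_continuous smooth_frechet_derivative continuous_on_const)

lemma smooth_directional_derivative:
  assumes "smooth w"
  shows "((\<lambda>s. w (x + s *\<^sub>R h)) has_real_derivative frechet_derivative w (at (x + s *\<^sub>R h)) h) (at s)"
proof -
  have lin: "linear (frechet_derivative w (at (x + s *\<^sub>R h)))"
    using smooth_has_derivative[OF assms] has_derivative_linear by blast
  have "((\<lambda>s. x + s *\<^sub>R h) has_derivative (\<lambda>t. t *\<^sub>R h)) (at s)"
    by (auto intro!: derivative_eq_intros)
  from has_derivative_compose[OF this smooth_has_derivative[OF assms]]
  have "((\<lambda>s. w (x + s *\<^sub>R h)) has_derivative (\<lambda>t. frechet_derivative w (at (x + s *\<^sub>R h)) (t *\<^sub>R h))) (at s)" .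
  then show ?thesis using lin by (simp add: has_field_derivative_def linear_scale mult_commute_abs)
qed

lemma continuous_borel_lebesgue:
  fixes f :: "'a::euclidean_space \<Rightarrow> 'b::euclidean_space"
  assumes "continuous_on UNIV f"
  shows "f \<in> borel_measurable borel" "f \<in> borel_measurable lebesgue" "f \<in> borel_measurable (lebesgue_on S)"
proof -
  show 1: "f \<in> borel_measurable borel" using assms by (rule borel_measurable_continuous_onI)
  then show "f \<in> borel_measurable lebesgue" by (simp add: measurable_completion)
  then show "f \<in> borel_measurable (lebesgue_on S)" by (rule measurable_restrict_space1)
qed

text \<open>By translation invariance every difference quotient of F in direction h integrates to 0.
  The mean value theorem bounds the quotients by a bound for the derivative, and they live on a
  common ball, so dominated convergence applies.\<close>

lemma integral_derivative_compact_support: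
  fixes F :: "'a::euclidean_space \<Rightarrow> real"
  assumes "smooth F" "compact K" "\<And>x. x \<notin> K \<Longrightarrow> F x = 0"
  shows "(LINT x|lborel. frechet_derivative F (at x) h) = 0"
proof -
  define F' where "F' x = frechet_derivative F (at x) h" for x
  have cF: "continuous_on UNIV F" and cF': "continuous_on UNIV F'"
    unfolding F'_def using assms(1) by (intro smooth_continuous smooth_frechet_derivative; assumption)+
  have F'0: "F' x = 0" if "x \<notin> K" for x
    unfolding F'_def by (rule test_functions_derivative_vanishes[OF assms(2,3) that])
  have "compact (F' ` K)" using assms(2) cF' by (intro compact_continuous_image) (auto intro: continuous_on_subset)
  then obtain B0 where B0: "\<And>x. x \<in> K \<Longrightarrow> \<bar>F' x\<bar> \<le> B0"
    using compact_imp_bounded[of "F' ` K"] by (auto simp: bounded_iff)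
  define B where "B = max B0 0"
  have B: "\<bar>F' x\<bar> \<le> B" for x
  proof (cases "x \<in> K")
    case True then show ?thesis using B0[of x] by (simp add: B_def)
  next
    case False then show ?thesis using F'0[of x] by (simp add: B_def)
  qed
  obtain r where r: "\<And>x. x \<in> K \<Longrightarrow> norm x \<le> r" using compact_imp_bounded[OF assms(2)] unfolding bounded_iff by auto
  \<comment> \<open>The step sizes are at most 1, so every difference quotient vanishes outside the
    ball of this radius.\<close>
  define R where "R = r + norm h"
  define t where "t n = inverse (real (Suc n))" for n
  have t: "0 < t n" "t n \<le> 1" for n by (auto simp: t_def inverse_le_1_iff)
  define d where "d n x = (F (x + t n *\<^sub>R h) - F x) / t n" for n x
  have iF: "integrable lborel F"
  proof -
    have "integrable lborel (\<lambda>x. indicator K x *\<^sub>R F x)"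
      by (rule borel_integrable_compact) (use assms(2) cF in \<open>auto intro: continuous_on_subset\<close>)
    moreover have "(\<lambda>x. indicator K x *\<^sub>R F x) = F" using assms(3) by (auto simp: indicator_def fun_eq_iff)
    ultimately show ?thesis by simp
  qed
  have tr: "integrable lborel (\<lambda>x. F (x + c)) \<and> (LINT x|lborel. F (x + c)) = (LINT x|lborel. F x)" for c
  proof -
    have m: "F \<in> borel_measurable borel" by (rule continuous_borel_lebesgue[OF cF])
    have "integrable (distr lborel borel ((+) c)) F" using iF by (simp add: lborel_distr_plus)
    then have "integrable lborel (\<lambda>x. F (c + x))" by (subst (asm) integrable_distr_eq) (use m in auto)
    moreover have "(LINT x|distr lborel borel ((+) c). F x) = (LINT x|lborel. F (c + x))"
      by (rule integral_distr) (use m in auto)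
    ultimately show ?thesis by (simp add: lborel_distr_plus add.commute)
  qed
  have d0: "(LINT x|lborel. d n x) = 0" for n
    unfolding d_def using tr[of "t n *\<^sub>R h"] iF by simp
  have "(\<lambda>n. LINT x|lborel. d n x) \<longlonglongrightarrow> (LINT x|lborel. F' x)"
  proof (rule integral_dominated_convergence)
    show "F' \<in> borel_measurable lborel" using continuous_borel_lebesgue(1)[OF cF'] by simp
    show "d n \<in> borel_measurable lborel" for n
    proof -
      have "continuous_on UNIV (d n)" unfolding d_def
        by (intro continuous_intros continuous_on_compose2[OF cF]) (use t(1)[of n] in auto)
      then show ?thesis using continuous_borel_lebesgue(1) by simp
    qed
    show "integrable lborel (\<lambda>x. B * indicator (cball (0::'a) R) x)"
      by (intro integrable_mult_right integrable_real_indicator) (auto intro: emeasure_lborel_cball_finite[unfolded infinity_ennreal_def])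
    show "AE x in lborel. (\<lambda>n. d n x) \<longlonglongrightarrow> F' x"
    proof (rule AE_I2)
      fix x
      have "((\<lambda>s. (F (x + s *\<^sub>R h) - F x) / s) \<longlongrightarrow> F' x) (at 0)"
        using smooth_directional_derivative[OF assms(1), of x h 0] by (simp add: has_field_derivative_iff F'_def)
      moreover have "filterlim t (at 0) sequentially"
        unfolding filterlim_at using LIMSEQ_inverse_real_of_nat less_imp_neq[OF t(1), symmetric]
        by (simp add: t_def[abs_def])
      ultimately show "(\<lambda>n. d n x) \<longlonglongrightarrow> F' x" unfolding d_def by (rule filterlim_compose)
    qed
    show "AE x in lborel. norm (d n x) \<le> B * indicator (cball 0 R) x" for n
    proof (rule AE_I2)
      fix x :: 'a
      show "norm (d n x) \<le> B * indicator (cball 0 R) x"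
      proof (cases "x \<in> cball 0 R")
        case True
        obtain z where z: "F (x + t n *\<^sub>R h) - F (x + 0 *\<^sub>R h) = (t n - 0) * frechet_derivative F (at (x + z *\<^sub>R h)) h"
          using MVT2[of 0 "t n" "\<lambda>s. F (x + s *\<^sub>R h)"] smooth_directional_derivative[OF assms(1)] t(1) by meson
        then have "d n x = F' (x + z *\<^sub>R h)" using t(1)[of n] by (simp add: d_def F'_def)
        then show ?thesis using B True by simp
      next
        case False
        have "x \<notin> K"
        proof
          assume "x \<in> K"
          then have "norm x \<le> r" by (rule r)
          also have "r \<le> R" by (simp add: R_def)
          finally show False using False by simp
        qed
        moreover have "x + t n *\<^sub>R h \<notin> K"
        proof
          assume "x + t n *\<^sub>R h \<in> K"
          then have "norm (x + t n *\<^sub>R h) \<le> r" using r by blast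
          moreover have "norm x \<le> norm (x + t n *\<^sub>R h) + norm (t n *\<^sub>R h)"
            using norm_triangle_ineq4[of "x + t n *\<^sub>R h" "t n *\<^sub>R h"] by simp
          moreover have "norm (t n *\<^sub>R h) \<le> norm h" using t[of n] by (simp add: mult_left_le_one_le)
          ultimately show False using False by (simp add: R_def)
        qed
        ultimately show ?thesis using False assms(3) by (simp add: d_def)
      qed
    qed
  qed
  then show ?thesis unfolding d0 LIMSEQ_const_iff F'_def by simp
qed

lemma absolutely_integrable_continuous_on_compact:
  fixes f :: "'a::euclidean_space \<Rightarrow> 'b::euclidean_space"
  assumes "continuous_on UNIV f" "compact K"
  shows "f absolutely_integrable_on K"
proof -
  have i: "integrable lborel (\<lambda>x. indicator K x *\<^sub>R f x)"
    by (rule borel_integrable_compact) (use assms in \<open>auto intro: continuous_on_subset\<close>)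
  then have "(\<lambda>x. indicator K x *\<^sub>R f x) \<in> borel_measurable lborel" by simp
  from integrable_completion[OF this] i show ?thesis by (simp only: set_integrable_def)
qed

text \<open>Integration by parts: by the product rule the two integrands add up to the derivative of
  \<open>w x * \<phi> x\<close>, which has compact support and hence integral 0.\<close>

lemma has_weak_gradient_smooth:
  assumes "open D" "smooth w"
  shows "has_weak_gradient D w (gradient w)"
  unfolding has_weak_gradient_def
proof (intro conjI allI impI ballI)
  fix K assume K: "compact K \<and> K \<subseteq> D"
  show "w absolutely_integrable_on K" "gradient w absolutely_integrable_on K"
    using K smooth_continuous[OF assms(2)] gradient_continuous[OF assms(2)]
    by (auto intro: absolutely_integrable_continuous_on_compact)
next
  fix \<phi> h assume \<phi>: "\<phi> \<in> test_functions D"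
  then obtain K where K: "compact K" "K \<subseteq> D" "\<And>x. x \<notin> K \<Longrightarrow> \<phi> x = 0" and s: "smooth \<phi>"
    by (auto simp: test_functions_def)
  let ?p = "\<lambda>x. w x * frechet_derivative \<phi> (at x) h" and ?q = "\<lambda>x. (gradient w x \<bullet> h) * \<phi> x"
  have der: "frechet_derivative (\<lambda>x. w x * \<phi> x) (at x) h = ?p x + ?q x" for x
  proof -
    have "((\<lambda>x. w x * \<phi> x) has_derivative (\<lambda>h. w x * frechet_derivative \<phi> (at x) h + frechet_derivative w (at x) h * \<phi> x)) (at x)"
      by (intro has_derivative_mult smooth_has_derivative assms s)
    from frechet_derivative_at[OF this] show ?thesis by (simp add: gradient_inner[OF assms(2)] fun_eq_iff)
  qed
  have z: "(LINT x|lborel. ?p x + ?q x) = 0"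
    using integral_derivative_compact_support[OF smooth_mult[OF assms(2) s] K(1), of h] K(3) by (simp add: der)
  have eq: "(LINT x|lebesgue_on D. f x) = (LINT x|lborel. f x)" "integrable lborel f"
    if "continuous_on UNIV f" "\<And>x. x \<notin> K \<Longrightarrow> f x = 0" for f :: "'a \<Rightarrow> real"
  proof -
    have e: "indicator D x *\<^sub>R f x = f x" "indicator K x *\<^sub>R f x = f x" for x
      using that(2)[of x] K(2) by (auto simp: indicator_def)
    have "(LINT x|lebesgue_on D. f x) = (LINT x|lebesgue. f x)"
      using integral_lebesgue_on_eq[of D f] assms(1) by (simp only: e open_sets_lebesgue)
    also have "\<dots> = (LINT x|lborel. f x)"
      using continuous_borel_lebesgue(1)[OF that(1)] by (intro integral_completion) simp
    finally show "(LINT x|lebesgue_on D. f x) = (LINT x|lborel. f x)" .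
    have "integrable lborel (\<lambda>x. indicator K x *\<^sub>R f x)"
      by (rule borel_integrable_compact) (use K(1) that(1) in \<open>auto intro: continuous_on_subset\<close>)
    then show "integrable lborel f" by (simp only: e)
  qed
  have c: "continuous_on UNIV ?p" "continuous_on UNIV ?q"
    by (intro continuous_intros smooth_continuous smooth_frechet_derivative assms(2) s gradient_continuous)+
  have "?p x = 0" "?q x = 0" if "x \<notin> K" for x
    using test_functions_derivative_vanishes[OF K(1,3) that] K(3)[OF that] by auto
  then have "(LINT x|lebesgue_on D. ?p x) + (LINT x|lebesgue_on D. ?q x) = (LINT x|lborel. ?p x + ?q x)"
    using eq[OF c(1)] eq[OF c(2)] by simp
  then show "(LINT x|lebesgue_on D. ?p x) = - (LINT x|lebesgue_on D. ?q x)" using z by simp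
qed

lemma finite_measure_lebesgue_on_bounded: "finite_measure (lebesgue_on D)" if "open D" "bounded D"
  using that by (intro finite_measure_lebesgue_on bounded_set_imp_lmeasurable) auto

lemma L2_continuous:
  fixes f :: "'a::euclidean_space \<Rightarrow> 'b::euclidean_space"
  assumes "open D" "bounded D" "continuous_on UNIV f"
  shows "f \<in> L2 (lebesgue_on D)"
proof -
  have "compact (f ` closure D)" using assms by (intro compact_continuous_image) (auto intro: continuous_on_subset)
  then obtain B where B: "\<And>x. x \<in> closure D \<Longrightarrow> norm (f x) \<le> B"
    using compact_imp_bounded[of "f ` closure D"] by (auto simp: bounded_iff)
  show ?thesis
  proof (rule L2_bounded(1)[OF finite_measure_lebesgue_on_bounded[OF assms(1,2)] continuous_borel_lebesgue(3)[OF assms(3)]])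
    show "AE x in lebesgue_on D. norm (f x) \<le> B" using B closure_subset by (intro AE_I2) auto
  qed
qed

lemma smooth_in_H1:
  assumes "open D" "bounded D" "smooth w"
  shows "w \<in> H1 D"
    and "(H1_norm D w)\<^sup>2 = (LINT x|lebesgue_on D. (w x)\<^sup>2 + (norm (gradient w x))\<^sup>2)"
proof -
  note wL = L2_continuous[OF assms(1,2) smooth_continuous[OF assms(3)]]
    and gL = L2_continuous[OF assms(1,2) gradient_continuous[OF assms(3)]]
    and g = has_weak_gradient_smooth[OF assms(1,3)]
  show h: "w \<in> H1 D" using wL gL g by (auto simp: H1_def)
  have "L2_norm (lebesgue_on D) (weak_gradient D w) = L2_norm (lebesgue_on D) (gradient w)"
    by (rule L2_norm_AE_eq[OF L2_D(1)[OF H1_D(3)[OF assms(1) h]] L2_D(1)[OF gL] weak_gradient_AE_eq[OF assms(1) g]])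
  then show "(H1_norm D w)\<^sup>2 = (LINT x|lebesgue_on D. (w x)\<^sup>2 + (norm (gradient w x))\<^sup>2)"
    using L2_D(2)[OF wL] L2_D(2)[OF gL] by (simp add: H1_norm_sq L2_norm_sq)
qed

section \<open>The trace inequality on Lipschitz domains\<close>

lemma nn_integral_shift:
  fixes f :: "'b::euclidean_space \<Rightarrow> ennreal"
  assumes "f \<in> borel_measurable borel"
  shows "(\<integral>\<^sup>+ x. f (x + c) \<partial>lborel) = (\<integral>\<^sup>+ x. f x \<partial>lborel)"
proof -
  have "(\<integral>\<^sup>+ x. f x \<partial>distr lborel borel ((+) c)) = (\<integral>\<^sup>+ x. f (c + x) \<partial>lborel)"
    using assms by (intro nn_integral_distr) auto
  then show ?thesis by (simp add: lborel_distr_plus add.commute)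
qed

locale lipschitz_patch =
  fixes D :: "'a::euclidean_space set" and p e :: 'a and r L :: real and \<gamma> :: "'a \<Rightarrow> real"
  assumes open_D: "open D" and e: "norm e = 1" and r: "r > 0" and lip: "L-lipschitz_on UNIV \<gamma>"
    and graph: "D \<inter> ball p r = {x \<in> ball p r. x \<bullet> e < \<gamma> (x - (x \<bullet> e) *\<^sub>R e)}"
begin

text \<open>Signed height above the graph, measured in direction e. A translation by
  \<open>s *\<^sub>R e\<close> changes it by exactly s, so a strip between two heights meets each
  line parallel to e in an interval.\<close>

definition F :: "'a \<Rightarrow> real" where "F x = x \<bullet> e - \<gamma> (x - (x \<bullet> e) *\<^sub>R e)"

lemma ee: "e \<bullet> e = 1" using e by (simp add: norm_eq_sqrt_inner)

lemma L_nonneg: "0 \<le> L" using lip by (rule lipschitz_on_nonneg)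

lemma F_shift: "F (x + s *\<^sub>R e) = F x + s"
  by (simp add: F_def inner_add_left ee scaleR_add_left algebra_simps)

text \<open>The orthogonal projection to the hyperplane does not increase distances, and
  \<open>x \<bullet> e\<close> is 1-Lipschitz; the constants 1 and L add up.\<close>

lemma F_lipschitz: "\<bar>F x - F y\<bar> \<le> (1 + L) * norm (x - y)"
proof -
  define z where "z = x - y"
  have 1: "norm (z - (z \<bullet> e) *\<^sub>R e) \<le> norm z"
  proof (rule power2_le_imp_le)
    have "(norm (z - (z \<bullet> e) *\<^sub>R e))\<^sup>2 = (norm z)\<^sup>2 - (z \<bullet> e)\<^sup>2"
      unfolding power2_norm_eq_inner
      by (simp add: inner_diff_left inner_diff_right ee inner_commute power2_eq_square)
    then show "(norm (z - (z \<bullet> e) *\<^sub>R e))\<^sup>2 \<le> (norm z)\<^sup>2" by simp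
  qed simp
  have 2: "z - (z \<bullet> e) *\<^sub>R e = (x - (x \<bullet> e) *\<^sub>R e) - (y - (y \<bullet> e) *\<^sub>R e)"
    by (simp add: z_def inner_diff_left scaleR_diff_left)
  have "norm ((x - (x \<bullet> e) *\<^sub>R e) - (y - (y \<bullet> e) *\<^sub>R e)) \<le> norm (x - y)"
    using 1 unfolding 2 by (simp only: z_def)
  then have "\<bar>\<gamma> (x - (x \<bullet> e) *\<^sub>R e) - \<gamma> (y - (y \<bullet> e) *\<^sub>R e)\<bar> \<le> L * norm (x - y)"
    using lipschitz_onD[OF lip, of "x - (x \<bullet> e) *\<^sub>R e" "y - (y \<bullet> e) *\<^sub>R e"] L_nonneg
      mult_left_mono[of _ _ L] by (fastforce simp: dist_norm)
  moreover have "\<bar>x \<bullet> e - y \<bullet> e\<bar> \<le> norm (x - y)"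
    using Cauchy_Schwarz_ineq2[of "x - y" e] e by (simp add: inner_diff_left)
  ultimately show ?thesis by (simp add: F_def distrib_right)
qed

lemma F_continuous: "continuous_on S F"
proof -
  have "(1 + L)-lipschitz_on S F"
    using F_lipschitz L_nonneg by (intro lipschitz_onI) (auto simp: dist_norm)
  then show ?thesis by (rule lipschitz_on_continuous_on)
qed

lemma in_D_iff:
  assumes "x \<in> ball p r"
  shows "x \<in> D \<longleftrightarrow> F x < 0"
proof -
  have "x \<in> D \<longleftrightarrow> x \<in> D \<inter> ball p r" using assms by blast
  then show ?thesis unfolding graph using assms by (simp add: F_def)
qed

text \<open>Frontier points lie outside the open set D, which excludes negative height; positive
  height would give a neighbourhood disjoint from D.\<close>

lemma F_frontier:
  assumes "x \<in> frontier D" "x \<in> ball p r"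
  shows "F x = 0"
proof (rule antisym)
  have "x \<notin> D" using assms(1) open_D by (simp add: frontier_def interior_open)
  then show "0 \<le> F x" using in_D_iff[OF assms(2)] by simp
  show "F x \<le> 0"
  proof (rule ccontr)
    assume "\<not> F x \<le> 0"
    then have "x \<in> ball p r \<inter> {y. 0 < F y}" using assms(2) by simp
    moreover have "open (ball p r \<inter> {y. 0 < F y})"
      by (intro open_Int open_ball open_Collect_less continuous_on_const F_continuous)
    moreover have "x \<in> closure D" using assms(1) by (simp add: frontier_def)
    ultimately obtain y where "y \<in> D" "y \<in> ball p r \<inter> {y. 0 < F y}"
      using open_Int_closure_eq_empty[of "ball p r \<inter> {y. 0 < F y}" D] by blast
    then show False using in_D_iff[of y] by auto
  qed
qed

definition strip :: "real \<Rightarrow> real \<Rightarrow> 'a set" where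
  "strip h q = {x. -h < F x} \<inter> {x. F x < 0} \<inter> ball p q"

lemma open_strip: "open (strip h q)"
  unfolding strip_def by (intro open_Int open_ball open_Collect_less continuous_on_const F_continuous)

text \<open>Along the ray, w^2 is multiplied by the ramp \<open>1 - s / \<rho>\<close>, which is 1
  at x and 0 at distance \<rho>, so that integrating the derivative leaves only the value at x. The
  coefficient \<open>1 / \<rho>\<close> is the slope of the ramp; the others come from Young's
  inequality for the product of w and its derivative.\<close>

lemma square_le_integral_along_ray:
  assumes "smooth w" "0 < \<rho>"
  shows "ennreal ((w x)\<^sup>2) \<le> (\<integral>\<^sup>+ s. ennreal ((1/\<rho> + 1) * (w (x - s *\<^sub>R e))\<^sup>2 + (norm (gradient w (x - s *\<^sub>R e)))\<^sup>2)
             * indicator {0..\<rho>} s \<partial>lborel)"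
proof -
  define G where "G s = (1/\<rho> + 1) * (w (x - s *\<^sub>R e))\<^sup>2 + (norm (gradient w (x - s *\<^sub>R e)))\<^sup>2" for s
  define m where "m s = (w (x - s *\<^sub>R e))\<^sup>2 * (1 - s / \<rho>)" for s
  have cG: "continuous_on UNIV G" unfolding G_def
    by (intro continuous_intros continuous_on_compose2[OF smooth_continuous[OF assms(1)]]
        continuous_on_compose2[OF gradient_continuous[OF assms(1)]]) auto
  have G0: "0 \<le> G s" for s using assms(2) by (simp add: G_def)
  obtain \<Phi> where \<Phi>: "\<And>s. (\<Phi> has_real_derivative G s) (at s)" using continuous_antiderivative_real[OF cG] by blast
  have dm: "(m has_real_derivative (2 * w (x - s *\<^sub>R e) * - (gradient w (x - s *\<^sub>R e) \<bullet> e)) * (1 - s / \<rho>)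
      + - (1 / \<rho>) * (w (x - s *\<^sub>R e))\<^sup>2) (at s)" for s
  proof -
    have d: "((\<lambda>s. w (x - s *\<^sub>R e)) has_real_derivative - (gradient w (x - s *\<^sub>R e) \<bullet> e)) (at s)"
      using smooth_directional_derivative[OF assms(1), of x "- e" s]
      by (simp add: gradient_inner[OF assms(1), symmetric])
    have "((\<lambda>s. 1 - s / \<rho>) has_real_derivative - (1 / \<rho>)) (at s)"
      using assms(2) by (auto intro!: derivative_eq_intros)
    from DERIV_mult[OF DERIV_power[OF d, of 2] this] show ?thesis
      unfolding m_def by (simp add: mult_ac)
  qed
  \<comment> \<open>Monotonicity of this sum is the integrated form of the inequality between G and
    the derivative of m.\<close>
  have "\<Phi> 0 + m 0 \<le> \<Phi> \<rho> + m \<rho>"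
  proof (rule DERIV_nonneg_imp_nondecreasing[where f="\<lambda>s. \<Phi> s + m s"])
    fix s assume s: "0 \<le> s" "s \<le> \<rho>"
    let ?a = "w (x - s *\<^sub>R e)" and ?b = "gradient w (x - s *\<^sub>R e) \<bullet> e"
    have "\<bar>?b\<bar> \<le> norm (gradient w (x - s *\<^sub>R e))" using Cauchy_Schwarz_ineq2[of _ e] e by simp
    then have b: "?b\<^sup>2 \<le> (norm (gradient w (x - s *\<^sub>R e)))\<^sup>2" by (simp add: abs_le_square_iff[symmetric])
    define c where "c = 1 - s / \<rho>"
    have "0 \<le> c" "c \<le> 1" using s assms(2) by (auto simp: c_def)
    then have "?b\<^sup>2 * c\<^sup>2 \<le> ?b\<^sup>2" by (intro mult_left_le power_le_one) auto
    moreover have "2 * ?a * (?b * c) \<le> ?a\<^sup>2 + (?b * c)\<^sup>2" by (rule sum_squares_bound)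
    ultimately have "(2 * ?a * ?b) * c \<le> ?a\<^sup>2 + ?b\<^sup>2"
      by (simp add: power_mult_distrib mult.assoc)
    moreover have "G s = (1/\<rho>) * ?a\<^sup>2 + ?a\<^sup>2 + (norm (gradient w (x - s *\<^sub>R e)))\<^sup>2"
      by (simp add: G_def distrib_right)
    ultimately have "0 \<le> G s + ((2 * ?a * - ?b) * c + - (1 / \<rho>) * ?a\<^sup>2)"
      using b by simp
    then show "\<exists>y. ((\<lambda>s. \<Phi> s + m s) has_real_derivative y) (at s) \<and> 0 \<le> y"
      using DERIV_add[OF \<Phi> dm, of s] unfolding c_def by (intro exI conjI)
  qed (use assms in auto)
  then have "(w x)\<^sup>2 \<le> \<Phi> \<rho> - \<Phi> 0" using assms(2) by (simp add: m_def)
  moreover have "(\<integral>\<^sup>+ s. ennreal (G s) * indicator {0..\<rho>} s \<partial>lborel) = ennreal (\<Phi> \<rho> - \<Phi> 0)"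
    using assms(2) G0 \<Phi> continuous_borel_lebesgue(1)[OF cG]
    by (intro nn_integral_FTC_Icc) (auto intro: has_field_derivative_at_within)
  ultimately show ?thesis unfolding G_def by (simp add: ennreal_leI)
qed

text \<open>After the ray estimate and an exchange of integrals, a point z is counted for those s
  with \<open>z + s *\<^sub>R e\<close> in the strip. The height grows by s, so these s lie in an
  interval of length h, which is the factor in front. The condition
  \<open>q + \<rho> \<le> r\<close> keeps z in the ball where D is the region below the
  graph.\<close>

lemma strip_integral_le:
  assumes "smooth w" "0 < \<rho>" "q + \<rho> \<le> r" "0 < h"
  shows "(\<integral>\<^sup>+ x. ennreal ((w x)\<^sup>2) * indicator (strip h q) x \<partial>lborel)
     \<le> ennreal h * (\<integral>\<^sup>+ x. ennreal ((1/\<rho> + 1) * (w x)\<^sup>2 + (norm (gradient w x))\<^sup>2) * indicator D x \<partial>lborel)"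
proof -
  define G where "G z = ennreal ((1/\<rho> + 1) * (w z)\<^sup>2 + (norm (gradient w z))\<^sup>2)" for z
  let ?A = "strip h q"
  have mw[measurable]: "w \<in> borel_measurable borel" "gradient w \<in> borel_measurable borel"
    using continuous_borel_lebesgue(1) smooth_continuous gradient_continuous assms(1) by blast+
  have mG[measurable]: "G \<in> borel_measurable borel" unfolding G_def by measurable
  have mA[measurable]: "?A \<in> sets borel" using open_strip by (rule borel_open)
  have "(\<integral>\<^sup>+ x. ennreal ((w x)\<^sup>2) * indicator ?A x \<partial>lborel)
     \<le> (\<integral>\<^sup>+ x. (\<integral>\<^sup>+ s. G (x - s *\<^sub>R e) * indicator {0..\<rho>} s * indicator ?A x \<partial>lborel) \<partial>lborel)"
  proof (rule nn_integral_mono)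
    fix x
    show "ennreal ((w x)\<^sup>2) * indicator ?A x \<le> (\<integral>\<^sup>+ s. G (x - s *\<^sub>R e) * indicator {0..\<rho>} s * indicator ?A x \<partial>lborel)"
      using square_le_integral_along_ray[OF assms(1,2), of x] by (auto simp: indicator_def G_def)
  qed
  also have "\<dots> = (\<integral>\<^sup>+ s. (\<integral>\<^sup>+ x. G (x - s *\<^sub>R e) * indicator {0..\<rho>} s * indicator ?A x \<partial>lborel) \<partial>lborel)"
    by (rule lborel_pair.Fubini') measurable
  also have "\<dots> = (\<integral>\<^sup>+ s. (\<integral>\<^sup>+ z. G z * indicator {0..\<rho>} s * indicator ?A (z + s *\<^sub>R e) \<partial>lborel) \<partial>lborel)"
  proof (rule nn_integral_cong)
    fix s :: real
    show "(\<integral>\<^sup>+ x. G (x - s *\<^sub>R e) * indicator {0..\<rho>} s * indicator ?A x \<partial>lborel)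
       = (\<integral>\<^sup>+ z. G z * indicator {0..\<rho>} s * indicator ?A (z + s *\<^sub>R e) \<partial>lborel)"
      by (subst nn_integral_shift[symmetric, where c="s *\<^sub>R e"]) auto
  qed
  also have "\<dots> = (\<integral>\<^sup>+ z. (\<integral>\<^sup>+ s. G z * indicator {0..\<rho>} s * indicator ?A (z + s *\<^sub>R e) \<partial>lborel) \<partial>lborel)"
    by (rule lborel_pair.Fubini'[symmetric]) measurable
  also have "\<dots> \<le> (\<integral>\<^sup>+ z. ennreal h * (G z * indicator D z) \<partial>lborel)"
  proof (rule nn_integral_mono)
    fix z
    have "(\<integral>\<^sup>+ s. G z * indicator {0..\<rho>} s * indicator ?A (z + s *\<^sub>R e) \<partial>lborel)
       \<le> (\<integral>\<^sup>+ s. (G z * indicator D z) * indicator {- h - F z..- F z} s \<partial>lborel)"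
    proof (rule nn_integral_mono)
      fix s :: real
      show "G z * indicator {0..\<rho>} s * indicator ?A (z + s *\<^sub>R e) \<le> (G z * indicator D z) * indicator {- h - F z..- F z} s"
      proof (cases "s \<in> {0..\<rho>} \<and> z + s *\<^sub>R e \<in> ?A")
        case True
        then have s: "0 \<le> s" "s \<le> \<rho>" "- h < F z + s" "F z + s < 0" "norm (p - (z + s *\<^sub>R e)) < q"
          by (auto simp: strip_def F_shift dist_norm)
        have "norm (p - z) \<le> norm (p - (z + s *\<^sub>R e)) + norm (s *\<^sub>R e)"
          using norm_triangle_ineq[of "p - (z + s *\<^sub>R e)" "s *\<^sub>R e"] by simp
        also have "\<dots> < q + \<rho>" using s e by simp
        finally have "z \<in> ball p r" using assms(3) by (simp add: dist_norm)
        then have "z \<in> D" using in_D_iff s by auto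
        then show ?thesis using s by (simp add: indicator_def)
      qed (auto simp: indicator_def)
    qed
    also have "\<dots> = (G z * indicator D z) * ennreal h"
      using assms(4) by (subst nn_integral_cmult_indicator) auto
    finally show "(\<integral>\<^sup>+ s. G z * indicator {0..\<rho>} s * indicator ?A (z + s *\<^sub>R e) \<partial>lborel) \<le> ennreal h * (G z * indicator D z)"
      by (simp add: mult.commute)
  qed
  also have "\<dots> = ennreal h * (\<integral>\<^sup>+ z. G z * indicator D z \<partial>lborel)"
    using open_D by (intro nn_integral_cmult) measurable
  finally show ?thesis by (simp add: G_def)
qed

text \<open>At depth \<open>h/4\<close> below each point of \<open>P\<close> the strip contains a ball whose radius is a fixed multiple of \<open>h\<close>;
  separation makes these balls disjoint.\<close>

lemma card_separated_bound:
  assumes "finite P" "P \<subseteq> frontier D \<inter> ball p q" "0 < h" "q + h \<le> r"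
    and sep: "\<And>x y. x \<in> P \<Longrightarrow> y \<in> P \<Longrightarrow> x \<noteq> y \<Longrightarrow> h \<le> dist x y"
    and sub: "\<And>x. x \<in> P \<Longrightarrow> ball x h \<subseteq> B" and B: "B \<in> sets borel"
  shows "of_nat (card P) * ennreal (unit_ball_vol (real DIM('a)) * (h / (4 * (1 + L))) ^ DIM('a))
    \<le> emeasure lborel (strip h r \<inter> B)"
proof -
  \<comment> \<open>On a ball of radius \<kappa> the height differs from that of the centre by less
    than h/4, so around depth h/4 it stays strictly between -h/2 and 0. Moreover
    \<open>\<kappa> \<le> h / 4\<close> keeps the ball within h/2 of x, which is half the
    separation.\<close>
  define \<kappa> where "\<kappa> = h / (4 * (1 + L))"
  have \<kappa>: "0 < \<kappa>" "\<kappa> \<le> h / 4" "(1 + L) * \<kappa> = h / 4"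
    using assms(3) L_nonneg by (auto simp: \<kappa>_def field_simps)
  define C where "C x = ball (x - (h/4) *\<^sub>R e) \<kappa>" for x
  have near: "dist x y < h / 2" if "y \<in> C x" for x y
  proof -
    have "dist x y \<le> dist x (x - (h/4) *\<^sub>R e) + dist (x - (h/4) *\<^sub>R e) y" by (rule dist_triangle)
    also have "\<dots> < h/4 + \<kappa>" using that e assms(3) by (simp add: C_def dist_norm)
    finally show ?thesis using \<kappa>(2) by simp
  qed
  have C_sub: "C x \<subseteq> strip h r \<inter> B" if "x \<in> P" for x
  proof
    fix y assume y: "y \<in> C x"
    have x: "x \<in> frontier D" "dist p x < q" using that assms(2) by auto
    have yx: "dist x y < h" using near[OF y] assms(3) by simp
    have "dist p y \<le> dist p x + dist x y" by (rule dist_triangle)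
    then have yr: "dist p y < r" using x yx assms(4) by simp
    have "x \<in> ball p r" using x assms(3,4) by simp
    then have "F x = 0" using F_frontier x by blast
    then have "F (x - (h/4) *\<^sub>R e) = - (h/4)" using F_shift[of x "- (h/4)"] by simp
    moreover have "\<bar>F y - F (x - (h/4) *\<^sub>R e)\<bar> \<le> (1 + L) * norm (y - (x - (h/4) *\<^sub>R e))" by (rule F_lipschitz)
    moreover have "(1 + L) * norm (y - (x - (h/4) *\<^sub>R e)) < (1 + L) * \<kappa>"
      using y L_nonneg by (intro mult_strict_left_mono) (auto simp: C_def dist_norm norm_minus_commute)
    ultimately have "\<bar>F y + h/4\<bar> < h/4" using \<kappa>(3) by simp
    then have "- h < F y" "F y < 0" by linarith+
    then show "y \<in> strip h r \<inter> B" using yr yx sub[OF that] by (auto simp: strip_def)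
  qed
  have disj: "disjoint_family_on C P"
    unfolding disjoint_family_on_def
  proof (intro ballI impI equals0I)
    fix x y z assume "x \<in> P" "y \<in> P" "x \<noteq> y" "z \<in> C x \<inter> C y"
    then have "dist x z < h/2" "dist y z < h/2" "h \<le> dist x y" using near sep by auto
    moreover have "dist x y \<le> dist x z + dist y z" by (metis dist_commute dist_triangle)
    ultimately show False by simp
  qed
  have "(\<Sum>x\<in>P. emeasure lborel (C x)) = emeasure lborel (\<Union>x\<in>P. C x)"
    by (rule sum_emeasure[OF _ disj assms(1)]) (auto simp: C_def)
  also have "\<dots> \<le> emeasure lborel (strip h r \<inter> B)"
    using C_sub B open_strip by (intro emeasure_mono) (auto intro: borel_open)
  finally show ?thesis
    using \<kappa>(1) by (simp add: C_def emeasure_ball \<kappa>_def)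
qed

text \<open>The volume bound \<open>card_separated_bound\<close> limits the size of separated
  subsets, so one of largest cardinality exists. A point of A outside its closed h-balls could be
  added to it.\<close>

lemma maximal_separated_set:
  assumes A: "A \<subseteq> frontier D \<inter> ball p q" "0 < h" "q + h \<le> r"
  obtains P where "finite P" "P \<subseteq> A" "A \<subseteq> (\<Union>x\<in>P. cball x h)"
    "\<And>x y. x \<in> P \<Longrightarrow> y \<in> P \<Longrightarrow> x \<noteq> y \<Longrightarrow> h \<le> dist x y"
proof -
  define Q where "Q P \<longleftrightarrow> finite P \<and> P \<subseteq> A \<and> (\<forall>x\<in>P. \<forall>y\<in>P. x \<noteq> y \<longrightarrow> h \<le> dist x y)" for P
  define c where "c = unit_ball_vol (real DIM('a)) * (h / (4 * (1 + L))) ^ DIM('a)"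
  have c: "c > 0" using assms(2) L_nonneg by (auto simp: c_def intro!: mult_pos_pos zero_less_power)
  define V where "V = measure lborel (strip h r)"
  have fin: "emeasure lborel (strip h r) < \<infinity>"
    using emeasure_mono[of "strip h r" "ball p r" lborel] emeasure_bounded_finite[of "ball p r"]
    by (auto simp: strip_def intro: le_less_trans)
  have bound: "card P \<le> nat \<lceil>V / c\<rceil>" if "Q P" for P
  proof -
    have "of_nat (card P) * ennreal c \<le> emeasure lborel (strip h r \<inter> UNIV)"
      unfolding c_def using that A by (intro card_separated_bound[where q=q]) (auto simp: Q_def)
    also have "\<dots> = ennreal V" using fin by (simp add: V_def emeasure_eq_ennreal_measure)
    finally have "ennreal (real (card P) * c) \<le> ennreal V" using c by (simp add: ennreal_mult ennreal_of_nat_eq_real_of_nat)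
    then have "real (card P) * c \<le> V" by (simp add: V_def)
    then have "real (card P) \<le> V / c" using c by (simp add: field_simps)
    then show ?thesis by linarith
  qed
  have "Q {}" by (simp add: Q_def)
  then obtain P where P: "Q P" "\<And>P'. Q P' \<Longrightarrow> card P' \<le> card P"
    using ex_has_greatest_nat[of Q "{}" card "Suc (nat \<lceil>V / c\<rceil>)"] bound by (auto simp: less_Suc_eq_le)
  have "A \<subseteq> (\<Union>x\<in>P. cball x h)"
  proof
    fix y assume y: "y \<in> A"
    show "y \<in> (\<Union>x\<in>P. cball x h)"
    proof (rule ccontr)
      assume "y \<notin> (\<Union>x\<in>P. cball x h)"
      then have far: "\<And>x. x \<in> P \<Longrightarrow> h < dist x y" by auto
      then have "y \<notin> P" using assms(2) by fastforce
      have "Q (insert y P)" using P(1) y far by (auto simp: Q_def dist_commute intro: less_imp_le)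
      then have "card (insert y P) \<le> card P" by (rule P(2))
      then show False using \<open>y \<notin> P\<close> P(1) by (simp add: Q_def)
    qed
  qed
  then show ?thesis using P(1) that by (auto simp: Q_def)
qed

end

section \<open>Coverings and Hausdorff measure\<close>

definition hausdorff_pre :: "nat \<Rightarrow> real \<Rightarrow> 'a::metric_space set \<Rightarrow> ennreal" where
  "hausdorff_pre s \<delta> A = (INF U\<in>{U::nat \<Rightarrow> 'a set. A \<subseteq> (\<Union>i. U i) \<and> (\<forall>i. bounded (U i) \<and> diameter (U i) \<le> \<delta>)}.
          \<Sum>i. hausdorff_gauge s (U i))"

lemma hausdorff_outer_eq_SUP_pre: "hausdorff_outer s A = (SUP \<delta>\<in>{0<..}. hausdorff_pre s \<delta> A)"
  by (simp add: hausdorff_outer_def hausdorff_pre_def)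

lemma hausdorff_pre_antimono: "\<delta> \<le> \<delta>' \<Longrightarrow> hausdorff_pre s \<delta>' A \<le> hausdorff_pre s \<delta> A"
  unfolding hausdorff_pre_def by (intro INF_superset_mono) (auto intro: order_trans)

text \<open>Monotonicity in \<delta> reduces the supremum to an increasing sequence, along which it
  commutes with the finite sums of \<open>patch_level_sum\<close>.\<close>

lemma hausdorff_outer_le_SUP_seq:
  "hausdorff_outer s A \<le> (SUP n. hausdorff_pre s (inverse (real (Suc n))) A)"
  unfolding hausdorff_outer_eq_SUP_pre
proof (rule SUP_least)
  fix \<delta> :: real assume "\<delta> \<in> {0<..}"
  then obtain n where "inverse (real (Suc n)) < \<delta>" using reals_Archimedean by auto
  then have "hausdorff_pre s \<delta> A \<le> hausdorff_pre s (inverse (real (Suc n))) A"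
    by (intro hausdorff_pre_antimono) simp
  then show "hausdorff_pre s \<delta> A \<le> (SUP n. hausdorff_pre s (inverse (real (Suc n))) A)"
    by (rule SUP_upper2[OF UNIV_I])
qed

lemma hausdorff_pre_le_card:
  assumes "finite P" "A \<subseteq> (\<Union>x\<in>P. cball x h)" "0 < h" "2 * h \<le> \<delta>"
  shows "hausdorff_pre s \<delta> (A :: 'a::euclidean_space set) \<le> of_nat (card P) * ennreal (unit_ball_vol (real s) * h ^ s)"
proof -
  obtain f where f: "bij_betw f {..<card P} P"
    using ex_bij_betw_nat_finite[OF assms(1)] by (auto simp: atLeast0LessThan)
  \<comment> \<open>The cover is padded with empty sets, whose gauge is 0 even for
    \<open>s = 0\<close>.\<close>
  define U where "U i = (if i < card P then cball (f i) h else {})" for i :: nat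
  have "A \<subseteq> (\<Union>i. U i)"
  proof
    fix y assume "y \<in> A"
    then obtain x where "x \<in> P" "y \<in> cball x h" using assms(2) by blast
    moreover obtain i where "i < card P" "f i = x"
      using f \<open>x \<in> P\<close> unfolding bij_betw_def by (metis imageE lessThan_iff)
    ultimately have "y \<in> U i" by (simp add: U_def)
    then show "y \<in> (\<Union>i. U i)" by blast
  qed
  moreover have "bounded (U i) \<and> diameter (U i) \<le> \<delta>" for i
    using assms(3,4) by (auto simp: U_def)
  ultimately have "hausdorff_pre s \<delta> A \<le> (\<Sum>i. hausdorff_gauge s (U i))"
    unfolding hausdorff_pre_def by (intro INF_lower) auto
  also have "\<dots> = (\<Sum>i<card P. hausdorff_gauge s (U i))"
    by (rule suminf_finite) (auto simp: U_def hausdorff_gauge_def)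
  also have "\<dots> = (\<Sum>i<card P. ennreal (unit_ball_vol (real s) * h ^ s))"
    using assms(3) by (intro sum.cong) (auto simp: U_def hausdorff_gauge_def)
  finally show ?thesis by simp
qed

context lipschitz_patch
begin

text \<open>Ratio between the gauge of a covering ball of radius h and the volume of the small ball
  packed into the strip, freed of its factor 1/h.\<close>

definition cover_const :: real where
  "cover_const = unit_ball_vol (real (DIM('a) - 1)) / (unit_ball_vol (real DIM('a)) * (1 / (4 * (1 + L))) ^ DIM('a))"

lemma cover_const_nonneg: "0 \<le> cover_const"
  using L_nonneg by (auto simp: cover_const_def intro!: divide_nonneg_nonneg)

text \<open>A maximal h-separated subset of A does two things at once: balls of radius h around it
  cover A, and smaller disjoint balls near it fit into the strip, so the covering sum is bounded by
  a volume. B records where the packed balls lie; for a superlevel set of w^2 it will be a slightly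
  lower superlevel set.\<close>

lemma hausdorff_pre_le_strip:
  assumes A: "A \<subseteq> frontier D \<inter> ball p q" "0 < h" "q + h \<le> r" "2 * h \<le> \<delta>"
    and sub: "\<And>x. x \<in> A \<Longrightarrow> ball x h \<subseteq> B" and B: "B \<in> sets borel"
  shows "hausdorff_pre (DIM('a) - 1) \<delta> A \<le> ennreal (cover_const / h) * emeasure lborel (strip h r \<inter> B)"
proof -
  obtain P where P: "finite P" "P \<subseteq> A" "A \<subseteq> (\<Union>x\<in>P. cball x h)"
    "\<And>x y. x \<in> P \<Longrightarrow> y \<in> P \<Longrightarrow> x \<noteq> y \<Longrightarrow> h \<le> dist x y"
    using maximal_separated_set[OF A(1-3)] by metis
  let ?N = "DIM('a)"
  define c where "c = unit_ball_vol (real ?N) * (h / (4 * (1 + L))) ^ ?N"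
  have c: "c > 0" using A(2) L_nonneg by (auto simp: c_def intro!: mult_pos_pos zero_less_power)
  have "hausdorff_pre (?N - 1) \<delta> A \<le> of_nat (card P) * ennreal (unit_ball_vol (real (?N - 1)) * h ^ (?N - 1))"
    using P A by (intro hausdorff_pre_le_card) auto
  also have "unit_ball_vol (real (?N - 1)) * h ^ (?N - 1) = c * (cover_const / h)"
  proof -
    define k where "k = (1 / (4 * (1 + L))) ^ ?N"
    define v where "v = unit_ball_vol (real ?N)"
    have pos: "k > 0" "v > 0" using L_nonneg by (auto simp: k_def v_def intro!: zero_less_power)
    have "(h / (4 * (1 + L))) ^ ?N = h ^ ?N * k"
      by (simp add: k_def power_divide)
    moreover have "h ^ ?N = h ^ (?N - 1) * h" by (metis DIM_positive Suc_diff_1 power_Suc2)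
    ultimately have "c = v * (h ^ (?N - 1) * h * k)" by (simp only: c_def v_def)
    moreover have "cover_const = unit_ball_vol (real (?N - 1)) / (v * k)"
      by (simp only: cover_const_def v_def k_def)
    ultimately show ?thesis using A(2) pos by simp
  qed
  also have "of_nat (card P) * ennreal (c * (cover_const / h)) = (of_nat (card P) * ennreal c) * ennreal (cover_const / h)"
  proof -
    have "ennreal (c * (cover_const / h)) = ennreal c * ennreal (cover_const / h)"
      using c cover_const_nonneg A(2) by (intro ennreal_mult) auto
    then show ?thesis by (simp only: mult.assoc)
  qed
  also have "\<dots> \<le> emeasure lborel (strip h r \<inter> B) * ennreal (cover_const / h)"
    unfolding c_def
  proof (rule mult_right_mono[OF card_separated_bound[OF P(1) subset_trans[OF P(2) A(1)] A(2,3) P(4) _ B]])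
    show "ball x h \<subseteq> B" if "x \<in> P" for x using sub P(2) that by blast
  qed auto
  finally show ?thesis by (simp add: mult.commute)
qed

end

text \<open>Only this upper bound is used, so the countable additivity of the outer measure is never needed.\<close>

lemma emeasure_hausdorff_measure_le: "emeasure (hausdorff_measure s) A \<le> hausdorff_outer s A"
  unfolding hausdorff_measure_def by (subst emeasure_measure_of_conv) auto

lemma sets_hausdorff_measure [simp, measurable_cong]: "sets (hausdorff_measure s) = sets borel"
  unfolding hausdorff_measure_def by (metis sets.sets_measure_of_eq sets_measure_of_conv space_borel)

lemma space_hausdorff_measure [simp]: "space (hausdorff_measure s) = UNIV"
  by (simp add: hausdorff_measure_def space_measure_of_conv)

section \<open>Integrals over the boundary by summation over levels\<close>

lemma level_sum_le:
  fixes g \<epsilon> :: real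
  assumes "0 \<le> g" "0 < \<epsilon>"
  shows "(\<Sum>k<m. if real k * \<epsilon> < g then \<epsilon> else 0) \<le> g + \<epsilon>"
proof -
  have "{k\<in>{..<m}. real k * \<epsilon> < g} \<subseteq> {..<nat \<lceil>g / \<epsilon>\<rceil>}"
  proof
    fix k assume "k \<in> {k\<in>{..<m}. real k * \<epsilon> < g}"
    then have "real k < g / \<epsilon>" using assms(2) by (simp add: field_simps)
    then show "k \<in> {..<nat \<lceil>g / \<epsilon>\<rceil>}" by (simp, linarith)
  qed
  then have "card {k\<in>{..<m}. real k * \<epsilon> < g} \<le> card {..<nat \<lceil>g / \<epsilon>\<rceil>}"
    by (intro card_mono) auto
  then have le: "card {k\<in>{..<m}. real k * \<epsilon> < g} \<le> nat \<lceil>g / \<epsilon>\<rceil>" by simp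
  have "(\<Sum>k<m. if real k * \<epsilon> < g then \<epsilon> else 0) = real (card {k\<in>{..<m}. real k * \<epsilon> < g}) * \<epsilon>"
    by (subst sum.inter_filter[symmetric]) auto
  also have "\<dots> \<le> real (nat \<lceil>g / \<epsilon>\<rceil>) * \<epsilon>"
    using assms(2) le by (intro mult_right_mono) auto
  also have "\<dots> \<le> (g / \<epsilon> + 1) * \<epsilon>"
    using assms by (intro mult_right_mono) auto
  also have "\<dots> = g + \<epsilon>" using assms(2) by (simp add: field_simps)
  finally show ?thesis .
qed

text \<open>The sum here runs over the levels \<open>Suc k\<close>, that of
  \<open>level_sum_le\<close> over the levels k with strict inequality. This offset by one level is
  the room that uniform continuity of w^2 consumes when a superlevel set on the boundary is replaced
  by balls around its points.\<close>

lemma level_sum_ge: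
  fixes g \<epsilon> :: real
  assumes "0 \<le> g" "0 < \<epsilon>" "g < real m * \<epsilon>"
  shows "g \<le> \<epsilon> + (\<Sum>k<m. if real (Suc k) * \<epsilon> \<le> g then \<epsilon> else 0)"
proof -
  have "{..<nat \<lfloor>g / \<epsilon>\<rfloor>} \<subseteq> {k\<in>{..<m}. real (Suc k) * \<epsilon> \<le> g}"
  proof
    fix k assume "k \<in> {..<nat \<lfloor>g / \<epsilon>\<rfloor>}"
    then have "real (Suc k) \<le> g / \<epsilon>" by (simp, linarith)
    then have "real (Suc k) * \<epsilon> \<le> g" using assms(2) by (simp add: field_simps)
    moreover from this have "real (Suc k) * \<epsilon> < real m * \<epsilon>" using assms(3) by linarith
    then have "real (Suc k) < real m" using assms(2) by (simp only: mult_less_cancel_right_pos)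
    ultimately show "k \<in> {k\<in>{..<m}. real (Suc k) * \<epsilon> \<le> g}" by simp
  qed
  then have "card {..<nat \<lfloor>g / \<epsilon>\<rfloor>} \<le> card {k\<in>{..<m}. real (Suc k) * \<epsilon> \<le> g}"
    by (intro card_mono) auto
  then have "nat \<lfloor>g / \<epsilon>\<rfloor> \<le> card {k\<in>{..<m}. real (Suc k) * \<epsilon> \<le> g}" by simp
  then have "real (nat \<lfloor>g / \<epsilon>\<rfloor>) * \<epsilon> \<le> real (card {k\<in>{..<m}. real (Suc k) * \<epsilon> \<le> g}) * \<epsilon>"
    using assms(2) by (intro mult_right_mono) auto
  also have "\<dots> = (\<Sum>k<m. if real (Suc k) * \<epsilon> \<le> g then \<epsilon> else 0)"
    by (subst sum.inter_filter[symmetric]) auto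
  finally have 1: "real (nat \<lfloor>g / \<epsilon>\<rfloor>) * \<epsilon> \<le> (\<Sum>k<m. if real (Suc k) * \<epsilon> \<le> g then \<epsilon> else 0)" .
  have "g / \<epsilon> - 1 \<le> real (nat \<lfloor>g / \<epsilon>\<rfloor>)" using assms by linarith
  then have "(g / \<epsilon> - 1) * \<epsilon> \<le> real (nat \<lfloor>g / \<epsilon>\<rfloor>) * \<epsilon>" using assms(2) by (intro mult_right_mono) auto
  moreover have "(g / \<epsilon> - 1) * \<epsilon> = g - \<epsilon>" using assms(2) by (simp add: field_simps)
  ultimately show ?thesis using 1 by linarith
qed

context lipschitz_patch
begin

lemma ball_near:
  assumes "x \<in> ball p (r/4)" "h \<le> r/4"
  shows "ball x h \<subseteq> ball p (r/2)"
proof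
  fix y assume "y \<in> ball x h"
  moreover have "dist p y \<le> dist p x + dist x y" by (rule dist_triangle)
  ultimately show "y \<in> ball p (r/2)" using assms by auto
qed

text \<open>Bound for the volume of the strip per unit of height: the right-hand side of
  \<open>strip_integral_le\<close> for the constant function 1 and \<rho> = r/4.\<close>

definition strip_mass :: ennreal where
  "strip_mass = (\<integral>\<^sup>+ x. ennreal (4/r + 1) * indicator D x \<partial>lborel)"

lemma strip_mass_bound:
  assumes "0 < h"
  shows "emeasure lborel (strip h (r/2)) \<le> ennreal h * strip_mass"
proof -
  have "gradient (\<lambda>x::'a. 1::real) = (\<lambda>x. 0)"
    by (simp add: gradient_def fun_eq_iff)
  moreover have "(\<integral>\<^sup>+ x. ennreal (1\<^sup>2) * indicator (strip h (r/2)) x \<partial>lborel) = emeasure lborel (strip h (r/2))"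
    using open_strip by simp
  ultimately show ?thesis
    using strip_integral_le[OF smooth_const[of 1], of "r/4" "r/2" h] assms r by (simp add: strip_mass_def)
qed

lemma strip_mass_finite: "bounded D \<Longrightarrow> strip_mass < top"
  unfolding strip_mass_def using open_D emeasure_bounded_finite[of D]
  by (subst nn_integral_cmult_indicator) (auto simp: ennreal_mult_less_top)

text \<open>The factor 1/h of the covering cancels the factor h of the strip volume, so the bound is
  uniform in the scale \<delta>.\<close>

lemma patch_measure_bound:
  "emeasure (hausdorff_measure (DIM('a) - 1)) (frontier D \<inter> ball p (r/4)) \<le> ennreal cover_const * strip_mass"
proof -
  let ?K = "frontier D \<inter> ball p (r/4)"
  have "hausdorff_pre (DIM('a) - 1) \<delta> ?K \<le> ennreal cover_const * strip_mass" if "\<delta> > 0" for \<delta>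
  proof -
    define h where "h = min (r/4) (\<delta>/2)"
    have h: "0 < h" "h \<le> r/4" "2 * h \<le> \<delta>" using r that by (auto simp: h_def)
    have "hausdorff_pre (DIM('a) - 1) \<delta> ?K \<le> ennreal (cover_const / h) * emeasure lborel (strip h r \<inter> ball p (r/2))"
      using h r ball_near by (intro hausdorff_pre_le_strip[where q="r/4"]) auto
    also have "strip h r \<inter> ball p (r/2) = strip h (r/2)" using r by (auto simp: strip_def)
    also have "ennreal (cover_const / h) * emeasure lborel (strip h (r/2)) \<le> ennreal (cover_const / h) * (ennreal h * strip_mass)"
      using strip_mass_bound[OF h(1)] by (rule mult_left_mono) simp
    also have "\<dots> = ennreal cover_const * strip_mass"
      using h(1) cover_const_nonneg by (simp add: mult.assoc[symmetric] ennreal_mult[symmetric])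
    finally show ?thesis .
  qed
  then have "hausdorff_outer (DIM('a) - 1) ?K \<le> ennreal cover_const * strip_mass"
    unfolding hausdorff_outer_eq_SUP_pre by (intro SUP_least) auto
  then show ?thesis using emeasure_hausdorff_measure_le order_trans by blast
qed

text \<open>At each scale \<delta> the superlevel sets are covered by balls so small that w^2 stays
  above the next lower level on them. Summing the levels under the volume integral returns at most
  w^2 plus \<epsilon>, and \<open>strip_integral_le\<close> with \<rho> = r/4 bounds this by h times
  an integral over D. Again h cancels, and the supremum over the scales is taken last.\<close>

lemma patch_level_sum:
  assumes w: "smooth w" and \<epsilon>: "0 < \<epsilon>"
  defines "A \<equiv> \<lambda>k. frontier D \<inter> ball p (r/4) \<inter> {x. real (Suc k) * \<epsilon> \<le> (w x)\<^sup>2}"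
    and "I \<equiv> (\<integral>\<^sup>+ x. ennreal ((4/r + 1) * (w x)\<^sup>2 + (norm (gradient w x))\<^sup>2) * indicator D x \<partial>lborel)"
  shows "(\<Sum>k<m. ennreal \<epsilon> * emeasure (hausdorff_measure (DIM('a) - 1)) (A k))
    \<le> ennreal cover_const * (I + ennreal \<epsilon> * strip_mass)"
proof -
  let ?s = "DIM('a) - 1"
  have pre: "(\<Sum>k<m. ennreal \<epsilon> * hausdorff_pre ?s \<delta> (A k)) \<le> ennreal cover_const * (I + ennreal \<epsilon> * strip_mass)"
    if "0 < \<delta>" for \<delta>
  proof -
    have cw: "continuous_on S (\<lambda>x. (w x)\<^sup>2)" for S
      by (intro continuous_intros continuous_on_subset[OF smooth_continuous[OF w]]) auto
    then have "uniformly_continuous_on (cball p r) (\<lambda>x. (w x)\<^sup>2)"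
      by (intro compact_uniformly_continuous) auto
    then obtain d where d: "d > 0" "\<And>x y. x \<in> cball p r \<Longrightarrow> y \<in> cball p r \<Longrightarrow> dist y x < d \<Longrightarrow> dist ((w y)\<^sup>2) ((w x)\<^sup>2) < \<epsilon>"
      using \<epsilon> unfolding uniformly_continuous_on_def by metis
    \<comment> \<open>The three bounds keep the balls inside \<open>ball p (r/2)\<close>, their
      diameters at most \<delta>, and the deviation of w^2 from its value at the centre below
      \<epsilon>.\<close>
    define h where "h = min (min (r/4) (\<delta>/2)) d"
    have h: "0 < h" "h \<le> r/4" "2 * h \<le> \<delta>" "h \<le> d" using r that d(1) by (auto simp: h_def)
    define B where "B k = ball p (r/2) \<inter> {y. real k * \<epsilon> < (w y)\<^sup>2}" for k
    have B: "B k \<in> sets borel" for k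
      unfolding B_def by (intro borel_open open_Int open_ball open_Collect_less continuous_on_const cw)
    have AB: "ball x h \<subseteq> B k" if "x \<in> A k" for x k
    proof
      fix y assume y: "y \<in> ball x h"
      have x: "x \<in> ball p (r/4)" "real (Suc k) * \<epsilon> \<le> (w x)\<^sup>2" using that by (auto simp: A_def)
      have y2: "y \<in> ball p (r/2)" using ball_near[OF x(1) h(2)] y by blast
      have "dist ((w y)\<^sup>2) ((w x)\<^sup>2) < \<epsilon>"
        using x y2 y h(4) r by (intro d(2)) (auto simp: dist_commute)
      then have "real k * \<epsilon> < (w y)\<^sup>2" using x(2) by (simp add: dist_real_def algebra_simps)
      then show "y \<in> B k" using y2 by (simp add: B_def)
    qed
    have strip_eq: "strip h r \<inter> B k = strip h (r/2) \<inter> {y. real k * \<epsilon> < (w y)\<^sup>2}" for k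
      using r by (auto simp: strip_def B_def)
    have mS: "strip h r \<inter> B k \<in> sets lborel" for k using B open_strip borel_open by simp
    have mw: "(\<lambda>x. ennreal ((w x)\<^sup>2)) \<in> borel_measurable borel"
      using continuous_borel_lebesgue(1)[OF cw] by simp
    have "(\<Sum>k<m. ennreal \<epsilon> * hausdorff_pre ?s \<delta> (A k))
        \<le> (\<Sum>k<m. ennreal \<epsilon> * (ennreal (cover_const / h) * emeasure lborel (strip h r \<inter> B k)))"
      using h r AB B by (intro sum_mono mult_left_mono hausdorff_pre_le_strip[where q="r/4"]) (auto simp: A_def)
    also have "\<dots> = ennreal (cover_const / h) * (\<Sum>k<m. ennreal \<epsilon> * emeasure lborel (strip h r \<inter> B k))"
      by (simp add: sum_distrib_left mult_ac)
    also have "(\<Sum>k<m. ennreal \<epsilon> * emeasure lborel (strip h r \<inter> B k))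
       = (\<integral>\<^sup>+ x. (\<Sum>k<m. ennreal \<epsilon> * indicator (strip h r \<inter> B k) x) \<partial>lborel)"
      using mS by (subst nn_integral_sum) (auto simp: nn_integral_cmult_indicator)
    also have "\<dots> \<le> (\<integral>\<^sup>+ x. ennreal ((w x)\<^sup>2) * indicator (strip h (r/2)) x + ennreal \<epsilon> * indicator (strip h (r/2)) x \<partial>lborel)"
    proof (rule nn_integral_mono)
      fix x
      show "(\<Sum>k<m. ennreal \<epsilon> * indicator (strip h r \<inter> B k) x)
          \<le> ennreal ((w x)\<^sup>2) * indicator (strip h (r/2)) x + ennreal \<epsilon> * indicator (strip h (r/2)) x"
      proof (cases "x \<in> strip h (r/2)")
        case True
        have "(\<Sum>k<m. ennreal \<epsilon> * indicator (strip h r \<inter> B k) x) = (\<Sum>k<m. ennreal (if real k * \<epsilon> < (w x)\<^sup>2 then \<epsilon> else 0))"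
          using True by (intro sum.cong) (auto simp: strip_eq indicator_def)
        also have "\<dots> = ennreal (\<Sum>k<m. if real k * \<epsilon> < (w x)\<^sup>2 then \<epsilon> else 0)"
          using \<epsilon> by (intro sum_ennreal) auto
        also have "\<dots> \<le> ennreal ((w x)\<^sup>2 + \<epsilon>)" using level_sum_le[OF _ \<epsilon>] by (intro ennreal_leI) auto
        finally show ?thesis using True \<epsilon> by (simp add: ennreal_plus)
      qed (simp add: strip_eq)
    qed
    also have "\<dots> = (\<integral>\<^sup>+ x. ennreal ((w x)\<^sup>2) * indicator (strip h (r/2)) x \<partial>lborel) + ennreal \<epsilon> * emeasure lborel (strip h (r/2))"
      using mw open_strip borel_open by (subst nn_integral_add) (auto simp: nn_integral_cmult_indicator)
    also have "\<dots> \<le> ennreal h * I + ennreal \<epsilon> * (ennreal h * strip_mass)"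
    proof (intro add_mono mult_left_mono)
      show "(\<integral>\<^sup>+ x. ennreal ((w x)\<^sup>2) * indicator (strip h (r/2)) x \<partial>lborel) \<le> ennreal h * I"
        using strip_integral_le[OF w, of "r/4" "r/2" h] r h(1) by (simp add: I_def)
    qed (use strip_mass_bound[OF h(1)] in auto)
    also have "\<dots> = ennreal h * (I + ennreal \<epsilon> * strip_mass)" by (simp add: distrib_left mult_ac)
    finally have "(\<Sum>k<m. ennreal \<epsilon> * hausdorff_pre ?s \<delta> (A k)) \<le> ennreal (cover_const / h) * (ennreal h * (I + ennreal \<epsilon> * strip_mass))"
      by (simp add: mult_left_mono)
    also have "\<dots> = ennreal cover_const * (I + ennreal \<epsilon> * strip_mass)"
      using h(1) cover_const_nonneg by (simp add: mult.assoc[symmetric] ennreal_mult[symmetric])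
    finally show ?thesis .
  qed
  have "(\<Sum>k<m. ennreal \<epsilon> * emeasure (hausdorff_measure ?s) (A k))
      \<le> (\<Sum>k<m. SUP n. ennreal \<epsilon> * hausdorff_pre ?s (inverse (real (Suc n))) (A k))"
    unfolding SUP_mult_left_ennreal[symmetric]
    by (intro sum_mono mult_left_mono order_trans[OF emeasure_hausdorff_measure_le hausdorff_outer_le_SUP_seq]) auto
  also have "\<dots> = (SUP n. \<Sum>k<m. ennreal \<epsilon> * hausdorff_pre ?s (inverse (real (Suc n))) (A k))"
    by (rule ennreal_SUP_sum[symmetric]) (auto intro!: incseq_SucI mult_left_mono hausdorff_pre_antimono simp: field_simps)
  also have "\<dots> \<le> ennreal cover_const * (I + ennreal \<epsilon> * strip_mass)"
    by (intro SUP_least pre) simp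
  finally show ?thesis .
qed

end

context lipschitz_patch
begin

text \<open>Cutting w^2 into levels of height \<epsilon> costs \<epsilon> once on the boundary and
  once in the strip, each time weighted with \<open>cover_const * strip_mass\<close>; hence the
  error \<open>\<epsilon> * (2 * S)\<close>. Finiteness of the strip mass lets it tend to 0.\<close>

lemma patch_trace:
  assumes w: "smooth w" and "bounded D"
  shows "(\<integral>\<^sup>+ x. ennreal ((w x)\<^sup>2) * indicator (frontier D \<inter> ball p (r/4)) x \<partial>hausdorff_measure (DIM('a) - 1))
    \<le> ennreal cover_const *
      (\<integral>\<^sup>+ x. ennreal ((4/r + 1) * (w x)\<^sup>2 + (norm (gradient w x))\<^sup>2) * indicator D x \<partial>lborel)"
    (is "?X \<le> ennreal cover_const * ?I")
proof (rule ennreal_le_epsilon)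
  let ?\<mu> = "hausdorff_measure (DIM('a) - 1) :: 'a measure" and ?K = "frontier D \<inter> ball p (r/4)"
  fix \<delta> :: real assume "0 < \<delta>"
  define S where "S = enn2real (ennreal cover_const * strip_mass)"
  have S: "ennreal cover_const * strip_mass = ennreal S"
    using strip_mass_finite[OF assms(2)] by (simp add: S_def ennreal_mult_less_top)
  have S0: "0 \<le> S" by (simp add: S_def)
  define \<epsilon> where "\<epsilon> = \<delta> / (2 * S + 1)"
  have \<epsilon>: "0 < \<epsilon>" "\<epsilon> * (2 * S) \<le> \<delta>"
    using \<open>0 < \<delta>\<close> S0 by (auto simp: \<epsilon>_def field_simps)
  have cw: "continuous_on T (\<lambda>x. (w x)\<^sup>2)" for T
    by (intro continuous_intros continuous_on_subset[OF smooth_continuous[OF w]]) auto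
  have "compact ((\<lambda>x. (w x)\<^sup>2) ` cball p r)" by (intro compact_continuous_image cw compact_cball)
  then obtain b where b: "\<And>x. x \<in> cball p r \<Longrightarrow> (w x)\<^sup>2 \<le> b"
    using compact_imp_bounded[of "(\<lambda>x. (w x)\<^sup>2) ` cball p r"] unfolding bounded_iff by fastforce
  \<comment> \<open>Enough levels to exceed w^2 on the closed ball, as \<open>level_sum_ge\<close>
    requires.\<close>
  obtain m :: nat where "b / \<epsilon> < real m" using reals_Archimedean2 by blast
  then have m: "b < real m * \<epsilon>" using \<epsilon>(1) by (simp add: field_simps)
  define A where "A k = ?K \<inter> {x. real (Suc k) * \<epsilon> \<le> (w x)\<^sup>2}" for k
  have K: "?K \<in> sets borel" by (intro sets.Int borel_closed borel_open) auto
  have A: "A k \<in> sets borel" for k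
    unfolding A_def by (intro sets.Int[OF K] borel_closed closed_Collect_le continuous_on_const cw)
  have "?X \<le> (\<integral>\<^sup>+ x. ennreal \<epsilon> * indicator ?K x + (\<Sum>k<m. ennreal \<epsilon> * indicator (A k) x) \<partial>?\<mu>)"
  proof (rule nn_integral_mono)
    fix x
    show "ennreal ((w x)\<^sup>2) * indicator ?K x \<le> ennreal \<epsilon> * indicator ?K x + (\<Sum>k<m. ennreal \<epsilon> * indicator (A k) x)"
    proof (cases "x \<in> ?K")
      case True
      then have "x \<in> cball p r" using r by auto
      then have "(w x)\<^sup>2 < real m * \<epsilon>" using b m by fastforce
      then have "(w x)\<^sup>2 \<le> \<epsilon> + (\<Sum>k<m. if real (Suc k) * \<epsilon> \<le> (w x)\<^sup>2 then \<epsilon> else 0)"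
        using \<epsilon>(1) by (intro level_sum_ge) auto
      then have "ennreal ((w x)\<^sup>2) \<le> ennreal (\<epsilon> + (\<Sum>k<m. if real (Suc k) * \<epsilon> \<le> (w x)\<^sup>2 then \<epsilon> else 0))"
        by (rule ennreal_leI)
      also have "\<dots> = ennreal \<epsilon> + (\<Sum>k<m. ennreal (if real (Suc k) * \<epsilon> \<le> (w x)\<^sup>2 then \<epsilon> else 0))"
        using \<epsilon>(1) by (subst ennreal_plus) (auto intro!: sum_nonneg sum_ennreal[symmetric])
      also have "(\<Sum>k<m. ennreal (if real (Suc k) * \<epsilon> \<le> (w x)\<^sup>2 then \<epsilon> else 0)) = (\<Sum>k<m. ennreal \<epsilon> * indicator (A k) x)"
        using True by (intro sum.cong) (auto simp: A_def indicator_def)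
      finally show ?thesis using True by simp
    qed simp
  qed
  also have "\<dots> = ennreal \<epsilon> * emeasure ?\<mu> ?K + (\<Sum>k<m. ennreal \<epsilon> * emeasure ?\<mu> (A k))"
  proof -
    have K': "?K \<in> sets ?\<mu>" and A': "\<And>k. A k \<in> sets ?\<mu>" using K A by simp_all
    have m: "(\<lambda>x. ennreal \<epsilon> * indicator (A k) x) \<in> borel_measurable ?\<mu>" for k
      by (intro borel_measurable_times_ennreal borel_measurable_indicator A' borel_measurable_const)
    have "(\<integral>\<^sup>+ x. ennreal \<epsilon> * indicator ?K x + (\<Sum>k<m. ennreal \<epsilon> * indicator (A k) x) \<partial>?\<mu>)
       = (\<integral>\<^sup>+ x. ennreal \<epsilon> * indicator ?K x \<partial>?\<mu>) + (\<integral>\<^sup>+ x. (\<Sum>k<m. ennreal \<epsilon> * indicator (A k) x) \<partial>?\<mu>)"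
      by (intro nn_integral_add borel_measurable_sum borel_measurable_times_ennreal borel_measurable_indicator K' m borel_measurable_const)
    also have "(\<integral>\<^sup>+ x. (\<Sum>k<m. ennreal \<epsilon> * indicator (A k) x) \<partial>?\<mu>) = (\<Sum>k<m. \<integral>\<^sup>+ x. ennreal \<epsilon> * indicator (A k) x \<partial>?\<mu>)"
      by (rule nn_integral_sum[OF m])
    finally show ?thesis by (simp only: nn_integral_cmult_indicator[OF K'] nn_integral_cmult_indicator[OF A'])
  qed
  also have "\<dots> \<le> ennreal \<epsilon> * (ennreal cover_const * strip_mass) + ennreal cover_const * (?I + ennreal \<epsilon> * strip_mass)"
    unfolding A_def by (intro add_mono mult_left_mono patch_measure_bound patch_level_sum w \<epsilon>(1)) auto
  also have "\<dots> = ennreal cover_const * ?I + (ennreal \<epsilon> * (ennreal cover_const * strip_mass) + ennreal \<epsilon> * (ennreal cover_const * strip_mass))"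
    by (simp add: distrib_left mult_ac add_ac)
  also have "ennreal \<epsilon> * (ennreal cover_const * strip_mass) + ennreal \<epsilon> * (ennreal cover_const * strip_mass) = ennreal (\<epsilon> * (2 * S))"
    unfolding S using \<epsilon>(1) S0 by (simp add: ennreal_mult[symmetric] ennreal_plus[symmetric] del: ennreal_plus)
  also have "ennreal cover_const * ?I + ennreal (\<epsilon> * (2 * S)) \<le> ennreal cover_const * ?I + ennreal \<delta>"
    using \<epsilon>(2) by (intro add_left_mono ennreal_leI)
  finally show "?X \<le> ennreal cover_const * ?I + ennreal \<delta>" .
qed

text \<open>The gradient has coefficient 1 in \<open>patch_trace\<close>; it is enlarged to
  \<open>4/r + 1\<close> so that both parts combine to the H1 norm.\<close>

lemma patch_trace_H1:
  assumes "bounded D"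
  obtains C q where "0 < q" "0 \<le> C"
    "\<And>w. smooth w \<Longrightarrow> (\<integral>\<^sup>+ x. ennreal ((w x)\<^sup>2) * indicator (frontier D \<inter> ball p q) x \<partial>hausdorff_measure (DIM('a) - 1))
      \<le> ennreal (C * (H1_norm D w)\<^sup>2)"
proof (rule that)
  show "0 < r/4" using r by simp
  show "0 \<le> cover_const * (4/r + 1)" using cover_const_nonneg r by simp
  fix w :: "'a \<Rightarrow> real" assume w: "smooth w"
  let ?G = "\<lambda>x. (w x)\<^sup>2 + (norm (gradient w x))\<^sup>2"
  have cG: "continuous_on UNIV ?G"
    by (intro continuous_intros smooth_continuous w gradient_continuous)
  note mG = continuous_borel_lebesgue(1)[OF cG]
  have iG: "integrable (lebesgue_on D) ?G"
    using L2_D(2)[OF L2_continuous[OF open_D assms smooth_continuous[OF w]]]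
      L2_D(2)[OF L2_continuous[OF open_D assms gradient_continuous[OF w]]] by simp
  have "(\<integral>\<^sup>+ x. ennreal ((4/r + 1) * (w x)\<^sup>2 + (norm (gradient w x))\<^sup>2) * indicator D x \<partial>lborel)
      \<le> (\<integral>\<^sup>+ x. ennreal (4/r + 1) * (ennreal (?G x) * indicator D x) \<partial>lborel)"
  proof (intro nn_integral_mono)
    fix x
    have "(4/r + 1) * (w x)\<^sup>2 + (norm (gradient w x))\<^sup>2 \<le> (4/r + 1) * ?G x"
      using r mult_right_mono[of 1 "4/r + 1" "(norm (gradient w x))\<^sup>2"] by (simp add: distrib_left)
    then have "ennreal ((4/r + 1) * (w x)\<^sup>2 + (norm (gradient w x))\<^sup>2) \<le> ennreal (4/r + 1) * ennreal (?G x)"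
      using r by (subst ennreal_mult[symmetric]) (auto intro: ennreal_leI simp del: ennreal_plus)
    then show "ennreal ((4/r + 1) * (w x)\<^sup>2 + (norm (gradient w x))\<^sup>2) * indicator D x \<le> ennreal (4/r + 1) * (ennreal (?G x) * indicator D x)"
      by (auto simp: indicator_def)
  qed
  also have "\<dots> = ennreal (4/r + 1) * (\<integral>\<^sup>+ x. ennreal (?G x) * indicator D x \<partial>lborel)"
    using measurable_compose[OF mG measurable_ennreal] open_D
    by (intro nn_integral_cmult borel_measurable_times_ennreal borel_measurable_indicator)
      (simp_all del: ennreal_plus add: borel_open)
  also have "(\<integral>\<^sup>+ x. ennreal (?G x) * indicator D x \<partial>lborel) = (\<integral>\<^sup>+ x. ennreal (?G x) * indicator D x \<partial>lebesgue)"
    by (simp only: nn_integral_completion)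
  also have "\<dots> = (\<integral>\<^sup>+ x. ennreal (?G x) \<partial>lebesgue_on D)"
    using open_D by (subst nn_integral_restrict_space) (auto simp del: ennreal_plus)
  also have "\<dots> = ennreal (LINT x|lebesgue_on D. ?G x)"
    using iG by (intro nn_integral_eq_integral) (auto simp del: ennreal_plus)
  also have "(LINT x|lebesgue_on D. ?G x) = (H1_norm D w)\<^sup>2"
    using smooth_in_H1(2)[OF open_D assms w] by simp
  finally have "ennreal cover_const * (\<integral>\<^sup>+ x. ennreal ((4/r + 1) * (w x)\<^sup>2 + (norm (gradient w x))\<^sup>2) * indicator D x \<partial>lborel)
      \<le> ennreal cover_const * (ennreal (4/r + 1) * ennreal ((H1_norm D w)\<^sup>2))" by (rule mult_left_mono) simp
  also have "\<dots> = ennreal (cover_const * (4/r + 1) * (H1_norm D w)\<^sup>2)"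
    using cover_const_nonneg r by (simp add: ennreal_mult mult.assoc)
  finally show "(\<integral>\<^sup>+ x. ennreal ((w x)\<^sup>2) * indicator (frontier D \<inter> ball p (r/4)) x \<partial>hausdorff_measure (DIM('a) - 1))
      \<le> ennreal (cover_const * (4/r + 1) * (H1_norm D w)\<^sup>2)"
    using patch_trace[OF w assms] by (rule order_trans[rotated])
qed

end

section \<open>The trace inequality on the whole boundary\<close>

lemma smooth_trace_inequality:
  fixes D :: "'a::euclidean_space set"
  assumes "bounded_lipschitz_domain D"
  obtains C where "0 \<le> C" "\<And>w. smooth w \<Longrightarrow>
    (\<integral>\<^sup>+ x. ennreal ((w x)\<^sup>2) * indicator (frontier D) x \<partial>hausdorff_measure (DIM('a) - 1)) \<le> ennreal (C * (H1_norm D w)\<^sup>2)"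
proof -
  have D: "open D" "bounded D" "lipschitz_boundary D" using assms by (auto simp: bounded_lipschitz_domain_def)
  let ?\<mu> = "hausdorff_measure (DIM('a) - 1) :: 'a measure"
  define Q where "Q p q C \<longleftrightarrow> 0 < q \<and> 0 \<le> C \<and> (\<forall>w. smooth w \<longrightarrow>
      (\<integral>\<^sup>+ x. ennreal ((w x)\<^sup>2) * indicator (frontier D \<inter> ball p q) x \<partial>?\<mu>) \<le> ennreal (C * (H1_norm D w)\<^sup>2))"
    for p q C
  have "\<exists>q C. Q p q C" if p: "p \<in> frontier D" for p
  proof -
    obtain e r \<gamma> L where "norm e = 1" "r > 0" "L-lipschitz_on UNIV \<gamma>"
        "D \<inter> ball p r = {x \<in> ball p r. x \<bullet> e < \<gamma> (x - (x \<bullet> e) *\<^sub>R e)}"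
      using bspec[OF D(3)[unfolded lipschitz_boundary_def] p] by (elim exE conjE) (rule that)
    then interpret lipschitz_patch D p e r L \<gamma> using D(1) by unfold_locales
    obtain C q where "0 < q" "0 \<le> C"
      "\<And>w. smooth w \<Longrightarrow> (\<integral>\<^sup>+ x. ennreal ((w x)\<^sup>2) * indicator (frontier D \<inter> ball p q) x \<partial>?\<mu>) \<le> ennreal (C * (H1_norm D w)\<^sup>2)"
      using patch_trace_H1[OF D(2)] by blast
    then show ?thesis unfolding Q_def by blast
  qed
  then obtain q C where Q: "\<And>p. p \<in> frontier D \<Longrightarrow> Q p (q p) (C p)" by metis
  have qC: "p \<in> frontier D \<Longrightarrow> 0 < q p" "p \<in> frontier D \<Longrightarrow> 0 \<le> C p"
    "p \<in> frontier D \<Longrightarrow> smooth w \<Longrightarrow>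
      (\<integral>\<^sup>+ x. ennreal ((w x)\<^sup>2) * indicator (frontier D \<inter> ball p (q p)) x \<partial>?\<mu>) \<le> ennreal (C p * (H1_norm D w)\<^sup>2)" for p w
    using Q[of p] unfolding Q_def by blast+
  \<comment> \<open>Compactness leaves finitely many patches, whose constants add up.\<close>
  have "compact (frontier D)" using D(2) by (simp add: compact_frontier_bounded)
  then obtain P where P: "P \<subseteq> frontier D" "finite P" "frontier D \<subseteq> (\<Union>p\<in>P. ball p (q p))"
    by (rule compactE_image[of _ "frontier D" "\<lambda>p. ball p (q p)"]) (use qC(1) in force)+
  show ?thesis
  proof (rule that[of "\<Sum>p\<in>P. C p"])
    show "0 \<le> (\<Sum>p\<in>P. C p)" using P qC(2) by (intro sum_nonneg) auto
    fix w :: "'a \<Rightarrow> real" assume w: "smooth w"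
    have mw: "(\<lambda>x. ennreal ((w x)\<^sup>2)) \<in> borel_measurable borel"
      using continuous_borel_lebesgue(1)[OF smooth_continuous[OF w]] by simp
    have "(\<integral>\<^sup>+ x. ennreal ((w x)\<^sup>2) * indicator (frontier D) x \<partial>?\<mu>)
        \<le> (\<integral>\<^sup>+ x. (\<Sum>p\<in>P. ennreal ((w x)\<^sup>2) * indicator (frontier D \<inter> ball p (q p)) x) \<partial>?\<mu>)"
    proof (rule nn_integral_mono)
      fix x
      show "ennreal ((w x)\<^sup>2) * indicator (frontier D) x \<le> (\<Sum>p\<in>P. ennreal ((w x)\<^sup>2) * indicator (frontier D \<inter> ball p (q p)) x)"
      proof (cases "x \<in> frontier D")
        case True
        then obtain p where p: "p \<in> P" "x \<in> ball p (q p)" using P(3) by blast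
        then have "ennreal ((w x)\<^sup>2) * indicator (frontier D) x \<le> ennreal ((w x)\<^sup>2) * indicator (frontier D \<inter> ball p (q p)) x"
          using True by simp
        also have "\<dots> \<le> (\<Sum>p\<in>P. ennreal ((w x)\<^sup>2) * indicator (frontier D \<inter> ball p (q p)) x)"
          using P(2) p(1) by (intro member_le_sum) auto
        finally show ?thesis .
      qed simp
    qed
    also have "\<dots> = (\<Sum>p\<in>P. \<integral>\<^sup>+ x. ennreal ((w x)\<^sup>2) * indicator (frontier D \<inter> ball p (q p)) x \<partial>?\<mu>)"
      using mw by (intro nn_integral_sum borel_measurable_times_ennreal borel_measurable_indicator)
        (auto simp: cong: measurable_cong_sets intro!: sets.Int borel_closed borel_open)
    also have "\<dots> \<le> (\<Sum>p\<in>P. ennreal (C p * (H1_norm D w)\<^sup>2))"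
      using P(1) qC(3)[OF _ w] by (intro sum_mono) auto
    also have "\<dots> = ennreal ((\<Sum>p\<in>P. C p) * (H1_norm D w)\<^sup>2)"
      using P(1) qC(2) by (subst sum_ennreal) (auto simp: sum_distrib_right)
    finally show "(\<integral>\<^sup>+ x. ennreal ((w x)\<^sup>2) * indicator (frontier D) x \<partial>?\<mu>) \<le> ennreal ((\<Sum>p\<in>P. C p) * (H1_norm D w)\<^sup>2)" .
  qed
qed

text \<open>The trace inequality for the constant function 1 bounds the total surface measure.
  Finiteness is what the slicing of boundary data in time and the square-integrability of bounded
  boundary functions rest on.\<close>

lemma surface_frontier:
  fixes D :: "'a::euclidean_space set"
  assumes "bounded_lipschitz_domain D" "\<Gamma> \<subseteq> frontier D" "\<Gamma> \<in> sets borel"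
  shows "finite_measure (surface \<Gamma>)"
proof (rule finite_measureI)
  have D: "open D" "bounded D" using assms by (auto simp: bounded_lipschitz_domain_def)
  obtain C where "\<And>w. smooth w \<Longrightarrow>
    (\<integral>\<^sup>+ x. ennreal ((w x)\<^sup>2) * indicator (frontier D) x \<partial>hausdorff_measure (DIM('a) - 1)) \<le> ennreal (C * (H1_norm D w)\<^sup>2)"
    using smooth_trace_inequality[OF assms(1)] by metis
  from this[OF smooth_const[of 1]]
  have "emeasure (hausdorff_measure (DIM('a) - 1)) (frontier D) < \<infinity>"
    by (simp add: borel_closed) (meson ennreal_less_top le_less_trans)
  moreover have "emeasure (hausdorff_measure (DIM('a) - 1)) \<Gamma> \<le> emeasure (hausdorff_measure (DIM('a) - 1)) (frontier D)"
    using assms(2,3) by (intro emeasure_mono) (auto simp: borel_closed)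
  ultimately show "emeasure (surface \<Gamma>) (space (surface \<Gamma>)) \<noteq> \<infinity>"
    using assms(3) by (simp add: surface_def space_restrict_space emeasure_restrict_space)
qed

lemma surface_frontier_L2_subset:
  fixes v :: "'a::euclidean_space \<Rightarrow> real"
  assumes "\<Gamma> \<subseteq> frontier D" "\<Gamma> \<in> sets borel" "v \<in> L2 (surface (frontier D))"
  shows "v \<in> L2 (surface \<Gamma>)" "L2_norm (surface \<Gamma>) v \<le> L2_norm (surface (frontier D)) v"
proof -
  let ?\<mu> = "hausdorff_measure (DIM('a) - 1) :: 'a measure"
  have f: "frontier D \<in> sets borel" by (simp add: borel_closed)
  have i: "integrable ?\<mu> (\<lambda>x. indicator (frontier D) x *\<^sub>R (norm (v x))\<^sup>2)"
    using L2_D(2)[OF assms(3)] f unfolding surface_def by (subst (asm) integrable_restrict_space) auto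
  have e: "indicator \<Gamma> x *\<^sub>R (norm (v x))\<^sup>2 = indicator \<Gamma> x *\<^sub>R (indicator (frontier D) x *\<^sub>R (norm (v x))\<^sup>2)" for x
    using assms(1) by (auto simp: indicator_def)
  have i2: "integrable ?\<mu> (\<lambda>x. indicator \<Gamma> x *\<^sub>R (norm (v x))\<^sup>2)"
    unfolding e by (rule integrable_mult_indicator[OF _ i]) (use assms in auto)
  have "surface \<Gamma> = restrict_space (surface (frontier D)) \<Gamma>"
    unfolding surface_def using assms(1,2) f by (subst restrict_restrict_space) (auto simp: Int_absorb1)
  then have "v \<in> borel_measurable (surface \<Gamma>)"
    using L2_D(1)[OF assms(3)] by (simp add: measurable_restrict_space1)
  moreover have "integrable (surface \<Gamma>) (\<lambda>x. (norm (v x))\<^sup>2)"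
    using i2 assms(2) unfolding surface_def by (subst integrable_restrict_space) auto
  ultimately show "v \<in> L2 (surface \<Gamma>)" by (simp add: L2_def)
  have "(LINT x|?\<mu>. indicator \<Gamma> x *\<^sub>R (norm (v x))\<^sup>2) \<le> (LINT x|?\<mu>. indicator (frontier D) x *\<^sub>R (norm (v x))\<^sup>2)"
    using assms(1) by (intro integral_mono[OF i2 i]) (auto simp: indicator_def)
  then show "L2_norm (surface \<Gamma>) v \<le> L2_norm (surface (frontier D)) v"
    unfolding L2_norm_def surface_def using f assms(2)
    by (subst (1 2) integral_restrict_space) auto
qed

text \<open>Smooth functions satisfy the inequality, and it passes to the limit along the
  approximating sequence that \<open>has_trace\<close> provides. It is stated for pairs in the graph
  of the trace operator.\<close>

lemma trace_inequality:
  fixes D :: "'a::euclidean_space set"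
  assumes "bounded_lipschitz_domain D"
  obtains C where "0 \<le> C" "\<And>u v. has_trace D u v \<Longrightarrow> L2_norm (surface (frontier D)) v \<le> C * H1_norm D u"
proof -
  have D: "open D" "bounded D" using assms by (auto simp: bounded_lipschitz_domain_def)
  interpret h: seminormed_functions "H1 D" "H1_norm D" by (rule seminormed_functions_H1[OF D(1)])
  let ?S = "surface (frontier D)" and ?\<mu> = "hausdorff_measure (DIM('a) - 1) :: 'a measure"
  interpret l: seminormed_functions "L2 ?S" "L2_norm ?S" by (rule seminormed_functions_L2)
  have f: "frontier D \<in> sets borel" by (simp add: borel_closed)
  obtain C where C: "0 \<le> C" "\<And>w. smooth w \<Longrightarrow>
    (\<integral>\<^sup>+ x. ennreal ((w x)\<^sup>2) * indicator (frontier D) x \<partial>?\<mu>) \<le> ennreal (C * (H1_norm D w)\<^sup>2)"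
    using smooth_trace_inequality[OF assms] by metis
  have sm: "w \<in> L2 ?S \<and> L2_norm ?S w \<le> sqrt C * H1_norm D w" if w: "smooth w" for w
  proof -
    have m: "w \<in> borel_measurable ?S"
      unfolding surface_def using continuous_borel_lebesgue(1)[OF smooth_continuous[OF w]]
      by (intro measurable_restrict_space1) (simp cong: measurable_cong_sets)
    have nn: "(\<integral>\<^sup>+ x. ennreal ((norm (w x))\<^sup>2) \<partial>?S) \<le> ennreal (C * (H1_norm D w)\<^sup>2)"
      unfolding surface_def using C(2)[OF w] f by (subst nn_integral_restrict_space) auto
    have i: "integrable ?S (\<lambda>x. (norm (w x))\<^sup>2)"
      using m nn by (intro integrableI_bounded) (auto intro: le_less_trans)
    then have "ennreal (LINT x|?S. (norm (w x))\<^sup>2) \<le> ennreal (C * (H1_norm D w)\<^sup>2)"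
      using nn by (subst (asm) nn_integral_eq_integral) auto
    then have "(LINT x|?S. (norm (w x))\<^sup>2) \<le> C * (H1_norm D w)\<^sup>2"
      using C(1) by simp
    then have "L2_norm ?S w \<le> sqrt (C * (H1_norm D w)\<^sup>2)"
      unfolding L2_norm_def by (rule real_sqrt_le_mono)
    then show ?thesis using m i by (simp add: L2_def real_sqrt_mult)
  qed
  show ?thesis
  proof (rule that[of "sqrt C"])
    show "0 \<le> sqrt C" using C(1) by simp
    fix u v assume "has_trace D u v"
    then obtain w where u: "u \<in> H1 D" and v: "v \<in> L2 ?S" and w: "\<And>k. smooth (w k)"
        "(\<lambda>k::nat. H1_norm D (\<lambda>x. w k x - u x)) \<longlonglongrightarrow> 0" "(\<lambda>k. L2_norm ?S (\<lambda>x. w k x - v x)) \<longlonglongrightarrow> 0"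
      unfolding has_trace_def by blast
    have "L2_norm ?S v \<le> sqrt C * (H1_norm D u + H1_norm D (\<lambda>x. w k x - u x)) + L2_norm ?S (\<lambda>x. w k x - v x)" for k
    proof -
      have wH: "w k \<in> H1 D" by (rule smooth_in_H1(1)[OF D w(1)])
      have wL: "w k \<in> L2 ?S" using sm w(1) by blast
      have "L2_norm ?S v \<le> L2_norm ?S (w k) + L2_norm ?S (\<lambda>x. w k x - v x)"
        using l.le_add_diff[OF v wL] l.minus_commute[OF v wL] by simp
      also have "L2_norm ?S (w k) \<le> sqrt C * H1_norm D (w k)" using sm w(1) by blast
      also have "H1_norm D (w k) \<le> H1_norm D u + H1_norm D (\<lambda>x. w k x - u x)" by (rule h.le_add_diff[OF wH u])
      finally show ?thesis using C(1) by (simp add: mult_left_mono)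
    qed
    moreover have "(\<lambda>k. sqrt C * (H1_norm D u + H1_norm D (\<lambda>x. w k x - u x)) + L2_norm ?S (\<lambda>x. w k x - v x))
       \<longlonglongrightarrow> sqrt C * (H1_norm D u + 0) + 0"
      by (intro tendsto_intros w)
    ultimately show "L2_norm ?S v \<le> sqrt C * H1_norm D u"
      by (intro LIMSEQ_le_const[where a="L2_norm ?S v"]) auto
  qed
qed

lemma LIMSEQ_squeeze_0:
  fixes a b :: "nat \<Rightarrow> real"
  assumes "\<And>k. 0 \<le> a k" "\<And>k. a k \<le> b k" "b \<longlonglongrightarrow> 0"
  shows "a \<longlonglongrightarrow> 0"
  by (rule tendsto_sandwich[OF _ _ tendsto_const assms(3)]) (simp_all add: assms(1,2))

text \<open>Differences of the approximating sequences serve as approximating sequence. Smooth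
  functions are bounded on the compact frontier, whose surface measure is finite, so they are square
  integrable there and the triangle inequality applies.\<close>

lemma has_trace_diff:
  fixes D :: "'a::euclidean_space set"
  assumes "bounded_lipschitz_domain D" "has_trace D u1 v1" "has_trace D u2 v2"
  shows "has_trace D (\<lambda>x. u1 x - u2 x) (\<lambda>x. v1 x - v2 x)"
proof -
  have D: "open D" "bounded D" using assms by (auto simp: bounded_lipschitz_domain_def)
  interpret h: seminormed_functions "H1 D" "H1_norm D" by (rule seminormed_functions_H1[OF D(1)])
  let ?S = "surface (frontier D)"
  interpret l: seminormed_functions "L2 ?S" "L2_norm ?S" by (rule seminormed_functions_L2)
  interpret fm: finite_measure ?S by (rule surface_frontier[OF assms(1)]) (auto simp: borel_closed)
  have wL: "w \<in> L2 ?S" if w: "smooth w" for w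
  proof -
    have "compact (frontier D)" using D(2) by (simp add: compact_frontier_bounded)
    then have "compact (w ` frontier D)"
      using smooth_continuous[OF w] by (intro compact_continuous_image) (auto intro: continuous_on_subset)
    then obtain B where B: "\<And>x. x \<in> frontier D \<Longrightarrow> norm (w x) \<le> B"
      using compact_imp_bounded[of "w ` frontier D"] unfolding bounded_iff by auto
    have m: "w \<in> borel_measurable ?S"
      unfolding surface_def using continuous_borel_lebesgue(1)[OF smooth_continuous[OF w]]
      by (intro measurable_restrict_space1) (simp cong: measurable_cong_sets)
    show ?thesis
      by (rule L2_bounded(1)[OF fm.finite_measure_axioms m, of B]) (use B in \<open>auto intro!: AE_I2 simp: surface_def space_restrict_space\<close>)
  qed
  obtain w1 where 1: "u1 \<in> H1 D" "v1 \<in> L2 ?S" "\<And>k. smooth (w1 k)"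
        "(\<lambda>k::nat. H1_norm D (\<lambda>x. w1 k x - u1 x)) \<longlonglongrightarrow> 0" "(\<lambda>k. L2_norm ?S (\<lambda>x. w1 k x - v1 x)) \<longlonglongrightarrow> 0"
      using assms(2) unfolding has_trace_def by blast
  obtain w2 where 2: "u2 \<in> H1 D" "v2 \<in> L2 ?S" "\<And>k. smooth (w2 k)"
        "(\<lambda>k::nat. H1_norm D (\<lambda>x. w2 k x - u2 x)) \<longlonglongrightarrow> 0" "(\<lambda>k. L2_norm ?S (\<lambda>x. w2 k x - v2 x)) \<longlonglongrightarrow> 0"
      using assms(3) unfolding has_trace_def by blast
  show ?thesis unfolding has_trace_def
  proof (intro conjI exI allI)
    show "(\<lambda>x. u1 x - u2 x) \<in> H1 D" by (rule h.diff_closed[OF 1(1) 2(1)])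
    show "(\<lambda>x. v1 x - v2 x) \<in> L2 ?S" by (rule l.diff_closed[OF 1(2) 2(2)])
    show "smooth (\<lambda>x. w1 k x - w2 k x)" for k by (rule smooth_diff[OF 1(3) 2(3)])
    have a: "w1 k \<in> H1 D" "w2 k \<in> H1 D" for k by (rule smooth_in_H1(1)[OF D]; rule 1 2)+
    have "H1_norm D (\<lambda>x. (w1 k x - w2 k x) - (u1 x - u2 x)) \<le> H1_norm D (\<lambda>x. w1 k x - u1 x) + H1_norm D (\<lambda>x. w2 k x - u2 x)" for k
      using h.triangle_diff[OF h.diff_closed[OF a(1) 1(1)] h.diff_closed[OF a(2) 2(1)], of k k] by (simp add: algebra_simps)
    from LIMSEQ_squeeze_0[OF H1_norm_nonneg this] tendsto_add[OF 1(4) 2(4)]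
    show "(\<lambda>k. H1_norm D (\<lambda>x. (w1 k x - w2 k x) - (u1 x - u2 x))) \<longlonglongrightarrow> 0" by simp
    have "L2_norm ?S (\<lambda>x. (w1 k x - w2 k x) - (v1 x - v2 x)) \<le> L2_norm ?S (\<lambda>x. w1 k x - v1 x) + L2_norm ?S (\<lambda>x. w2 k x - v2 x)" for k
      using l.triangle_diff[OF l.diff_closed[OF wL[OF 1(3)] 1(2)] l.diff_closed[OF wL[OF 2(3)] 2(2)], of k k] by (simp add: algebra_simps)
    from LIMSEQ_squeeze_0[OF L2_norm_nonneg this] tendsto_add[OF 1(5) 2(5)]
    show "(\<lambda>k. L2_norm ?S (\<lambda>x. (w1 k x - w2 k x) - (v1 x - v2 x))) \<longlonglongrightarrow> 0" by simp
  qed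
qed

section \<open>Square-integrable functions of time\<close>

text \<open>The limit functional \<open>lim\<close> produces a measurable function that equals g
  outside a null set; completeness of Lebesgue measure carries measurability over to g.\<close>

lemma AE_limit_measurable:
  fixes f :: "nat \<Rightarrow> 'a::euclidean_space \<Rightarrow> real"
  assumes "S \<in> sets lebesgue" "\<And>k. f k \<in> borel_measurable (lebesgue_on S)"
    and "AE t in lebesgue_on S. (\<lambda>k. f k t) \<longlonglongrightarrow> g t"
  shows "g \<in> borel_measurable (lebesgue_on S)"
proof (rule measurable_lebesgue_on_AE_eq[OF assms(1)])
  show "(\<lambda>t. lim (\<lambda>k. f k t)) \<in> borel_measurable (lebesgue_on S)"
    using assms(2) by (rule borel_measurable_lim_metric)
  show "AE t in lebesgue_on S. lim (\<lambda>k. f k t) = g t"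
    using assms(3) by eventually_elim (rule limI)
qed

lemma simple_function_real_measurable: "simple_function M f \<Longrightarrow> (f :: _ \<Rightarrow> real) \<in> borel_measurable M"
  by (rule borel_measurable_simple_function)

lemma finite_measure_interval: "finite_measure (lebesgue_on {0<..<T::real})"
  by (rule finite_measure_lebesgue_on) simp

lemma add_power2_le: "(a + b)\<^sup>2 \<le> 2 * a\<^sup>2 + 2 * (b::real)\<^sup>2"
  using sum_squares_bound[of a b] by (simp add: power2_sum)

section \<open>Bochner spaces over a space of functions\<close>

context seminormed_functions
begin

lemma bochner_D:
  assumes "u \<in> bochner_L2 T X N"
  shows "AE t in lebesgue_on {0<..<T}. u t \<in> X" "integrable (lebesgue_on {0<..<T}) (\<lambda>t. (N (u t))\<^sup>2)"
  using assms by (auto simp: bochner_L2_def)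

lemma bochner_E:
  assumes "u \<in> bochner_L2 T X N"
  obtains s where "\<And>k::nat. simple_function (lebesgue_on {0<..<T}) (s k)" "\<And>k t. t \<in> {0<..<T} \<Longrightarrow> s k t \<in> X"
    "AE t in lebesgue_on {0<..<T}. (\<lambda>k. N (\<lambda>x. s k t x - u t x)) \<longlonglongrightarrow> 0"
  using assms unfolding bochner_L2_def by blast

lemma bochner_norm_measurable:
  assumes "u \<in> bochner_L2 T X N"
  shows "(\<lambda>t. N (u t)) \<in> borel_measurable (lebesgue_on {0<..<T})"
proof (rule measurable_lebesgue_on_AE_eq)
  show "(\<lambda>t. sqrt ((N (u t))\<^sup>2)) \<in> borel_measurable (lebesgue_on {0<..<T})"
    using borel_measurable_integrable[OF bochner_D(2)[OF assms]] by measurable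
  show "AE t in lebesgue_on {0<..<T}. sqrt ((N (u t))\<^sup>2) = N (u t)"
    using bochner_D(1)[OF assms] by eventually_elim (simp add: nonneg)
qed simp

text \<open>All measurability of u comes from its approximation by simple functions, so the distance
  is obtained as a limit almost everywhere of distances between simple functions.\<close>

lemma bochner_diff_simple_measurable:
  assumes "u \<in> bochner_L2 T X N" "simple_function (lebesgue_on {0<..<T}) z" "\<And>t. t \<in> {0<..<T} \<Longrightarrow> z t \<in> X"
  shows "(\<lambda>t. N (\<lambda>x. z t x - u t x)) \<in> borel_measurable (lebesgue_on {0<..<T})"
proof -
  obtain s where s: "\<And>k::nat. simple_function (lebesgue_on {0<..<T}) (s k)" "\<And>k t. t \<in> {0<..<T} \<Longrightarrow> s k t \<in> X"
    "AE t in lebesgue_on {0<..<T}. (\<lambda>k. N (\<lambda>x. s k t x - u t x)) \<longlonglongrightarrow> 0"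
    by (rule bochner_E[OF assms(1)]) (rule that)
  show ?thesis
  proof (rule AE_limit_measurable)
    show "(\<lambda>t. N (\<lambda>x. z t x - s k t x)) \<in> borel_measurable (lebesgue_on {0<..<T})" for k
      by (rule simple_function_real_measurable)
        (rule simple_function_compose2[OF assms(2) s(1), where h="\<lambda>a b. N (\<lambda>x. a x - b x)"])
    have "AE t in lebesgue_on {0<..<T}. t \<in> {0<..<T}" by (rule AE_I2) simp
    with s(3) bochner_D(1)[OF assms(1)]
    show "AE t in lebesgue_on {0<..<T}. (\<lambda>k. N (\<lambda>x. z t x - s k t x)) \<longlonglongrightarrow> N (\<lambda>x. z t x - u t x)"
    proof eventually_elim
      case (elim t)
      have "\<bar>N (\<lambda>x. z t x - s k t x) - N (\<lambda>x. z t x - u t x)\<bar> \<le> N (\<lambda>x. s k t x - u t x)" for k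
      proof -
        have "\<bar>N (\<lambda>x. z t x - s k t x) - N (\<lambda>x. z t x - u t x)\<bar> \<le> N (\<lambda>x. (z t x - s k t x) - (z t x - u t x))"
          using elim assms(3) s(2) by (intro abs_diff_le diff_closed) auto
        also have "\<dots> = N (\<lambda>x. s k t x - u t x)"
          using minus_commute[of "u t" "s k t"] elim s(2) by simp
        finally show ?thesis .
      qed
      then have "(\<lambda>k. N (\<lambda>x. z t x - s k t x) - N (\<lambda>x. z t x - u t x)) \<longlonglongrightarrow> 0"
        by (intro Lim_null_comparison[OF _ elim(1)] always_eventually) simp
      then show ?case by (rule LIM_zero_cancel)
    qed
  qed simp
qed

lemma bochner_diff:
  assumes "u \<in> bochner_L2 T X N" "v \<in> bochner_L2 T X N"
  shows "(\<lambda>t x. u t x - v t x) \<in> bochner_L2 T X N"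
proof -
  let ?M = "lebesgue_on {0<..<T}"
  obtain s where s: "\<And>k::nat. simple_function ?M (s k)" "\<And>k t. t \<in> {0<..<T} \<Longrightarrow> s k t \<in> X"
    "AE t in ?M. (\<lambda>k. N (\<lambda>x. s k t x - u t x)) \<longlonglongrightarrow> 0" by (rule bochner_E[OF assms(1)]) (rule that)
  obtain r where r: "\<And>k::nat. simple_function ?M (r k)" "\<And>k t. t \<in> {0<..<T} \<Longrightarrow> r k t \<in> X"
    "AE t in ?M. (\<lambda>k. N (\<lambda>x. r k t x - v t x)) \<longlonglongrightarrow> 0" by (rule bochner_E[OF assms(2)]) (rule that)
  have T: "AE t in ?M. t \<in> {0<..<T}" by (rule AE_I2) simp
  have inX: "AE t in ?M. (\<lambda>x. u t x - v t x) \<in> X"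
    using bochner_D(1)[OF assms(1)] bochner_D(1)[OF assms(2)] by eventually_elim (rule diff_closed)
  have sf: "simple_function ?M (\<lambda>t x. s k t x - r k t x)" for k
    by (rule simple_function_compose2[OF s(1) r(1), where h="\<lambda>a b x. a x - b x"])
  have srX: "(\<lambda>x. s k t x - r k t x) \<in> X" if "t \<in> {0<..<T}" for k t
    using s(2) r(2) that by (intro diff_closed)
  have conv: "AE t in ?M. (\<lambda>k. N (\<lambda>x. (s k t x - r k t x) - (u t x - v t x))) \<longlonglongrightarrow> 0"
    using s(3) r(3) T bochner_D(1)[OF assms(1)] bochner_D(1)[OF assms(2)]
  proof eventually_elim
    case (elim t)
    have 1: "N (\<lambda>x. (s k t x - r k t x) - (u t x - v t x)) \<le> N (\<lambda>x. s k t x - u t x) + N (\<lambda>x. r k t x - v t x)" for k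
      using triangle_diff[OF diff_closed[of "s k t" "u t"] diff_closed[of "r k t" "v t"]] elim s(2) r(2)
      by (simp add: algebra_simps)
    have 2: "0 \<le> N (\<lambda>x. (s k t x - r k t x) - (u t x - v t x))" for k
      by (rule nonneg[OF diff_closed[OF srX[OF elim(3)] diff_closed[OF elim(4,5)]]])
    have 3: "(\<lambda>k. N (\<lambda>x. s k t x - u t x) + N (\<lambda>x. r k t x - v t x)) \<longlonglongrightarrow> 0"
      using tendsto_add[OF elim(1,2)] by simp
    show ?case by (rule LIMSEQ_squeeze_0[OF 2 1 3])
  qed
  have meas: "(\<lambda>t. N (\<lambda>x. u t x - v t x)) \<in> borel_measurable ?M"
  proof (rule AE_limit_measurable)
    show "(\<lambda>t. N (\<lambda>x. s k t x - r k t x)) \<in> borel_measurable ?M" for k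
      by (rule simple_function_real_measurable)
        (rule simple_function_compose2[OF s(1) r(1), where h="\<lambda>a b. N (\<lambda>x. a x - b x)"])
    show "AE t in ?M. (\<lambda>k. N (\<lambda>x. s k t x - r k t x)) \<longlonglongrightarrow> N (\<lambda>x. u t x - v t x)"
      using conv inX T
    proof eventually_elim
      case (elim t)
      have "(\<lambda>k. N (\<lambda>x. s k t x - r k t x) - N (\<lambda>x. u t x - v t x)) \<longlonglongrightarrow> 0"
        using abs_diff_le[OF srX[OF elim(3)] elim(2)]
        by (intro Lim_null_comparison[OF _ elim(1)] always_eventually) simp
      then show ?case by (rule LIM_zero_cancel)
    qed
  qed simp
  have "integrable ?M (\<lambda>t. (N (\<lambda>x. u t x - v t x))\<^sup>2)"
  proof (rule Bochner_Integration.integrable_bound)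
    show "integrable ?M (\<lambda>t. 2 * (N (u t))\<^sup>2 + 2 * (N (v t))\<^sup>2)"
      using bochner_D(2)[OF assms(1)] bochner_D(2)[OF assms(2)] by simp
    show "(\<lambda>t. (N (\<lambda>x. u t x - v t x))\<^sup>2) \<in> borel_measurable ?M" using meas by measurable
    show "AE t in ?M. norm ((N (\<lambda>x. u t x - v t x))\<^sup>2) \<le> norm (2 * (N (u t))\<^sup>2 + 2 * (N (v t))\<^sup>2)"
      using bochner_D(1)[OF assms(1)] bochner_D(1)[OF assms(2)] inX
    proof eventually_elim
      case (elim t)
      have "(N (\<lambda>x. u t x - v t x))\<^sup>2 \<le> (N (u t) + N (v t))\<^sup>2"
        using triangle_diff[OF elim(1,2)] nonneg[OF elim(3)] by (intro power_mono)
      also have "\<dots> \<le> 2 * (N (u t))\<^sup>2 + 2 * (N (v t))\<^sup>2" by (rule add_power2_le)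
      finally show ?case by simp
    qed
  qed
  then show ?thesis unfolding bochner_L2_def
    using inX sf srX conv by (auto intro!: exI[where x="\<lambda>k t x. s k t x - r k t x"])
qed

lemma bochner_const:
  assumes "\<phi> \<in> X"
  shows "(\<lambda>t. \<phi>) \<in> bochner_L2 T X N"
proof -
  interpret finite_measure "lebesgue_on {0<..<T}" by (rule finite_measure_interval)
  have "N (\<lambda>x. \<phi> x - \<phi> x) = 0" using homogeneous[OF assms, of 0] by simp
  then show ?thesis unfolding bochner_L2_def using assms by (auto intro!: exI[where x="\<lambda>k t. \<phi>"])
qed

text \<open>The approximating simple functions come without a bound by u. Replacing
  \<open>s k t\<close> by 0 where its norm exceeds \<open>2 * N (u t)\<close> yields the majorant
  \<open>3 * N (u t)\<close>, and it does not worsen the approximation: at such t the error of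
  \<open>s k t\<close> already exceeds \<open>N (u t)\<close>, the error of 0. Dominated convergence
  then turns convergence almost everywhere into convergence in mean square.\<close>

lemma bochner_simple_approximation:
  assumes u: "u \<in> bochner_L2 T X N" and "0 < \<epsilon>"
  obtains z where "simple_function (lebesgue_on {0<..<T}) z" "\<And>t. t \<in> {0<..<T} \<Longrightarrow> z t \<in> X"
    "integrable (lebesgue_on {0<..<T}) (\<lambda>t. (N (\<lambda>x. z t x - u t x))\<^sup>2)"
    "(LINT t|lebesgue_on {0<..<T}. (N (\<lambda>x. z t x - u t x))\<^sup>2) < \<epsilon>"
proof -
  let ?M = "lebesgue_on {0<..<T}"
  obtain s where s: "\<And>k::nat. simple_function ?M (s k)" "\<And>k t. t \<in> {0<..<T} \<Longrightarrow> s k t \<in> X"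
    "AE t in ?M. (\<lambda>k. N (\<lambda>x. s k t x - u t x)) \<longlonglongrightarrow> 0" by (rule bochner_E[OF u]) (rule that)
  define z where "z k t = (if N (s k t) \<le> 2 * N (u t) then s k t else (\<lambda>x. 0))" for k t
  have T: "AE t in ?M. t \<in> {0<..<T}" by (rule AE_I2) simp
  have zero: "(\<lambda>x. 0) \<in> X" "N (\<lambda>x. 0) = 0" if "\<phi> \<in> X" for \<phi>
    using scale_closed[OF that, of 0] homogeneous[OF that, of 0] by simp_all
  have zX: "z k t \<in> X" if "t \<in> {0<..<T}" for k t
    using s(2)[OF that] zero(1)[OF s(2)[OF that]] by (simp add: z_def)
  have ms: "(\<lambda>t. N (s k t)) \<in> borel_measurable ?M" for k
    by (rule simple_function_real_measurable) (rule simple_function_compose1[OF s(1), where g=N])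
  have sz: "simple_function ?M (z k)" for k
    unfolding z_def
  proof (rule simple_function_If[OF s(1) simple_function_const])
    show "{t \<in> space ?M. N (s k t) \<le> 2 * N (u t)} \<in> sets ?M"
      using ms[of k] bochner_norm_measurable[OF u] by measurable
  qed
  have mz: "(\<lambda>t. N (\<lambda>x. z k t x - u t x)) \<in> borel_measurable ?M" for k
    by (rule bochner_diff_simple_measurable[OF u sz zX])
  have le: "N (\<lambda>x. z k t x - u t x) \<le> N (\<lambda>x. s k t x - u t x) \<and> N (\<lambda>x. z k t x - u t x) \<le> 3 * N (u t)"
    if t: "t \<in> {0<..<T}" "u t \<in> X" for k t
  proof (cases "N (s k t) \<le> 2 * N (u t)")
    case True
    then show ?thesis using triangle_diff[OF s(2)[OF t(1)] t(2), of k] by (simp add: z_def)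
  next
    case False
    have "N (\<lambda>x. - u t x) = N (u t)" using homogeneous[OF t(2), of "-1"] by simp
    then show ?thesis using le_add_diff[OF s(2)[OF t(1)] t(2), of k] False nonneg[OF t(2)] by (simp add: z_def)
  qed
  have i: "integrable ?M (\<lambda>t. 9 * (N (u t))\<^sup>2)" using bochner_D(2)[OF u] by simp
  have b: "AE t in ?M. norm ((N (\<lambda>x. z k t x - u t x))\<^sup>2) \<le> 9 * (N (u t))\<^sup>2" for k
    using T bochner_D(1)[OF u]
  proof eventually_elim
    case (elim t)
    have "(N (\<lambda>x. z k t x - u t x))\<^sup>2 \<le> (3 * N (u t))\<^sup>2"
      using le[OF elim] nonneg[OF diff_closed[OF zX[OF elim(1)] elim(2)]] by (intro power_mono) auto
    then show ?case by (simp add: power_mult_distrib)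
  qed
  have iz: "integrable ?M (\<lambda>t. (N (\<lambda>x. z k t x - u t x))\<^sup>2)" for k
  proof (rule Bochner_Integration.integrable_bound[OF i])
    show "(\<lambda>t. (N (\<lambda>x. z k t x - u t x))\<^sup>2) \<in> borel_measurable ?M" using mz by measurable
  qed (use b in \<open>auto elim: eventually_mono\<close>)
  have "(\<lambda>k. LINT t|?M. (N (\<lambda>x. z k t x - u t x))\<^sup>2) \<longlonglongrightarrow> (LINT t|?M. 0)"
  proof (rule integral_dominated_convergence[OF _ _ i _ b])
    show "(\<lambda>t. (N (\<lambda>x. z k t x - u t x))\<^sup>2) \<in> borel_measurable ?M" for k using mz by measurable
    show "AE t in ?M. (\<lambda>k. (N (\<lambda>x. z k t x - u t x))\<^sup>2) \<longlonglongrightarrow> 0"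
      using T bochner_D(1)[OF u] s(3)
    proof eventually_elim
      case (elim t)
      have "(\<lambda>k. N (\<lambda>x. z k t x - u t x)) \<longlonglongrightarrow> 0"
        by (rule LIMSEQ_squeeze_0[OF nonneg[OF diff_closed[OF zX[OF elim(1)] elim(2)]]
              conjunct1[OF le[OF elim(1,2)]] elim(3)])
      from tendsto_power[OF this, of 2] show ?case by simp
    qed
  qed simp
  then have "\<forall>\<^sub>F k in sequentially. (LINT t|?M. (N (\<lambda>x. z k t x - u t x))\<^sup>2) < \<epsilon>"
    using \<open>0 < \<epsilon>\<close> by (intro order_tendstoD) auto
  then obtain k where "(LINT t|?M. (N (\<lambda>x. z k t x - u t x))\<^sup>2) < \<epsilon>"
    by (auto simp: eventually_sequentially)
  then show ?thesis using that[OF sz zX iz] by blast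
qed

text \<open>The dense sequence consists of values of \<open>u\<close> itself, which inherit \<open>P\<close>. With \<open>P\<close> the existence of a trace,
  no trace theorem for all of \<open>H\<^sup>1(D)\<close> is needed.\<close>

lemma bochner_separable:
  assumes u: "u \<in> bochner_L2 T X N" and P: "AE t in lebesgue_on {0<..<T}. P t"
  obtains E where "countable E" "E \<subseteq> {0<..<T}" "\<And>e. e \<in> E \<Longrightarrow> P e" "\<And>e. e \<in> E \<Longrightarrow> u e \<in> X"
    "AE t in lebesgue_on {0<..<T}. \<forall>\<delta>>0. \<exists>e\<in>E. N (\<lambda>x. u e x - u t x) < \<delta>"
proof -
  let ?M = "lebesgue_on {0<..<T}"
  obtain s where s: "\<And>k::nat. simple_function ?M (s k)" "\<And>k t. t \<in> {0<..<T} \<Longrightarrow> s k t \<in> X"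
    "AE t in ?M. (\<lambda>k. N (\<lambda>x. s k t x - u t x)) \<longlonglongrightarrow> 0" by (rule bochner_E[OF u]) (rule that)
  define Q where "Q = (\<Union>k. s k ` {0<..<T})"
  have "finite (s k ` {0<..<T})" for k using simple_functionD(1)[OF s(1), of k] by simp
  then have cQ: "countable Q" unfolding Q_def by (intro countable_UN) (auto intro: countable_finite)
  have QX: "Q \<subseteq> X" using s(2) by (auto simp: Q_def)
  define good where "good t \<longleftrightarrow> t \<in> {0<..<T} \<and> P t \<and> u t \<in> X" for t
  \<comment> \<open>One good time at which u is within 1/(n+1) of q, if there is one. For a simple
    value q close to \<open>u t\<close> the picked value of u is then close to \<open>u t\<close> as
    well.\<close>
  define pick where "pick q n = (SOME t. good t \<and> N (\<lambda>x. q x - u t x) < inverse (real (Suc n)))" for q n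
  define E where "E = {t. \<exists>q\<in>Q. \<exists>n. t = pick q n \<and> good t}"
  have "E \<subseteq> (\<lambda>(q, n). pick q n) ` (Q \<times> UNIV)" by (auto simp: E_def)
  then have cE: "countable E" by (rule countable_subset) (use cQ in auto)
  have dense: "\<exists>e\<in>E. N (\<lambda>x. u e x - u t x) < \<delta>"
    if t: "good t" "(\<lambda>k. N (\<lambda>x. s k t x - u t x)) \<longlonglongrightarrow> 0" and "\<delta> > 0" for t \<delta>
  proof -
    obtain n where n: "inverse (real (Suc n)) < \<delta> / 2" using reals_Archimedean[of "\<delta> / 2"] \<open>\<delta> > 0\<close> by auto
    have "\<forall>\<^sub>F k in sequentially. N (\<lambda>x. s k t x - u t x) < inverse (real (Suc n))"
      by (rule order_tendstoD(2)[OF t(2)]) simp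
    then obtain k where k: "N (\<lambda>x. s k t x - u t x) < inverse (real (Suc n))" by (auto simp: eventually_sequentially)
    define q where "q = s k t"
    have "t \<in> {0<..<T}" using t(1) by (simp add: good_def)
    then have q: "q \<in> Q" unfolding Q_def q_def by blast
    have "good (pick q n) \<and> N (\<lambda>x. q x - u (pick q n) x) < inverse (real (Suc n))"
      unfolding pick_def by (rule someI[where x=t]) (use t(1) k in \<open>simp add: q_def\<close>)
    note e = conjunct1[OF this] conjunct2[OF this]
    have "pick q n \<in> E" using q e(1) by (auto simp: E_def)
    moreover have "N (\<lambda>x. u (pick q n) x - u t x) \<le> N (\<lambda>x. u (pick q n) x - q x) + N (\<lambda>x. q x - u t x)"
      using t(1) e(1) q QX by (intro triangle_via) (auto simp: good_def)
    moreover have "N (\<lambda>x. u (pick q n) x - q x) = N (\<lambda>x. q x - u (pick q n) x)"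
      using e(1) q QX by (intro minus_commute) (auto simp: good_def)
    ultimately show ?thesis using e(2) k n unfolding q_def by (intro bexI[of _ "pick (s k t) n"]) auto
  qed
  show ?thesis
  proof (rule that[OF cE])
    show "E \<subseteq> {0<..<T}" "\<And>e. e \<in> E \<Longrightarrow> P e" "\<And>e. e \<in> E \<Longrightarrow> u e \<in> X" by (auto simp: E_def good_def)
    have "AE t in ?M. t \<in> {0<..<T}" by (rule AE_I2) simp
    with P bochner_D(1)[OF u] s(3) show "AE t in ?M. \<forall>\<delta>>0. \<exists>e\<in>E. N (\<lambda>x. u e x - u t x) < \<delta>"
      by eventually_elim (use dense in \<open>auto simp: good_def\<close>)
  qed
qed

end

lemma sum3_power2_le: "(a + b + c)\<^sup>2 \<le> 3 * a\<^sup>2 + 3 * b\<^sup>2 + 3 * (c::real)\<^sup>2"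
proof -
  have "0 \<le> (a - b)\<^sup>2 + (b - c)\<^sup>2 + (a - c)\<^sup>2" by simp
  then show ?thesis by (simp add: power2_eq_square algebra_simps)
qed

section \<open>Continuity of translations in time, averaged over a strip along the diagonal\<close>

lemma diagonal_strip_measurable [measurable]:
  "(\<lambda>p. indicator {p. \<bar>snd p - fst p\<bar> < h} p :: ennreal) \<in> borel_measurable (lebesgue_on {0<..<T::real} \<Otimes>\<^sub>M lebesgue_on {0<..<T})"
proof -
  let ?M = "lebesgue_on {0<..<T}"
  have id: "(\<lambda>t. t) \<in> borel_measurable ?M" using continuous_borel_lebesgue(3)[of "\<lambda>t. t"] by simp
  have f: "fst \<in> borel_measurable (?M \<Otimes>\<^sub>M ?M)" "snd \<in> borel_measurable (?M \<Otimes>\<^sub>M ?M)"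
    using measurable_compose[OF measurable_fst id] measurable_compose[OF measurable_snd id] by auto
  have "{p \<in> space (?M \<Otimes>\<^sub>M ?M). \<bar>snd p - fst p\<bar> < h} \<in> sets (?M \<Otimes>\<^sub>M ?M)"
    using f by measurable
  then have "(\<lambda>p. indicator {p \<in> space (?M \<Otimes>\<^sub>M ?M). \<bar>snd p - fst p\<bar> < h} p :: ennreal) \<in> borel_measurable (?M \<Otimes>\<^sub>M ?M)"
    by (rule borel_measurable_indicator)
  then show ?thesis by (rule measurable_cong[THEN iffD1, rotated]) (auto simp: indicator_def)
qed

lemma diagonal_strip_section:
  assumes "0 \<le> h"
  shows "(\<integral>\<^sup>+ s. indicator {p. \<bar>snd p - fst p\<bar> < h} (t, s) \<partial>lebesgue_on {0<..<T::real}) \<le> ennreal (2 * h)"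
    and "(\<integral>\<^sup>+ s. indicator {p. \<bar>snd p - fst p\<bar> < h} (s, t) \<partial>lebesgue_on {0<..<T::real}) \<le> ennreal (2 * h)"
proof -
  have *: "(\<integral>\<^sup>+ s. indicator (ball t h) s \<partial>lebesgue_on {0<..<T}) \<le> ennreal (2 * h)"
  proof -
    have "(\<integral>\<^sup>+ s. indicator (ball t h) s \<partial>lebesgue_on {0<..<T}) = (\<integral>\<^sup>+ s. indicator (ball t h) s * indicator {0<..<T} s \<partial>lebesgue)"
      by (subst nn_integral_restrict_space) auto
    also have "\<dots> \<le> (\<integral>\<^sup>+ s. indicator (ball t h) s \<partial>lebesgue)"
      by (intro nn_integral_mono) (auto simp: indicator_def)
    also have "\<dots> = emeasure lborel (ball t h)" by (simp add: emeasure_completion)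
    also have "\<dots> = ennreal (2 * h)" using assms by (simp add: ball_eq_greaterThanLessThan)
    finally show ?thesis .
  qed
  have e: "indicator {p. \<bar>snd p - fst p\<bar> < h} (t, s) = (indicator (ball t h) s :: ennreal)"
    "indicator {p. \<bar>snd p - fst p\<bar> < h} (s, t) = (indicator (ball t h) s :: ennreal)" for s
    by (auto simp: indicator_def dist_real_def)
  show "(\<integral>\<^sup>+ s. indicator {p. \<bar>snd p - fst p\<bar> < h} (t, s) \<partial>lebesgue_on {0<..<T::real}) \<le> ennreal (2 * h)"
    "(\<integral>\<^sup>+ s. indicator {p. \<bar>snd p - fst p\<bar> < h} (s, t) \<partial>lebesgue_on {0<..<T::real}) \<le> ennreal (2 * h)"
    using * by (simp_all only: e)
qed

lemma diagonal_strip_Fubini: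
  assumes "0 \<le> h" and a[measurable]: "a \<in> borel_measurable (lebesgue_on {0<..<T::real})"
  shows "(\<integral>\<^sup>+ t. (\<integral>\<^sup>+ s. a t * indicator {p. \<bar>snd p - fst p\<bar> < h} (t, s) \<partial>lebesgue_on {0<..<T}) \<partial>lebesgue_on {0<..<T})
      \<le> ennreal (2 * h) * (\<integral>\<^sup>+ t. a t \<partial>lebesgue_on {0<..<T})" (is ?th1)
    and "(\<integral>\<^sup>+ t. (\<integral>\<^sup>+ s. a s * indicator {p. \<bar>snd p - fst p\<bar> < h} (t, s) \<partial>lebesgue_on {0<..<T}) \<partial>lebesgue_on {0<..<T})
      \<le> ennreal (2 * h) * (\<integral>\<^sup>+ t. a t \<partial>lebesgue_on {0<..<T})" (is ?th2)
proof -
  let ?M = "lebesgue_on {0<..<T}"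
  interpret finite_measure ?M by (rule finite_measure_interval)
  interpret pair_sigma_finite ?M ?M ..
  let ?d = "\<lambda>p. indicator {p. \<bar>snd p - fst p\<bar> < h} p :: ennreal"
  have md: "(\<lambda>s. ?d (t, s)) \<in> borel_measurable ?M" "(\<lambda>s. ?d (s, t)) \<in> borel_measurable ?M" if "t \<in> space ?M" for t
    using measurable_compose[OF measurable_Pair1'[OF that] diagonal_strip_measurable]
      measurable_compose[OF measurable_Pair2'[OF that] diagonal_strip_measurable] by auto
  have "(\<integral>\<^sup>+ t. (\<integral>\<^sup>+ s. a t * ?d (t, s) \<partial>?M) \<partial>?M) = (\<integral>\<^sup>+ t. a t * (\<integral>\<^sup>+ s. ?d (t, s) \<partial>?M) \<partial>?M)"
    by (intro nn_integral_cong nn_integral_cmult md)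
  also have "\<dots> \<le> (\<integral>\<^sup>+ t. a t * ennreal (2 * h) \<partial>?M)"
    by (intro nn_integral_mono mult_left_mono diagonal_strip_section assms) simp
  also have "\<dots> = ennreal (2 * h) * (\<integral>\<^sup>+ t. a t \<partial>?M)" unfolding nn_integral_multc[OF a] by (rule mult.commute)
  finally show ?th1 .
  have "(\<integral>\<^sup>+ t. (\<integral>\<^sup>+ s. a s * ?d (t, s) \<partial>?M) \<partial>?M) = (\<integral>\<^sup>+ s. (\<integral>\<^sup>+ t. a s * ?d (t, s) \<partial>?M) \<partial>?M)"
    by (rule Fubini') (simp add: case_prod_beta')
  also have "\<dots> = (\<integral>\<^sup>+ s. a s * (\<integral>\<^sup>+ t. ?d (t, s) \<partial>?M) \<partial>?M)"
    by (intro nn_integral_cong nn_integral_cmult md)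
  also have "\<dots> \<le> (\<integral>\<^sup>+ s. a s * ennreal (2 * h) \<partial>?M)"
    by (intro nn_integral_mono mult_left_mono diagonal_strip_section assms) simp
  also have "\<dots> = ennreal (2 * h) * (\<integral>\<^sup>+ t. a t \<partial>?M)" unfolding nn_integral_multc[OF a] by (rule mult.commute)
  finally show ?th2 .
qed

text \<open>A is squeezed between a compact K and an open U with small difference U - K. Two times
  closer than the distance from K to the complement of U cannot lie one in K and the other outside
  U, so every pair with t inside and s outside A has a member in U - K. The part of the strip with a
  given coordinate in U - K has mass at most 2 h times the measure of U - K.\<close>

lemma set_translation_continuity:
  fixes A :: "real set"
  assumes A: "A \<in> sets lebesgue" "A \<subseteq> {0<..<T}" and \<epsilon>: "0 < \<epsilon>"
  obtains h0 where "0 < h0" "\<And>h. 0 < h \<Longrightarrow> h < h0 \<Longrightarrow>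
    (\<integral>\<^sup>+ t. (\<integral>\<^sup>+ s. indicator A t * indicator (- A) s * indicator {p. \<bar>snd p - fst p\<bar> < h} (t, s) \<partial>lebesgue_on {0<..<T}) \<partial>lebesgue_on {0<..<T})
      \<le> ennreal (\<epsilon> * h)"
proof -
  let ?M = "lebesgue_on {0<..<T}"
  interpret finite_measure ?M by (rule finite_measure_interval)
  obtain K where K: "closed K" "K \<subseteq> A" "A - K \<in> lmeasurable" "emeasure lebesgue (A - K) < ennreal (\<epsilon> / 8)"
    using sets_lebesgue_inner_closed[OF A(1), of "\<epsilon> / 8"] \<epsilon> by auto
  obtain U where U: "open U" "A \<subseteq> U" "U - A \<in> lmeasurable" "emeasure lebesgue (U - A) < ennreal (\<epsilon> / 8)"
    using sets_lebesgue_outer_open[OF A(1), of "\<epsilon> / 8"] \<epsilon> by auto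
  have "bounded K" using K(2) A(2) bounded_subset[of "{0<..<T}" K] by auto
  then have cK: "compact K" using K(1) compact_eq_bounded_closed by blast
  have "closed (- U)" "K \<inter> - U = {}" using U K by auto
  then obtain d where d: "d > 0" "\<And>x y. x \<in> K \<Longrightarrow> y \<in> - U \<Longrightarrow> d \<le> dist x y"
    using separate_compact_closed[OF cK, of "- U"] by blast
  define W where "W = U - K"
  have W: "W \<in> sets lebesgue" using U K by (auto simp: W_def borel_closed borel_open)
  have "emeasure lebesgue W \<le> emeasure lebesgue (A - K) + emeasure lebesgue (U - A)"
    using K U W by (intro order_trans[OF emeasure_mono emeasure_subadditive]) (auto simp: W_def fmeasurableD)
  also have "\<dots> \<le> ennreal (\<epsilon> / 8) + ennreal (\<epsilon> / 8)" using K(4) U(4) by (intro add_mono) auto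
  also have "\<dots> = ennreal (\<epsilon> / 4)" using \<epsilon> by (simp add: ennreal_plus[symmetric] del: ennreal_plus)
  finally have eW: "emeasure lebesgue W \<le> ennreal (\<epsilon> / 4)" .
  have iW: "(\<integral>\<^sup>+ t. indicator W t \<partial>?M) \<le> ennreal (\<epsilon> / 4)"
  proof -
    have "(\<integral>\<^sup>+ t. indicator W t \<partial>?M) = (\<integral>\<^sup>+ t. indicator W t * indicator {0<..<T} t \<partial>lebesgue)"
      by (subst nn_integral_restrict_space) auto
    also have "\<dots> \<le> (\<integral>\<^sup>+ t. indicator W t \<partial>lebesgue)" by (intro nn_integral_mono) (auto simp: indicator_def)
    finally show ?thesis using W eW by (simp add: order_trans)
  qed
  have mW[measurable]: "(indicator W :: real \<Rightarrow> ennreal) \<in> borel_measurable ?M"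
    using W by (intro measurable_restrict_space1) auto
  show ?thesis
  proof (rule that[OF d(1)])
    fix h assume h: "0 < h" "h < d"
    let ?d = "\<lambda>p. indicator {p. \<bar>snd p - fst p\<bar> < h} p :: ennreal"
    have "(\<integral>\<^sup>+ t. (\<integral>\<^sup>+ s. indicator A t * indicator (- A) s * ?d (t, s) \<partial>?M) \<partial>?M)
       \<le> (\<integral>\<^sup>+ t. (\<integral>\<^sup>+ s. indicator W t * ?d (t, s) + indicator W s * ?d (t, s) \<partial>?M) \<partial>?M)"
    proof (intro nn_integral_mono)
      fix t s
      show "indicator A t * indicator (- A) s * ?d (t, s) \<le> indicator W t * ?d (t, s) + indicator W s * ?d (t, s)"
      proof (cases "t \<in> A \<and> s \<notin> A \<and> \<bar>s - t\<bar> < h")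
        case True
        have "t \<in> W \<or> s \<in> W"
        proof (cases "t \<in> K")
          case True': True
          have "s \<in> U" using d(2)[of t s] True True' h by (force simp: dist_real_def)
          then show ?thesis using True K by (auto simp: W_def)
        qed (use True U in \<open>auto simp: W_def\<close>)
        then show ?thesis using True by (auto simp: indicator_def)
      qed (auto simp: indicator_def)
    qed
    also have "\<dots> = (\<integral>\<^sup>+ t. (\<integral>\<^sup>+ s. indicator W t * ?d (t, s) \<partial>?M) \<partial>?M) + (\<integral>\<^sup>+ t. (\<integral>\<^sup>+ s. indicator W s * ?d (t, s) \<partial>?M) \<partial>?M)"
    proof -
      have m: "(\<lambda>p. indicator W (fst p) * ?d p) \<in> borel_measurable (?M \<Otimes>\<^sub>M ?M)"
        "(\<lambda>p. indicator W (snd p) * ?d p) \<in> borel_measurable (?M \<Otimes>\<^sub>M ?M)"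
        using measurable_compose[OF measurable_fst mW] measurable_compose[OF measurable_snd mW] diagonal_strip_measurable
        by (auto intro: borel_measurable_times_ennreal)
      have m1: "(\<lambda>s. indicator W t * ?d (t, s)) \<in> borel_measurable ?M" "(\<lambda>s. indicator W s * ?d (t, s)) \<in> borel_measurable ?M"
        if "t \<in> space ?M" for t
        using measurable_compose[OF measurable_Pair1'[OF that] m(1)] measurable_compose[OF measurable_Pair1'[OF that] m(2)]
        by (simp_all only: fst_conv snd_conv)
      have "(\<integral>\<^sup>+ t. (\<integral>\<^sup>+ s. indicator W t * ?d (t, s) + indicator W s * ?d (t, s) \<partial>?M) \<partial>?M)
        = (\<integral>\<^sup>+ t. (\<integral>\<^sup>+ s. indicator W t * ?d (t, s) \<partial>?M) + (\<integral>\<^sup>+ s. indicator W s * ?d (t, s) \<partial>?M) \<partial>?M)"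
        by (intro nn_integral_cong nn_integral_add m1)
      also have "\<dots> = (\<integral>\<^sup>+ t. (\<integral>\<^sup>+ s. indicator W t * ?d (t, s) \<partial>?M) \<partial>?M) + (\<integral>\<^sup>+ t. (\<integral>\<^sup>+ s. indicator W s * ?d (t, s) \<partial>?M) \<partial>?M)"
        using borel_measurable_nn_integral_fst[OF m(1)] borel_measurable_nn_integral_fst[OF m(2)]
        by (intro nn_integral_add) auto
      finally show ?thesis .
    qed
    also have "\<dots> \<le> ennreal (2 * h) * ennreal (\<epsilon> / 4) + ennreal (2 * h) * ennreal (\<epsilon> / 4)"
      using h iW by (intro add_mono order_trans[OF diagonal_strip_Fubini(1)[OF _ mW]] order_trans[OF diagonal_strip_Fubini(2)[OF _ mW]] mult_left_mono) auto
    also have "\<dots> = ennreal (\<epsilon> * h)"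
      using h \<epsilon> by (simp add: ennreal_plus[symmetric] ennreal_mult[symmetric] del: ennreal_plus)
    finally show "(\<integral>\<^sup>+ t. (\<integral>\<^sup>+ s. indicator A t * indicator (- A) s * ?d (t, s) \<partial>?M) \<partial>?M) \<le> ennreal (\<epsilon> * h)" .
  qed
qed

context seminormed_functions
begin

text \<open>The majorant \<open>\<Psi>\<close> is there because the inner integral need not depend measurably on \<open>t\<close>.\<close>

lemma translation_continuity:
  assumes u: "u \<in> bochner_L2 T X N" and "0 < \<epsilon>"
  obtains h0 where "0 < h0" "\<And>h. 0 < h \<Longrightarrow> h < h0 \<Longrightarrow>
    \<exists>\<Psi>\<in>borel_measurable (lebesgue_on {0<..<T}).
      (AE t in lebesgue_on {0<..<T}. (\<integral>\<^sup>+ s. ennreal ((N (\<lambda>x. u t x - u s x))\<^sup>2) * indicator {p. \<bar>snd p - fst p\<bar> < h} (t, s)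
          \<partial>lebesgue_on {0<..<T}) \<le> \<Psi> t) \<and>
      (\<integral>\<^sup>+ t. \<Psi> t \<partial>lebesgue_on {0<..<T}) \<le> ennreal (\<epsilon> * h)"
proof -
  let ?M = "lebesgue_on {0<..<T}"
  interpret finite_measure ?M by (rule finite_measure_interval)
  \<comment> \<open>The difference \<open>u t - u s\<close> is split through \<open>z t\<close> and
    \<open>z s\<close>, and squaring three summands costs a factor 3. The two outer errors
    contribute 3 times 2 h \<epsilon>/24 each, together \<epsilon> h / 2; the number \<eta> below is
    chosen so that the middle term stays within the other half.\<close>
  obtain z where z: "simple_function ?M z" "\<And>t. t \<in> {0<..<T} \<Longrightarrow> z t \<in> X"
    "integrable ?M (\<lambda>t. (N (\<lambda>x. z t x - u t x))\<^sup>2)" "(LINT t|?M. (N (\<lambda>x. z t x - u t x))\<^sup>2) < \<epsilon> / 24"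
    by (rule bochner_simple_approximation[OF u, of "\<epsilon> / 24"]) (use \<open>0 < \<epsilon>\<close> in auto)
  define a where "a t = ennreal ((N (\<lambda>x. z t x - u t x))\<^sup>2)" for t
  have ma[measurable]: "a \<in> borel_measurable ?M" unfolding a_def using z(3) by measurable
  have ia: "(\<integral>\<^sup>+ t. a t \<partial>?M) \<le> ennreal (\<epsilon> / 24)"
    unfolding a_def using z(3,4) by (subst nn_integral_eq_integral) (auto intro: ennreal_leI)
  define R where "R = z ` {0<..<T}"
  have fR: "finite R" using simple_functionD(1)[OF z(1)] by (simp add: R_def)
  define B where "B = (\<Sum>v\<in>R. \<Sum>v'\<in>R. (N (\<lambda>x. v x - v' x))\<^sup>2)"
  have B: "(N (\<lambda>x. v x - v' x))\<^sup>2 \<le> B" if "v \<in> R" "v' \<in> R" for v v'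
  proof -
    have "(N (\<lambda>x. v x - v' x))\<^sup>2 \<le> (\<Sum>v'\<in>R. (N (\<lambda>x. v x - v' x))\<^sup>2)"
      using fR that by (intro member_le_sum) auto
    also have "\<dots> \<le> B" unfolding B_def using fR that by (intro member_le_sum[of v R "\<lambda>v. \<Sum>v'\<in>R. (N (\<lambda>x. v x - v' x))\<^sup>2"]) (auto intro: sum_nonneg)
    finally show ?thesis .
  qed
  have B0: "0 \<le> B" by (auto simp: B_def intro!: sum_nonneg)
  define A where "A v = z -` {v} \<inter> {0<..<T}" for v
  have A: "A v \<in> sets lebesgue" "A v \<subseteq> {0<..<T}" for v
  proof -
    have "A v \<in> sets ?M" using simple_functionD(2)[OF z(1), of "{v}"] by (simp add: A_def)
    then show "A v \<in> sets lebesgue" by (simp add: sets_restrict_space_iff)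
  qed (auto simp: A_def)
  define Y where "Y = (B + 1) * (real (card R) + 1)"
  have Y: "Y > 0" "B * real (card R) \<le> Y"
    unfolding Y_def using B0 by (auto intro!: mult_pos_pos mult_mono)
  define \<eta> where "\<eta> = \<epsilon> / (6 * Y)"
  have \<eta>: "\<eta> > 0" using \<open>0 < \<epsilon>\<close> Y by (simp add: \<eta>_def)
  have \<eta>2: "3 * B * (real (card R) * \<eta>) \<le> \<epsilon> / 2"
  proof -
    have "3 * B * (real (card R) * \<eta>) = (B * real (card R)) * (\<epsilon> / (2 * Y))"
      by (simp add: \<eta>_def)
    also have "\<dots> \<le> Y * (\<epsilon> / (2 * Y))"
      using Y \<open>0 < \<epsilon>\<close> by (intro mult_right_mono) auto
    also have "\<dots> = \<epsilon> / 2" using Y by simp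
    finally show ?thesis .
  qed
  let ?d = "\<lambda>h p. indicator {p. \<bar>snd p - fst p\<bar> < h} p :: ennreal"
  define S where "S h v = (\<integral>\<^sup>+ t. (\<integral>\<^sup>+ s. indicator (A v) t * indicator (- A v) s * ?d h (t, s) \<partial>?M) \<partial>?M)" for h v
  have "\<exists>h0>0. \<forall>h. 0 < h \<and> h < h0 \<longrightarrow> S h v \<le> ennreal (\<eta> * h)" for v
  proof -
    obtain h1 where h1: "0 < h1" "\<And>h. 0 < h \<Longrightarrow> h < h1 \<Longrightarrow> S h v \<le> ennreal (\<eta> * h)"
      by (rule set_translation_continuity[OF A(1)[of v] A(2)[of v] \<eta>]) (rule that[unfolded S_def])
    then show ?thesis by (intro exI[of _ h1]) simp
  qed
  then obtain H where H: "\<And>v. 0 < H v" "\<And>v h. 0 < h \<Longrightarrow> h < H v \<Longrightarrow> S h v \<le> ennreal (\<eta> * h)" by metis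
  define h0 where "h0 = Min (insert 1 (H ` R))"
  have h0: "0 < h0" "\<And>v. v \<in> R \<Longrightarrow> h0 \<le> H v" using fR H(1) by (auto simp: h0_def)
  show ?thesis
  proof (rule that[OF h0(1)])
    fix h assume h: "0 < h" "h < h0"
    \<comment> \<open>Near the diagonal, m is at least 1 whenever \<open>z t\<close> and
      \<open>z s\<close> differ, since s is then outside the level set of z that contains t. The
      constant B bounds the squared jump.\<close>
    define m where "m p = (\<Sum>v\<in>R. indicator (A v) (fst p) * indicator (- A v) (snd p) * ?d h p)" for p
    define G where "G p = 3 * (a (fst p) * ?d h p) + 3 * (ennreal B * m p) + 3 * (a (snd p) * ?d h p)" for p
    have mI: "(indicator (A v) :: real \<Rightarrow> ennreal) \<in> borel_measurable ?M" "(indicator (- A v) :: real \<Rightarrow> ennreal) \<in> borel_measurable ?M" for v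
      using A(1)[of v] sets.compl_sets[OF A(1)[of v]]
      by (simp_all add: Compl_eq_Diff_UNIV borel_measurable_indicator measurable_restrict_space1)
    have m1: "(\<lambda>p. indicator (A v) (fst p) * indicator (- A v) (snd p) * ?d h p) \<in> borel_measurable (?M \<Otimes>\<^sub>M ?M)" for v
      by (intro borel_measurable_times_ennreal measurable_compose[OF measurable_fst mI(1)] measurable_compose[OF measurable_snd mI(2)] diagonal_strip_measurable)
    have mm: "m \<in> borel_measurable (?M \<Otimes>\<^sub>M ?M)" unfolding m_def by (intro borel_measurable_sum m1)
    have mf: "(\<lambda>p. a (fst p) * ?d h p) \<in> borel_measurable (?M \<Otimes>\<^sub>M ?M)"
      by (intro borel_measurable_times_ennreal measurable_compose[OF measurable_fst ma] diagonal_strip_measurable)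
    have ms: "(\<lambda>p. a (snd p) * ?d h p) \<in> borel_measurable (?M \<Otimes>\<^sub>M ?M)"
      by (intro borel_measurable_times_ennreal measurable_compose[OF measurable_snd ma] diagonal_strip_measurable)
    have mG: "G \<in> borel_measurable (?M \<Otimes>\<^sub>M ?M)" unfolding G_def
      by (intro borel_measurable_add borel_measurable_times_ennreal borel_measurable_const mf ms mm)
    define \<Psi> where "\<Psi> t = (\<integral>\<^sup>+ s. G (t, s) \<partial>?M)" for t
    show "\<exists>\<Psi>\<in>borel_measurable ?M.
      (AE t in ?M. (\<integral>\<^sup>+ s. ennreal ((N (\<lambda>x. u t x - u s x))\<^sup>2) * ?d h (t, s) \<partial>?M) \<le> \<Psi> t) \<and> (\<integral>\<^sup>+ t. \<Psi> t \<partial>?M) \<le> ennreal (\<epsilon> * h)"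
    proof (intro bexI conjI)
      show "\<Psi> \<in> borel_measurable ?M" unfolding \<Psi>_def by (rule borel_measurable_nn_integral_fst[OF mG])
      have T: "AE t in ?M. t \<in> {0<..<T}" by (rule AE_I2) simp
      show "AE t in ?M. (\<integral>\<^sup>+ s. ennreal ((N (\<lambda>x. u t x - u s x))\<^sup>2) * ?d h (t, s) \<partial>?M) \<le> \<Psi> t"
        using T bochner_D(1)[OF u]
      proof eventually_elim
        case t: (elim t)
        show ?case unfolding \<Psi>_def
        proof (rule nn_integral_mono_AE)
          show "AE s in ?M. ennreal ((N (\<lambda>x. u t x - u s x))\<^sup>2) * ?d h (t, s) \<le> G (t, s)"
            using T bochner_D(1)[OF u]
          proof eventually_elim
            case s: (elim s)
            show ?case
            proof (cases "\<bar>s - t\<bar> < h")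
              case True
              have zz: "z t \<in> X" "z s \<in> X" using z(2) t s by auto
              have "N (\<lambda>x. u t x - u s x) \<le> N (\<lambda>x. z t x - u t x) + N (\<lambda>x. z t x - z s x) + N (\<lambda>x. z s x - u s x)"
                using triangle_via[OF t(2) s(2) zz(1)] triangle_via[OF zz(1) s(2) zz(2)] minus_commute[OF t(2) zz(1)] by linarith
              then have "(N (\<lambda>x. u t x - u s x))\<^sup>2 \<le> (N (\<lambda>x. z t x - u t x) + N (\<lambda>x. z t x - z s x) + N (\<lambda>x. z s x - u s x))\<^sup>2"
                by (intro power_mono nonneg diff_closed t(2) s(2))
              also have "\<dots> \<le> 3 * (N (\<lambda>x. z t x - u t x))\<^sup>2 + 3 * (N (\<lambda>x. z t x - z s x))\<^sup>2 + 3 * (N (\<lambda>x. z s x - u s x))\<^sup>2"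
                by (rule sum3_power2_le)
              finally have "ennreal ((N (\<lambda>x. u t x - u s x))\<^sup>2) \<le> ennreal (3 * (N (\<lambda>x. z t x - u t x))\<^sup>2 + 3 * (N (\<lambda>x. z t x - z s x))\<^sup>2 + 3 * (N (\<lambda>x. z s x - u s x))\<^sup>2)"
                by (rule ennreal_leI)
              also have "\<dots> = 3 * a t + 3 * ennreal ((N (\<lambda>x. z t x - z s x))\<^sup>2) + 3 * a s"
                by (simp add: a_def ennreal_plus ennreal_mult)
              also have "ennreal ((N (\<lambda>x. z t x - z s x))\<^sup>2) \<le> ennreal B * m (t, s)"
              proof (cases "z t = z s")
                case True
                have "N (\<lambda>x. z s x - z s x) = 0" using homogeneous[OF zz(2), of 0] by simp
                then show ?thesis using True by simp
              next
                case False
                have tR: "z t \<in> R" "z s \<in> R" using t s by (auto simp: R_def)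
                have "(1::ennreal) = indicator (A (z t)) (fst (t, s)) * indicator (- A (z t)) (snd (t, s)) * ?d h (t, s)"
                  using False True t s by (simp add: A_def)
                also have "\<dots> \<le> m (t, s)" unfolding m_def using fR tR(1)
                  by (intro member_le_sum[of "z t" R "\<lambda>v. indicator (A v) (fst (t, s)) * indicator (- A v) (snd (t, s)) * ?d h (t, s)"]) auto
                finally have "ennreal B * 1 \<le> ennreal B * m (t, s)" by (rule mult_left_mono) simp
                then show ?thesis using ennreal_leI[OF B[OF tR]] by (simp add: order_trans)
              qed
              finally show ?thesis using True by (simp add: G_def add_mono mult_left_mono)
            qed simp
          qed
        qed
      qed
      have "(\<integral>\<^sup>+ t. \<Psi> t \<partial>?M) = (\<integral>\<^sup>+ p. G p \<partial>(?M \<Otimes>\<^sub>M ?M))"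
        unfolding \<Psi>_def by (rule nn_integral_fst[OF mG])
      also have "\<dots> = 3 * (\<integral>\<^sup>+ p. a (fst p) * ?d h p \<partial>(?M \<Otimes>\<^sub>M ?M)) + 3 * (ennreal B * (\<Sum>v\<in>R. S h v)) + 3 * (\<integral>\<^sup>+ p. a (snd p) * ?d h p \<partial>(?M \<Otimes>\<^sub>M ?M))"
      proof -
        have "(\<integral>\<^sup>+ p. m p \<partial>(?M \<Otimes>\<^sub>M ?M)) = (\<Sum>v\<in>R. S h v)"
          unfolding m_def S_def nn_integral_sum[OF m1]
          by (intro sum.cong refl) (simp only: nn_integral_fst[OF m1, symmetric] fst_conv snd_conv)
        moreover have "(\<integral>\<^sup>+ p. G p \<partial>(?M \<Otimes>\<^sub>M ?M)) = (\<integral>\<^sup>+ p. 3 * (a (fst p) * ?d h p) + 3 * (ennreal B * m p) \<partial>(?M \<Otimes>\<^sub>M ?M))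
            + (\<integral>\<^sup>+ p. 3 * (a (snd p) * ?d h p) \<partial>(?M \<Otimes>\<^sub>M ?M))"
          unfolding G_def
          by (rule nn_integral_add) (intro borel_measurable_add borel_measurable_times_ennreal[OF borel_measurable_const] mf ms mm)+
        moreover have "(\<integral>\<^sup>+ p. 3 * (a (fst p) * ?d h p) + 3 * (ennreal B * m p) \<partial>(?M \<Otimes>\<^sub>M ?M))
            = (\<integral>\<^sup>+ p. 3 * (a (fst p) * ?d h p) \<partial>(?M \<Otimes>\<^sub>M ?M)) + (\<integral>\<^sup>+ p. 3 * (ennreal B * m p) \<partial>(?M \<Otimes>\<^sub>M ?M))"
          by (rule nn_integral_add) (intro borel_measurable_times_ennreal[OF borel_measurable_const] mf mm)+
        ultimately show ?thesis
          by (simp only: nn_integral_cmult[OF mf] nn_integral_cmult[OF ms] nn_integral_cmult[OF mm]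
              nn_integral_cmult[OF borel_measurable_times_ennreal[OF borel_measurable_const mm]])
      qed
      also have "\<dots> \<le> 3 * (ennreal (2 * h) * ennreal (\<epsilon> / 24)) + 3 * (ennreal B * (\<Sum>v\<in>R. ennreal (\<eta> * h))) + 3 * (ennreal (2 * h) * ennreal (\<epsilon> / 24))"
      proof -
        have 1: "(\<integral>\<^sup>+ p. a (fst p) * ?d h p \<partial>(?M \<Otimes>\<^sub>M ?M)) \<le> ennreal (2 * h) * ennreal (\<epsilon> / 24)"
        proof -
          have "(\<integral>\<^sup>+ p. a (fst p) * ?d h p \<partial>(?M \<Otimes>\<^sub>M ?M)) = (\<integral>\<^sup>+ t. (\<integral>\<^sup>+ s. a t * ?d h (t, s) \<partial>?M) \<partial>?M)"
            using nn_integral_fst[OF mf, symmetric] by (simp only: fst_conv snd_conv)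
          also have "\<dots> \<le> ennreal (2 * h) * ennreal (\<epsilon> / 24)"
            by (rule order_trans[OF diagonal_strip_Fubini(1)[OF _ ma] mult_left_mono[OF ia]]) (use h in auto)
          finally show ?thesis .
        qed
        have 2: "(\<integral>\<^sup>+ p. a (snd p) * ?d h p \<partial>(?M \<Otimes>\<^sub>M ?M)) \<le> ennreal (2 * h) * ennreal (\<epsilon> / 24)"
        proof -
          have "(\<integral>\<^sup>+ p. a (snd p) * ?d h p \<partial>(?M \<Otimes>\<^sub>M ?M)) = (\<integral>\<^sup>+ t. (\<integral>\<^sup>+ s. a s * ?d h (t, s) \<partial>?M) \<partial>?M)"
            using nn_integral_fst[OF ms, symmetric] by (simp only: fst_conv snd_conv)
          also have "\<dots> \<le> ennreal (2 * h) * ennreal (\<epsilon> / 24)"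
            by (rule order_trans[OF diagonal_strip_Fubini(2)[OF _ ma] mult_left_mono[OF ia]]) (use h in auto)
          finally show ?thesis .
        qed
        have 3: "(\<Sum>v\<in>R. S h v) \<le> (\<Sum>v\<in>R. ennreal (\<eta> * h))"
          using H(2) h h0(2) by (intro sum_mono) (auto intro: less_le_trans)
        show ?thesis by (intro add_mono mult_left_mono 1 2 3) auto
      qed
      also have "\<dots> = ennreal (\<epsilon> / 2 * h + 3 * B * (real (card R) * \<eta>) * h)"
      proof -
        have "(\<Sum>v\<in>R. ennreal (\<eta> * h)) = ennreal (real (card R) * (\<eta> * h))"
          using \<eta> h by (simp add: ennreal_mult ennreal_of_nat_eq_real_of_nat)
        moreover have "(3::ennreal) = ennreal 3" by simp
        ultimately have "3 * (ennreal (2 * h) * ennreal (\<epsilon> / 24)) + 3 * (ennreal B * (\<Sum>v\<in>R. ennreal (\<eta> * h))) + 3 * (ennreal (2 * h) * ennreal (\<epsilon> / 24))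
          = ennreal (3 * (2 * h * (\<epsilon> / 24)) + 3 * (B * (real (card R) * (\<eta> * h))) + 3 * (2 * h * (\<epsilon> / 24)))"
          using h \<eta> B0 \<open>0 < \<epsilon>\<close> by (simp only: ennreal_mult[symmetric] ennreal_plus[symmetric] mult_nonneg_nonneg
              less_imp_le divide_nonneg_nonneg zero_le_numeral add_nonneg_nonneg of_nat_0_le_iff)
        then show ?thesis by (simp add: algebra_simps)
      qed
      also have "\<dots> \<le> ennreal (\<epsilon> * h)"
        using mult_right_mono[OF \<eta>2, of h] h by (intro ennreal_leI) (simp add: field_simps)
      finally show "(\<integral>\<^sup>+ t. \<Psi> t \<partial>?M) \<le> ennreal (\<epsilon> * h)" .
    qed
  qed
qed

end

section \<open>The duality pairing as a function of time\<close>

lemma pairing_difference_bound: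
  assumes "open D" "F \<in> H1_dual D" "G \<in> H1_dual D" "u \<in> H1 D" "v \<in> H1 D"
  shows "\<bar>F u - G v\<bar> \<le> H1_dual_norm D (\<lambda>\<phi>. F \<phi> - G \<phi>) * H1_norm D u + H1_dual_norm D G * H1_norm D (\<lambda>x. u x - v x)"
proof -
  interpret h: seminormed_functions "H1 D" "H1_norm D" by (rule seminormed_functions_H1[OF assms(1)])
  interpret d: seminormed_functions "H1_dual D" "H1_dual_norm D" by (rule seminormed_functions_H1_dual[OF assms(1)])
  have "F u - G v = (F u - G u) + G (\<lambda>x. u x - v x)" using H1_dual_diff[OF assms(1,3,4,5)] by simp
  then show ?thesis
    using H1_dual_norm_bounds(1)[OF assms(1) d.diff_closed[OF assms(2,3)] assms(4)]
      H1_dual_norm_bounds(1)[OF assms(1,3) h.diff_closed[OF assms(4,5)]] by linarith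
qed

text \<open>Simple approximations of F and u are paired to a real simple function, and
  \<open>pairing_difference_bound\<close> carries the values to the limit.\<close>

lemma pairing_measurable:
  assumes "open D" and F: "F \<in> bochner_L2 T (H1_dual D) (H1_dual_norm D)" and u: "u \<in> bochner_L2 T (H1 D) (H1_norm D)"
  shows "(\<lambda>t. F t (u t)) \<in> borel_measurable (lebesgue_on {0<..<T})"
proof -
  let ?M = "lebesgue_on {0<..<T}"
  interpret h: seminormed_functions "H1 D" "H1_norm D" by (rule seminormed_functions_H1[OF assms(1)])
  interpret d: seminormed_functions "H1_dual D" "H1_dual_norm D" by (rule seminormed_functions_H1_dual[OF assms(1)])
  obtain s where s: "\<And>k::nat. simple_function ?M (s k)" "\<And>k t. t \<in> {0<..<T} \<Longrightarrow> s k t \<in> H1 D"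
    "AE t in ?M. (\<lambda>k. H1_norm D (\<lambda>x. s k t x - u t x)) \<longlonglongrightarrow> 0" by (rule h.bochner_E[OF u]) (rule that)
  obtain r where r: "\<And>k::nat. simple_function ?M (r k)" "\<And>k t. t \<in> {0<..<T} \<Longrightarrow> r k t \<in> H1_dual D"
    "AE t in ?M. (\<lambda>k. H1_dual_norm D (\<lambda>x. r k t x - F t x)) \<longlonglongrightarrow> 0" by (rule d.bochner_E[OF F]) (rule that)
  have T: "AE t in ?M. t \<in> {0<..<T}" by (rule AE_I2) simp
  show ?thesis
  proof (rule AE_limit_measurable)
    show "(\<lambda>t. r k t (s k t)) \<in> borel_measurable ?M" for k
      by (rule simple_function_real_measurable)
        (rule simple_function_compose2[OF r(1) s(1), where h="\<lambda>a b. a b"])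
    show "AE t in ?M. (\<lambda>k. r k t (s k t)) \<longlonglongrightarrow> F t (u t)"
      using s(3) r(3) T h.bochner_D(1)[OF u] d.bochner_D(1)[OF F]
    proof eventually_elim
      case (elim t)
      let ?a = "\<lambda>k. H1_norm D (\<lambda>x. s k t x - u t x)" and ?b = "\<lambda>k. H1_dual_norm D (\<lambda>x. r k t x - F t x)"
      have le: "norm (r k t (s k t) - F t (u t)) \<le> ?b k * (H1_norm D (u t) + ?a k) + H1_dual_norm D (F t) * ?a k" for k
      proof -
        have "\<bar>r k t (s k t) - F t (u t)\<bar> \<le> ?b k * H1_norm D (s k t) + H1_dual_norm D (F t) * ?a k"
          by (rule pairing_difference_bound[OF assms(1) r(2)[OF elim(3)] elim(5) s(2)[OF elim(3)] elim(4)])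
        also have "?b k * H1_norm D (s k t) \<le> ?b k * (H1_norm D (u t) + ?a k)"
          using h.le_add_diff[OF s(2)[OF elim(3)] elim(4)] d.nonneg[OF d.diff_closed[OF r(2)[OF elim(3)] elim(5)]]
          by (intro mult_left_mono)
        finally show ?thesis by simp
      qed
      have "(\<lambda>k. ?b k * (H1_norm D (u t) + ?a k) + H1_dual_norm D (F t) * ?a k) \<longlonglongrightarrow> 0 * (H1_norm D (u t) + 0) + H1_dual_norm D (F t) * 0"
        by (intro tendsto_intros elim)
      then have lim: "(\<lambda>k. ?b k * (H1_norm D (u t) + ?a k) + H1_dual_norm D (F t) * ?a k) \<longlonglongrightarrow> 0" by simp
      have "(\<lambda>k. r k t (s k t) - F t (u t)) \<longlonglongrightarrow> 0"
        by (rule Lim_null_comparison[OF always_eventually[OF allI[OF le]] lim])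
      then show ?case by (rule LIM_zero_cancel)
    qed
  qed simp
qed

lemma pairing_integrable:
  assumes "open D" and F: "F \<in> bochner_L2 T (H1_dual D) (H1_dual_norm D)" and u: "u \<in> bochner_L2 T (H1 D) (H1_norm D)"
  shows "integrable (lebesgue_on {0<..<T}) (\<lambda>t. F t (u t))"
proof -
  let ?M = "lebesgue_on {0<..<T}"
  interpret h: seminormed_functions "H1 D" "H1_norm D" by (rule seminormed_functions_H1[OF assms(1)])
  interpret d: seminormed_functions "H1_dual D" "H1_dual_norm D" by (rule seminormed_functions_H1_dual[OF assms(1)])
  show ?thesis
  proof (rule Bochner_Integration.integrable_bound)
    show "integrable ?M (\<lambda>t. (H1_dual_norm D (F t))\<^sup>2 + (H1_norm D (u t))\<^sup>2)"
      using d.bochner_D(2)[OF F] h.bochner_D(2)[OF u] by simp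
    show "(\<lambda>t. F t (u t)) \<in> borel_measurable ?M" by (rule pairing_measurable[OF assms])
    show "AE t in ?M. norm (F t (u t)) \<le> norm ((H1_dual_norm D (F t))\<^sup>2 + (H1_norm D (u t))\<^sup>2)"
      using d.bochner_D(1)[OF F] h.bochner_D(1)[OF u]
    proof eventually_elim
      case (elim t)
      have "\<bar>F t (u t)\<bar> \<le> H1_dual_norm D (F t) * H1_norm D (u t)" by (rule H1_dual_norm_bounds(1)[OF assms(1) elim])
      also have "\<dots> \<le> (H1_dual_norm D (F t))\<^sup>2 + (H1_norm D (u t))\<^sup>2"
        using sum_squares_bound[of "H1_dual_norm D (F t)" "H1_norm D (u t)"]
          mult_nonneg_nonneg[OF d.nonneg[OF elim(1)] h.nonneg[OF elim(2)]] by linarith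
      finally show ?case by simp
    qed
  qed
qed

section \<open>The energy inequality\<close>

lemma continuous_integrable_interval:
  fixes f :: "real \<Rightarrow> real"
  assumes "continuous_on {0..T} f"
  shows "integrable (lebesgue_on {0<..<T}) f" "(LINT t|lebesgue_on {0<..<T}. f t) = integral {0..T} f"
proof -
  have a: "f absolutely_integrable_on {0..T}" by (rule absolutely_integrable_continuous_real[OF assms])
  have s: "set_integrable lebesgue {0<..<T} f" by (rule set_integrable_subset[OF a]) auto
  then show i: "integrable (lebesgue_on {0<..<T}) f"
    by (simp only: set_integrable_def integrable_lebesgue_on_iff open_sets_lebesgue open_greaterThanLessThan)
  have "(LINT t|lebesgue_on {0<..<T}. f t) = integral {0<..<T} f"
    using set_lebesgue_integral_eq_integral(2)[OF s]
    by (simp only: set_lebesgue_integral_def integral_lebesgue_on_eq open_sets_lebesgue open_greaterThanLessThan)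
  then show "(LINT t|lebesgue_on {0<..<T}. f t) = integral {0..T} f" by (simp add: integral_open_interval_real)
qed

text \<open>The mollifier sits to the right of \<tau>, on an interval of length 1/n, and has mass 1
  as soon as this interval fits before T. Continuity of c on the shrinking interval gives the
  limit.\<close>

lemma approximate_identity:
  fixes c r R :: "real \<Rightarrow> real"
  assumes c: "continuous_on {0..T} c" and \<tau>: "0 < \<tau>" "\<tau> < T"
    and R: "\<And>x. (R has_real_derivative r x) (at x)" "\<And>x. 0 \<le> r x" "\<And>x. x \<le> 0 \<Longrightarrow> R x = 0" "\<And>x. 1 \<le> x \<Longrightarrow> R x = 1"
      "continuous_on UNIV r" "\<And>x. x \<notin> {0<..<1} \<Longrightarrow> r x = 0"
  shows "(\<lambda>n. LINT t|lebesgue_on {0<..<T}. (real n * r (real n * (t - \<tau>))) * c t) \<longlonglongrightarrow> c \<tau>"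
proof (rule LIMSEQ_I)
  fix e :: real assume "0 < e"
  let ?M = "lebesgue_on {0<..<T}"
  obtain d where d: "d > 0" "\<And>t. t \<in> {0..T} \<Longrightarrow> dist t \<tau> < d \<Longrightarrow> dist (c t) (c \<tau>) < e / 2"
    using c \<tau> \<open>0 < e\<close> unfolding continuous_on_iff by (metis atLeastAtMost_iff half_gt_zero less_imp_le)
  define m where "m = min d (T - \<tau>)"
  have m: "0 < m" using d \<tau> by (simp add: m_def)
  obtain n0 where n0: "0 < n0" "inverse (real n0) < m" using m ex_inverse_of_nat_less by blast
  show "\<exists>n0. \<forall>n\<ge>n0. norm ((LINT t|?M. (real n * r (real n * (t - \<tau>))) * c t) - c \<tau>) < e"
  proof (intro exI allI impI)
    fix n assume "n0 \<le> n"
    then have n: "0 < n" "1 / real n < m" using n0 by (auto simp: field_simps intro: less_le_trans)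
      (metis less_le_trans mult_left_mono of_nat_le_iff less_imp_le m mult.commute)
    define \<rho> where "\<rho> t = real n * r (real n * (t - \<tau>))" for t
    have c\<rho>: "continuous_on S \<rho>" for S
      unfolding \<rho>_def by (intro continuous_intros continuous_on_compose2[OF R(5)]) auto
    have \<rho>0: "0 \<le> \<rho> t" for t using R(2) by (simp add: \<rho>_def)
    have \<rho>s: "\<rho> t = 0" if "\<not> (\<tau> < t \<and> t < \<tau> + 1 / real n)" for t
    proof -
      have "real n * (t - \<tau>) \<notin> {0<..<1}"
        using that n(1) by (auto simp: zero_less_mult_iff field_simps)
      then show ?thesis by (simp add: \<rho>_def R(6))
    qed
    have dR: "((\<lambda>t. R (real n * (t - \<tau>))) has_real_derivative \<rho> t) (at t)" for t
      unfolding \<rho>_def by (rule DERIV_chain2[OF R(1), where Db="real n", THEN DERIV_cong]) (auto intro!: derivative_eq_intros)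
    have "(\<rho> has_integral R (real n * (T - \<tau>)) - R (real n * (0 - \<tau>))) {0..T}"
      using \<tau> dR by (intro fundamental_theorem_of_calculus)
        (auto simp: has_real_derivative_iff_has_vector_derivative[symmetric] intro: has_field_derivative_at_within)
    moreover have "R (real n * (T - \<tau>)) = 1"
    proof (rule R(4))
      have "1 / real n < T - \<tau>" using n by (simp add: m_def)
      then show "1 \<le> real n * (T - \<tau>)" using n(1) by (simp add: field_simps)
    qed
    moreover have "R (real n * (0 - \<tau>)) = 0" using \<tau> by (intro R(3)) (simp add: mult_nonneg_nonpos)
    ultimately have "integral {0..T} \<rho> = 1" by (simp add: integral_unique)
    then have \<rho>1: "(LINT t|?M. \<rho> t) = 1" using continuous_integrable_interval(2)[OF c\<rho>] by simp
    note i\<rho> = continuous_integrable_interval(1)[OF c\<rho>, of T]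
    have ic: "integrable ?M (\<lambda>t. \<rho> t * c t)" by (intro continuous_integrable_interval continuous_on_mult c\<rho> c)
    have "(LINT t|?M. \<rho> t * c t) - c \<tau> = (LINT t|?M. \<rho> t * c t) - (LINT t|?M. \<rho> t * c \<tau>)" using \<rho>1 i\<rho> by simp
    also have "\<dots> = (LINT t|?M. \<rho> t * c t - \<rho> t * c \<tau>)" using ic i\<rho> by simp
    finally have "\<bar>(LINT t|?M. \<rho> t * c t) - c \<tau>\<bar> \<le> (LINT t|?M. \<bar>\<rho> t * c t - \<rho> t * c \<tau>\<bar>)"
      using integral_abs_bound[of ?M "\<lambda>t. \<rho> t * c t - \<rho> t * c \<tau>"] by simp
    also have "\<dots> \<le> (LINT t|?M. e / 2 * \<rho> t)"
    proof (rule integral_mono)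
      show "integrable ?M (\<lambda>t. \<bar>\<rho> t * c t - \<rho> t * c \<tau>\<bar>)" using ic i\<rho> by simp
      show "integrable ?M (\<lambda>t. e / 2 * \<rho> t)" using i\<rho> by simp
      fix t assume "t \<in> space ?M"
      then have t: "0 < t" "t < T" by auto
      show "\<bar>\<rho> t * c t - \<rho> t * c \<tau>\<bar> \<le> e / 2 * \<rho> t"
      proof (cases "\<tau> < t \<and> t < \<tau> + 1 / real n")
        case True
        then have "dist t \<tau> < d" using n(2) by (simp add: m_def dist_real_def)
        then have "\<bar>c t - c \<tau>\<bar> \<le> e / 2" using d(2)[of t] t by (simp add: dist_real_def)
        then have "\<rho> t * \<bar>c t - c \<tau>\<bar> \<le> \<rho> t * (e / 2)" using \<rho>0 by (rule mult_left_mono)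
        then show ?thesis using \<rho>0[of t] by (simp add: abs_mult right_diff_distrib[symmetric] mult.commute)
      qed (simp add: \<rho>s)
    qed
    also have "\<dots> = e / 2" using \<rho>1 by simp
    also have "\<dots> < e" using \<open>0 < e\<close> by simp
    finally show "norm ((LINT t|?M. (real n * r (real n * (t - \<tau>))) * c t) - c \<tau>) < e" by (simp add: \<rho>_def)
  qed
qed

lemma LIMSEQ_step:
  fixes R :: "real \<Rightarrow> real"
  assumes "\<And>x. x \<le> 0 \<Longrightarrow> R x = 0" "\<And>x. 1 \<le> x \<Longrightarrow> R x = 1"
  shows "(\<lambda>n. R (real n * d)) \<longlonglongrightarrow> (if 0 < d then 1 else 0)"
proof (cases "0 < d")
  case True
  obtain m :: nat where m: "1 / d < m" using reals_Archimedean2 by blast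
  have "R (real n * d) = 1" if "n \<ge> m" for n
  proof (rule assms(2))
    have "1 < m * d" using m True by (simp add: field_simps)
    also have "\<dots> \<le> n * d" using that True by simp
    finally show "1 \<le> real n * d" by simp
  qed
  then have "\<forall>\<^sub>F n in sequentially. 1 = R (real n * d)" by (auto simp: eventually_sequentially)
  then show ?thesis using True by (auto intro: Lim_transform_eventually[OF tendsto_const])
next
  case False
  then have "R (real n * d) = 0" for n by (intro assms(1)) (simp add: mult_nonneg_nonpos)
  then show ?thesis using False by simp
qed

text \<open>The test functions are differences of two steps and tend to the indicator of
  \<open>{t1<..t2}\<close>; their derivatives are differences of two mollifiers, which single out
  the values of the continuous function c at t1 and t2.\<close>

lemma weak_derivative_increment:
  fixes c d :: "real \<Rightarrow> real"
  assumes c: "continuous_on {0..T} c" and d: "integrable (lebesgue_on {0<..<T}) d"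
    and weak: "\<And>\<psi>. \<psi> \<in> test_functions {0<..<T} \<Longrightarrow>
      (LINT t|lebesgue_on {0<..<T}. deriv \<psi> t * c t) = - (LINT t|lebesgue_on {0<..<T}. \<psi> t * d t)"
    and t: "0 < t1" "t1 < t2" "t2 < T"
  shows "c t2 - c t1 = (LINT t|lebesgue_on {0<..<T}. indicator {t1<..t2} t * d t)"
proof -
  let ?M = "lebesgue_on {0<..<T}"
  obtain R r :: "real \<Rightarrow> real" where R: "smooth R" "\<And>x. (R has_real_derivative r x) (at x)"
    "\<And>x. 0 \<le> r x" "\<And>x. x \<le> 0 \<Longrightarrow> R x = 0" "\<And>x. 1 \<le> x \<Longrightarrow> R x = 1"
    "\<And>x. 0 \<le> R x" "\<And>x. R x \<le> 1" "continuous_on UNIV r" "\<And>x. x \<notin> {0<..<1} \<Longrightarrow> r x = 0"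
    by (rule smooth_step_exists) blast
  define \<psi> where "\<psi> n t = R (real n * (t - t1)) - R (real n * (t - t2))" for n t
  define \<rho> where "\<rho> n \<tau> t = real n * r (real n * (t - \<tau>))" for n \<tau> t
  have s: "smooth (\<psi> n)" for n
    unfolding \<psi>_def by (intro smooth_diff smooth_compose_real[OF R(1)] smooth_mult smooth_const smooth_bounded_linear bounded_linear_ident)
  have "((\<lambda>t. R (real n * (t - \<tau>))) has_real_derivative \<rho> n \<tau> t) (at t)" for n \<tau> t
    unfolding \<rho>_def by (rule DERIV_chain2[OF R(2), where Db="real n", THEN DERIV_cong]) (auto intro!: derivative_eq_intros)
  then have "(\<psi> n has_real_derivative \<rho> n t1 t - \<rho> n t2 t) (at t)" for n t
    unfolding \<psi>_def by (intro DERIV_diff)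
  then have deriv: "deriv (\<psi> n) t = \<rho> n t1 t - \<rho> n t2 t" for n t by (rule DERIV_imp_deriv)
  \<comment> \<open>For n beyond n0 the step at t2 is completed before T, so the difference of the
    steps has compact support in the open interval.\<close>
  obtain n0 where n0: "0 < n0" "inverse (real n0) < T - t2" using ex_inverse_of_nat_less[of "T - t2"] t by auto
  have test: "\<psi> n \<in> test_functions {0<..<T}" if "n \<ge> n0" for n
  proof -
    have n: "0 < n" using that n0 by simp
    have "inverse (real n) \<le> inverse (real n0)" using that n0(1) by simp
    then have "inverse (real n) < T - t2" using n0(2) by linarith
    then have sub: "{t1..t2 + inverse (real n)} \<subseteq> {0<..<T}" using t by auto
    have "\<psi> n x = 0" if "x \<notin> {t1..t2 + inverse (real n)}" for x
    proof (cases "x < t1")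
      case True
      then have "R (real n * (x - t1)) = 0" "R (real n * (x - t2)) = 0"
        using t by (auto intro!: R(4) mult_nonneg_nonpos)
      then show ?thesis by (simp add: \<psi>_def)
    next
      case False
      then have "t2 + inverse (real n) < x" using that by auto
      then have "inverse (real n) \<le> x - t2" "inverse (real n) \<le> x - t1" using t by auto
      then have "1 \<le> real n * (x - t2)" "1 \<le> real n * (x - t1)" using n by (auto simp: field_simps)
      then show ?thesis by (simp add: \<psi>_def R(5))
    qed
    then show ?thesis unfolding test_functions_def using s sub
      by (auto intro!: exI[where x="{t1..t2 + inverse (real n)}"])
  qed
  have id: "integrable ?M (\<lambda>t. (real n * r (real n * (t - \<tau>))) * c t)" for n \<tau>
    by (intro continuous_integrable_interval continuous_on_mult c continuous_intros continuous_on_compose2[OF R(8)]) auto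
  have "(\<lambda>n. (LINT t|?M. \<rho> n t1 t * c t) - (LINT t|?M. \<rho> n t2 t * c t)) \<longlonglongrightarrow> c t1 - c t2"
    unfolding \<rho>_def using t by (intro tendsto_diff approximate_identity[OF c _ _ R(2-5) R(8,9)]) auto
  moreover have "(LINT t|?M. \<rho> n t1 t * c t) - (LINT t|?M. \<rho> n t2 t * c t) = (LINT t|?M. deriv (\<psi> n) t * c t)" for n
    using id[of n t1] id[of n t2] by (simp add: deriv \<rho>_def left_diff_distrib)
  ultimately have lim1: "(\<lambda>n. LINT t|?M. deriv (\<psi> n) t * c t) \<longlonglongrightarrow> c t1 - c t2" by simp
  have lim2: "(\<lambda>n. LINT t|?M. \<psi> n t * d t) \<longlonglongrightarrow> (LINT t|?M. indicator {t1<..t2} t * d t)"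
  proof (rule integral_dominated_convergence[where w="\<lambda>t. \<bar>d t\<bar>"])
    note md = borel_measurable_integrable[OF d]
    show "(\<lambda>t. indicator {t1<..t2} t * d t) \<in> borel_measurable ?M"
      using t by (intro borel_measurable_times md borel_measurable_indicator) (auto simp: sets_restrict_space_iff)
    show "(\<lambda>t. \<psi> n t * d t) \<in> borel_measurable ?M" for n
      by (intro borel_measurable_times md continuous_borel_lebesgue(3) smooth_continuous s)
    show "integrable ?M (\<lambda>t. \<bar>d t\<bar>)" using d by simp
    show "AE t in ?M. (\<lambda>n. \<psi> n t * d t) \<longlonglongrightarrow> indicator {t1<..t2} t * d t"
    proof (rule AE_I2)
      fix x
      have "(\<lambda>n. \<psi> n x) \<longlonglongrightarrow> (if 0 < x - t1 then 1 else 0) - (if 0 < x - t2 then 1 else 0)"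
        unfolding \<psi>_def by (intro tendsto_diff LIMSEQ_step R(4,5))
      moreover have "(if 0 < x - t1 then 1 else 0) - (if 0 < x - t2 then 1 else 0) = (indicator {t1<..t2} x :: real)"
        using t by (auto simp: indicator_def)
      ultimately show "(\<lambda>n. \<psi> n x * d x) \<longlonglongrightarrow> indicator {t1<..t2} x * d x"
        by (intro tendsto_mult_right) simp
    qed
    show "AE t in ?M. norm (\<psi> n t * d t) \<le> \<bar>d t\<bar>" for n
    proof (rule AE_I2)
      fix x
      have "\<bar>\<psi> n x\<bar> \<le> 1" unfolding \<psi>_def
        using R(6)[of "real n * (x - t1)"] R(7)[of "real n * (x - t1)"] R(6)[of "real n * (x - t2)"] R(7)[of "real n * (x - t2)"] by linarith
      then show "norm (\<psi> n x * d x) \<le> \<bar>d x\<bar>" by (simp add: abs_mult mult_left_le_one_le)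
    qed
  qed
  have "\<forall>\<^sub>F n in sequentially. (LINT t|?M. deriv (\<psi> n) t * c t) = - (LINT t|?M. \<psi> n t * d t)"
    using weak[OF test] by (auto simp: eventually_sequentially)
  from tendsto_cong[OF this] lim1
  have "(\<lambda>n. - (LINT t|?M. \<psi> n t * d t)) \<longlonglongrightarrow> c t1 - c t2" by simp
  from LIMSEQ_unique[OF this tendsto_minus[OF lim2]] show ?thesis by simp
qed

text \<open>v is the representative of w that is continuous with values in L2: it can be evaluated
  at every time, whereas w lies in H1 at almost every time. The relation between w and w' is added
  later.\<close>

locale time_dependent =
  fixes D :: "'a::euclidean_space set" and T :: real and w :: "real \<Rightarrow> 'a \<Rightarrow> real"
    and w' :: "real \<Rightarrow> ('a \<Rightarrow> real) \<Rightarrow> real" and v :: "real \<Rightarrow> 'a \<Rightarrow> real"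
  assumes open_D: "open D" and T: "0 < T"
    and w: "w \<in> bochner_L2 T (H1 D) (H1_norm D)"
    and w'_bochner: "w' \<in> bochner_L2 T (H1_dual D) (H1_dual_norm D)"
    and v: "\<And>t. t \<in> {0..T} \<Longrightarrow> v t \<in> L2 (lebesgue_on D)"
    and v_continuous: "\<And>t. t \<in> {0..T} \<Longrightarrow>
       ((\<lambda>s. L2_norm (lebesgue_on D) (\<lambda>x. v s x - v t x)) \<longlongrightarrow> 0) (at t within {0..T})"
    and v_eq: "AE t in lebesgue_on {0<..<T}. AE x in lebesgue_on D. w t x = v t x"
begin

sublocale h: seminormed_functions "H1 D" "H1_norm D" by (rule seminormed_functions_H1[OF open_D])
sublocale d: seminormed_functions "H1_dual D" "H1_dual_norm D" by (rule seminormed_functions_H1_dual[OF open_D])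
sublocale l: seminormed_functions "L2 (lebesgue_on D)" "L2_norm (lebesgue_on D)" by (rule seminormed_functions_L2)

lemma inner_continuous:
  assumes "\<phi> \<in> L2 (lebesgue_on D)"
  shows "continuous_on {0..T} (\<lambda>t. LINT x|lebesgue_on D. v t x * \<phi> x)"
  unfolding continuous_on_def
proof
  fix t assume t: "t \<in> {0..T}"
  have "((\<lambda>s. (LINT x|lebesgue_on D. v s x * \<phi> x) - (LINT x|lebesgue_on D. v t x * \<phi> x)) \<longlongrightarrow> 0) (at t within {0..T})"
  proof (rule Lim_null_comparison)
    show "((\<lambda>s. L2_norm (lebesgue_on D) (\<lambda>x. v s x - v t x) * L2_norm (lebesgue_on D) \<phi>) \<longlongrightarrow> 0) (at t within {0..T})"
      using tendsto_mult_right[OF v_continuous[OF t], of "L2_norm (lebesgue_on D) \<phi>"] by simp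
    show "\<forall>\<^sub>F s in at t within {0..T}. norm ((LINT x|lebesgue_on D. v s x * \<phi> x) - (LINT x|lebesgue_on D. v t x * \<phi> x))
       \<le> L2_norm (lebesgue_on D) (\<lambda>x. v s x - v t x) * L2_norm (lebesgue_on D) \<phi>"
      unfolding eventually_at_filter
    proof (rule always_eventually, intro allI impI)
      fix s assume "s \<noteq> t" "s \<in> {0..T}"
      note i = L2_inner_integrable[OF v[OF this(2)] assms] L2_inner_integrable[OF v[OF t] assms]
      have "(LINT x|lebesgue_on D. v s x * \<phi> x) - (LINT x|lebesgue_on D. v t x * \<phi> x) = (LINT x|lebesgue_on D. (v s x - v t x) \<bullet> \<phi> x)"
        using i by (simp add: left_diff_distrib)
      then show "norm ((LINT x|lebesgue_on D. v s x * \<phi> x) - (LINT x|lebesgue_on D. v t x * \<phi> x))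
       \<le> L2_norm (lebesgue_on D) (\<lambda>x. v s x - v t x) * L2_norm (lebesgue_on D) \<phi>"
        using L2_inner_bound[OF l.diff_closed[OF v[OF \<open>s \<in> {0..T}\<close>] v[OF t]] assms] by simp
    qed
  qed
  then show "((\<lambda>t. LINT x|lebesgue_on D. v t x * \<phi> x) \<longlongrightarrow> (LINT x|lebesgue_on D. v t x * \<phi> x)) (at t within {0..T})"
    by (rule LIM_zero_cancel)
qed

lemma energy_continuous: "continuous_on {0..T} (\<lambda>t. (L2_norm (lebesgue_on D) (v t))\<^sup>2)"
proof (rule continuous_on_power)
  show "continuous_on {0..T} (\<lambda>t. L2_norm (lebesgue_on D) (v t))"
    unfolding continuous_on_def
  proof
    fix t assume t: "t \<in> {0..T}"
    have "((\<lambda>s. L2_norm (lebesgue_on D) (v s) - L2_norm (lebesgue_on D) (v t)) \<longlongrightarrow> 0) (at t within {0..T})"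
      by (rule Lim_null_comparison[OF _ v_continuous[OF t]])
        (auto simp: eventually_at_filter intro!: always_eventually l.abs_diff_le v t)
    then show "((\<lambda>t. L2_norm (lebesgue_on D) (v t)) \<longlongrightarrow> L2_norm (lebesgue_on D) (v t)) (at t within {0..T})"
      by (rule LIM_zero_cancel)
  qed
qed

text \<open>For fixed \<phi> this concerns the scalar function of time given by the inner product of
  \<open>v t\<close> with \<phi>, which is continuous. Replacing w by v in the distributional
  identity changes the integrand on a null set of times.\<close>

lemma weak_time_derivative_increment:
  assumes w': "has_weak_time_derivative D T w w'" and \<phi>: "\<phi> \<in> H1 D" and t: "0 < t1" "t1 < t2" "t2 < T"
  shows "(LINT x|lebesgue_on D. v t2 x * \<phi> x) - (LINT x|lebesgue_on D. v t1 x * \<phi> x)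
    = (LINT t|lebesgue_on {0<..<T}. indicator {t1<..t2} t * w' t \<phi>)"
proof (rule weak_derivative_increment[OF _ _ _ t])
  let ?M = "lebesgue_on {0<..<T}"
  note \<phi>L = H1_D(1)[OF open_D \<phi>]
  show c: "continuous_on {0..T} (\<lambda>t. LINT x|lebesgue_on D. v t x * \<phi> x)" by (rule inner_continuous[OF \<phi>L])
  show "integrable ?M (\<lambda>t. w' t \<phi>)" by (rule pairing_integrable[OF open_D w'_bochner h.bochner_const[OF \<phi>]])
  fix \<psi> assume \<psi>: "\<psi> \<in> test_functions {0<..<T}"
  have "AE t in ?M. t \<in> {0<..<T}" by (rule AE_I2) simp
  with v_eq h.bochner_D(1)[OF w]
  have eq: "AE t in ?M. (LINT x|lebesgue_on D. v t x * \<phi> x) = (LINT x|lebesgue_on D. w t x * \<phi> x)"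
  proof eventually_elim
    case (elim t)
    have "v t \<in> borel_measurable (lebesgue_on D)" "w t \<in> borel_measurable (lebesgue_on D)" "\<phi> \<in> borel_measurable (lebesgue_on D)"
      using v[of t] elim H1_D(1)[OF open_D elim(2)] \<phi>L by (auto simp: L2_def)
    then show ?case using elim(1) by (intro integral_cong_AE) auto
  qed
  have m: "(\<lambda>t. LINT x|lebesgue_on D. v t x * \<phi> x) \<in> borel_measurable ?M"
    using continuous_integrable_interval(1)[OF c] by simp
  have m2: "(\<lambda>t. LINT x|lebesgue_on D. w t x * \<phi> x) \<in> borel_measurable ?M"
    by (rule measurable_lebesgue_on_AE_eq[OF _ m eq]) simp
  have "deriv \<psi> = (\<lambda>t. frechet_derivative \<psi> (at t) 1)"
  proof
    fix t
    have "smooth \<psi>" using \<psi> by (simp add: test_functions_def)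
    from smooth_directional_derivative[OF this, of 0 1 t] show "deriv \<psi> t = frechet_derivative \<psi> (at t) 1"
      by (simp add: DERIV_imp_deriv)
  qed
  then have md: "deriv \<psi> \<in> borel_measurable ?M"
    using \<psi> by (simp add: test_functions_def continuous_borel_lebesgue(3) smooth_continuous smooth_frechet_derivative)
  have "(LINT t|?M. deriv \<psi> t * (LINT x|lebesgue_on D. v t x * \<phi> x)) = (LINT t|?M. deriv \<psi> t * (LINT x|lebesgue_on D. w t x * \<phi> x))"
    using md m m2 eq by (intro integral_cong_AE borel_measurable_times) auto
  then show "(LINT t|?M. deriv \<psi> t * (LINT x|lebesgue_on D. v t x * \<phi> x)) = - (LINT t|?M. \<psi> t * w' t \<phi>)"
    using w' \<psi> \<phi> by (auto simp: has_weak_time_derivative_def)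
qed

end

section \<open>From averaged increments to the energy inequality\<close>

lemma continuous_indefinite_lebesgue_integral:
  fixes q :: "real \<Rightarrow> real"
  assumes "integrable (lebesgue_on {0<..<T}) q"
  shows "continuous_on S (\<lambda>\<tau>. LINT t|lebesgue_on {0<..<T}. indicator {0<..\<tau>} t * q t)"
  unfolding continuous_on_sequentially
proof (intro allI ballI impI)
  let ?M = "lebesgue_on {0<..<T}"
  fix x :: "nat \<Rightarrow> real" and \<tau> assume x: "(\<forall>n. x n \<in> S) \<and> x \<longlonglongrightarrow> \<tau>"
  have mi: "(\<lambda>t. indicator {0<..\<tau>} t :: real) \<in> borel_measurable ?M" for \<tau>
    by (intro measurable_restrict_space1 borel_measurable_indicator) auto
  note mq = borel_measurable_integrable[OF assms]
  have "(\<lambda>n. LINT t|?M. indicator {0<..x n} t * q t) \<longlonglongrightarrow> (LINT t|?M. indicator {0<..\<tau>} t * q t)"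
  proof (rule integral_dominated_convergence[where w="\<lambda>t. \<bar>q t\<bar>"])
    show "(\<lambda>t. indicator {0<..\<tau>} t * q t) \<in> borel_measurable ?M" for \<tau>
      by (intro borel_measurable_times mi mq)
    then show "(\<lambda>t. indicator {0<..x n} t * q t) \<in> borel_measurable ?M" for n .
    show "integrable ?M (\<lambda>t. \<bar>q t\<bar>)" using assms by simp
    have "AE t in lebesgue. t \<noteq> \<tau>" using AE_lborel_singleton[of \<tau>] by (rule AE_completion)
    then have "AE t in ?M. t \<noteq> \<tau>" by (simp add: AE_lebesgue_on_iff eventually_mono)
    then show "AE t in ?M. (\<lambda>n. indicator {0<..x n} t * q t) \<longlonglongrightarrow> indicator {0<..\<tau>} t * q t"
    proof eventually_elim
      case (elim t)
      have "\<forall>\<^sub>F n in sequentially. indicator {0<..\<tau>} t * q t = indicator {0<..x n} t * q t"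
      proof (cases "t < \<tau>")
        case True
        then have "\<forall>\<^sub>F n in sequentially. t < x n" using x by (auto intro: order_tendstoD)
        then show ?thesis by eventually_elim (use True in \<open>auto simp: indicator_def\<close>)
      next
        case False
        then have "\<forall>\<^sub>F n in sequentially. x n < t" using x elim by (auto intro: order_tendstoD)
        then show ?thesis by eventually_elim (use False elim in \<open>auto simp: indicator_def\<close>)
      qed
      then show ?case by (rule Lim_transform_eventually[OF tendsto_const])
    qed
    show "AE t in ?M. norm (indicator {0<..x n} t * q t) \<le> \<bar>q t\<bar>" for n
      by (intro AE_I2) (simp add: indicator_def)
  qed
  then show "((\<lambda>\<tau>. LINT t|?M. indicator {0<..\<tau>} t * q t) \<circ> x) \<longlonglongrightarrow> (LINT t|?M. indicator {0<..\<tau>} t * q t)"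
    by (simp add: comp_def)
qed

lemma integral_indicator_split:
  fixes q :: "real \<Rightarrow> real"
  assumes "integrable (lebesgue_on {0<..<T}) q" "0 \<le> a" "a \<le> b"
  shows "(LINT t|lebesgue_on {0<..<T}. indicator {0<..b} t * q t) - (LINT t|lebesgue_on {0<..<T}. indicator {0<..a} t * q t)
     = (LINT t|lebesgue_on {0<..<T}. indicator {a<..b} t * q t)"
    and "integrable (lebesgue_on {0<..<T}) (\<lambda>t. indicator {a<..b} t * q t)"
proof -
  let ?M = "lebesgue_on {0<..<T}"
  have i: "integrable ?M (\<lambda>t. indicator {c<..e} t * q t)" for c e
  proof (rule Bochner_Integration.integrable_bound[OF assms(1)])
    show "(\<lambda>t. indicator {c<..e} t * q t) \<in> borel_measurable ?M"
      by (intro borel_measurable_times borel_measurable_integrable[OF assms(1)] measurable_restrict_space1 borel_measurable_indicator) auto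
  qed (auto simp: indicator_def)
  then show "integrable ?M (\<lambda>t. indicator {a<..b} t * q t)" .
  have "(\<lambda>t. indicator {a<..b} t * q t) = (\<lambda>t. indicator {0<..b} t * q t - indicator {0<..a} t * q t)"
    using assms by (auto simp: indicator_def fun_eq_iff)
  then show "(LINT t|?M. indicator {0<..b} t * q t) - (LINT t|?M. indicator {0<..a} t * q t) = (LINT t|?M. indicator {a<..b} t * q t)"
    using i[of 0 b] i[of 0 a] by simp
qed

text \<open>Integrating \<open>K t - K (t - h)\<close> over t between h and \<tau> telescopes to the
  integral of K over the last h minus that over the first h, which is close to
  \<open>h * (K \<tau> - K 0)\<close>. One e in the bound comes from the averaged increments, two
  from the continuity of K at the end points. Passing to \<open>ennreal\<close> drops negative
  increments, which is harmless for an upper bound.\<close>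

lemma increment_average_bound:
  fixes K :: "real \<Rightarrow> real"
  assumes K: "continuous_on {0..T} K" and \<tau>: "0 < \<tau>" "\<tau> \<le> T" and "0 < e"
    and small: "\<And>h. 0 < h \<Longrightarrow> h < h0 \<Longrightarrow> \<exists>\<Theta>. (AE t in lebesgue_on {0<..<T}. h < t \<longrightarrow> ennreal (K t - K (t - h)) \<le> \<Theta> t) \<and>
        (\<integral>\<^sup>+ t. \<Theta> t \<partial>lebesgue_on {0<..<T}) \<le> ennreal (e * h)" and "0 < h0"
  shows "K \<tau> - K 0 \<le> 3 * e"
proof -
  have near: "\<exists>d>0. \<forall>t\<in>{0..T}. dist t s < d \<longrightarrow> dist (K t) (K s) < e" if "s \<in> {0..T}" for s
    using K that \<open>0 < e\<close> unfolding continuous_on_iff by blast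
  obtain d1 where d1: "0 < d1" "\<forall>t\<in>{0..T}. dist t \<tau> < d1 \<longrightarrow> dist (K t) (K \<tau>) < e"
    using near[of \<tau>] \<tau> by auto
  obtain d2 where d2: "0 < d2" "\<forall>t\<in>{0..T}. dist t 0 < d2 \<longrightarrow> dist (K t) (K 0) < e"
    using near[of 0] \<tau> by auto
  define h where "h = min (min d1 d2) (min h0 \<tau>) / 2"
  have h: "0 < h" "h < d1" "h < d2" "h < h0" "h < \<tau>" using d1(1) d2(1) \<tau> \<open>0 < h0\<close> by (auto simp: h_def)
  obtain \<Theta> where \<Theta>: "AE t in lebesgue_on {0<..<T}. h < t \<longrightarrow> ennreal (K t - K (t - h)) \<le> \<Theta> t"
     "(\<integral>\<^sup>+ t. \<Theta> t \<partial>lebesgue_on {0<..<T}) \<le> ennreal (e * h)" using small[OF h(1,4)] by blast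
  define f where "f t = K t - K (t - h)" for t
  have cK: "continuous_on {a..b} K" if "0 \<le> a" "b \<le> T" for a b
    using continuous_on_subset[OF K] that by auto
  have csh: "continuous_on {h..\<tau>} (\<lambda>t. K (t - h))"
    using \<tau> h by (intro continuous_on_compose2[OF K]) (auto intro!: continuous_intros)
  have cf: "continuous_on {h..\<tau>} f" unfolding f_def using \<tau> h by (intro continuous_on_diff cK csh) auto
  have ifh: "set_integrable lebesgue {h<..<\<tau>} f"
    using absolutely_integrable_continuous_real[OF cf] by (rule set_integrable_subset) auto
  have "integral {h..\<tau>} f \<le> e * h"
  proof -
    let ?g = "\<lambda>t. indicator {h<..<\<tau>} t *\<^sub>R f t"
    have ig: "integrable lebesgue ?g" using ifh by (simp add: set_integrable_def)
    then have ig': "integrable lebesgue (\<lambda>t. max 0 (?g t))" by simp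
    have "integral {h..\<tau>} f = (LINT t|lebesgue. ?g t)"
      using set_lebesgue_integral_eq_integral(2)[OF ifh] by (simp add: set_lebesgue_integral_def integral_open_interval_real)
    also have "\<dots> \<le> (LINT t|lebesgue. max 0 (?g t))" using ig ig' by (intro integral_mono) auto
    finally have 1: "integral {h..\<tau>} f \<le> (LINT t|lebesgue. max 0 (?g t))" .
    have "ennreal (LINT t|lebesgue. max 0 (?g t)) = (\<integral>\<^sup>+ t. ennreal (max 0 (?g t)) \<partial>lebesgue)"
      using ig' by (intro nn_integral_eq_integral[symmetric]) auto
    also have "\<dots> \<le> (\<integral>\<^sup>+ t. \<Theta> t * indicator {0<..<T} t \<partial>lebesgue)"
    proof (rule nn_integral_mono_AE)
      have "AE t in lebesgue. t \<in> {0<..<T} \<longrightarrow> h < t \<longrightarrow> ennreal (K t - K (t - h)) \<le> \<Theta> t"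
        using \<Theta>(1) by (simp add: AE_lebesgue_on_iff)
      then show "AE t in lebesgue. ennreal (max 0 (?g t)) \<le> \<Theta> t * indicator {0<..<T} t"
      proof eventually_elim
        case (elim t)
        show ?case
        proof (cases "h < t \<and> t < \<tau>")
          case True
          then have "t \<in> {0<..<T}" using \<tau> h by auto
          then have "ennreal (K t - K (t - h)) \<le> \<Theta> t" using elim True by blast
          then show ?thesis using True \<open>t \<in> {0<..<T}\<close> by (simp add: f_def max_def ennreal_neg)
        qed auto
      qed
    qed
    also have "\<dots> = (\<integral>\<^sup>+ t. \<Theta> t \<partial>lebesgue_on {0<..<T})"
      by (subst nn_integral_restrict_space) auto
    also have "\<dots> \<le> ennreal (e * h)" by (rule \<Theta>(2))
    finally have "(LINT t|lebesgue. max 0 (?g t)) \<le> e * h"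
      using \<open>0 < e\<close> h(1) by simp
    then show ?thesis using 1 by linarith
  qed
  moreover have "integral {h..\<tau>} f = integral {\<tau>-h..\<tau>} K - integral {0..h} K"
  proof -
    have int: "K integrable_on {a..b}" if "0 \<le> a" "b \<le> T" for a b
      by (rule integrable_continuous_real[OF cK[OF that]])
    have "integral {h..\<tau>} f = integral {h..\<tau>} K - integral {h..\<tau>} (\<lambda>t. K (t - h))"
      unfolding f_def using \<tau> h by (intro Henstock_Kurzweil_Integration.integral_diff int integrable_continuous_real csh) auto
    also have "integral {h..\<tau>} (\<lambda>t. K (t - h)) = integral {0..\<tau>-h} K"
    proof -
      have "continuous_on {h + -h..\<tau> + -h} K" using \<tau> h by (intro cK) auto
      from integral_shift[OF this] show ?thesis by (simp add: comp_def)
    qed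
    also have "integral {h..\<tau>} K = integral {0..\<tau>} K - integral {0..h} K"
      using Henstock_Kurzweil_Integration.integral_combine[of 0 h \<tau> K] int[of 0 \<tau>] \<tau> h by auto
    also have "integral {0..\<tau>-h} K = integral {0..\<tau>} K - integral {\<tau>-h..\<tau>} K"
      using Henstock_Kurzweil_Integration.integral_combine[of 0 "\<tau>-h" \<tau> K] int[of 0 \<tau>] \<tau> h by auto
    finally show ?thesis by simp
  qed
  moreover have "h * (K \<tau> - e) \<le> integral {\<tau>-h..\<tau>} K"
  proof -
    have "integral {\<tau>-h..\<tau>} (\<lambda>t. K \<tau> - e) \<le> integral {\<tau>-h..\<tau>} K"
    proof (rule integral_le)
      show "K integrable_on {\<tau>-h..\<tau>}" using \<tau> h by (intro integrable_continuous_real cK) auto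
      fix t assume "t \<in> {\<tau>-h..\<tau>}"
      then show "K \<tau> - e \<le> K t" using d1(2)[rule_format, of t] \<tau> h by (auto simp: dist_real_def)
    qed auto
    then show ?thesis using h by simp
  qed
  moreover have "integral {0..h} K \<le> h * (K 0 + e)"
  proof -
    have "integral {0..h} K \<le> integral {0..h} (\<lambda>t. K 0 + e)"
    proof (rule integral_le)
      show "K integrable_on {0..h}" using \<tau> h by (intro integrable_continuous_real cK) auto
      fix t assume "t \<in> {0..h}"
      then show "K t \<le> K 0 + e" using d2(2)[rule_format, of t] \<tau> h by (auto simp: dist_real_def)
    qed auto
    then show ?thesis using h by simp
  qed
  ultimately have "h * (K \<tau> - e) - h * (K 0 + e) \<le> h * e" by (simp add: mult.commute)
  then have "h * (K \<tau> - K 0 - 2 * e) \<le> h * e" by (simp add: algebra_simps)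
  then show ?thesis using h(1) by simp
qed

text \<open>The time derivative enters as increments against a fixed test function. This form is
  linear in v and w', so it passes to differences in \<open>energy_space_diff\<close>, and it can be
  tested with the value of w at one time.\<close>

locale energy_space = time_dependent +
  assumes increment: "\<phi> \<in> H1 D \<Longrightarrow> 0 < t1 \<Longrightarrow> t1 < t2 \<Longrightarrow> t2 < T \<Longrightarrow>
    (LINT x|lebesgue_on D. v t2 x * \<phi> x) - (LINT x|lebesgue_on D. v t1 x * \<phi> x)
    = (LINT t|lebesgue_on {0<..<T}. indicator {t1<..t2} t * w' t \<phi>)"
begin

text \<open>For almost every t the value \<open>w t\<close> is a fixed element of H1 and may be
  inserted into the increment identity. Compared with the wanted integrand \<open>w' s (w s)\<close>
  this leaves the error of \<open>w' s\<close> applied to \<open>w t - w s\<close>, for s in the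
  last h before t. Young's inequality splits it into a dual norm with small weight and a squared
  translation with large weight. K is the energy minus the claimed integral, and its averaged
  increments turn out to be at most e h for every positive e.\<close>

lemma energy_inequality:
  assumes \<tau>: "\<tau> \<in> {0..T}"
  shows "(L2_norm (lebesgue_on D) (v \<tau>))\<^sup>2 \<le> (L2_norm (lebesgue_on D) (v 0))\<^sup>2
    + 2 * (LINT t|lebesgue_on {0<..<T}. indicator {0<..\<tau>} t * w' t (w t))"
proof -
  let ?M = "lebesgue_on {0<..<T}" and ?D = "lebesgue_on D"
  define q where "q t = w' t (w t)" for t
  have iq: "integrable ?M q" unfolding q_def by (rule pairing_integrable[OF open_D w'_bochner w])
  define Q where "Q \<tau> = (LINT t|?M. indicator {0<..\<tau>} t * q t)" for \<tau>
  define E where "E t = (L2_norm ?D (v t))\<^sup>2" for t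
  define K where "K t = E t - 2 * Q t" for t
  have cK: "continuous_on {0..T} K"
    unfolding K_def E_def Q_def
    by (intro continuous_on_diff energy_continuous continuous_on_mult continuous_on_const continuous_indefinite_lebesgue_integral iq)
  have Q0: "Q 0 = 0" by (simp add: Q_def)
  define A2 where "A2 = (LINT t|?M. (H1_dual_norm D (w' t))\<^sup>2)"
  have A2: "0 \<le> A2" by (simp add: A2_def)
  note iA = d.bochner_D(2)[OF w'_bochner]
  have T': "AE t in ?M. t \<in> {0<..<T}" by (rule AE_I2) simp
  let ?d = "\<lambda>h p. indicator {p. \<bar>snd p - fst p\<bar> < h} p :: ennreal"
  have incr: "K \<tau> - K 0 \<le> 3 * e" if e: "0 < e" and \<tau>: "0 < \<tau>" "\<tau> \<le> T" for e \<tau>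
  proof -
    \<comment> \<open>With this weight the dual norms contribute at most e h / 2. The modulus
      \<open>e * \<delta> / 2\<close> requested from \<open>translation_continuity\<close>
      compensates the weight \<open>1 / \<delta>\<close> and contributes the other half.\<close>
    define \<delta> where "\<delta> = e / (4 * (A2 + 1))"
    have \<delta>: "0 < \<delta>" "2 * \<delta> * A2 \<le> e / 2" using e A2 by (auto simp: \<delta>_def field_simps)
    obtain h0 where h0: "0 < h0" "\<And>h. 0 < h \<Longrightarrow> h < h0 \<Longrightarrow>
      \<exists>\<Psi>\<in>borel_measurable ?M.
      (AE t in ?M. (\<integral>\<^sup>+ s. ennreal ((H1_norm D (\<lambda>x. w t x - w s x))\<^sup>2) * ?d h (t, s) \<partial>?M) \<le> \<Psi> t) \<and>
      (\<integral>\<^sup>+ t. \<Psi> t \<partial>?M) \<le> ennreal (e * \<delta> / 2 * h)"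
      by (rule h.translation_continuity[OF w, of "e * \<delta> / 2"]) (use e \<delta> in auto)
    show ?thesis
    proof (rule increment_average_bound[OF cK \<tau> e _ h0(1)])
      fix h assume h: "0 < h" "h < h0"
      obtain \<Psi> where \<Psi>: "\<Psi> \<in> borel_measurable ?M"
        "AE t in ?M. (\<integral>\<^sup>+ s. ennreal ((H1_norm D (\<lambda>x. w t x - w s x))\<^sup>2) * ?d h (t, s) \<partial>?M) \<le> \<Psi> t"
        "(\<integral>\<^sup>+ t. \<Psi> t \<partial>?M) \<le> ennreal (e * \<delta> / 2 * h)" using h0(2)[OF h] by blast
      define a where "a s = ennreal (\<delta> * (H1_dual_norm D (w' s))\<^sup>2)" for s
      have ma: "a \<in> borel_measurable ?M" unfolding a_def using iA by measurable
      define \<Theta> where "\<Theta> t = (\<integral>\<^sup>+ s. a s * ?d h (t, s) \<partial>?M) + ennreal (1 / \<delta>) * \<Psi> t" for t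
      have ms: "(\<lambda>p. a (snd p) * ?d h p) \<in> borel_measurable (?M \<Otimes>\<^sub>M ?M)"
        by (intro borel_measurable_times_ennreal measurable_compose[OF measurable_snd ma] diagonal_strip_measurable)
      interpret finite_measure ?M by (rule finite_measure_interval)
      have mst: "(\<lambda>s. a s * ?d h (t, s)) \<in> borel_measurable ?M" if "t \<in> space ?M" for t
        using measurable_compose[OF measurable_Pair1'[OF that] ms] by (simp only: snd_conv)
      show "\<exists>\<Theta>. (AE t in ?M. h < t \<longrightarrow> ennreal (K t - K (t - h)) \<le> \<Theta> t) \<and> (\<integral>\<^sup>+ t. \<Theta> t \<partial>?M) \<le> ennreal (e * h)"
      proof (intro exI conjI)
        have "(\<integral>\<^sup>+ t. \<Theta> t \<partial>?M) = (\<integral>\<^sup>+ t. (\<integral>\<^sup>+ s. a s * ?d h (t, s) \<partial>?M) \<partial>?M) + ennreal (1 / \<delta>) * (\<integral>\<^sup>+ t. \<Psi> t \<partial>?M)"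
          unfolding \<Theta>_def
        proof (subst nn_integral_add)
          show "(\<lambda>t. \<integral>\<^sup>+ s. a s * ?d h (t, s) \<partial>?M) \<in> borel_measurable ?M"
            using borel_measurable_nn_integral_fst[OF ms] by (simp only: snd_conv)
          show "(\<lambda>t. ennreal (1 / \<delta>) * \<Psi> t) \<in> borel_measurable ?M"
            by (intro borel_measurable_times_ennreal borel_measurable_const \<Psi>(1))
        qed (simp add: \<Psi>(1) nn_integral_cmult)
        also have "\<dots> \<le> ennreal (2 * h) * ennreal (\<delta> * A2) + ennreal (1 / \<delta>) * ennreal (e * \<delta> / 2 * h)"
        proof (intro add_mono mult_left_mono \<Psi>(3))
          have "(\<integral>\<^sup>+ t. a t \<partial>?M) = ennreal (\<delta> * A2)"
            unfolding a_def A2_def using iA \<delta>(1) by (subst nn_integral_eq_integral) auto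
          then show "(\<integral>\<^sup>+ t. (\<integral>\<^sup>+ s. a s * ?d h (t, s) \<partial>?M) \<partial>?M) \<le> ennreal (2 * h) * ennreal (\<delta> * A2)"
            using diagonal_strip_Fubini(2)[OF _ ma, of h] h by simp
        qed simp
        also have "\<dots> = ennreal (2 * h * (\<delta> * A2) + 1 / \<delta> * (e * \<delta> / 2 * h))"
          using h e \<delta>(1) A2 by (simp add: ennreal_mult[symmetric] ennreal_plus[symmetric] del: ennreal_plus)
        also have "\<dots> \<le> ennreal (e * h)"
        proof (rule ennreal_leI)
          have "2 * h * (\<delta> * A2) = h * (2 * \<delta> * A2)" by simp
          also have "\<dots> \<le> h * (e / 2)" using h \<delta>(2) by (intro mult_left_mono) auto
          finally show "2 * h * (\<delta> * A2) + 1 / \<delta> * (e * \<delta> / 2 * h) \<le> e * h" using \<delta>(1) by (simp add: mult.commute)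
        qed
        finally show "(\<integral>\<^sup>+ t. \<Theta> t \<partial>?M) \<le> ennreal (e * h)" .
        show "AE t in ?M. h < t \<longrightarrow> ennreal (K t - K (t - h)) \<le> \<Theta> t"
          using T' h.bochner_D(1)[OF w] v_eq \<Psi>(2)
        proof eventually_elim
          case t: (elim t)
          show ?case
          proof
            assume ht: "h < t"
            have vt: "v t \<in> L2 ?D" "v (t - h) \<in> L2 ?D" using v t(1) ht h by auto
            note wL = H1_D(1)[OF open_D t(2)]
            \<comment> \<open>The second factor \<open>v t\<close> is exchanged for
              \<open>w t\<close>, which is equal to it almost everywhere and is an admissible test
              function.\<close>
            have sw: "(LINT x|?D. v s x * v t x) = (LINT x|?D. v s x * w t x)" if "v s \<in> L2 ?D" for s
              using t(3) L2_D(1)[OF that] L2_D(1)[OF vt(1)] L2_D(1)[OF wL] by (intro integral_cong_AE) auto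
            note i = L2_inner_integrable[OF vt(1,1)] L2_inner_integrable[OF vt(2,2)] L2_inner_integrable[OF vt(2,1)]
            have "0 \<le> (LINT x|?D. (v t x - v (t - h) x)\<^sup>2)" by simp
            also have "\<dots> = (LINT x|?D. v t x * v t x - 2 * (v (t - h) x * v t x) + v (t - h) x * v (t - h) x)"
              by (intro Bochner_Integration.integral_cong) (auto simp: power2_eq_square algebra_simps)
            also have "\<dots> = (LINT x|?D. v t x * v t x) - 2 * (LINT x|?D. v (t - h) x * v t x) + (LINT x|?D. v (t - h) x * v (t - h) x)"
              using i by simp
            finally have "0 \<le> (LINT x|?D. v t x * v t x) - 2 * (LINT x|?D. v (t - h) x * v t x) + (LINT x|?D. v (t - h) x * v (t - h) x)" .
            moreover have "E s = (LINT x|?D. v s x * v s x)" for s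
              unfolding E_def L2_norm_sq by (simp add: power2_eq_square)
            ultimately have "E t - E (t - h) \<le> 2 * ((LINT x|?D. v t x * v t x) - (LINT x|?D. v (t - h) x * v t x))" by simp
            also have "\<dots> = 2 * (LINT s|?M. indicator {t - h<..t} s * w' s (w t))"
              unfolding sw[OF vt(1)] sw[OF vt(2)] using increment[OF t(2), of "t - h" t] t(1) ht h by simp
            finally have E: "E t - E (t - h) \<le> 2 * (LINT s|?M. indicator {t - h<..t} s * w' s (w t))" .
            have iw: "integrable ?M (\<lambda>s. indicator {t - h<..t} s * w' s (w t))"
              using ht h by (intro integral_indicator_split(2) pairing_integrable[OF open_D w'_bochner h.bochner_const[OF t(2)]]) auto
            have iqh: "integrable ?M (\<lambda>s. indicator {t - h<..t} s * q s)"
              using ht h by (intro integral_indicator_split(2) iq) auto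
            define F where "F s = 2 * (indicator {t - h<..t} s * w' s (w t) - indicator {t - h<..t} s * q s)" for s
            have iF: "integrable ?M F" unfolding F_def using iw iqh by simp
            have "Q t - Q (t - h) = (LINT s|?M. indicator {t - h<..t} s * q s)"
              unfolding Q_def using ht h by (intro integral_indicator_split(1) iq) auto
            then have "K t - K (t - h) \<le> (LINT s|?M. F s)"
              using E iw iqh by (simp add: K_def F_def)
            also have "\<dots> \<le> (LINT s|?M. \<bar>F s\<bar>)" using iF by (intro integral_mono) auto
            finally have "ennreal (K t - K (t - h)) \<le> ennreal (LINT s|?M. \<bar>F s\<bar>)" by (rule ennreal_leI)
            also have "\<dots> = (\<integral>\<^sup>+ s. ennreal \<bar>F s\<bar> \<partial>?M)" using iF by (intro nn_integral_eq_integral[symmetric]) auto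
            also have "\<dots> \<le> (\<integral>\<^sup>+ s. a s * ?d h (t, s) + ennreal (1 / \<delta>) * (ennreal ((H1_norm D (\<lambda>x. w t x - w s x))\<^sup>2) * ?d h (t, s)) \<partial>?M)"
            proof (rule nn_integral_mono_AE)
              show "AE s in ?M. ennreal \<bar>F s\<bar> \<le> a s * ?d h (t, s) + ennreal (1 / \<delta>) * (ennreal ((H1_norm D (\<lambda>x. w t x - w s x))\<^sup>2) * ?d h (t, s))"
                using T' h.bochner_D(1)[OF w] d.bochner_D(1)[OF w'_bochner]
              proof eventually_elim
                case s: (elim s)
                show ?case
                proof (cases "s \<in> {t - h<..t}")
                  case True
                  let ?A = "H1_dual_norm D (w' s)" and ?n = "H1_norm D (\<lambda>x. w t x - w s x)"
                  have "w' s (w t) - q s = w' s (\<lambda>x. w t x - w s x)"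
                    using H1_dual_diff[OF open_D s(3) t(2) s(2)] by (simp add: q_def)
                  then have "\<bar>F s\<bar> = 2 * \<bar>w' s (\<lambda>x. w t x - w s x)\<bar>" using True by (simp add: F_def abs_mult)
                  also have "\<dots> \<le> 2 * (?A * ?n)"
                    using H1_dual_norm_bounds(1)[OF open_D s(3) h.diff_closed[OF t(2) s(2)]] by simp
                  also have "\<dots> \<le> \<delta> * ?A\<^sup>2 + 1 / \<delta> * ?n\<^sup>2"
                  proof -
                    have "0 \<le> (\<delta> * ?A - ?n)\<^sup>2 / \<delta>" using \<delta>(1) by simp
                    also have "\<dots> = \<delta> * ?A\<^sup>2 + 1 / \<delta> * ?n\<^sup>2 - 2 * (?A * ?n)"
                      using \<delta>(1) by (simp add: power2_eq_square field_simps)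
                    finally show ?thesis by simp
                  qed
                  finally have "ennreal \<bar>F s\<bar> \<le> ennreal (\<delta> * ?A\<^sup>2 + 1 / \<delta> * ?n\<^sup>2)" by (rule ennreal_leI)
                  also have "\<dots> = a s + ennreal (1 / \<delta>) * ennreal (?n\<^sup>2)"
                    using \<delta>(1) by (simp add: a_def ennreal_plus ennreal_mult[symmetric])
                  finally show ?thesis using True h by (cases "s = t - h") (auto simp: indicator_def)
                qed (simp add: F_def)
              qed
            qed
            also have "\<dots> \<le> (\<integral>\<^sup>+ s. a s * ?d h (t, s) \<partial>?M) + ennreal (1 / \<delta>) * (\<integral>\<^sup>+ s. ennreal ((H1_norm D (\<lambda>x. w t x - w s x))\<^sup>2) * ?d h (t, s) \<partial>?M)"
            proof -
              have mn: "(\<lambda>s. H1_norm D (\<lambda>x. w t x - w s x)) \<in> borel_measurable ?M"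
                by (rule h.bochner_norm_measurable[OF h.bochner_diff[OF h.bochner_const[OF t(2)] w]])
              have "(\<lambda>s. ?d h (t, s)) \<in> borel_measurable ?M"
                using measurable_compose[OF measurable_Pair1'[of t ?M ?M] diagonal_strip_measurable] t(1) by simp
              then have m2: "(\<lambda>s. ennreal ((H1_norm D (\<lambda>x. w t x - w s x))\<^sup>2) * ?d h (t, s)) \<in> borel_measurable ?M"
                using mn by (intro borel_measurable_times_ennreal) (measurable, simp)
              show ?thesis using t(1) m2 mst[of t]
                by (subst nn_integral_add) (auto simp: nn_integral_cmult)
            qed
            also have "\<dots> \<le> \<Theta> t" unfolding \<Theta>_def by (intro add_left_mono mult_left_mono t(4)) simp
            finally show "ennreal (K t - K (t - h)) \<le> \<Theta> t" .
          qed
        qed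
      qed
    qed
  qed
  have "K \<tau> \<le> K 0"
  proof (cases "\<tau> = 0")
    case False
    show ?thesis
    proof (rule field_le_epsilon)
      fix e :: real assume "0 < e"
      then show "K \<tau> \<le> K 0 + e" using incr[of "e / 3" \<tau>] \<tau> False by simp
    qed
  qed simp
  then show ?thesis by (simp add: K_def Q0 E_def Q_def q_def)
qed

end

section \<open>Gronwall's inequality\<close>

lemma continuous_on_interval_bounded_above:
  fixes f :: "real \<Rightarrow> real"
  assumes "continuous_on {a..b} f"
  obtains c where "\<And>t. t \<in> {a..b} \<Longrightarrow> f t \<le> c"
proof -
  have "bounded (f ` {a..b})" using assms by (intro compact_imp_bounded compact_continuous_image) auto
  then obtain c where "\<forall>x\<in>f ` {a..b}. norm x \<le> c" unfolding bounded_iff by blast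
  then have "f t \<le> c" if "t \<in> {a..b}" for t using that by (force simp: abs_le_iff)
  then show ?thesis by (rule that)
qed

text \<open>With \<open>F\<close> the right-hand side and \<open>A\<close> the primitive of \<open>\<alpha>\<close>, \<open>F\<close> at most doubles while \<open>A\<close> grows by \<open>1/2\<close>. This avoids
  differentiating the exponential of \<open>A\<close>.\<close>

lemma gronwall_integrable_coefficient:
  fixes E \<alpha> :: "real \<Rightarrow> real"
  assumes T: "0 < T" and E: "continuous_on {0..T} E" "\<And>t. t \<in> {0..T} \<Longrightarrow> 0 \<le> E t"
    and \<alpha>: "integrable (lebesgue_on {0<..<T}) \<alpha>" "\<And>t. t \<in> {0<..<T} \<Longrightarrow> 0 \<le> \<alpha> t" and "0 \<le> B"
    and ineq: "\<And>\<tau>. \<tau> \<in> {0..T} \<Longrightarrow> E \<tau> \<le> B + (LINT t|lebesgue_on {0<..<T}. indicator {0<..\<tau>} t * (\<alpha> t * E t))"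
  shows "integrable (lebesgue_on {0<..<T}) (\<lambda>t. \<alpha> t * E t)"
    and "\<And>\<tau>. \<tau> \<in> {0..T} \<Longrightarrow> B + (LINT t|lebesgue_on {0<..<T}. indicator {0<..\<tau>} t * (\<alpha> t * E t))
        \<le> exp (2 * (LINT t|lebesgue_on {0<..<T}. \<alpha> t) + 1) * B"
proof -
  let ?M = "lebesgue_on {0<..<T}"
  obtain b where b: "\<And>t. t \<in> {0..T} \<Longrightarrow> E t \<le> b" by (rule continuous_on_interval_bounded_above[OF E(1)]) blast
  have mE: "E \<in> borel_measurable ?M" using continuous_integrable_interval(1)[OF E(1)] by simp
  show i: "integrable ?M (\<lambda>t. \<alpha> t * E t)"
  proof (rule Bochner_Integration.integrable_bound)
    show "integrable ?M (\<lambda>t. \<alpha> t * b)" using \<alpha>(1) by simp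
    show "(\<lambda>t. \<alpha> t * E t) \<in> borel_measurable ?M" using borel_measurable_integrable[OF \<alpha>(1)] mE by measurable
    show "AE t in ?M. norm (\<alpha> t * E t) \<le> norm (\<alpha> t * b)"
    proof (rule AE_I2)
      fix t assume "t \<in> space ?M"
      then have "0 \<le> \<alpha> t" "0 \<le> E t" "E t \<le> b" using \<alpha>(2)[of t] E(2)[of t] b[of t] by auto
      then show "norm (\<alpha> t * E t) \<le> norm (\<alpha> t * b)" by (simp add: abs_mult mult_left_mono)
    qed
  qed
  define F where "F \<tau> = B + (LINT t|?M. indicator {0<..\<tau>} t * (\<alpha> t * E t))" for \<tau>
  define A where "A \<tau> = (LINT t|?M. indicator {0<..\<tau>} t * \<alpha> t)" for \<tau>
  have F0: "F 0 = B" and A0: "A 0 = 0" by (simp_all add: F_def A_def)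
  have dA: "A y - A x = (LINT t|?M. indicator {x<..y} t * \<alpha> t)" and dF: "F y - F x = (LINT t|?M. indicator {x<..y} t * (\<alpha> t * E t))"
    if "0 \<le> x" "x \<le> y" for x y
    using integral_indicator_split(1)[OF \<alpha>(1) that] integral_indicator_split(1)[OF i that] by (simp_all add: F_def A_def)
  have A_mono: "A x \<le> A y" if "0 \<le> x" "x \<le> y" for x y
  proof -
    have "0 \<le> (LINT t|?M. indicator {x<..y} t * \<alpha> t)"
      using \<alpha>(2) by (intro Bochner_Integration.integral_nonneg) (auto simp: indicator_def)
    then show ?thesis using dA[OF that] by simp
  qed
  have F_mono: "F x \<le> F y" if "0 \<le> x" "x \<le> y" for x y
  proof -
    have "0 \<le> (LINT t|?M. indicator {x<..y} t * (\<alpha> t * E t))"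
      using \<alpha>(2) E(2) by (intro Bochner_Integration.integral_nonneg) (auto simp: indicator_def intro!: mult_nonneg_nonneg)
    then show ?thesis using dF[OF that] by simp
  qed
  \<comment> \<open>E is bounded by F and F is monotone, so the integrand is at most
    \<open>F y\<close> times \<alpha>.\<close>
  have step: "F y - F x \<le> F y * (A y - A x)" if xy: "0 \<le> x" "x \<le> y" "y \<le> T" for x y
  proof -
    have "(LINT t|?M. indicator {x<..y} t * (\<alpha> t * E t)) \<le> (LINT t|?M. F y * (indicator {x<..y} t * \<alpha> t))"
    proof (rule integral_mono)
      show "integrable ?M (\<lambda>t. indicator {x<..y} t * (\<alpha> t * E t))" by (rule integral_indicator_split(2)[OF i xy(1,2)])
      show "integrable ?M (\<lambda>t. F y * (indicator {x<..y} t * \<alpha> t))"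
        using integral_indicator_split(2)[OF \<alpha>(1) xy(1,2)] by simp
      fix t assume "t \<in> space ?M"
      then have t: "0 < t" "t < T" by auto
      show "indicator {x<..y} t * (\<alpha> t * E t) \<le> F y * (indicator {x<..y} t * \<alpha> t)"
      proof (cases "t \<in> {x<..y}")
        case True
        have "E t \<le> F t" using ineq[of t] t by (simp add: F_def)
        also have "F t \<le> F y" using F_mono[of t y] t True by simp
        finally show ?thesis using True mult_left_mono[of "E t" "F y" "\<alpha> t"] \<alpha>(2)[of t] t by (simp add: mult.commute)
      qed simp
    qed
    then show ?thesis using dA[OF xy(1,2)] dF[OF xy(1,2)] by simp
  qed
  have cA: "continuous_on S A" for S unfolding A_def by (rule continuous_indefinite_lebesgue_integral[OF \<alpha>(1)])
  have doubling: "F \<tau> \<le> 2 ^ n * B" if "\<tau> \<in> {0..T}" "A \<tau> \<le> real n / 2" for n \<tau>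
    using that
  proof (induction n arbitrary: \<tau>)
    case 0
    then have "A \<tau> = 0" using A_mono[of 0 \<tau>] A0 by simp
    then show ?case using step[of 0 \<tau>] 0 F0 A0 by simp
  next
    case (Suc n)
    show ?case
    proof (cases "A \<tau> \<le> real n / 2")
      case True
      then have "F \<tau> \<le> 2 ^ n * B" using Suc by blast
      also have "\<dots> \<le> 2 ^ Suc n * B" using \<open>0 \<le> B\<close> by simp
      finally show ?thesis .
    next
      case False
      \<comment> \<open>A is continuous, so it takes the value n/2 at some earlier time; from there
        on it grows by at most 1/2.\<close>
      have "\<exists>s. 0 \<le> s \<and> s \<le> \<tau> \<and> A s = real n / 2"
        using A0 False Suc.prems by (intro IVT' cA) auto
      then obtain s where s: "0 \<le> s" "s \<le> \<tau>" "A s = real n / 2" by blast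
      have "F \<tau> - F s \<le> F \<tau> * (A \<tau> - A s)" using step[OF s(1,2)] Suc.prems by simp
      also have "\<dots> \<le> F \<tau> * (1 / 2)"
      proof (rule mult_left_mono)
        show "A \<tau> - A s \<le> 1 / 2" using Suc.prems(2) s(3) by (simp add: field_simps)
        show "0 \<le> F \<tau>" using F_mono[of 0 \<tau>] F0 \<open>0 \<le> B\<close> Suc.prems by simp
      qed
      finally have "F \<tau> \<le> 2 * F s" by simp
      also have "F s \<le> 2 ^ n * B" using Suc.IH[of s] s Suc.prems by simp
      finally show ?thesis by simp
    qed
  qed
  fix \<tau> assume \<tau>: "\<tau> \<in> {0..T}"
  have AT: "A \<tau> \<le> (LINT t|?M. \<alpha> t)"
    unfolding A_def using \<alpha> integral_indicator_split(2)[OF \<alpha>(1), of 0 \<tau>] \<tau>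
    by (intro integral_mono) (auto simp: indicator_def)
  \<comment> \<open>Rounding up costs at most 1, which is the summand 1 in the exponent of the
    bound; the base 2 is then replaced by exp 1.\<close>
  define n where "n = nat \<lceil>2 * A \<tau>\<rceil>"
  have An: "0 \<le> A \<tau>" using A_mono[of 0 \<tau>] A0 \<tau> by simp
  have "A \<tau> \<le> real n / 2" "real n \<le> 2 * A \<tau> + 1" using An unfolding n_def by linarith+
  then have "F \<tau> \<le> 2 ^ n * B" using doubling \<tau> by blast
  also have "(2::real) ^ n \<le> exp (2 * (LINT t|?M. \<alpha> t) + 1)"
  proof -
    have "(2::real) ^ n \<le> exp 1 ^ n" using exp_ge_add_one_self[of 1] by (intro power_mono) auto
    also have "\<dots> = exp (real n)" by (simp add: exp_of_nat_mult[symmetric])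
    also have "\<dots> \<le> exp (2 * (LINT t|?M. \<alpha> t) + 1)" using \<open>real n \<le> 2 * A \<tau> + 1\<close> AT by simp
    finally show ?thesis .
  qed
  finally show "B + (LINT t|?M. indicator {0<..\<tau>} t * (\<alpha> t * E t)) \<le> exp (2 * (LINT t|?M. \<alpha> t) + 1) * B"
    using \<open>0 \<le> B\<close> by (simp add: F_def mult_right_mono)
qed

context energy_space
begin

text \<open>The gradient term stays on the left of the integrated inequality while Gronwall's
  inequality bounds the right-hand side by F. Then F controls the integral of the gradient term once
  and that of the energy with a factor T, hence T + 1. The coefficient \<open>2 * \<alpha>\<close>
  and the 2 in the Gronwall bound make up the 4 in the exponent.\<close>

lemma energy_gronwall:
  fixes \<alpha> \<beta> :: "real \<Rightarrow> real"
  assumes \<alpha>: "integrable (lebesgue_on {0<..<T}) \<alpha>" "\<And>t. 0 \<le> \<alpha> t"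
    and \<beta>: "integrable (lebesgue_on {0<..<T}) \<beta>" "\<And>t. 0 \<le> \<beta> t"
    and q: "AE t in lebesgue_on {0<..<T}. w' t (w t) \<le>
        - (L2_norm (lebesgue_on D) (weak_gradient D (w t)))\<^sup>2 / 2 + \<alpha> t * (L2_norm (lebesgue_on D) (w t))\<^sup>2 + \<beta> t"
  shows "(LINT t|lebesgue_on {0<..<T}. (H1_norm D (w t))\<^sup>2)
     \<le> (T + 1) * exp (4 * (LINT t|lebesgue_on {0<..<T}. \<alpha> t) + 1) *
        ((L2_norm (lebesgue_on D) (v 0))\<^sup>2 + 2 * (LINT t|lebesgue_on {0<..<T}. \<beta> t))"
proof -
  let ?M = "lebesgue_on {0<..<T}"
  define E where "E t = (L2_norm (lebesgue_on D) (v t))\<^sup>2" for t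
  \<comment> \<open>Written as a difference so that integrability in time follows from that of
    \<open>(H1_norm D (w t))\<^sup>2\<close> and the continuity of E; almost everywhere it is the
    squared norm of the gradient.\<close>
  define G where "G t = (H1_norm D (w t))\<^sup>2 - E t" for t
  have cE: "continuous_on {0..T} E" unfolding E_def by (rule energy_continuous)
  note iE = continuous_integrable_interval[OF cE]
  have iN: "integrable ?M (\<lambda>t. (H1_norm D (w t))\<^sup>2)" by (rule h.bochner_D(2)[OF w])
  have iG: "integrable ?M G" unfolding G_def using iN iE by simp
  have T': "AE t in ?M. t \<in> {0<..<T}" by (rule AE_I2) simp
  have EG: "AE t in ?M. (L2_norm (lebesgue_on D) (w t))\<^sup>2 = E t \<and> (L2_norm (lebesgue_on D) (weak_gradient D (w t)))\<^sup>2 = G t"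
    using T' v_eq h.bochner_D(1)[OF w]
  proof eventually_elim
    case (elim t)
    have "L2_norm (lebesgue_on D) (w t) = L2_norm (lebesgue_on D) (v t)"
      using H1_D(1)[OF open_D elim(3)] v[of t] elim by (intro L2_norm_AE_eq) (auto simp: L2_def)
    then show ?case by (simp add: E_def G_def H1_norm_sq)
  qed
  define B where "B = (L2_norm (lebesgue_on D) (v 0))\<^sup>2 + 2 * (LINT t|?M. \<beta> t)"
  have B0: "0 \<le> B" using \<beta> by (simp add: B_def)
  have i\<alpha>: "integrable ?M (\<lambda>t. 2 * \<alpha> t)" using \<alpha> by simp
  have mG: "AE t in ?M. 0 \<le> G t" using EG by eventually_elim (metis zero_le_power2)
  obtain b where b: "\<And>t. t \<in> {0..T} \<Longrightarrow> E t \<le> b" by (rule continuous_on_interval_bounded_above[OF cE]) blast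
  have i\<alpha>E: "integrable ?M (\<lambda>t. 2 * \<alpha> t * E t)"
  proof (rule Bochner_Integration.integrable_bound)
    show "integrable ?M (\<lambda>t. 2 * \<alpha> t * b)" using \<alpha>(1) by simp
    show "(\<lambda>t. 2 * \<alpha> t * E t) \<in> borel_measurable ?M"
      using borel_measurable_integrable[OF \<alpha>(1)] borel_measurable_integrable[OF iE(1)] by measurable
    show "AE t in ?M. norm (2 * \<alpha> t * E t) \<le> norm (2 * \<alpha> t * b)"
    proof (rule AE_I2)
      fix t assume "t \<in> space ?M"
      then have "0 \<le> E t" "E t \<le> b" using b[of t] by (auto simp: E_def)
      then show "norm (2 * \<alpha> t * E t) \<le> norm (2 * \<alpha> t * b)" using \<alpha>(2)[of t] by (simp add: abs_mult mult_left_mono)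
    qed
  qed
  have key: "E \<tau> + (LINT t|?M. indicator {0<..\<tau>} t * G t) \<le> B + (LINT t|?M. indicator {0<..\<tau>} t * (2 * \<alpha> t * E t))"
    if \<tau>: "\<tau> \<in> {0..T}" for \<tau>
  proof -
    have \<tau>0: "0 \<le> \<tau>" using \<tau> by simp
    note iq = pairing_integrable[OF open_D w'_bochner w]
    note I = integral_indicator_split(2)[OF _ order_refl \<tau>0]
    have "2 * (LINT t|?M. indicator {0<..\<tau>} t * w' t (w t)) = (LINT t|?M. 2 * (indicator {0<..\<tau>} t * w' t (w t)))" by simp
    also have "\<dots> \<le> (LINT t|?M. 2 * \<beta> t + indicator {0<..\<tau>} t * (2 * \<alpha> t * E t) - indicator {0<..\<tau>} t * G t)"
    proof (rule integral_mono_AE)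
      show "integrable ?M (\<lambda>t. 2 * (indicator {0<..\<tau>} t * w' t (w t)))" using I[OF iq] by simp
      show "integrable ?M (\<lambda>t. 2 * \<beta> t + indicator {0<..\<tau>} t * (2 * \<alpha> t * E t) - indicator {0<..\<tau>} t * G t)"
        using \<beta>(1) I[OF i\<alpha>E] I[OF iG] by simp
      show "AE t in ?M. 2 * (indicator {0<..\<tau>} t * w' t (w t)) \<le> 2 * \<beta> t + indicator {0<..\<tau>} t * (2 * \<alpha> t * E t) - indicator {0<..\<tau>} t * G t"
        using q EG
      proof eventually_elim
        case (elim t)
        then show ?case using \<beta>(2)[of t] by (auto simp: indicator_def)
      qed
    qed
    also have "\<dots> = 2 * (LINT t|?M. \<beta> t) + (LINT t|?M. indicator {0<..\<tau>} t * (2 * \<alpha> t * E t)) - (LINT t|?M. indicator {0<..\<tau>} t * G t)"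
      using \<beta>(1) I[OF i\<alpha>E] I[OF iG] by simp
    finally show ?thesis using energy_inequality[OF \<tau>] by (simp add: E_def B_def)
  qed
  have ineq: "E \<tau> \<le> B + (LINT t|?M. indicator {0<..\<tau>} t * (2 * \<alpha> t * E t))" if "\<tau> \<in> {0..T}" for \<tau>
  proof -
    have "0 \<le> (LINT t|?M. indicator {0<..\<tau>} t * G t)"
      using mG by (intro integral_nonneg_AE) (auto elim!: eventually_mono simp: indicator_def)
    then show ?thesis using key[OF that] by linarith
  qed
  define F where "F = exp (4 * (LINT t|?M. \<alpha> t) + 1) * B"
  have gr: "B + (LINT t|?M. indicator {0<..\<tau>} t * (2 * \<alpha> t * E t)) \<le> F" if "\<tau> \<in> {0..T}" for \<tau>
    using gronwall_integrable_coefficient(2)[OF T cE _ i\<alpha> _ B0 ineq that] \<alpha>(2) by (simp add: F_def E_def)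
  have "(LINT t|?M. indicator {0<..T} t * G t) \<le> F"
    using key[of T] gr[of T] T by (simp add: E_def) (smt (verit) zero_le_power2)
  moreover have "(LINT t|?M. indicator {0<..T} t * G t) = (LINT t|?M. G t)"
    by (intro Bochner_Integration.integral_cong) (auto simp: indicator_def)
  moreover have "(LINT t|?M. E t) \<le> T * F"
  proof -
    have "integral {0..T} E \<le> integral {0..T} (\<lambda>t. F)"
      using ineq gr by (intro integral_le integrable_continuous_real cE) (auto intro: order_trans)
    then show ?thesis using iE(2) T by simp
  qed
  moreover have "(LINT t|?M. (H1_norm D (w t))\<^sup>2) = (LINT t|?M. E t) + (LINT t|?M. G t)"
    using iN iE(1) by (simp add: G_def)
  ultimately have "(LINT t|?M. (H1_norm D (w t))\<^sup>2) \<le> (T + 1) * F" by (simp add: distrib_right)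
  then show ?thesis by (simp add: F_def B_def mult.assoc)
qed

end

lemma energy_space_weak_derivative:
  assumes "time_dependent D T w w' v" "has_weak_time_derivative D T w w'"
  shows "energy_space D T w w' v"
proof -
  interpret time_dependent D T w w' v by fact
  show ?thesis by unfold_locales (rule weak_time_derivative_increment[OF assms(2)])
qed

lemma energy_space_diff:
  assumes "energy_space D T w1 w1' v1" "energy_space D T w2 w2' v2"
  shows "energy_space D T (\<lambda>t x. w1 t x - w2 t x) (\<lambda>t \<phi>. w1' t \<phi> - w2' t \<phi>) (\<lambda>t x. v1 t x - v2 t x)"
proof -
  interpret a: energy_space D T w1 w1' v1 by fact
  interpret b: energy_space D T w2 w2' v2 by fact
  let ?M = "lebesgue_on D"
  show ?thesis
  proof unfold_locales
    show "open D" "0 < T" by (rule a.open_D a.T)+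
    show "(\<lambda>t x. w1 t x - w2 t x) \<in> bochner_L2 T (H1 D) (H1_norm D)" by (rule a.h.bochner_diff[OF a.w b.w])
    show "(\<lambda>t \<phi>. w1' t \<phi> - w2' t \<phi>) \<in> bochner_L2 T (H1_dual D) (H1_dual_norm D)"
      by (rule a.d.bochner_diff[OF a.w'_bochner b.w'_bochner])
    show "(\<lambda>x. v1 t x - v2 t x) \<in> L2 ?M" if "t \<in> {0..T}" for t by (rule a.l.diff_closed[OF a.v[OF that] b.v[OF that]])
    show "((\<lambda>s. L2_norm ?M (\<lambda>x. v1 s x - v2 s x - (v1 t x - v2 t x))) \<longlongrightarrow> 0) (at t within {0..T})" if t: "t \<in> {0..T}" for t
    proof (rule Lim_null_comparison)
      show "((\<lambda>s. L2_norm ?M (\<lambda>x. v1 s x - v1 t x) + L2_norm ?M (\<lambda>x. v2 s x - v2 t x)) \<longlongrightarrow> 0) (at t within {0..T})"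
        using tendsto_add[OF a.v_continuous[OF t] b.v_continuous[OF t]] by simp
      show "\<forall>\<^sub>F s in at t within {0..T}. norm (L2_norm ?M (\<lambda>x. v1 s x - v2 s x - (v1 t x - v2 t x)))
          \<le> L2_norm ?M (\<lambda>x. v1 s x - v1 t x) + L2_norm ?M (\<lambda>x. v2 s x - v2 t x)"
        unfolding eventually_at_filter
      proof (rule always_eventually, intro allI impI)
        fix s assume "s \<noteq> t" and s: "s \<in> {0..T}"
        show "norm (L2_norm ?M (\<lambda>x. v1 s x - v2 s x - (v1 t x - v2 t x)))
          \<le> L2_norm ?M (\<lambda>x. v1 s x - v1 t x) + L2_norm ?M (\<lambda>x. v2 s x - v2 t x)"
          using a.l.triangle_diff[OF a.l.diff_closed[OF a.v[OF s] a.v[OF t]] a.l.diff_closed[OF b.v[OF s] b.v[OF t]]]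
          by (simp add: algebra_simps)
      qed
    qed
    show "AE t in lebesgue_on {0<..<T}. AE x in ?M. w1 t x - w2 t x = v1 t x - v2 t x"
      using a.v_eq b.v_eq
    proof eventually_elim
      case (elim t)
      then show ?case by eventually_elim simp
    qed
    fix \<phi> t1 t2 assume \<phi>: "\<phi> \<in> H1 D" and t: "0 < t1" "t1 < t2" "t2 < T"
    note \<phi>L = H1_D(1)[OF a.open_D \<phi>]
    have s: "(LINT x|?M. (v1 t x - v2 t x) * \<phi> x) = (LINT x|?M. v1 t x * \<phi> x) - (LINT x|?M. v2 t x * \<phi> x)" if "t \<in> {0..T}" for t
      using L2_inner_integrable[OF a.v[OF that] \<phi>L] L2_inner_integrable[OF b.v[OF that] \<phi>L] by (simp add: left_diff_distrib)
    have i: "integrable (lebesgue_on {0<..<T}) (\<lambda>t. indicator {t1<..t2} t * w1' t \<phi>)"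
      "integrable (lebesgue_on {0<..<T}) (\<lambda>t. indicator {t1<..t2} t * w2' t \<phi>)"
      using t by (intro integral_indicator_split(2) pairing_integrable[OF a.open_D a.w'_bochner a.h.bochner_const[OF \<phi>]]
          pairing_integrable[OF a.open_D b.w'_bochner a.h.bochner_const[OF \<phi>]]; simp)+
    show "(LINT x|?M. (v1 t2 x - v2 t2 x) * \<phi> x) - (LINT x|?M. (v1 t1 x - v2 t1 x) * \<phi> x)
       = (LINT t|lebesgue_on {0<..<T}. indicator {t1<..t2} t * (w1' t \<phi> - w2' t \<phi>))"
      using s[of t1] s[of t2] t a.increment[OF \<phi> t] b.increment[OF \<phi> t] i by (simp add: right_diff_distrib)
  qed
qed

section \<open>The boundary value problem\<close>

lemma AE_lateral_slice:
  fixes \<Gamma> :: "'a::euclidean_space set"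
  assumes "finite_measure (surface \<Gamma>)" "AE p in lateral T \<Gamma>. P p"
  shows "AE t in lebesgue_on {0<..<T}. AE x in surface \<Gamma>. P (t, x)"
proof -
  interpret s: finite_measure "surface \<Gamma>" by fact
  interpret t: finite_measure "lebesgue_on {0<..<T}" by (rule finite_measure_interval)
  interpret pair_sigma_finite "lebesgue_on {0<..<T}" "surface \<Gamma>" ..
  show ?thesis using assms(2) by (rule AE_pair)
qed

lemma lateral_slice_measurable:
  assumes "b \<in> borel_measurable (lateral T \<Gamma>)" "t \<in> {0<..<T}"
  shows "(\<lambda>x. b (t, x)) \<in> borel_measurable (surface \<Gamma>)"
  using measurable_compose[OF measurable_Pair1' assms(1), of t] assms(2) by simp

text \<open>Collects the constants on which the estimates depend, so that the final bound is
  expressed through them before the time horizon and the data are given. Here \<open>Ct\<close> is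
  the trace constant, not the exponential rate of the theorem.\<close>

locale boundary_problem =
  fixes D \<Gamma>in \<Gamma>out :: "'a::euclidean_space set" and f g :: "real \<Rightarrow> real" and Lf Fb gb Ct :: real
  assumes domain: "bounded_lipschitz_domain D"
    and \<Gamma>in: "\<Gamma>in \<subseteq> frontier D" "\<Gamma>in \<in> sets borel"
    and \<Gamma>out: "\<Gamma>out \<subseteq> frontier D" "\<Gamma>out \<in> sets borel"
    and f_lipschitz: "Lf-lipschitz_on UNIV f" and f_bound: "\<And>s. \<bar>f s\<bar> \<le> Fb"
    and g_continuous: "continuous_on UNIV g" and g_bound: "\<And>s. \<bar>g s\<bar> \<le> gb" and g_antimono: "antimono g"
    and trace_nonneg: "0 \<le> Ct" and trace: "\<And>u v. has_trace D u v \<Longrightarrow> L2_norm (surface (frontier D)) v \<le> Ct * H1_norm D u"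
begin

lemma open_D: "open D" and bounded_D: "bounded D"
  using domain by (auto simp: bounded_lipschitz_domain_def)

lemma finite_D: "finite_measure (lebesgue_on D)"
  by (rule finite_measure_lebesgue_on_bounded[OF open_D bounded_D])

lemma finite_in: "finite_measure (surface \<Gamma>in)" and finite_out: "finite_measure (surface \<Gamma>out)"
  by (rule surface_frontier[OF domain \<Gamma>in], rule surface_frontier[OF domain \<Gamma>out])

lemma Fb_nonneg: "0 \<le> Fb" and gb_nonneg: "0 \<le> gb" and Lf_nonneg: "0 \<le> Lf"
  using f_bound[of 0] g_bound[of 0] lipschitz_on_nonneg[OF f_lipschitz] by linarith+

lemma f_diff_le: "\<bar>f x - f y\<bar> \<le> Lf * \<bar>x - y\<bar>"
  using lipschitz_onD[OF f_lipschitz, of x y] by (simp add: dist_real_def)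

lemma measurable_f_comp: "u \<in> borel_measurable M \<Longrightarrow> (\<lambda>x. f (u x)) \<in> borel_measurable M"
  using continuous_borel_lebesgue(1)[OF lipschitz_on_continuous_on[OF f_lipschitz]] by (rule measurable_compose[rotated])

lemma measurable_g_comp: "u \<in> borel_measurable M \<Longrightarrow> (\<lambda>x. g (u x)) \<in> borel_measurable M"
  using continuous_borel_lebesgue(1)[OF g_continuous] by (rule measurable_compose[rotated])

sublocale h: seminormed_functions "H1 D" "H1_norm D" by (rule seminormed_functions_H1[OF open_D])
sublocale d: seminormed_functions "H1_dual D" "H1_dual_norm D" by (rule seminormed_functions_H1_dual[OF open_D])
sublocale w: seminormed_functions "W1inf D" "W1inf_norm D" by (rule seminormed_functions_W1inf[OF open_D])

lemma trace_D:
  assumes "has_trace D u v"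
  shows "u \<in> H1 D" "v \<in> L2 (surface \<Gamma>in)" "v \<in> L2 (surface \<Gamma>out)"
    "L2_norm (surface \<Gamma>in) v \<le> Ct * H1_norm D u" "L2_norm (surface \<Gamma>out) v \<le> Ct * H1_norm D u"
proof -
  have "v \<in> L2 (surface (frontier D))" "u \<in> H1 D" using assms by (auto simp: has_trace_def)
  then show "u \<in> H1 D" "v \<in> L2 (surface \<Gamma>in)" "v \<in> L2 (surface \<Gamma>out)"
    "L2_norm (surface \<Gamma>in) v \<le> Ct * H1_norm D u" "L2_norm (surface \<Gamma>out) v \<le> Ct * H1_norm D u"
    using surface_frontier_L2_subset[OF \<Gamma>in] surface_frontier_L2_subset[OF \<Gamma>out] trace[OF assms] order_trans by blast+
qed

definition drift :: "('a \<Rightarrow> real) \<Rightarrow> ('a \<Rightarrow> real) \<Rightarrow> 'a \<Rightarrow> 'a" where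
  "drift u V x = f (u x) *\<^sub>R weak_gradient D V x"

lemma drift_L2:
  assumes "u \<in> H1 D" "V \<in> W1inf D"
  shows "drift u V \<in> L2 (lebesgue_on D)"
    "L2_norm (lebesgue_on D) (drift u V) \<le> Fb * W1inf_norm D V * sqrt (measure lebesgue D)"
proof -
  have m: "drift u V \<in> borel_measurable (lebesgue_on D)" unfolding drift_def
    using measurable_f_comp[OF L2_D(1)[OF H1_D(1)[OF open_D assms(1)]]] Linf_measurable[OF W1inf_D(3)[OF open_D assms(2)]]
    by measurable
  have b: "AE x in lebesgue_on D. norm (drift u V x) \<le> Fb * W1inf_norm D V"
    using weak_gradient_W1inf_bound[OF open_D assms(2)]
    by eventually_elim (simp add: drift_def, intro mult_mono f_bound Fb_nonneg, auto)
  show "drift u V \<in> L2 (lebesgue_on D)" by (rule L2_bounded(1)[OF finite_D m b])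
  show "L2_norm (lebesgue_on D) (drift u V) \<le> Fb * W1inf_norm D V * sqrt (measure lebesgue D)"
    using L2_norm_le_bounded[OF finite_D m b] Fb_nonneg w.nonneg[OF assms(2)] open_D
    by (simp add: measure_restrict_space)
qed

definition flux :: "('a \<Rightarrow> real) \<Rightarrow> ('a \<Rightarrow> real) \<Rightarrow> 'a \<Rightarrow> 'a" where
  "flux u V x = - weak_gradient D u x + f (u x) *\<^sub>R weak_gradient D V x"

lemma flux_L2:
  assumes "u \<in> H1 D" "V \<in> W1inf D"
  shows "flux u V \<in> L2 (lebesgue_on D)"
  using L2_add[OF L2_scaleR[OF H1_D(3)[OF open_D assms(1)], of "-1"] drift_L2(1)[OF assms]]
  by (simp add: flux_def[abs_def] drift_def[abs_def])

definition boundary_data :: "('a \<Rightarrow> real) \<Rightarrow> ('a \<Rightarrow> real) \<Rightarrow> bool" where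
  "boundary_data a b \<longleftrightarrow>
     a \<in> borel_measurable (surface \<Gamma>in) \<and> (AE x in surface \<Gamma>in. 0 \<le> a x \<and> a x \<le> 1) \<and>
     b \<in> borel_measurable (surface \<Gamma>out) \<and> (AE x in surface \<Gamma>out. 0 \<le> b x \<and> b x \<le> 1)"

lemma boundary_terms_L2:
  assumes "boundary_data a b" "has_trace D u \<gamma>"
  shows "(\<lambda>x. a x * g (\<gamma> x)) \<in> L2 (surface \<Gamma>in)" "(\<lambda>x. b x * \<gamma> x) \<in> L2 (surface \<Gamma>out)"
proof -
  have a: "a \<in> borel_measurable (surface \<Gamma>in)" "AE x in surface \<Gamma>in. 0 \<le> a x \<and> a x \<le> 1"
    and b: "b \<in> borel_measurable (surface \<Gamma>out)" "AE x in surface \<Gamma>out. 0 \<le> b x \<and> b x \<le> 1"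
    using assms(1) by (auto simp: boundary_data_def)
  show "(\<lambda>x. a x * g (\<gamma> x)) \<in> L2 (surface \<Gamma>in)"
  proof (rule L2_bounded(1)[OF finite_in, of _ gb])
    show "(\<lambda>x. a x * g (\<gamma> x)) \<in> borel_measurable (surface \<Gamma>in)"
      by (intro borel_measurable_times a measurable_g_comp L2_D(1) trace_D[OF assms(2)])
    show "AE x in surface \<Gamma>in. norm (a x * g (\<gamma> x)) \<le> gb"
      using a(2)
    proof eventually_elim
      case (elim x)
      have "\<bar>a x\<bar> * \<bar>g (\<gamma> x)\<bar> \<le> 1 * gb" using elim by (intro mult_mono g_bound) auto
      then show ?case by (simp add: abs_mult)
    qed
  qed
  show "(\<lambda>x. b x * \<gamma> x) \<in> L2 (surface \<Gamma>out)"
  proof (rule L2_dominated(1)[OF trace_D(3)[OF assms(2)], of _ 1])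
    show "(\<lambda>x. b x * \<gamma> x) \<in> borel_measurable (surface \<Gamma>out)"
      by (intro borel_measurable_times b L2_D(1) trace_D[OF assms(2)])
    show "AE x in surface \<Gamma>out. norm (b x * \<gamma> x) \<le> 1 * norm (\<gamma> x)"
      using b(2) by eventually_elim (simp add: abs_mult mult_left_le_one_le)
  qed simp
qed

text \<open>The equation at one time. The test function carries its trace \<eta> along because
  \<open>has_trace\<close> is a relation.\<close>

definition weak_form ::
  "('a \<Rightarrow> real) \<Rightarrow> ('a \<Rightarrow> real) \<Rightarrow> ('a \<Rightarrow> real) \<Rightarrow> ('a \<Rightarrow> real) \<Rightarrow> ('a \<Rightarrow> real) \<Rightarrow> (('a \<Rightarrow> real) \<Rightarrow> real) \<Rightarrow>
    ('a \<Rightarrow> real) \<Rightarrow> ('a \<Rightarrow> real) \<Rightarrow> bool" where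
  "weak_form a b V u \<gamma> F \<phi> \<eta> \<longleftrightarrow>
     F \<phi> - (LINT x|lebesgue_on D. flux u V x \<bullet> weak_gradient D \<phi> x) + (LINT x|surface \<Gamma>out. b x * \<gamma> x * \<eta> x)
       = (LINT x|surface \<Gamma>in. a x * g (\<gamma> x) * \<eta> x)"

text \<open>The residual R of the equation is Lipschitz in the test function with respect to the H1
  norm: the dual pairing and the volume term by norm bounds, the boundary terms by the trace
  inequality for the difference of two test functions. It vanishes at test functions arbitrarily
  close to \<phi>.\<close>

lemma weak_form_closed:
  assumes ab: "boundary_data a b" and V: "V \<in> W1inf D" and u: "has_trace D u \<gamma>" and F: "F \<in> H1_dual D"
    and \<phi>: "has_trace D \<phi> \<eta>"
    and dense: "\<And>\<delta>. \<delta> > 0 \<Longrightarrow> \<exists>\<psi> \<zeta>. has_trace D \<psi> \<zeta> \<and> weak_form a b V u \<gamma> F \<psi> \<zeta> \<and> H1_norm D (\<lambda>x. \<psi> x - \<phi> x) < \<delta>"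
  shows "weak_form a b V u \<gamma> F \<phi> \<eta>"
proof -
  note \<Phi> = flux_L2[OF trace_D(1)[OF u] V] and B = boundary_terms_L2[OF ab u]
  define R where "R \<phi> \<eta> = F \<phi> - (LINT x|lebesgue_on D. flux u V x \<bullet> weak_gradient D \<phi> x)
     + (LINT x|surface \<Gamma>out. b x * \<gamma> x * \<eta> x) - (LINT x|surface \<Gamma>in. a x * g (\<gamma> x) * \<eta> x)" for \<phi> \<eta>
  define C where "C = H1_dual_norm D F + L2_norm (lebesgue_on D) (flux u V)
     + L2_norm (surface \<Gamma>out) (\<lambda>x. b x * \<gamma> x) * Ct + L2_norm (surface \<Gamma>in) (\<lambda>x. a x * g (\<gamma> x)) * Ct"
  have R: "\<bar>R \<psi> \<zeta> - R \<phi> \<eta>\<bar> \<le> C * H1_norm D (\<lambda>x. \<psi> x - \<phi> x)" if \<psi>: "has_trace D \<psi> \<zeta>" for \<psi> \<zeta>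
  proof -
    note tr = trace_D[OF has_trace_diff[OF domain \<psi> \<phi>]]
    note T\<psi> = trace_D[OF \<psi>] and T\<phi> = trace_D[OF \<phi>]
    note wg = weak_gradient_diff[OF open_D H1_D(2)[OF open_D T\<psi>(1)] H1_D(2)[OF open_D T\<phi>(1)]]
    let ?n = "H1_norm D (\<lambda>x. \<psi> x - \<phi> x)"
    note i = L2_inner_integrable[OF \<Phi> H1_D(3)[OF open_D T\<psi>(1)]] L2_inner_integrable[OF \<Phi> H1_D(3)[OF open_D T\<phi>(1)]]
    have 1: "\<bar>F \<psi> - F \<phi>\<bar> \<le> H1_dual_norm D F * ?n"
      using H1_dual_norm_bounds(1)[OF open_D F tr(1)] H1_dual_diff[OF open_D F T\<psi>(1) T\<phi>(1)] by simp
    have "(LINT x|lebesgue_on D. flux u V x \<bullet> weak_gradient D \<psi> x) - (LINT x|lebesgue_on D. flux u V x \<bullet> weak_gradient D \<phi> x)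
      = (LINT x|lebesgue_on D. flux u V x \<bullet> weak_gradient D \<psi> x - flux u V x \<bullet> weak_gradient D \<phi> x)"
      using i by simp
    also have "\<dots> = (LINT x|lebesgue_on D. flux u V x \<bullet> weak_gradient D (\<lambda>x. \<psi> x - \<phi> x) x)"
    proof (rule integral_cong_AE)
      show "AE x in lebesgue_on D. flux u V x \<bullet> weak_gradient D \<psi> x - flux u V x \<bullet> weak_gradient D \<phi> x
        = flux u V x \<bullet> weak_gradient D (\<lambda>x. \<psi> x - \<phi> x) x"
        using wg by eventually_elim (simp add: inner_diff_right)
      show "(\<lambda>x. flux u V x \<bullet> weak_gradient D (\<lambda>x. \<psi> x - \<phi> x) x) \<in> borel_measurable (lebesgue_on D)"
        by (rule borel_measurable_integrable[OF L2_inner_integrable[OF \<Phi> H1_D(3)[OF open_D tr(1)]]])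
    qed (use i in simp)
    finally have "(LINT x|lebesgue_on D. flux u V x \<bullet> weak_gradient D \<psi> x) - (LINT x|lebesgue_on D. flux u V x \<bullet> weak_gradient D \<phi> x)
      = (LINT x|lebesgue_on D. flux u V x \<bullet> weak_gradient D (\<lambda>x. \<psi> x - \<phi> x) x)" .
    then have 2: "\<bar>(LINT x|lebesgue_on D. flux u V x \<bullet> weak_gradient D \<psi> x) - (LINT x|lebesgue_on D. flux u V x \<bullet> weak_gradient D \<phi> x)\<bar>
      \<le> L2_norm (lebesgue_on D) (flux u V) * ?n"
      using order_trans[OF L2_inner_bound[OF \<Phi> H1_D(3)[OF open_D tr(1)]] mult_left_mono[OF L2_norm_le_H1_norm(2) L2_norm_nonneg]]
      by (simp only:)
    have bd: "\<bar>(LINT x|M. \<beta> x * \<zeta> x) - (LINT x|M. \<beta> x * \<eta> x)\<bar> \<le> L2_norm M \<beta> * Ct * ?n"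
      if "\<beta> \<in> L2 M" "\<zeta> \<in> L2 M" "\<eta> \<in> L2 M" "L2_norm M (\<lambda>x. \<zeta> x - \<eta> x) \<le> Ct * ?n" for M and \<beta> :: "'a \<Rightarrow> real"
    proof -
      have "(LINT x|M. \<beta> x * \<zeta> x) - (LINT x|M. \<beta> x * \<eta> x) = (LINT x|M. \<beta> x \<bullet> (\<zeta> x - \<eta> x))"
        using L2_inner_integrable[OF that(1,2)] L2_inner_integrable[OF that(1,3)] by (simp add: right_diff_distrib)
      also have "\<bar>\<dots>\<bar> \<le> L2_norm M \<beta> * L2_norm M (\<lambda>x. \<zeta> x - \<eta> x)"
        by (rule L2_inner_bound[OF that(1) L2_diff[OF that(2,3)]])
      also have "\<dots> \<le> L2_norm M \<beta> * (Ct * ?n)" by (rule mult_left_mono[OF that(4)]) simp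
      finally show ?thesis by (simp add: mult.assoc)
    qed
    have 3: "\<bar>(LINT x|surface \<Gamma>out. b x * \<gamma> x * \<zeta> x) - (LINT x|surface \<Gamma>out. b x * \<gamma> x * \<eta> x)\<bar>
        \<le> L2_norm (surface \<Gamma>out) (\<lambda>x. b x * \<gamma> x) * Ct * ?n"
      by (rule bd[OF B(2) T\<psi>(3) T\<phi>(3) tr(5)])
    have 4: "\<bar>(LINT x|surface \<Gamma>in. a x * g (\<gamma> x) * \<zeta> x) - (LINT x|surface \<Gamma>in. a x * g (\<gamma> x) * \<eta> x)\<bar>
        \<le> L2_norm (surface \<Gamma>in) (\<lambda>x. a x * g (\<gamma> x)) * Ct * ?n"
      by (rule bd[OF B(1) T\<psi>(2) T\<phi>(2) tr(4)])
    show ?thesis using 1 2 3 4 by (simp add: R_def C_def distrib_right)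
  qed
  have C0: "0 \<le> C" unfolding C_def using trace_nonneg d.nonneg[OF F] by simp
  have "\<bar>R \<phi> \<eta>\<bar> \<le> 0 + e" if "0 < e" for e
  proof -
    obtain \<psi> \<zeta> where \<psi>: "has_trace D \<psi> \<zeta>" "weak_form a b V u \<gamma> F \<psi> \<zeta>" "H1_norm D (\<lambda>x. \<psi> x - \<phi> x) < e / (C + 1)"
      using dense[of "e / (C + 1)"] C0 \<open>0 < e\<close> by auto
    have "R \<psi> \<zeta> = 0" using \<psi>(2) by (simp add: R_def weak_form_def)
    then have "\<bar>R \<phi> \<eta>\<bar> \<le> C * H1_norm D (\<lambda>x. \<psi> x - \<phi> x)" using R[OF \<psi>(1)] by simp
    also have "\<dots> \<le> C * (e / (C + 1))" using \<psi>(3) C0 by (intro mult_left_mono) auto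
    also have "\<dots> \<le> e" using C0 \<open>0 < e\<close> by (simp add: field_simps)
    finally show ?thesis by simp
  qed
  then have "\<bar>R \<phi> \<eta>\<bar> \<le> 0" by (rule field_le_epsilon)
  then show ?thesis by (simp add: R_def weak_form_def)
qed

text \<open>The null set of times at which the equation may fail depends on the test function.
  Countably many values of z, each with a trace, have a common null set; for almost every t they
  come arbitrarily close to \<open>z t\<close>, so \<open>weak_form_closed\<close> applies.\<close>

lemma weak_form_tested:
  assumes weak: "\<And>\<phi> \<eta>. has_trace D \<phi> \<eta> \<Longrightarrow>
        AE t in lebesgue_on {0<..<T}. weak_form (\<lambda>x. a (t, x)) (\<lambda>x. b (t, x)) (V t) (u t) (\<gamma> t) (u' t) \<phi> \<eta>"
    and u': "AE t in lebesgue_on {0<..<T}. u' t \<in> H1_dual D"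
    and \<gamma>: "AE t in lebesgue_on {0<..<T}. has_trace D (u t) (\<gamma> t)"
    and ab: "AE t in lebesgue_on {0<..<T}. boundary_data (\<lambda>x. a (t, x)) (\<lambda>x. b (t, x))"
    and V: "AE t in lebesgue_on {0<..<T}. V t \<in> W1inf D"
    and z: "z \<in> bochner_L2 T (H1 D) (H1_norm D)" and \<zeta>: "AE t in lebesgue_on {0<..<T}. has_trace D (z t) (\<zeta> t)"
  shows "AE t in lebesgue_on {0<..<T}. weak_form (\<lambda>x. a (t, x)) (\<lambda>x. b (t, x)) (V t) (u t) (\<gamma> t) (u' t) (z t) (\<zeta> t)"
proof -
  let ?M = "lebesgue_on {0<..<T}"
  obtain E where E: "countable E" "\<And>e. e \<in> E \<Longrightarrow> has_trace D (z e) (\<zeta> e)"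
    "AE t in ?M. \<forall>\<delta>>0. \<exists>e\<in>E. H1_norm D (\<lambda>x. z e x - z t x) < \<delta>"
    by (rule h.bochner_separable[OF z \<zeta>]) blast
  have "AE t in ?M. \<forall>e\<in>E. weak_form (\<lambda>x. a (t, x)) (\<lambda>x. b (t, x)) (V t) (u t) (\<gamma> t) (u' t) (z e) (\<zeta> e)"
    using weak E(2) by (subst AE_ball_countable[OF E(1)]) blast
  with E(3) u' \<gamma> ab V \<zeta> show ?thesis
  proof eventually_elim
    case (elim t)
    show ?case
      by (rule weak_form_closed[OF elim(4) elim(5) elim(3) elim(2) elim(6)]) (use elim(1,7) E(2) in blast)
  qed
qed

end

text \<open>Young's inequality with weight 1/4 on both products. Since n^2 contains s^2, half of the
  dissipation is spent; what remains is \<open>- s\<^sup>2 / 2\<close> and the term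
  \<open>e / 4\<close>, the origin of the coefficient 1/4 in the energy rates.\<close>

lemma absorb_into_gradient:
  fixes q s e n P X :: real
  assumes "q \<le> - s\<^sup>2 + P * s + X * n" "n\<^sup>2 = e + s\<^sup>2"
  shows "q \<le> - s\<^sup>2 / 2 + e / 4 + P\<^sup>2 + X\<^sup>2"
proof -
  have "P * s \<le> P\<^sup>2 + s\<^sup>2 / 4" "X * n \<le> X\<^sup>2 + n\<^sup>2 / 4"
    using sum_squares_bound[of P "s / 2"] sum_squares_bound[of X "n / 2"] by (simp_all add: power_divide)
  then show ?thesis using assms by linarith
qed

section \<open>Energy rates at a fixed time\<close>

context boundary_problem
begin

definition volume_const :: real where "volume_const = measure lebesgue D"
definition inflow_const :: real where "inflow_const = measure (surface \<Gamma>in) (space (surface \<Gamma>in))"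

lemma const_nonneg: "0 \<le> volume_const" "0 \<le> inflow_const"
  by (simp_all add: volume_const_def inflow_const_def)

lemma boundary_dataD:
  assumes "boundary_data a b"
  shows "a \<in> borel_measurable (surface \<Gamma>in)" "AE x in surface \<Gamma>in. 0 \<le> a x" "AE x in surface \<Gamma>in. \<bar>a x\<bar> \<le> 1"
    "b \<in> borel_measurable (surface \<Gamma>out)" "AE x in surface \<Gamma>out. 0 \<le> b x"
proof -
  have a: "AE x in surface \<Gamma>in. 0 \<le> a x \<and> a x \<le> 1" and b: "AE x in surface \<Gamma>out. 0 \<le> b x \<and> b x \<le> 1"
    using assms unfolding boundary_data_def by blast+
  show "a \<in> borel_measurable (surface \<Gamma>in)" "b \<in> borel_measurable (surface \<Gamma>out)"
    using assms unfolding boundary_data_def by blast+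
  show "AE x in surface \<Gamma>in. 0 \<le> a x" using a by eventually_elim simp
  show "AE x in surface \<Gamma>in. \<bar>a x\<bar> \<le> 1" using a by eventually_elim simp
  show "AE x in surface \<Gamma>out. 0 \<le> b x" using b by eventually_elim simp
qed

lemma g_trace_L2:
  assumes "has_trace D u \<gamma>" "c \<in> borel_measurable (surface \<Gamma>in)" "AE x in surface \<Gamma>in. \<bar>c x\<bar> \<le> L" "0 \<le> L"
  shows "(\<lambda>x. c x * g (\<gamma> x)) \<in> L2 (surface \<Gamma>in)"
    "L2_norm (surface \<Gamma>in) (\<lambda>x. c x * g (\<gamma> x)) \<le> L * gb * sqrt inflow_const"
proof -
  have m: "(\<lambda>x. c x * g (\<gamma> x)) \<in> borel_measurable (surface \<Gamma>in)"
    by (intro borel_measurable_times assms(2) measurable_g_comp L2_D(1) trace_D[OF assms(1)])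
  have b: "AE x in surface \<Gamma>in. norm (c x * g (\<gamma> x)) \<le> L * gb"
    using assms(3) by eventually_elim (simp add: abs_mult, intro mult_mono g_bound, auto simp: assms(4))
  show "(\<lambda>x. c x * g (\<gamma> x)) \<in> L2 (surface \<Gamma>in)" by (rule L2_bounded(1)[OF finite_in m b])
  show "L2_norm (surface \<Gamma>in) (\<lambda>x. c x * g (\<gamma> x)) \<le> L * gb * sqrt inflow_const"
    using L2_norm_le_bounded[OF finite_in m b] assms(4) gb_nonneg by (simp add: inflow_const_def)
qed

lemma flux_inner_split:
  assumes "u \<in> H1 D" "V \<in> W1inf D" "\<phi> \<in> H1 D"
  shows "(LINT x|lebesgue_on D. flux u V x \<bullet> weak_gradient D \<phi> x)
    = - (LINT x|lebesgue_on D. weak_gradient D u x \<bullet> weak_gradient D \<phi> x) + (LINT x|lebesgue_on D. drift u V x \<bullet> weak_gradient D \<phi> x)"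
  using L2_inner_integrable[OF H1_D(3)[OF open_D assms(1)] H1_D(3)[OF open_D assms(3)]]
    L2_inner_integrable[OF drift_L2(1)[OF assms(1,2)] H1_D(3)[OF open_D assms(3)]]
  by (simp add: flux_def drift_def inner_add_left inner_diff_left)

lemma gradient_inner_self:
  "(LINT x|lebesgue_on D. weak_gradient D u x \<bullet> weak_gradient D u x) = (L2_norm (lebesgue_on D) (weak_gradient D u))\<^sup>2"
  by (simp add: L2_norm_sq power2_norm_eq_inner)

text \<open>The drift is estimated through the bound on f, independently of u, the outflow term has
  a sign because b is nonnegative, and g is bounded at the inflow. Hence the L2 norm has the
  constant coefficient 1/4. In \<open>solution_bound\<close> this yields the H1 bound on a solution
  that the outflow term of the difference estimate needs.\<close>

lemma energy_rate_single:
  assumes eq: "weak_form a b V u \<gamma> F u \<gamma>" and ab: "boundary_data a b" and V: "V \<in> W1inf D" and u: "has_trace D u \<gamma>"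
  shows "F u \<le> - (L2_norm (lebesgue_on D) (weak_gradient D u))\<^sup>2 / 2 + (L2_norm (lebesgue_on D) u)\<^sup>2 / 4
    + Fb\<^sup>2 * volume_const * (W1inf_norm D V)\<^sup>2 + (gb * sqrt inflow_const * Ct)\<^sup>2"
proof -
  let ?s = "L2_norm (lebesgue_on D) (weak_gradient D u)"
  define P where "P = Fb * W1inf_norm D V * sqrt volume_const"
  define X where "X = gb * sqrt inflow_const * Ct"
  note uH = trace_D(1)[OF u]
  note gL = g_trace_L2[OF u boundary_dataD(1,3)[OF ab]]
  have "(LINT x|lebesgue_on D. drift u V x \<bullet> weak_gradient D u x) \<le> L2_norm (lebesgue_on D) (drift u V) * ?s"
    by (rule L2_inner_le_norms[OF drift_L2(1)[OF uH V] H1_D(3)[OF open_D uH]])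
  also have "\<dots> \<le> P * ?s" unfolding P_def volume_const_def by (intro mult_right_mono drift_L2(2)[OF uH V]) simp
  finally have 1: "(LINT x|lebesgue_on D. flux u V x \<bullet> weak_gradient D u x) \<le> - ?s\<^sup>2 + P * ?s"
    using flux_inner_split[OF uH V uH] gradient_inner_self[of u] by simp
  have 2: "0 \<le> (LINT x|surface \<Gamma>out. b x * \<gamma> x * \<gamma> x)"
  proof (rule integral_nonneg_AE)
    show "AE x in surface \<Gamma>out. 0 \<le> b x * \<gamma> x * \<gamma> x"
      using boundary_dataD(5)[OF ab] by eventually_elim (simp add: mult.assoc)
  qed
  have "(LINT x|surface \<Gamma>in. (a x * g (\<gamma> x)) \<bullet> \<gamma> x) \<le> L2_norm (surface \<Gamma>in) (\<lambda>x. a x * g (\<gamma> x)) * L2_norm (surface \<Gamma>in) \<gamma>"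
    by (rule L2_inner_le_norms[OF gL(1) trace_D(2)[OF u]]) simp
  also have "\<dots> \<le> (1 * gb * sqrt inflow_const) * (Ct * H1_norm D u)"
    using gL(2) trace_D(4)[OF u] gb_nonneg const_nonneg by (intro mult_mono) auto
  finally have 3: "(LINT x|surface \<Gamma>in. a x * g (\<gamma> x) * \<gamma> x) \<le> X * H1_norm D u" by (simp add: X_def mult.assoc)
  have "F u \<le> - ?s\<^sup>2 + P * ?s + X * H1_norm D u" using eq 1 2 3 by (simp add: weak_form_def)
  from absorb_into_gradient[OF this H1_norm_sq]
  show ?thesis using const_nonneg by (simp add: P_def X_def power_mult_distrib mult_ac)
qed

text \<open>The drifts differ by \<open>f u1 - f u2\<close> times the gradient of V1 plus
  \<open>f u2\<close> times the gradient of \<open>V1 - V2\<close>. The Lipschitz constant of f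
  handles the first part, its bound the second, so V1 alone multiplies the unknown difference and
  enters the Gronwall coefficient.\<close>

lemma drift_difference:
  assumes "u1 \<in> H1 D" "u2 \<in> H1 D" "V1 \<in> W1inf D" "V2 \<in> W1inf D" "\<phi> \<in> H1 D"
  shows "(LINT x|lebesgue_on D. drift u1 V1 x \<bullet> weak_gradient D \<phi> x) - (LINT x|lebesgue_on D. drift u2 V2 x \<bullet> weak_gradient D \<phi> x)
    \<le> (Lf * W1inf_norm D V1 * L2_norm (lebesgue_on D) (\<lambda>x. u1 x - u2 x)
        + Fb * W1inf_norm D (\<lambda>x. V1 x - V2 x) * sqrt volume_const) * L2_norm (lebesgue_on D) (weak_gradient D \<phi>)"
proof -
  let ?M = "lebesgue_on D"
  define A where "A x = (f (u1 x) - f (u2 x)) *\<^sub>R weak_gradient D V1 x" for x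
  define B where "B x = f (u2 x) *\<^sub>R (weak_gradient D V1 x - weak_gradient D V2 x)" for x
  note u = H1_D(1)[OF open_D assms(1)] H1_D(1)[OF open_D assms(2)] and p = H1_D(3)[OF open_D assms(5)]
  note mf = measurable_f_comp[OF L2_D(1)[OF u(1)]] measurable_f_comp[OF L2_D(1)[OF u(2)]]
  note mV = Linf_measurable[OF W1inf_D(3)[OF open_D assms(3)]] Linf_measurable[OF W1inf_D(3)[OF open_D assms(4)]]
  have mA: "A \<in> borel_measurable ?M" and mB: "B \<in> borel_measurable ?M"
    unfolding A_def B_def using mf mV by measurable
  have bA: "AE x in ?M. norm (A x) \<le> (Lf * W1inf_norm D V1) * norm (u1 x - u2 x)"
    using weak_gradient_W1inf_bound[OF open_D assms(3)]
  proof eventually_elim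
    case (elim x)
    have "norm (A x) \<le> (Lf * \<bar>u1 x - u2 x\<bar>) * W1inf_norm D V1"
      unfolding A_def norm_scaleR using elim f_diff_le Lf_nonneg by (intro mult_mono) auto
    then show ?case by (simp add: mult_ac)
  qed
  note LA = L2_dominated[OF L2_diff[OF u] mA bA mult_nonneg_nonneg[OF Lf_nonneg w.nonneg[OF assms(3)]]]
  have bB: "AE x in ?M. norm (B x) \<le> Fb * W1inf_norm D (\<lambda>x. V1 x - V2 x)"
    using weak_gradient_W1inf_bound[OF open_D w.diff_closed[OF assms(3,4)]]
      weak_gradient_diff[OF open_D W1inf_D(2)[OF open_D assms(3)] W1inf_D(2)[OF open_D assms(4)]]
  proof eventually_elim
    case (elim x)
    show ?case unfolding B_def norm_scaleR using elim f_bound Fb_nonneg by (intro mult_mono) auto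
  qed
  have LB: "B \<in> L2 ?M" "L2_norm ?M B \<le> Fb * W1inf_norm D (\<lambda>x. V1 x - V2 x) * sqrt volume_const"
    using L2_bounded(1)[OF finite_D mB bB] L2_norm_le_bounded[OF finite_D mB bB] Fb_nonneg
      w.nonneg[OF w.diff_closed[OF assms(3,4)]] open_D
    by (simp_all add: volume_const_def measure_restrict_space)
  have "(LINT x|?M. drift u1 V1 x \<bullet> weak_gradient D \<phi> x) - (LINT x|?M. drift u2 V2 x \<bullet> weak_gradient D \<phi> x)
      = (LINT x|?M. drift u1 V1 x \<bullet> weak_gradient D \<phi> x - drift u2 V2 x \<bullet> weak_gradient D \<phi> x)"
    using L2_inner_integrable[OF drift_L2(1)[OF assms(1,3)] p] L2_inner_integrable[OF drift_L2(1)[OF assms(2,4)] p] by simp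
  also have "\<dots> = (LINT x|?M. A x \<bullet> weak_gradient D \<phi> x + B x \<bullet> weak_gradient D \<phi> x)"
    by (intro Bochner_Integration.integral_cong refl)
      (simp add: A_def B_def drift_def algebra_simps inner_add_left[symmetric] inner_diff_left[symmetric])
  also have "\<dots> = (LINT x|?M. A x \<bullet> weak_gradient D \<phi> x) + (LINT x|?M. B x \<bullet> weak_gradient D \<phi> x)"
    using L2_inner_integrable[OF LA(1) p] L2_inner_integrable[OF LB(1) p] by simp
  also have "\<dots> \<le> L2_norm ?M A * L2_norm ?M (weak_gradient D \<phi>) + L2_norm ?M B * L2_norm ?M (weak_gradient D \<phi>)"
    by (intro add_mono L2_inner_le_norms LA(1) LB(1) p)
  also have "\<dots> \<le> (Lf * W1inf_norm D V1 * L2_norm ?M (\<lambda>x. u1 x - u2 x)) * L2_norm ?M (weak_gradient D \<phi>)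
      + (Fb * W1inf_norm D (\<lambda>x. V1 x - V2 x) * sqrt volume_const) * L2_norm ?M (weak_gradient D \<phi>)"
    by (intro add_mono mult_right_mono LA(2) LB(2)) auto
  finally show ?thesis by (simp add: distrib_right)
qed

text \<open>At the outflow \<open>b1 * \<gamma>1 - b2 * \<gamma>2\<close> is split into
  \<open>b1 * \<omega>\<close> plus \<open>(b1 - b2) * \<gamma>2\<close>, and at the inflow
  \<open>a1 * g \<gamma>1 - a2 * g \<gamma>2\<close> into
  \<open>a1 * (g \<gamma>1 - g \<gamma>2)\<close> plus \<open>(a1 - a2) * g \<gamma>2\<close>.
  Multiplied by \<omega>, the first parts have the good sign and the second parts are bounded by X1
  and X2 times the H1 norm. In X1 one factor Ct comes from the trace of u2 and one from the trace of
  w. The factors 2 come from squaring \<open>P1 + P2\<close> and \<open>X1 + X2\<close>.\<close>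

lemma energy_rate_difference:
  assumes eq1: "weak_form a1 b1 V1 u1 \<gamma>1 F1 (\<lambda>x. u1 x - u2 x) (\<lambda>x. \<gamma>1 x - \<gamma>2 x)"
    and eq2: "weak_form a2 b2 V2 u2 \<gamma>2 F2 (\<lambda>x. u1 x - u2 x) (\<lambda>x. \<gamma>1 x - \<gamma>2 x)"
    and ab1: "boundary_data a1 b1" and ab2: "boundary_data a2 b2"
    and V: "V1 \<in> W1inf D" "V2 \<in> W1inf D" and u: "has_trace D u1 \<gamma>1" "has_trace D u2 \<gamma>2"
    and La: "AE x in surface \<Gamma>in. \<bar>a1 x - a2 x\<bar> \<le> La" "0 \<le> La"
    and Lb: "AE x in surface \<Gamma>out. \<bar>b1 x - b2 x\<bar> \<le> Lb" "0 \<le> Lb"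
  defines "w \<equiv> \<lambda>x. u1 x - u2 x"
  shows "F1 w - F2 w \<le> - (L2_norm (lebesgue_on D) (weak_gradient D w))\<^sup>2 / 2
    + (1 / 4 + 2 * (Lf * W1inf_norm D V1)\<^sup>2) * (L2_norm (lebesgue_on D) w)\<^sup>2
    + (2 * Fb\<^sup>2 * volume_const * (W1inf_norm D (\<lambda>x. V1 x - V2 x))\<^sup>2 + 2 * (Lb * Ct\<^sup>2)\<^sup>2 * (H1_norm D u2)\<^sup>2
       + 2 * (La * gb * sqrt inflow_const * Ct)\<^sup>2)"
proof -
  let ?M = "lebesgue_on D" and ?I = "surface \<Gamma>in" and ?O = "surface \<Gamma>out"
  define \<omega> where "\<omega> x = \<gamma>1 x - \<gamma>2 x" for x
  let ?s = "L2_norm ?M (weak_gradient D w)" and ?n = "H1_norm D w"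
  have tr: "has_trace D w \<omega>" unfolding w_def \<omega>_def by (rule has_trace_diff[OF domain u])
  note W = trace_D[OF tr] and U1 = trace_D[OF u(1)] and U2 = trace_D[OF u(2)]
  define P1 where "P1 = Lf * W1inf_norm D V1 * L2_norm ?M w"
  define P2 where "P2 = Fb * W1inf_norm D (\<lambda>x. V1 x - V2 x) * sqrt volume_const"
  define X1 where "X1 = Lb * Ct\<^sup>2 * H1_norm D u2"
  define X2 where "X2 = La * gb * sqrt inflow_const * Ct"
  note wH = W(1) note p = H1_D(3)[OF open_D wH]
  note gr = H1_D(3)[OF open_D U1(1)] H1_D(3)[OF open_D U2(1)]
  have "(LINT x|?M. weak_gradient D u1 x \<bullet> weak_gradient D w x) - (LINT x|?M. weak_gradient D u2 x \<bullet> weak_gradient D w x)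
     = (LINT x|?M. weak_gradient D u1 x \<bullet> weak_gradient D w x - weak_gradient D u2 x \<bullet> weak_gradient D w x)"
    using L2_inner_integrable[OF gr(1) p] L2_inner_integrable[OF gr(2) p] by simp
  also have "\<dots> = (LINT x|?M. weak_gradient D w x \<bullet> weak_gradient D w x)"
  proof (rule integral_cong_AE)
    show "AE x in ?M. weak_gradient D u1 x \<bullet> weak_gradient D w x - weak_gradient D u2 x \<bullet> weak_gradient D w x
       = weak_gradient D w x \<bullet> weak_gradient D w x"
      using weak_gradient_diff[OF open_D H1_D(2)[OF open_D U1(1)] H1_D(2)[OF open_D U2(1)]]
      unfolding w_def by eventually_elim (simp add: inner_diff_left)
    show "(\<lambda>x. weak_gradient D w x \<bullet> weak_gradient D w x) \<in> borel_measurable ?M"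
      by (rule borel_measurable_integrable[OF L2_inner_integrable[OF p p]])
    show "(\<lambda>x. weak_gradient D u1 x \<bullet> weak_gradient D w x - weak_gradient D u2 x \<bullet> weak_gradient D w x) \<in> borel_measurable ?M"
      using L2_inner_integrable[OF gr(1) p] L2_inner_integrable[OF gr(2) p] by simp
  qed
  also have "\<dots> = ?s\<^sup>2" by (rule gradient_inner_self)
  finally have 1: "(LINT x|?M. flux u1 V1 x \<bullet> weak_gradient D w x) - (LINT x|?M. flux u2 V2 x \<bullet> weak_gradient D w x) \<le> - ?s\<^sup>2 + (P1 + P2) * ?s"
    using flux_inner_split[OF U1(1) V(1) wH] flux_inner_split[OF U2(1) V(2) wH] drift_difference[OF U1(1) U2(1) V wH]
    by (simp add: P1_def P2_def w_def)
  note b = boundary_dataD(4,5)[OF ab1] boundary_dataD(4)[OF ab2]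
    and a = boundary_dataD(1,2)[OF ab1] boundary_dataD(1)[OF ab2]
  note B1 = boundary_terms_L2[OF ab1 u(1)] and B2 = boundary_terms_L2[OF ab2 u(2)]
  have 2: "- ((LINT x|?O. b1 x * \<gamma>1 x * \<omega> x) - (LINT x|?O. b2 x * \<gamma>2 x * \<omega> x)) \<le> X1 * ?n"
  proof -
    have m: "(\<lambda>x. (b2 x - b1 x) * \<gamma>2 x) \<in> borel_measurable ?O"
      by (intro borel_measurable_times borel_measurable_diff b L2_D(1) U2)
    have bd: "AE x in ?O. norm ((b2 x - b1 x) * \<gamma>2 x) \<le> Lb * norm (\<gamma>2 x)"
      using Lb(1) by eventually_elim (simp add: abs_mult abs_minus_commute mult_right_mono)
    note L = L2_dominated[OF U2(3) m bd Lb(2)]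
    note i = L2_inner_integrable[OF B1(2) W(3)] L2_inner_integrable[OF B2(2) W(3)] L2_inner_integrable[OF L(1) W(3)]
    have "- ((LINT x|?O. b1 x * \<gamma>1 x * \<omega> x) - (LINT x|?O. b2 x * \<gamma>2 x * \<omega> x)) = (LINT x|?O. b2 x * \<gamma>2 x * \<omega> x - b1 x * \<gamma>1 x * \<omega> x)"
      using i by simp
    also have "\<dots> \<le> (LINT x|?O. ((b2 x - b1 x) * \<gamma>2 x) \<bullet> \<omega> x)"
    proof (rule integral_mono_AE)
      show "AE x in ?O. b2 x * \<gamma>2 x * \<omega> x - b1 x * \<gamma>1 x * \<omega> x \<le> ((b2 x - b1 x) * \<gamma>2 x) \<bullet> \<omega> x"
        using b(2)
      proof eventually_elim
        case (elim x)
        have "0 \<le> b1 x * (\<omega> x * \<omega> x)" using elim by simp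
        then show ?case by (simp add: \<omega>_def algebra_simps)
      qed
    qed (use i in simp_all)
    also have "\<dots> \<le> L2_norm ?O (\<lambda>x. (b2 x - b1 x) * \<gamma>2 x) * L2_norm ?O \<omega>" by (rule L2_inner_le_norms[OF L(1) W(3)])
    also have "\<dots> \<le> (Lb * (Ct * H1_norm D u2)) * (Ct * ?n)"
      using L(2) U2(5) W(5) Lb(2) trace_nonneg by (intro mult_mono order_trans[OF L(2)] mult_left_mono) auto
    finally show ?thesis by (simp add: X1_def power2_eq_square mult_ac)
  qed
  have 3: "(LINT x|?I. a1 x * g (\<gamma>1 x) * \<omega> x) - (LINT x|?I. a2 x * g (\<gamma>2 x) * \<omega> x) \<le> X2 * ?n"
  proof -
    have mc: "(\<lambda>x. a1 x - a2 x) \<in> borel_measurable ?I" using a by simp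
    note L = g_trace_L2[OF u(2) mc La]
    note i = L2_inner_integrable[OF B1(1) W(2)] L2_inner_integrable[OF B2(1) W(2)] L2_inner_integrable[OF L(1) W(2)]
    have "(LINT x|?I. a1 x * g (\<gamma>1 x) * \<omega> x) - (LINT x|?I. a2 x * g (\<gamma>2 x) * \<omega> x) = (LINT x|?I. a1 x * g (\<gamma>1 x) * \<omega> x - a2 x * g (\<gamma>2 x) * \<omega> x)"
      using i by simp
    also have "\<dots> \<le> (LINT x|?I. ((a1 x - a2 x) * g (\<gamma>2 x)) \<bullet> \<omega> x)"
    proof (rule integral_mono_AE)
      show "AE x in ?I. a1 x * g (\<gamma>1 x) * \<omega> x - a2 x * g (\<gamma>2 x) * \<omega> x \<le> ((a1 x - a2 x) * g (\<gamma>2 x)) \<bullet> \<omega> x"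
        using a(2)
      proof eventually_elim
        case (elim x)
        have "(g (\<gamma>1 x) - g (\<gamma>2 x)) * \<omega> x \<le> 0"
          using antimonoD[OF g_antimono, of "\<gamma>1 x" "\<gamma>2 x"] antimonoD[OF g_antimono, of "\<gamma>2 x" "\<gamma>1 x"]
          by (cases "\<gamma>1 x \<le> \<gamma>2 x") (auto simp: \<omega>_def intro: mult_nonneg_nonpos mult_nonpos_nonneg)
        then have "a1 x * ((g (\<gamma>1 x) - g (\<gamma>2 x)) * \<omega> x) \<le> 0" using elim by (simp add: mult_nonneg_nonpos)
        then show ?case by (simp add: algebra_simps)
      qed
    qed (use i in simp_all)
    also have "\<dots> \<le> L2_norm ?I (\<lambda>x. (a1 x - a2 x) * g (\<gamma>2 x)) * L2_norm ?I \<omega>" by (rule L2_inner_le_norms[OF L(1) W(2)])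
    also have "\<dots> \<le> (La * gb * sqrt inflow_const) * (Ct * ?n)"
      using L(2) W(4) La(2) gb_nonneg const_nonneg by (intro mult_mono) auto
    finally show ?thesis by (simp add: X2_def mult.assoc)
  qed
  have "F1 w - F2 w \<le> - ?s\<^sup>2 + (P1 + P2) * ?s + (X1 + X2) * ?n"
    using eq1 eq2 1 2 3 by (simp add: weak_form_def w_def \<omega>_def distrib_right)
  from absorb_into_gradient[OF this H1_norm_sq]
  have "F1 w - F2 w \<le> - ?s\<^sup>2 / 2 + (L2_norm ?M w)\<^sup>2 / 4 + (P1 + P2)\<^sup>2 + (X1 + X2)\<^sup>2" .
  also have "\<dots> \<le> - ?s\<^sup>2 / 2 + (L2_norm ?M w)\<^sup>2 / 4 + (2 * P1\<^sup>2 + 2 * P2\<^sup>2) + (2 * X1\<^sup>2 + 2 * X2\<^sup>2)"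
    by (intro add_mono add_power2_le) auto
  also have "P2\<^sup>2 = Fb\<^sup>2 * volume_const * (W1inf_norm D (\<lambda>x. V1 x - V2 x))\<^sup>2"
    using const_nonneg by (simp add: P2_def power_mult_distrib)
  finally show ?thesis by (simp add: P1_def X1_def X2_def power_mult_distrib algebra_simps)
qed

end

section \<open>Integration in time and the stability estimate\<close>

lemma bochner_norm_sq: "(bochner_norm T N u)\<^sup>2 = (LINT t|lebesgue_on {0<..<T}. (N (u t))\<^sup>2)"
  by (simp add: bochner_norm_def)

lemma LINT_const_interval: "0 < T \<Longrightarrow> (LINT t|lebesgue_on {0<..<T}. c) = T * (c::real)"
  by (simp add: measure_restrict_space)

context boundary_problem
begin

text \<open>The equation is provided for every Bochner test function with traces because it is used
  in two ways: with a solution itself and with the difference of two solutions.\<close>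

lemma solution_energy_space:
  assumes T: "0 < T" and pos: "0 < a0" "0 < b0" and adm: "admissible_data D T \<Gamma>in \<Gamma>out a0 b0 a b V u0"
    and sol: "weak_solution D T \<Gamma>in \<Gamma>out f g a b V u" and init: "has_initial_value D T u u0"
  obtains u' \<gamma> v where "energy_space D T u u' v" "AE t in lebesgue_on {0<..<T}. has_trace D (u t) (\<gamma> t)"
    "AE t in lebesgue_on {0<..<T}. boundary_data (\<lambda>x. a (t, x)) (\<lambda>x. b (t, x))"
    "\<And>z \<zeta>. z \<in> bochner_L2 T (H1 D) (H1_norm D) \<Longrightarrow> AE t in lebesgue_on {0<..<T}. has_trace D (z t) (\<zeta> t) \<Longrightarrow>
      AE t in lebesgue_on {0<..<T}. weak_form (\<lambda>x. a (t, x)) (\<lambda>x. b (t, x)) (V t) (u t) (\<gamma> t) (u' t) (z t) (\<zeta> t)"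
    "AE x in lebesgue_on D. v 0 x = u0 x"
proof -
  let ?M = "lebesgue_on {0<..<T}"
  obtain u' \<gamma> where u: "u \<in> bochner_L2 T (H1 D) (H1_norm D)" and u': "has_weak_time_derivative D T u u'"
    and \<gamma>: "AE t in ?M. has_trace D (u t) (\<gamma> t)"
    and eq: "\<And>\<phi> \<eta>. \<phi> \<in> H1 D \<Longrightarrow> has_trace D \<phi> \<eta> \<Longrightarrow>
        AE t in ?M. weak_form (\<lambda>x. a (t, x)) (\<lambda>x. b (t, x)) (V t) (u t) (\<gamma> t) (u' t) \<phi> \<eta>"
    using sol unfolding weak_solution_def weak_form_def flux_def by blast
  obtain v where v: "\<forall>t\<in>{0..T}. v t \<in> L2 (lebesgue_on D)"
    "\<forall>t\<in>{0..T}. ((\<lambda>s. L2_norm (lebesgue_on D) (\<lambda>x. v s x - v t x)) \<longlongrightarrow> 0) (at t within {0..T})"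
    "AE t in ?M. AE x in lebesgue_on D. u t x = v t x" "AE x in lebesgue_on D. v 0 x = u0 x"
    using init unfolding has_initial_value_def by blast
  have u'b: "u' \<in> bochner_L2 T (H1_dual D) (H1_dual_norm D)" using u' by (simp add: has_weak_time_derivative_def)
  have "time_dependent D T u u' v"
    by unfold_locales (use open_D T u u'b v in auto)
  then have es: "energy_space D T u u' v" using u' by (rule energy_space_weak_derivative)
  have a: "a \<in> Linf (lateral T \<Gamma>in)" "AE p in lateral T \<Gamma>in. a0 \<le> a p \<and> a p \<le> 1"
    and b: "b \<in> Linf (lateral T \<Gamma>out)" "AE p in lateral T \<Gamma>out. b0 \<le> b p \<and> b p \<le> 1"
    and V: "V \<in> bochner_L2 T (W1inf D) (W1inf_norm D)"
    using adm by (auto simp: admissible_data_def)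
  have "AE t in ?M. t \<in> {0<..<T}" by (rule AE_I2) simp
  with AE_lateral_slice[OF finite_in a(2)] AE_lateral_slice[OF finite_out b(2)]
  have bd: "AE t in ?M. boundary_data (\<lambda>x. a (t, x)) (\<lambda>x. b (t, x))"
  proof eventually_elim
    case (elim t)
    have "AE x in surface \<Gamma>in. 0 \<le> a (t, x) \<and> a (t, x) \<le> 1" using elim(1) by eventually_elim (use pos in simp)
    moreover have "AE x in surface \<Gamma>out. 0 \<le> b (t, x) \<and> b (t, x) \<le> 1" using elim(2) by eventually_elim (use pos in simp)
    ultimately show ?case
      unfolding boundary_data_def
      using lateral_slice_measurable[OF Linf_measurable[OF a(1)] elim(3)] lateral_slice_measurable[OF Linf_measurable[OF b(1)] elim(3)]
      by (intro conjI)
  qed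
  show ?thesis
  proof (rule that[OF es \<gamma> bd _ v(4)])
    fix z \<zeta> assume z: "z \<in> bochner_L2 T (H1 D) (H1_norm D)" "AE t in ?M. has_trace D (z t) (\<zeta> t)"
    show "AE t in ?M. weak_form (\<lambda>x. a (t, x)) (\<lambda>x. b (t, x)) (V t) (u t) (\<gamma> t) (u' t) (z t) (\<zeta> t)"
      by (rule weak_form_tested[OF eq d.bochner_D(1)[OF u'b] \<gamma> bd w.bochner_D(1)[OF V] z]) (rule trace_D)
  qed
qed

text \<open>\<open>energy_gronwall\<close> with the constant coefficient 1/4: four times its
  integral is T, whence the exponent T + 1.\<close>

lemma solution_bound:
  assumes T: "0 < T" and es: "energy_space D T u u' v" and V: "V \<in> bochner_L2 T (W1inf D) (W1inf_norm D)"
    and \<gamma>: "AE t in lebesgue_on {0<..<T}. has_trace D (u t) (\<gamma> t)"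
    and bd: "AE t in lebesgue_on {0<..<T}. boundary_data (\<lambda>x. a (t, x)) (\<lambda>x. b (t, x))"
    and eq: "AE t in lebesgue_on {0<..<T}. weak_form (\<lambda>x. a (t, x)) (\<lambda>x. b (t, x)) (V t) (u t) (\<gamma> t) (u' t) (u t) (\<gamma> t)"
  shows "(LINT t|lebesgue_on {0<..<T}. (H1_norm D (u t))\<^sup>2) \<le> (T + 1) * exp (T + 1) *
     ((L2_norm (lebesgue_on D) (v 0))\<^sup>2 + 2 * (Fb\<^sup>2 * volume_const * (bochner_norm T (W1inf_norm D) V)\<^sup>2
        + T * (gb * sqrt inflow_const * Ct)\<^sup>2))"
proof -
  let ?M = "lebesgue_on {0<..<T}"
  interpret es: energy_space D T u u' v by fact
  interpret fm: finite_measure ?M by (rule finite_measure_interval)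
  define \<beta> where "\<beta> t = Fb\<^sup>2 * volume_const * (W1inf_norm D (V t))\<^sup>2 + (gb * sqrt inflow_const * Ct)\<^sup>2" for t
  note iV = w.bochner_D(2)[OF V]
  have i\<beta>: "integrable ?M \<beta>" unfolding \<beta>_def using iV by simp
  have int\<beta>: "(LINT t|?M. \<beta> t) = Fb\<^sup>2 * volume_const * (bochner_norm T (W1inf_norm D) V)\<^sup>2 + T * (gb * sqrt inflow_const * Ct)\<^sup>2"
    unfolding \<beta>_def bochner_norm_sq using iV LINT_const_interval[OF T] by simp
  have "(LINT t|?M. (H1_norm D (u t))\<^sup>2) \<le> (T + 1) * exp (4 * (LINT t|?M. 1/4) + 1) * ((L2_norm (lebesgue_on D) (v 0))\<^sup>2 + 2 * (LINT t|?M. \<beta> t))"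
  proof (rule es.energy_gronwall)
    show "integrable ?M (\<lambda>t. 1/4 :: real)" by simp
    show "integrable ?M \<beta>" by (rule i\<beta>)
    show "0 \<le> \<beta> t" for t using const_nonneg by (simp add: \<beta>_def)
    show "AE t in ?M. u' t (u t) \<le> - (L2_norm (lebesgue_on D) (weak_gradient D (u t)))\<^sup>2 / 2
        + 1/4 * (L2_norm (lebesgue_on D) (u t))\<^sup>2 + \<beta> t"
      using eq bd w.bochner_D(1)[OF V] \<gamma>
    proof eventually_elim
      case (elim t)
      from energy_rate_single[OF this] show ?case by (simp add: \<beta>_def)
    qed
  qed simp
  then show ?thesis unfolding int\<beta> using LINT_const_interval[OF T, of "1/4"] by simp
qed

text \<open>The Gronwall coefficient contains the squared norm of \<open>V1 t\<close>, which is
  integrable in time but need not be bounded. The term with \<open>b1 - b2\<close> carries the H1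
  norm of u2, whose square integral is kept in the bound and estimated afterwards by
  \<open>solution_bound\<close>.\<close>

lemma difference_bound:
  assumes T: "0 < T" and es1: "energy_space D T u1 u1' v1" and es2: "energy_space D T u2 u2' v2"
    and V1: "V1 \<in> bochner_L2 T (W1inf D) (W1inf_norm D)" and V2: "V2 \<in> bochner_L2 T (W1inf D) (W1inf_norm D)"
    and \<gamma>1: "AE t in lebesgue_on {0<..<T}. has_trace D (u1 t) (\<gamma>1 t)" and \<gamma>2: "AE t in lebesgue_on {0<..<T}. has_trace D (u2 t) (\<gamma>2 t)"
    and bd1: "AE t in lebesgue_on {0<..<T}. boundary_data (\<lambda>x. a1 (t, x)) (\<lambda>x. b1 (t, x))"
    and bd2: "AE t in lebesgue_on {0<..<T}. boundary_data (\<lambda>x. a2 (t, x)) (\<lambda>x. b2 (t, x))"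
    and eq1: "AE t in lebesgue_on {0<..<T}. weak_form (\<lambda>x. a1 (t, x)) (\<lambda>x. b1 (t, x)) (V1 t) (u1 t) (\<gamma>1 t) (u1' t) (\<lambda>x. u1 t x - u2 t x) (\<lambda>x. \<gamma>1 t x - \<gamma>2 t x)"
    and eq2: "AE t in lebesgue_on {0<..<T}. weak_form (\<lambda>x. a2 (t, x)) (\<lambda>x. b2 (t, x)) (V2 t) (u2 t) (\<gamma>2 t) (u2' t) (\<lambda>x. u1 t x - u2 t x) (\<lambda>x. \<gamma>1 t x - \<gamma>2 t x)"
    and La: "AE t in lebesgue_on {0<..<T}. AE x in surface \<Gamma>in. \<bar>a1 (t, x) - a2 (t, x)\<bar> \<le> La" "0 \<le> La"
    and Lb: "AE t in lebesgue_on {0<..<T}. AE x in surface \<Gamma>out. \<bar>b1 (t, x) - b2 (t, x)\<bar> \<le> Lb" "0 \<le> Lb"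
  shows "(LINT t|lebesgue_on {0<..<T}. (H1_norm D (\<lambda>x. u1 t x - u2 t x))\<^sup>2)
     \<le> (T + 1) * exp (T + 8 * Lf\<^sup>2 * (bochner_norm T (W1inf_norm D) V1)\<^sup>2 + 1) *
       ((L2_norm (lebesgue_on D) (\<lambda>x. v1 0 x - v2 0 x))\<^sup>2
        + 2 * (2 * Fb\<^sup>2 * volume_const * (bochner_norm T (W1inf_norm D) (\<lambda>t x. V1 t x - V2 t x))\<^sup>2
          + 2 * (Lb * Ct\<^sup>2)\<^sup>2 * (LINT t|lebesgue_on {0<..<T}. (H1_norm D (u2 t))\<^sup>2)
          + T * (2 * (La * gb * sqrt inflow_const * Ct)\<^sup>2)))"
proof -
  let ?M = "lebesgue_on {0<..<T}"
  interpret es2: energy_space D T u2 u2' v2 by fact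
  interpret es: energy_space D T "\<lambda>t x. u1 t x - u2 t x" "\<lambda>t \<phi>. u1' t \<phi> - u2' t \<phi>" "\<lambda>t x. v1 t x - v2 t x"
    by (rule energy_space_diff[OF es1 es2])
  interpret fm: finite_measure ?M by (rule finite_measure_interval)
  define \<alpha> where "\<alpha> t = 1/4 + 2 * (Lf * W1inf_norm D (V1 t))\<^sup>2" for t
  define \<beta> where "\<beta> t = 2 * Fb\<^sup>2 * volume_const * (W1inf_norm D (\<lambda>x. V1 t x - V2 t x))\<^sup>2
    + 2 * (Lb * Ct\<^sup>2)\<^sup>2 * (H1_norm D (u2 t))\<^sup>2 + 2 * (La * gb * sqrt inflow_const * Ct)\<^sup>2" for t
  note i1 = w.bochner_D(2)[OF V1] and id = w.bochner_D(2)[OF w.bochner_diff[OF V1 V2]] and iu = h.bochner_D(2)[OF es2.w]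
  have i\<alpha>: "integrable ?M \<alpha>" unfolding \<alpha>_def power_mult_distrib using i1 by simp
  have i\<beta>: "integrable ?M \<beta>" unfolding \<beta>_def using id iu by simp
  have int\<alpha>: "4 * (LINT t|?M. \<alpha> t) = T + 8 * Lf\<^sup>2 * (bochner_norm T (W1inf_norm D) V1)\<^sup>2"
    unfolding \<alpha>_def bochner_norm_sq power_mult_distrib using i1 LINT_const_interval[OF T, of "1/4"] by simp
  have int\<beta>: "(LINT t|?M. \<beta> t) = 2 * Fb\<^sup>2 * volume_const * (bochner_norm T (W1inf_norm D) (\<lambda>t x. V1 t x - V2 t x))\<^sup>2
          + 2 * (Lb * Ct\<^sup>2)\<^sup>2 * (LINT t|?M. (H1_norm D (u2 t))\<^sup>2) + T * (2 * (La * gb * sqrt inflow_const * Ct)\<^sup>2)"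
    unfolding \<beta>_def bochner_norm_sq using id iu LINT_const_interval[OF T, of "2 * (La * gb * sqrt inflow_const * Ct)\<^sup>2"] by simp
  have "(LINT t|?M. (H1_norm D (\<lambda>x. u1 t x - u2 t x))\<^sup>2) \<le> (T + 1) * exp (4 * (LINT t|?M. \<alpha> t) + 1)
      * ((L2_norm (lebesgue_on D) (\<lambda>x. v1 0 x - v2 0 x))\<^sup>2 + 2 * (LINT t|?M. \<beta> t))"
  proof (rule es.energy_gronwall[OF i\<alpha> _ i\<beta>])
    show "0 \<le> \<alpha> t" "0 \<le> \<beta> t" for t using const_nonneg by (simp_all add: \<alpha>_def \<beta>_def)
    show "AE t in ?M. u1' t (\<lambda>x. u1 t x - u2 t x) - u2' t (\<lambda>x. u1 t x - u2 t x)
        \<le> - (L2_norm (lebesgue_on D) (weak_gradient D (\<lambda>x. u1 t x - u2 t x)))\<^sup>2 / 2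
        + \<alpha> t * (L2_norm (lebesgue_on D) (\<lambda>x. u1 t x - u2 t x))\<^sup>2 + \<beta> t"
      using eq1 eq2 bd1 bd2 w.bochner_D(1)[OF V1] w.bochner_D(1)[OF V2] \<gamma>1 \<gamma>2 La(1) Lb(1)
    proof eventually_elim
      case (elim t)
      from energy_rate_difference[OF elim(1-9) La(2) elim(10) Lb(2)] show ?case by (simp only: \<alpha>_def \<beta>_def)
    qed
  qed
  then show ?thesis by (simp only: int\<alpha> int\<beta>)
qed

end

text \<open>Bookkeeping of constants; \<open>M\<close> bounds the squared norms of the potentials.
  By \<open>T + 1 \<le> exp T\<close> the bound on N2 becomes
  \<open>\<kappa> * exp (3 * T + 1)\<close>, and the prefactor of N1 contributes another
  \<open>exp (2 * T + 8 * Lf\<^sup>2 * M + 1)\<close>.\<close>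

lemma stability_constants:
  fixes T e0 dV La Lb vol Fb Lf M1 M X Ct N2 N1 :: real
  assumes T: "0 < T" and nn: "0 \<le> vol" "0 \<le> e0" "0 \<le> dV"
    and N2: "N2 \<le> (T + 1) * exp (T + 1) * (E2 + 2 * (Fb\<^sup>2 * vol * M2 + T * X\<^sup>2))" and E2: "E2 \<le> vol" and M: "M1 \<le> M" "M2 \<le> M"
    and N1: "N1 \<le> (T + 1) * exp (T + 8 * Lf\<^sup>2 * M1 + 1) * (e0 + 2 * (2 * Fb\<^sup>2 * vol * dV + 2 * (Lb * Ct\<^sup>2)\<^sup>2 * N2 + T * (2 * (La * X)\<^sup>2)))"
    and "0 \<le> M" "0 \<le> N2"
  defines "\<kappa> \<equiv> vol + 2 * Fb\<^sup>2 * vol * M + 2 * X\<^sup>2"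
  shows "N1 \<le> ((1 + 4 * Fb\<^sup>2 * vol + 4 * Ct^4 * \<kappa> + 4 * X\<^sup>2) * exp (8 * Lf\<^sup>2 * M + 2)) * exp (5 * T) * (La\<^sup>2 + Lb\<^sup>2 + dV + e0)"
proof -
  let ?e = "exp (3 * T + 1)"
  have T1: "T + 1 \<le> exp T" using exp_ge_add_one_self[of T] by linarith
  have \<kappa>0: "0 \<le> \<kappa>" using nn \<open>0 \<le> M\<close> by (simp add: \<kappa>_def)
  have "E2 + 2 * (Fb\<^sup>2 * vol * M2 + T * X\<^sup>2) \<le> vol + 2 * (Fb\<^sup>2 * vol * M + T * X\<^sup>2)"
    using E2 M nn T by (intro add_mono mult_left_mono) auto
  also have "\<dots> \<le> \<kappa> * (T + 1)"
  proof -
    have "\<kappa> * (T + 1) - (vol + 2 * (Fb\<^sup>2 * vol * M + T * X\<^sup>2)) = (vol + 2 * Fb\<^sup>2 * vol * M) * T + 2 * X\<^sup>2"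
      by (simp add: \<kappa>_def algebra_simps)
    moreover have "0 \<le> (vol + 2 * Fb\<^sup>2 * vol * M) * T + 2 * X\<^sup>2" using nn \<open>0 \<le> M\<close> T by simp
    ultimately show ?thesis by linarith
  qed
  also have "\<dots> \<le> \<kappa> * exp T" using T1 \<kappa>0 by (intro mult_left_mono)
  finally have k: "E2 + 2 * (Fb\<^sup>2 * vol * M2 + T * X\<^sup>2) \<le> \<kappa> * exp T" .
  have "N2 \<le> (T + 1) * exp (T + 1) * (\<kappa> * exp T)"
    using N2 k T by (intro order_trans[OF N2] mult_left_mono) auto
  also have "\<dots> \<le> exp T * exp (T + 1) * (\<kappa> * exp T)" using T1 \<kappa>0 by (intro mult_right_mono) auto
  also have "\<dots> = \<kappa> * ?e" by (simp add: mult_exp_exp algebra_simps)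
  finally have N2': "N2 \<le> \<kappa> * ?e" .
  have e1: "1 \<le> ?e" and eT: "T \<le> ?e"
    using T exp_ge_add_one_self[of "3 * T + 1"] by linarith+
  define S where "S = La\<^sup>2 + Lb\<^sup>2 + dV + e0"
  define K where "K = 1 + 4 * Fb\<^sup>2 * vol + 4 * Ct^4 * \<kappa> + 4 * X\<^sup>2"
  have S: "e0 \<le> S" "dV \<le> S" "La\<^sup>2 \<le> S" "Lb\<^sup>2 \<le> S" "0 \<le> S" using nn by (auto simp: S_def)
  have K0: "0 \<le> K" using nn \<kappa>0 by (simp add: K_def)
  have "e0 + 2 * (2 * Fb\<^sup>2 * vol * dV + 2 * (Lb * Ct\<^sup>2)\<^sup>2 * N2 + T * (2 * (La * X)\<^sup>2))
      = e0 * 1 + (4 * Fb\<^sup>2 * vol) * (dV * 1) + (4 * Ct^4) * (Lb\<^sup>2 * N2) + (4 * X\<^sup>2) * (La\<^sup>2 * T)"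
    by (simp add: power_mult_distrib algebra_simps)
  \<comment> \<open>Each data term is bounded by the sum S, and 1, T and N2 by multiples of the same
    exponential \<open>?e\<close>.\<close>
  also have "\<dots> \<le> S * ?e + (4 * Fb\<^sup>2 * vol) * (S * ?e) + (4 * Ct^4) * (S * (\<kappa> * ?e)) + (4 * X\<^sup>2) * (S * ?e)"
    using S e1 eT N2' nn T \<open>0 \<le> N2\<close> by (intro add_mono mult_left_mono mult_mono) auto
  also have "\<dots> = K * ?e * S" by (simp add: K_def algebra_simps)
  finally have 1: "e0 + 2 * (2 * Fb\<^sup>2 * vol * dV + 2 * (Lb * Ct\<^sup>2)\<^sup>2 * N2 + T * (2 * (La * X)\<^sup>2)) \<le> K * ?e * S" .
  have "8 * Lf\<^sup>2 * M1 \<le> 8 * Lf\<^sup>2 * M" using M by (intro mult_left_mono) auto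
  then have 2: "(T + 1) * exp (T + 8 * Lf\<^sup>2 * M1 + 1) \<le> exp T * exp (T + 8 * Lf\<^sup>2 * M + 1)"
    using T1 T by (intro mult_mono) auto
  have "N1 \<le> (T + 1) * exp (T + 8 * Lf\<^sup>2 * M1 + 1) * (K * ?e * S)"
    using 1 T by (intro order_trans[OF N1] mult_left_mono) auto
  also have "\<dots> \<le> exp T * exp (T + 8 * Lf\<^sup>2 * M + 1) * (K * ?e * S)"
    using 2 K0 S(5) by (intro mult_right_mono) auto
  also have "\<dots> = K * S * (exp T * exp (T + 8 * Lf\<^sup>2 * M + 1) * ?e)" by simp
  also have "exp T * exp (T + 8 * Lf\<^sup>2 * M + 1) * ?e = exp (8 * Lf\<^sup>2 * M + 2) * exp (5 * T)"
    unfolding exp_add[symmetric] by (simp add: algebra_simps)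
  finally show ?thesis by (simp add: K_def S_def mult_ac)
qed

text \<open>The essential bound holds on a closed set of full measure, hence everywhere. Pointwise
  bounds are wanted because f and g are composed with solutions and traces, whose values may lie in
  any given null set.\<close>

lemma W1inf_continuous_bounded:
  fixes f :: "real \<Rightarrow> real"
  assumes "f \<in> W1inf UNIV" "continuous_on UNIV f"
  obtains c where "\<And>s. \<bar>f s\<bar> \<le> c"
proof -
  have "f \<in> Linf lebesgue" using assms(1) by (simp add: W1inf_def lebesgue_on_UNIV_eq)
  from Linf_norm_AE[OF this] have ae: "AE s in lebesgue. s \<in> {s. \<bar>f s\<bar> \<le> Linf_norm lebesgue f}" by simp
  have "closed {s. \<bar>f s\<bar> \<le> Linf_norm lebesgue f}"
    by (intro closed_Collect_le continuous_intros assms(2))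
  then show ?thesis using mem_closed_if_AE_lebesgue[OF _ ae] by (intro that[of "Linf_norm lebesgue f"]) blast
qed

lemma openin_frontier_borel:
  fixes D \<Gamma> :: "'a::euclidean_space set"
  assumes "openin (top_of_set (frontier D)) \<Gamma>"
  shows "\<Gamma> \<subseteq> frontier D" "\<Gamma> \<in> sets borel"
proof -
  obtain U where "open U" "\<Gamma> = frontier D \<inter> U" using assms by (auto simp: openin_open)
  then show "\<Gamma> \<subseteq> frontier D" "\<Gamma> \<in> sets borel" by (auto simp: borel_open borel_closed)
qed

theorem theorem3p9:
  fixes D \<Gamma>in \<Gamma>out :: "'a::euclidean_space set"
    and f g :: "real \<Rightarrow> real"
    and Lf Lg a0 b0 M :: real
  assumes "DIM('a) \<in> {1, 2, 3}"
    and "bounded_lipschitz_domain D"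
    and "openin (top_of_set (frontier D)) \<Gamma>in"
    and "openin (top_of_set (frontier D)) \<Gamma>out"
    and "\<Gamma>in \<inter> \<Gamma>out = {}"
    and "\<Gamma>out \<noteq> {}"
    and "f \<in> W1inf UNIV" and "Lf-lipschitz_on UNIV f"
    and "f 0 = 0" and "f 1 = 0" and "\<And>s. 0 < s \<Longrightarrow> s < 1 \<Longrightarrow> f s \<ge> 0"
    and "g \<in> W1inf UNIV" and "Lg-lipschitz_on UNIV g"
    and "antimono g" and "g 0 = 1" and "g 1 = 0"
    and "a0 > 0" and "b0 > 0"
  shows "\<exists>C Ct. C > 0 \<and> Ct > 0 \<and>
    (\<forall>T a1 a2 b1 b2 V1 V2 u01 u02 u1 u2.
       T > 0 \<longrightarrow>
       admissible_data D T \<Gamma>in \<Gamma>out a0 b0 a1 b1 V1 u01 \<longrightarrow>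
       admissible_data D T \<Gamma>in \<Gamma>out a0 b0 a2 b2 V2 u02 \<longrightarrow>
       bochner_norm T (W1inf_norm D) V1 \<le> M \<longrightarrow>
       bochner_norm T (W1inf_norm D) V2 \<le> M \<longrightarrow>
       weak_solution D T \<Gamma>in \<Gamma>out f g a1 b1 V1 u1 \<longrightarrow> has_initial_value D T u1 u01 \<longrightarrow>
       weak_solution D T \<Gamma>in \<Gamma>out f g a2 b2 V2 u2 \<longrightarrow> has_initial_value D T u2 u02 \<longrightarrow>
       (bochner_norm T (H1_norm D) (\<lambda>t x. u1 t x - u2 t x))\<^sup>2
         \<le> C * exp (Ct * T) *
             ((Linf_norm (lateral T \<Gamma>in) (\<lambda>p. a1 p - a2 p))\<^sup>2
              + (Linf_norm (lateral T \<Gamma>out) (\<lambda>p. b1 p - b2 p))\<^sup>2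
              + (bochner_norm T (W1inf_norm D) (\<lambda>t x. V1 t x - V2 t x))\<^sup>2
              + (L2_norm (lebesgue_on D) (\<lambda>x. u01 x - u02 x))\<^sup>2))"
proof -
  have cont: "continuous_on UNIV f" "continuous_on UNIV g"
    using lipschitz_on_continuous_on assms(8,13) by blast+
  obtain Fb where Fb: "\<And>s. \<bar>f s\<bar> \<le> Fb" using W1inf_continuous_bounded[OF assms(7) cont(1)] by blast
  obtain gb where gb: "\<And>s. \<bar>g s\<bar> \<le> gb" using W1inf_continuous_bounded[OF assms(12) cont(2)] by blast
  obtain Ct where Ct: "0 \<le> Ct" "\<And>u v. has_trace D u v \<Longrightarrow> L2_norm (surface (frontier D)) v \<le> Ct * H1_norm D u"
    using trace_inequality[OF assms(2)] by blast
  interpret boundary_problem D \<Gamma>in \<Gamma>out f g Lf Fb gb Ct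
    by (rule boundary_problem.intro[OF assms(2) openin_frontier_borel[OF assms(3)] openin_frontier_borel[OF assms(4)]
          assms(8) Fb cont(2) gb assms(14) Ct])
  define X where "X = gb * sqrt inflow_const * Ct"
  define \<kappa> where "\<kappa> = volume_const + 2 * Fb\<^sup>2 * volume_const * M\<^sup>2 + 2 * X\<^sup>2"
  \<comment> \<open>The constant of \<open>stability_constants\<close>, whose parameter
    \<open>M\<close> is \<open>M\<^sup>2\<close> here because it bounds squared norms.\<close>
  define C where "C = (1 + 4 * Fb\<^sup>2 * volume_const + 4 * Ct^4 * \<kappa> + 4 * X\<^sup>2) * exp (8 * Lf\<^sup>2 * M\<^sup>2 + 2)"
  have "0 \<le> \<kappa>" using const_nonneg by (simp add: \<kappa>_def)
  then have C: "C > 0" unfolding C_def using const_nonneg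
    by (intro mult_pos_pos) (auto intro!: add_pos_nonneg)
  show ?thesis
  proof (intro exI conjI allI impI)
    show "C > 0" "(5::real) > 0" using C by simp_all
    fix T a1 a2 b1 b2 V1 V2 u01 u02 u1 u2
    assume T: "0 < (T::real)"
      and adm1: "admissible_data D T \<Gamma>in \<Gamma>out a0 b0 a1 b1 V1 u01"
      and adm2: "admissible_data D T \<Gamma>in \<Gamma>out a0 b0 a2 b2 V2 u02"
      and M1: "bochner_norm T (W1inf_norm D) V1 \<le> M" and M2: "bochner_norm T (W1inf_norm D) V2 \<le> M"
      and sol1: "weak_solution D T \<Gamma>in \<Gamma>out f g a1 b1 V1 u1" "has_initial_value D T u1 u01"
      and sol2: "weak_solution D T \<Gamma>in \<Gamma>out f g a2 b2 V2 u2" "has_initial_value D T u2 u02"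
    let ?M = "lebesgue_on {0<..<T}"
    obtain u1' \<gamma>1 v1 where s1: "energy_space D T u1 u1' v1" "AE t in ?M. has_trace D (u1 t) (\<gamma>1 t)"
      "AE t in ?M. boundary_data (\<lambda>x. a1 (t, x)) (\<lambda>x. b1 (t, x))"
      "\<And>z \<zeta>. z \<in> bochner_L2 T (H1 D) (H1_norm D) \<Longrightarrow> AE t in ?M. has_trace D (z t) (\<zeta> t) \<Longrightarrow>
        AE t in ?M. weak_form (\<lambda>x. a1 (t, x)) (\<lambda>x. b1 (t, x)) (V1 t) (u1 t) (\<gamma>1 t) (u1' t) (z t) (\<zeta> t)"
      "AE x in lebesgue_on D. v1 0 x = u01 x"
      by (rule solution_energy_space[OF T assms(17,18) adm1 sol1]) blast
    obtain u2' \<gamma>2 v2 where s2: "energy_space D T u2 u2' v2" "AE t in ?M. has_trace D (u2 t) (\<gamma>2 t)"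
      "AE t in ?M. boundary_data (\<lambda>x. a2 (t, x)) (\<lambda>x. b2 (t, x))"
      "\<And>z \<zeta>. z \<in> bochner_L2 T (H1 D) (H1_norm D) \<Longrightarrow> AE t in ?M. has_trace D (z t) (\<zeta> t) \<Longrightarrow>
        AE t in ?M. weak_form (\<lambda>x. a2 (t, x)) (\<lambda>x. b2 (t, x)) (V2 t) (u2 t) (\<gamma>2 t) (u2' t) (z t) (\<zeta> t)"
      "AE x in lebesgue_on D. v2 0 x = u02 x"
      by (rule solution_energy_space[OF T assms(17,18) adm2 sol2]) blast
    interpret e1: energy_space D T u1 u1' v1 by (rule s1(1))
    interpret e2: energy_space D T u2 u2' v2 by (rule s2(1))
    have V: "V1 \<in> bochner_L2 T (W1inf D) (W1inf_norm D)" "V2 \<in> bochner_L2 T (W1inf D) (W1inf_norm D)"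
      and u0: "u01 \<in> L2 (lebesgue_on D)" "u02 \<in> L2 (lebesgue_on D)" "AE x in lebesgue_on D. 0 \<le> u02 x \<and> u02 x \<le> 1"
      and ab: "a1 \<in> Linf (lateral T \<Gamma>in)" "a2 \<in> Linf (lateral T \<Gamma>in)" "b1 \<in> Linf (lateral T \<Gamma>out)" "b2 \<in> Linf (lateral T \<Gamma>out)"
      using adm1 adm2 by (auto simp: admissible_data_def)
    define La where "La = Linf_norm (lateral T \<Gamma>in) (\<lambda>p. a1 p - a2 p)"
    define Lb where "Lb = Linf_norm (lateral T \<Gamma>out) (\<lambda>p. b1 p - b2 p)"
    have La: "0 \<le> La" "AE t in ?M. AE x in surface \<Gamma>in. \<bar>a1 (t, x) - a2 (t, x)\<bar> \<le> La"
      using Linf_norm_nonneg[OF Linf_diff[OF ab(1,2)]] AE_lateral_slice[OF finite_in Linf_norm_AE[OF Linf_diff[OF ab(1,2)]]]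
      by (simp_all add: La_def)
    have Lb: "0 \<le> Lb" "AE t in ?M. AE x in surface \<Gamma>out. \<bar>b1 (t, x) - b2 (t, x)\<bar> \<le> Lb"
      using Linf_norm_nonneg[OF Linf_diff[OF ab(3,4)]] AE_lateral_slice[OF finite_out Linf_norm_AE[OF Linf_diff[OF ab(3,4)]]]
      by (simp_all add: Lb_def)
    have v0: "v1 0 \<in> L2 (lebesgue_on D)" "v2 0 \<in> L2 (lebesgue_on D)" using e1.v[of 0] e2.v[of 0] T by auto
    \<comment> \<open>The continuous representatives start at the prescribed initial values up to
      null sets, so the energy at time 0 is the initial distance in the claim.\<close>
    have e0: "L2_norm (lebesgue_on D) (\<lambda>x. v1 0 x - v2 0 x) = L2_norm (lebesgue_on D) (\<lambda>x. u01 x - u02 x)"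
      using s1(5) s2(5) L2_D(1)[OF L2_diff[OF v0]] L2_D(1)[OF L2_diff[OF u0(1,2)]]
      by (intro L2_norm_AE_eq) (auto elim: eventually_elim2)
    \<comment> \<open>Initial values between 0 and 1 bound the initial energy of u2 by the volume of
      D, so C is independent of the initial data.\<close>
    have E2: "(L2_norm (lebesgue_on D) (v2 0))\<^sup>2 \<le> volume_const"
    proof -
      have "AE x in lebesgue_on D. norm (v2 0 x) \<le> 1" using s2(5) u0(3) by eventually_elim simp
      from L2_bounded(2)[OF finite_D L2_D(1)[OF v0(2)] this] show ?thesis
        using open_D by (simp add: volume_const_def measure_restrict_space)
    qed
    have wt: "AE t in ?M. has_trace D (\<lambda>x. u1 t x - u2 t x) (\<lambda>x. \<gamma>1 t x - \<gamma>2 t x)"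
      using s1(2) s2(2) by eventually_elim (rule has_trace_diff[OF assms(2)])
    note wb = h.bochner_diff[OF e1.w e2.w]
    have b0: "0 \<le> bochner_norm T (W1inf_norm D) V1" "0 \<le> bochner_norm T (W1inf_norm D) V2" by (simp_all add: bochner_norm_def)
    have "(LINT t|?M. (H1_norm D (\<lambda>x. u1 t x - u2 t x))\<^sup>2) \<le> C * exp (5 * T) *
        (La\<^sup>2 + Lb\<^sup>2 + (bochner_norm T (W1inf_norm D) (\<lambda>t x. V1 t x - V2 t x))\<^sup>2 + (L2_norm (lebesgue_on D) (\<lambda>x. u01 x - u02 x))\<^sup>2)"
      unfolding C_def \<kappa>_def
    proof (rule stability_constants[OF T const_nonneg(1) zero_le_power2 zero_le_power2 _ E2 power_mono[OF M1 b0(1)] power_mono[OF M2 b0(2)] _ zero_le_power2])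
      show "(LINT t|?M. (H1_norm D (u2 t))\<^sup>2) \<le> (T + 1) * exp (T + 1) *
         ((L2_norm (lebesgue_on D) (v2 0))\<^sup>2 + 2 * (Fb\<^sup>2 * volume_const * (bochner_norm T (W1inf_norm D) V2)\<^sup>2 + T * X\<^sup>2))"
        unfolding X_def by (rule solution_bound[OF T s2(1) V(2) s2(2,3) s2(4)[OF e2.w s2(2)]])
      show "(LINT t|?M. (H1_norm D (\<lambda>x. u1 t x - u2 t x))\<^sup>2)
         \<le> (T + 1) * exp (T + 8 * Lf\<^sup>2 * (bochner_norm T (W1inf_norm D) V1)\<^sup>2 + 1) *
           ((L2_norm (lebesgue_on D) (\<lambda>x. u01 x - u02 x))\<^sup>2
            + 2 * (2 * Fb\<^sup>2 * volume_const * (bochner_norm T (W1inf_norm D) (\<lambda>t x. V1 t x - V2 t x))\<^sup>2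
              + 2 * (Lb * Ct\<^sup>2)\<^sup>2 * (LINT t|?M. (H1_norm D (u2 t))\<^sup>2)
              + T * (2 * (La * X)\<^sup>2)))"
        using difference_bound[OF T s1(1) s2(1) V s1(2) s2(2) s1(3) s2(3) s1(4)[OF wb wt] s2(4)[OF wb wt] La(2,1) Lb(2,1)]
        by (simp only: e0 X_def mult.assoc)
      show "0 \<le> (LINT t|?M. (H1_norm D (u2 t))\<^sup>2)" by simp
    qed
    then show "(bochner_norm T (H1_norm D) (\<lambda>t x. u1 t x - u2 t x))\<^sup>2
         \<le> C * exp (5 * T) *
             ((Linf_norm (lateral T \<Gamma>in) (\<lambda>p. a1 p - a2 p))\<^sup>2
              + (Linf_norm (lateral T \<Gamma>out) (\<lambda>p. b1 p - b2 p))\<^sup>2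
              + (bochner_norm T (W1inf_norm D) (\<lambda>t x. V1 t x - V2 t x))\<^sup>2
              + (L2_norm (lebesgue_on D) (\<lambda>x. u01 x - u02 x))\<^sup>2)"
      by (simp only: bochner_norm_sq[of T "H1_norm D"] La_def Lb_def)
  qed
qed

end
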